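(* Let $n\in\mathbb{N}$ and let $\rho:\mathbb{R}^n\setminus\{0\}\to[0,\infty)$ be a radial kernel with $\rho\in L^1_{\mathrm{loc}}(\mathbb{R}^n)$, $\int_{\mathbb{R}^n}\min\{1,|x|^{-1}\}\rho(x)\,dx<\infty$ and $\inf_{\overline{B(0,\varepsilon)}}\rho>0$ for some $\varepsilon>0$. Assume that $K_\rho(x)\ge0$ for $x\neq0$. Let $\Omega\subset\mathbb{R}^n$ be a bounded open set and $f\in L^2(\Omega)$. If $u\in H^{\rho,2}_0(\Omega)$ is a weak solution of the Dirichlet problem $-\Delta_\rho u=f$ in $\Omega$, $u=0$ in $\Omega^c$, such that $\langle u,\phi\rangle_\rho\ge0$ for every nonnegative $\phi\in H^{\rho,2}_0(\Omega)$ and $u\ge0$ in $\Omega^c$, then $u\ge0$ (a.e.) in $\mathbb{R}^n$.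
   Context: Fourier transform convention: $\widehat f(\xi)=\int_{\mathbb{R}^n}f(x)e^{-2\pi i x\cdot\xi}\,dx$, extended to tempered distributions. $\overline\rho$ is the radial representation of $\rho$, $\rho(x)=\overline\rho(|x|)$. For $u\in C_c^\infty(\mathbb{R}^n)$, $D_\rho u(x)=\int_{\mathbb{R}^n}\frac{u(x)-u(y)}{|x-y|}\frac{x-y}{|x-y|}\rho(x-y)\,dy$. The space $H^{\rho,2}(\mathbb{R}^n)$ is the closure (completion within $L^2(\mathbb{R}^n)$) of $C_c^\infty(\mathbb{R}^n)$ under the norm $\|u\|_{L^2}+\|D_\rho u\|_{L^2}$, with $D_\rho$ extended by density, and $H^{\rho,2}_0(\Omega)=\{u\in H^{\rho,2}(\mathbb{R}^n):u=0\text{ a.e. in }\Omega^c\}$. A function $u\in H_0^{\rho,2}(\Omega)$ is a weak solution of $-\Delta_\rho u=f$ in $\Omega$, $u=0$ in $\Omega^c$, if $\int_{\mathbb{R}^n}D_\rho u\cdot D_\rho v\,dx=\int_\Omega fv\,dx$ for all $v\in C_c^\infty(\Omega)$. $Q_\rho(x):=\int_{|x|}^\infty\frac{\overline\rho(t)}{t}\,dt$ ($x\ne0$) is a locally integrable tempered distribution; its Fourier transform is the function $\widehat{Q_\rho}(\xi)=\frac{1}{2\pi|\xi|}\int_{\mathbb{R}^n}\frac{\rho(x)x_1}{|x|^2}\sin(2\pi|\xi|x_1)\,dx$, $\xi\ne0$, and $\lambda_\rho(\xi):=2\pi i\,\xi\,\widehat{Q_\rho}(\xi)$. $K_\rho$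 is the tempered distribution $K_\rho=\sum_{j}\partial_jQ_\rho*\partial_jQ_\rho$, equivalently the one with $\widehat{K_\rho}(\xi)=-|\lambda_\rho(\xi)|^2$. The assumption "$K_\rho(x)\ge0$ for $x\ne0$" means that the restriction of $K_\rho$ to $\mathbb{R}^n\setminus\{0\}$ is given by a nonnegative function in $L^1_{\mathrm{loc}}(\mathbb{R}^n\setminus\{0\})$, again denoted $K_\rho$. The bilinear form is $\langle u,v\rangle_\rho:=\int_{\mathbb{R}^n}\int_{\mathbb{R}^n}(u(x)-u(y))(v(x)-v(y))K_\rho(x-y)\,dy\,dx$, which is well defined on $H^{\rho,2}(\mathbb{R}^n)$. *)

theory Defs
  imports "HOL-Analysis.Analysis"
begin

section \<open>Function spaces\<close>

definition partial_deriv ::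
    "'n::finite \<Rightarrow> (real^'n \<Rightarrow> 'b::real_normed_vector) \<Rightarrow> real^'n \<Rightarrow> 'b"
  where "partial_deriv j f x = frechet_derivative f (at x) (axis j 1)"

definition partial_derivs ::
    "'n::finite list \<Rightarrow> (real^'n \<Rightarrow> 'b::real_normed_vector) \<Rightarrow> real^'n \<Rightarrow> 'b"
  where "partial_derivs js f = foldr partial_deriv js f"

definition smooth :: "(real^'n::finite \<Rightarrow> 'b::real_normed_vector) \<Rightarrow> bool"
  where "smooth f \<longleftrightarrow> (\<forall>js. partial_derivs js f differentiable_on UNIV)"

definition test_functions ::
    "(real^'n::finite) set \<Rightarrow> (real^'n \<Rightarrow> 'b::real_normed_vector) set"
  where "test_functions \<Omega> =
    {\<phi>. smooth \<phi> \<and> compact (closure {x. \<phi> x \<noteq> 0}) \<and> closure {x. \<phi> x \<noteq> 0} \<subseteq> \<Omega>}"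

definition schwartz :: "(real^'n::finite \<Rightarrow> complex) set"
  where "schwartz = {\<phi>. smooth \<phi> \<and>
    (\<forall>js N. bdd_above (range (\<lambda>x. (1 + norm x) ^ N * norm (partial_derivs js \<phi> x))))}"

definition schwartz_norm :: "nat \<Rightarrow> (real^'n::finite \<Rightarrow> complex) \<Rightarrow> real"
  where "schwartz_norm N \<phi> =
    (SUP (js, x) \<in> {js. length js \<le> N} \<times> UNIV.
       (1 + norm x) ^ N * norm (partial_derivs js \<phi> x))"

definition loc_integrable_on ::
    "(real^'n::finite \<Rightarrow> 'b::{banach, second_countable_topology}) \<Rightarrow> (real^'n) set \<Rightarrow> bool"
    (infix \<open>loc'_integrable'_on\<close> 50)
  where "f loc_integrable_on S \<longleftrightarrow>
    (\<forall>C. compact C \<and> C \<subseteq> S \<longrightarrow> set_integrable lebesgue C f)"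

definition L2_on ::
    "(real^'n::finite) set \<Rightarrow> (real^'n \<Rightarrow> 'b::euclidean_space) \<Rightarrow> bool"
  where "L2_on S f \<longleftrightarrow>
    set_borel_measurable lebesgue S f \<and> set_integrable lebesgue S (\<lambda>x. (norm (f x))\<^sup>2)"

definition L2_tendsto ::
    "(nat \<Rightarrow> real^'n::finite \<Rightarrow> 'b::euclidean_space) \<Rightarrow> (real^'n \<Rightarrow> 'b) \<Rightarrow> bool"
  where "L2_tendsto F f \<longleftrightarrow>
    (\<forall>k. L2_on UNIV (\<lambda>x. F k x - f x)) \<and>
    (\<lambda>k. LINT x|lebesgue. (norm (F k x - f x))\<^sup>2) \<longlonglongrightarrow> 0"


section \<open>Tempered distributions and the Fourier transform\<close>

text \<open>
  A tempered distribution is represented by a functional on all functions, of which only the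
  values on the Schwartz space matter.
\<close>

type_synonym 'n distribution = "(real^'n \<Rightarrow> complex) \<Rightarrow> complex"

definition tempered_distribution :: "'n::finite distribution \<Rightarrow> bool"
  where "tempered_distribution T \<longleftrightarrow>
    (\<forall>\<phi>\<in>schwartz. \<forall>\<psi>\<in>schwartz. T (\<lambda>x. \<phi> x + \<psi> x) = T \<phi> + T \<psi>) \<and>
    (\<forall>c. \<forall>\<phi>\<in>schwartz. T (\<lambda>x. c * \<phi> x) = c * T \<phi>) \<and>
    (\<exists>C N. \<forall>\<phi>\<in>schwartz. norm (T \<phi>) \<le> C * schwartz_norm N \<phi>)"

definition distr_of_fun :: "(real^'n::finite \<Rightarrow> complex) \<Rightarrow> 'n distribution"
  where "distr_of_fun g \<phi> = (LINT x|lebesgue. g x * \<phi> x)"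

definition fourier :: "(real^'n::finite \<Rightarrow> complex) \<Rightarrow> real^'n \<Rightarrow> complex"
  where "fourier f \<xi> = (LINT x|lebesgue. f x * exp (- 2 * pi * \<i> * complex_of_real (x \<bullet> \<xi>)))"

definition fourier_distr :: "'n::finite distribution \<Rightarrow> 'n distribution"
  where "fourier_distr T \<phi> = T (fourier \<phi>)"

definition represents_off_origin ::
    "'n::finite distribution \<Rightarrow> (real^'n \<Rightarrow> complex) \<Rightarrow> bool"
  where "represents_off_origin T g \<longleftrightarrow>
    g loc_integrable_on (- {0}) \<and> (\<forall>\<phi> \<in> test_functions (- {0}). T \<phi> = distr_of_fun g \<phi>)"


section \<open>The nonlocal gradient and its function spaces\<close>

text \<open>
  Kernels are total functions on \<open>real^'n\<close>; their value at the origin is never used.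
\<close>

definition radial :: "(real^'n::finite \<Rightarrow> real) \<Rightarrow> bool"
  where "radial \<rho> \<longleftrightarrow> (\<forall>x y. x \<noteq> 0 \<and> norm x = norm y \<longrightarrow> \<rho> x = \<rho> y)"

definition radial_rep :: "(real^'n::finite \<Rightarrow> real) \<Rightarrow> real \<Rightarrow> real"
  where "radial_rep \<rho> t = \<rho> (SOME x. norm x = t)"

definition D_rho ::
    "(real^'n::finite \<Rightarrow> real) \<Rightarrow> (real^'n \<Rightarrow> real) \<Rightarrow> real^'n \<Rightarrow> real^'n"
  where "D_rho \<rho> u x =
    (LINT y|lebesgue.
       ((u x - u y) / norm (x - y) * \<rho> (x - y)) *\<^sub>R ((x - y) /\<^sub>R norm (x - y)))"

text \<open>
  \<open>has_D_rho \<rho> u V\<close>: the pair \<open>(u, V)\<close> lies in the closure in \<open>L\<^sup>2 \<times> L\<^sup>2\<close> of the graph of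
  \<open>D_rho \<rho>\<close> on \<open>C\<^sub>c\<^sup>\<infinity>\<close>.
\<close>

definition has_D_rho ::
    "(real^'n::finite \<Rightarrow> real) \<Rightarrow> (real^'n \<Rightarrow> real) \<Rightarrow> (real^'n \<Rightarrow> real^'n) \<Rightarrow> bool"
  where "has_D_rho \<rho> u V \<longleftrightarrow>
    L2_on UNIV u \<and> L2_on UNIV V \<and>
    (\<exists>\<phi>. (\<forall>k. \<phi> k \<in> test_functions UNIV) \<and>
         L2_tendsto \<phi> u \<and> L2_tendsto (\<lambda>k. D_rho \<rho> (\<phi> k)) V)"

definition H_rho :: "(real^'n::finite \<Rightarrow> real) \<Rightarrow> (real^'n \<Rightarrow> real) set"
  where "H_rho \<rho> = {u. \<exists>V. has_D_rho \<rho> u V}"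

definition D_rho_ext ::
    "(real^'n::finite \<Rightarrow> real) \<Rightarrow> (real^'n \<Rightarrow> real) \<Rightarrow> real^'n \<Rightarrow> real^'n"
  where "D_rho_ext \<rho> u = (SOME V. has_D_rho \<rho> u V)"

definition H_rho_0 ::
    "(real^'n::finite \<Rightarrow> real) \<Rightarrow> (real^'n) set \<Rightarrow> (real^'n \<Rightarrow> real) set"
  where "H_rho_0 \<rho> \<Omega> = {u \<in> H_rho \<rho>. AE x in lebesgue. x \<in> - \<Omega> \<longrightarrow> u x = 0}"

definition weak_solution ::
    "(real^'n::finite \<Rightarrow> real) \<Rightarrow> (real^'n) set \<Rightarrow> (real^'n \<Rightarrow> real) \<Rightarrow> (real^'n \<Rightarrow> real) \<Rightarrow> bool"
  where "weak_solution \<rho> \<Omega> f u \<longleftrightarrow>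
    u \<in> H_rho_0 \<rho> \<Omega> \<and>
    (\<forall>v \<in> test_functions \<Omega>.
       (LINT x|lebesgue. D_rho_ext \<rho> u x \<bullet> D_rho_ext \<rho> v x) = (LINT x:\<Omega>|lebesgue. f x * v x))"


section \<open>The kernel K and the bilinear form\<close>

definition Q_rho :: "(real^'n::finite \<Rightarrow> real) \<Rightarrow> real^'n \<Rightarrow> real"
  where "Q_rho \<rho> x = (LINT t:{norm x<..}|lebesgue. radial_rep \<rho> t / t)"

text \<open>
  The Fourier transform of \<open>Q_rho \<rho>\<close> is taken in the sense of distributions and is given by a
  function away from the origin, namely (for almost every \<open>\<xi>\<close>)
  \<open>1 / (2 \<pi> |\<xi>|) \<integral> \<rho>(x) x\<^sub>1 / |x|\<^sup>2 sin (2 \<pi> |\<xi>| x\<^sub>1) dx\<close>. Nothing is required of it at the origin: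
  if \<open>n = 1\<close> this function need not be integrable near \<open>0\<close>, whereas \<open>lambda_rho\<close> is always
  locally bounded (up to a null set).
\<close>

definition Q_hat :: "(real^'n::finite \<Rightarrow> real) \<Rightarrow> real^'n \<Rightarrow> complex"
  where "Q_hat \<rho> =
    (SOME g. represents_off_origin
       (fourier_distr (distr_of_fun (\<lambda>x. complex_of_real (Q_rho \<rho> x)))) g)"

definition lambda_rho :: "(real^'n::finite \<Rightarrow> real) \<Rightarrow> real^'n \<Rightarrow> complex^'n"
  where "lambda_rho \<rho> \<xi> = (\<chi> j. 2 * pi * \<i> * complex_of_real (\<xi> $ j) * Q_hat \<rho> \<xi>)"

definition is_K_rho :: "(real^'n::finite \<Rightarrow> real) \<Rightarrow> 'n distribution \<Rightarrow> bool"
  where "is_K_rho \<rho> T \<longleftrightarrow>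
    tempered_distribution T \<and>
    (\<forall>\<phi>\<in>schwartz. fourier_distr T \<phi> =
       distr_of_fun (\<lambda>\<xi>. - complex_of_real ((norm (lambda_rho \<rho> \<xi>))\<^sup>2)) \<phi>)"

definition bilinear_form ::
    "(real^'n::finite \<Rightarrow> real) \<Rightarrow> (real^'n \<Rightarrow> real) \<Rightarrow> (real^'n \<Rightarrow> real) \<Rightarrow> real"
  where "bilinear_form K u v =
    (LINT x|lebesgue. LINT y|lebesgue. (u x - u y) * (v x - v y) * K (x - y))"

end

theory Submission
  imports Defs "HOL-Probability.Probability"
begin

text \<open>
  The negative part \<open>u\<^sup>- = max 0 (- u)\<close> is an admissible competitor, and since
  \<open>(u x - u y) * (u\<^sup>- x - u\<^sup>- y) \<le> - (u\<^sup>- x - u\<^sup>- y)\<^sup>2\<close> pointwise, the hypothesis forces the energy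
  of \<open>u\<^sup>-\<close> with respect to \<open>K\<close> to vanish. As \<open>K\<close> is not identically zero, \<open>u\<^sup>-\<close> is then invariant
  under a translation, so it vanishes because its support is bounded.

  The admissibility of \<open>u\<^sup>-\<close> rests on the identity between the energy with respect to \<open>K\<close> and twice the
  squared \<open>L\<^sup>2\<close> norm of the nonlocal gradient on test functions, as energies with respect to a nonnegative
  kernel decrease under Lipschitz truncations. On the Fourier side the identity is the Levy--Khintchine formula
  \<open>\<bar>\<lambda>\<bar>\<^sup>2 (\<eta>) = \<integral> (1 - cos (2 \<pi> z \<bullet> \<eta>)) K z dz\<close>. It follows by testing the definition of \<open>K\<close> with
  \<open>(1 - cos (2 \<pi> z \<bullet> \<eta>))\<close> times a cutoff away from the origin and removing the cutoff.
\<close>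

section \<open>Smooth functions\<close>

text \<open>The distribution behind \<open>K\<close> is a function only away from the origin, so a
  part supported at \<open>0\<close> could spoil the identity between energy and gradient. Two facts
  exclude it. Multiplication by \<open>1 - cos (2 \<pi> z \<bullet> \<eta>)\<close>, which vanishes
  to second order at \<open>z = 0\<close>, kills a Dirac mass and its first derivatives. Second and
  higher derivatives would force at least quadratic growth of the squared symbol, whereas
  integrability of \<open>min 1 (1 / norm z) * \<rho> z\<close> makes the symbol
  \<open>o(norm \<xi>)\<close>. A second obstacle is that truncated approximants have gradients that
  are bounded in L2 but need not converge. Instead of weak compactness, nearly energy-minimal test
  functions in shrinking L2 balls provide strongly convergent gradients. Finally,
  \<open>\<rho>\<close> and \<open>K\<close> are only Lebesgue measurable, and \<open>Q_hat\<close>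
  is an arbitrary choice among functions that agree almost everywhere. The analysis is therefore
  carried out for Borel representatives, with a symbol defined directly by an integral, and is tied
  to the given objects by almost everywhere identities.\<close>

primrec Ck :: "nat \<Rightarrow> (real^'n::finite \<Rightarrow> 'b::real_normed_vector) \<Rightarrow> bool" where
  "Ck 0 f \<longleftrightarrow> f differentiable_on UNIV"
| "Ck (Suc k) f \<longleftrightarrow> f differentiable_on UNIV \<and> (\<forall>j. Ck k (partial_deriv j f))"

lemma partial_deriv_eqI:
  "(f has_derivative f') (at x) \<Longrightarrow> partial_deriv j f x = f' (axis j 1)"
  unfolding partial_deriv_def using frechet_derivative_at by fastforce

lemma partial_derivs_snoc: "partial_derivs (js @ [j]) f = partial_derivs js (partial_deriv j f)"
  by (simp add: partial_derivs_def)

text \<open>The product and chain rules turn one derivative into several new functions, so a fixed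
  list of indices is awkward to induct on. Counting the remaining derivatives in \<open>Ck\<close>
  allows induction on the order for all functions at once. \<open>foldr\<close> applies the last
  index first, hence the splitting of lists from the right.\<close>

lemma Ck_iff_partial_derivs:
  "Ck k f \<longleftrightarrow> (\<forall>js. length js \<le> k \<longrightarrow> partial_derivs js f differentiable_on UNIV)"
proof (induction k arbitrary: f)
  case 0
  then show ?case by (simp add: partial_derivs_def)
next
  case (Suc k)
  show ?case
  proof
    assume L: "Ck (Suc k) f"
    show "\<forall>js. length js \<le> Suc k \<longrightarrow> partial_derivs js f differentiable_on UNIV"
    proof (intro allI impI)
      fix js :: "'a list" assume "length js \<le> Suc k"
      then show "partial_derivs js f differentiable_on UNIV"
        using L Suc by (cases js rule: rev_cases) (auto simp: partial_derivs_snoc, simp add: partial_derivs_def)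
    qed
  next
    assume R: "\<forall>js. length js \<le> Suc k \<longrightarrow> partial_derivs js f differentiable_on UNIV"
    have "f differentiable_on UNIV" using R[rule_format, of "[]"] by (simp add: partial_derivs_def)
    moreover have "Ck k (partial_deriv j f)" for j
      unfolding Suc
    proof (intro allI impI)
      fix js :: "'a list" assume "length js \<le> k"
      then show "partial_derivs js (partial_deriv j f) differentiable_on UNIV"
        using R[rule_format, of "js @ [j]"] by (simp add: partial_derivs_snoc)
    qed
    ultimately show "Ck (Suc k) f" by simp
  qed
qed

lemma smooth_iff_Ck: "smooth f \<longleftrightarrow> (\<forall>k. Ck k f)"
  unfolding smooth_def Ck_iff_partial_derivs by auto

lemma Ck_imp_differentiable: "Ck k f \<Longrightarrow> f differentiable (at x)"
  by (cases k) (auto simp: differentiable_on_def)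

lemma Ck_has_derivative:
  assumes "Ck k f"
  shows "(f has_derivative (\<lambda>h. \<Sum>j\<in>UNIV. (h $ j) *\<^sub>R partial_deriv j f x)) (at x)"
proof -
  have D: "(f has_derivative frechet_derivative f (at x)) (at x)"
    using Ck_imp_differentiable[OF assms] by (simp add: frechet_derivative_works)
  then interpret bounded_linear "frechet_derivative f (at x)" by (rule has_derivative_bounded_linear)
  have "frechet_derivative f (at x) h = (\<Sum>j\<in>UNIV. (h $ j) *\<^sub>R partial_deriv j f x)" for h
  proof -
    have "h = (\<Sum>j\<in>UNIV. (h $ j) *\<^sub>R axis j 1)"
      by (metis basis_expansion scalar_mult_eq_scaleR)
    then have "frechet_derivative f (at x) h = frechet_derivative f (at x) (\<Sum>j\<in>UNIV. (h $ j) *\<^sub>R axis j 1)" by simp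
    then show ?thesis by (simp add: sum scaleR partial_deriv_def)
  qed
  then show ?thesis using D by presburger
qed

lemma Ck_SucD: "Ck (Suc k) f \<Longrightarrow> Ck k f"
  by (auto simp: Ck_iff_partial_derivs)

lemma CkI:
  assumes "\<And>x. (f has_derivative f' x) (at x)"
    and "\<And>k' j. k = Suc k' \<Longrightarrow> Ck k' (\<lambda>x. f' x (axis j 1))"
  shows "Ck k f"
proof -
  have "f differentiable_on UNIV"
    using assms(1) by (auto simp: differentiable_on_def differentiable_def)
  moreover have "partial_deriv j f = (\<lambda>x. f' x (axis j 1))" for j
    using partial_deriv_eqI[OF assms(1)] by blast
  ultimately show ?thesis using assms(2) by (cases k) auto
qed

lemma Ck_const: "Ck k (\<lambda>x. c)"
proof (induction k arbitrary: c)
  case (Suc k)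
  show ?case by (rule CkI[where f'="\<lambda>x h. 0"]) (use Suc in auto)
qed auto

lemma Ck_add:
  assumes "Ck k f" "Ck k g" shows "Ck k (\<lambda>x. f x + g x)"
  using assms
proof (induction k arbitrary: f g)
  case 0
  then show ?case by simp
next
  case (Suc k)
  show ?case
  proof (rule CkI)
    show "((\<lambda>x. f x + g x) has_derivative (\<lambda>h. (\<Sum>j\<in>UNIV. (h $ j) *\<^sub>R partial_deriv j f x) +
        (\<Sum>j\<in>UNIV. (h $ j) *\<^sub>R partial_deriv j g x))) (at x)" for x
      by (intro has_derivative_add Ck_has_derivative[OF Suc.prems(1)] Ck_has_derivative[OF Suc.prems(2)])
  qed (use Suc in \<open>simp add: axis_def if_distrib[of "\<lambda>c. c *\<^sub>R _"] cong: if_cong\<close>)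
qed

lemma Ck_sum:
  assumes "\<And>i. i \<in> I \<Longrightarrow> Ck k (f i)" shows "Ck k (\<lambda>x. \<Sum>i\<in>I. f i x)"
  using assms by (induction I rule: infinite_finite_induct) (auto intro: Ck_const Ck_add)

lemma axis_sum: "(\<Sum>i\<in>UNIV. (axis j (1::real) $ i) *\<^sub>R v i) = (v j :: 'b::real_normed_vector)"
  by (simp add: axis_def if_distrib[of "\<lambda>c. c *\<^sub>R _"] cong: if_cong)

lemma (in bounded_bilinear) Ck_bilinear:
  assumes "Ck k f" "Ck k g" shows "Ck k (\<lambda>x. prod (f x) (g x))"
  using assms
proof (induction k arbitrary: f g)
  case 0
  have "(\<lambda>x. prod (f x) (g x)) differentiable at x" for x
    using FDERIV[OF Ck_has_derivative[OF 0(1)] Ck_has_derivative[OF 0(2)]] unfolding differentiable_def by blast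
  then show ?case by (simp add: differentiable_on_def)
next
  case (Suc k)
  show ?case
  proof (rule CkI)
    show "((\<lambda>x. prod (f x) (g x)) has_derivative (\<lambda>h. prod (f x) (\<Sum>j\<in>UNIV. (h $ j) *\<^sub>R partial_deriv j g x) +
       prod (\<Sum>j\<in>UNIV. (h $ j) *\<^sub>R partial_deriv j f x) (g x))) (at x)" for x
      by (intro FDERIV Ck_has_derivative[OF Suc.prems(1)] Ck_has_derivative[OF Suc.prems(2)])
  next
    fix k' j assume "Suc k = Suc k'"
    then show "Ck k' (\<lambda>x. prod (f x) (\<Sum>i\<in>UNIV. (axis j 1 $ i) *\<^sub>R partial_deriv i g x) +
       prod (\<Sum>i\<in>UNIV. (axis j 1 $ i) *\<^sub>R partial_deriv i f x) (g x))"
      unfolding axis_sum using Suc Ck_SucD[OF Suc.prems(1)] Ck_SucD[OF Suc.prems(2)] by (auto intro!: Ck_add)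
  qed
qed

lemmas Ck_mult = bounded_bilinear.Ck_bilinear[OF bounded_bilinear_mult]
lemmas Ck_scaleR = bounded_bilinear.Ck_bilinear[OF bounded_bilinear_scaleR]

lemma Ck_linear:
  assumes "bounded_linear L" "Ck k f" shows "Ck k (\<lambda>x. L (f x))"
  using assms(2)
proof (induction k arbitrary: f)
  case 0
  have "(\<lambda>x. L (f x)) differentiable at x" for x
    using bounded_linear.has_derivative[OF assms(1) Ck_has_derivative[OF 0]] unfolding differentiable_def by blast
  then show ?case by (simp add: differentiable_on_def)
next
  case (Suc k)
  show ?case
    by (rule CkI, rule bounded_linear.has_derivative[OF assms(1) Ck_has_derivative[OF Suc.prems]])
       (use Suc in \<open>auto simp: axis_sum\<close>)
qed

lemma Ck_affine:
  assumes "Ck k f" shows "Ck k (\<lambda>x. f (c *\<^sub>R x + t))"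
  using assms
proof (induction k arbitrary: f)
  case 0
  show ?case
  proof (rule CkI)
    show "((\<lambda>x. f (c *\<^sub>R x + t)) has_derivative
      (\<lambda>h. \<Sum>j\<in>UNIV. ((c *\<^sub>R h) $ j) *\<^sub>R partial_deriv j f (c *\<^sub>R x + t))) (at x)" for x
      by (rule has_derivative_compose[where g=f and f="\<lambda>x. c *\<^sub>R x + t", OF _ Ck_has_derivative[OF 0]])
         (auto intro!: derivative_eq_intros)
  qed simp
next
  case (Suc k)
  show ?case
  proof (rule CkI)
    show "((\<lambda>x. f (c *\<^sub>R x + t)) has_derivative
      (\<lambda>h. \<Sum>j\<in>UNIV. ((c *\<^sub>R h) $ j) *\<^sub>R partial_deriv j f (c *\<^sub>R x + t))) (at x)" for x
      by (rule has_derivative_compose[where g=f and f="\<lambda>x. c *\<^sub>R x + t", OF _ Ck_has_derivative[OF Suc.prems]])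
         (auto intro!: derivative_eq_intros)
  next
    fix k' j assume "Suc k = Suc k'"
    moreover have "(\<lambda>x. \<Sum>i\<in>UNIV. ((c *\<^sub>R axis j 1) $ i) *\<^sub>R partial_deriv i f (c *\<^sub>R x + t)) =
       (\<lambda>x. c *\<^sub>R partial_deriv j f (c *\<^sub>R x + t))"
      unfolding vector_scaleR_component real_scaleR_def scaleR_scaleR[symmetric] scaleR_sum_right[symmetric] axis_sum ..
    ultimately show "Ck k' (\<lambda>x. \<Sum>i\<in>UNIV. ((c *\<^sub>R axis j 1) $ i) *\<^sub>R partial_deriv i f (c *\<^sub>R x + t))"
      using Suc by (auto intro!: Ck_linear[OF bounded_linear_scaleR_right])
  qed
qed

text \<open>In a family closed under differentiation every derivative of \<open>h p\<close> is again
  a member \<open>h (d p)\<close>, so a bare induction on the order works. It serves the multiples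
  of \<open>cis\<close> and the products of polynomials in \<open>1 / t\<close> with
  \<open>exp (- 1 / t)\<close>.\<close>

lemma Ck_compose_family:
  fixes h :: "'p \<Rightarrow> real \<Rightarrow> 'b::real_normed_vector" and f :: "real^'n::finite \<Rightarrow> real"
  assumes h: "\<And>p t. (h p has_vector_derivative h (d p) t) (at t)" and "Ck k f"
  shows "Ck k (\<lambda>x. h p (f x))"
  using assms(2)
proof (induction k arbitrary: p)
  case 0
  have "(\<lambda>x. h p (f x)) differentiable at x" for x
    using has_derivative_compose[OF Ck_has_derivative[OF 0], of "h p"] h[of p, unfolded has_vector_derivative_def]
    by (auto simp: differentiable_def)
  then show ?case by (simp add: differentiable_on_def)
next
  case (Suc k)
  have D: "((\<lambda>x. h p (f x)) has_derivative
      (\<lambda>v. (\<Sum>j\<in>UNIV. (v $ j) *\<^sub>R partial_deriv j f x) *\<^sub>R h (d p) (f x))) (at x)" for x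
    by (rule has_derivative_compose[OF Ck_has_derivative[OF Suc.prems], of "h p"])
       (use h[of p, unfolded has_vector_derivative_def] in auto)
  show ?case
    by (rule CkI[OF D], unfold axis_sum)
       (use Suc Ck_SucD[OF Suc.prems] in \<open>auto intro!: Ck_scaleR\<close>)
qed

lemma Ck_inverse:
  fixes f :: "real^'n::finite \<Rightarrow> real"
  assumes "Ck k f" "\<And>x. f x \<noteq> 0" shows "Ck k (\<lambda>x. inverse (f x))"
  using assms(1)
proof (induction k)
  case 0
  then show ?case using assms(2) by (auto simp: differentiable_on_def intro!: differentiable_inverse)
next
  case (Suc k)
  have D: "((\<lambda>x. inverse (f x)) has_derivative
      (\<lambda>v. - (inverse (f x) * (\<Sum>j\<in>UNIV. (v $ j) *\<^sub>R partial_deriv j f x) * inverse (f x)))) (at x)" for x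
    by (rule Deriv.has_derivative_inverse[OF assms(2) Ck_has_derivative[OF Suc.prems]])
  show ?case
    by (rule CkI[OF D], unfold axis_sum)
       (use Suc Ck_SucD[OF Suc.prems] in \<open>auto intro!: Ck_mult Ck_linear[OF bounded_linear_minus[OF bounded_linear_ident]]\<close>)
qed

lemma Ck_sqrt:
  fixes f :: "real^'n::finite \<Rightarrow> real"
  assumes "Ck k f" "\<And>x. f x > 0" shows "Ck k (\<lambda>x. sqrt (f x))"
  using assms(1)
proof (induction k)
  case 0
  have "(\<lambda>x. sqrt (f x)) differentiable at x" for x
    using has_derivative_real_sqrt[OF assms(2) Ck_has_derivative[OF 0]] by (auto simp: differentiable_def)
  then show ?case by (auto simp: differentiable_on_def)
next
  case (Suc k)
  have pos: "sqrt (f x) \<noteq> 0" for x using assms(2)[of x] by simp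
  have D: "((\<lambda>x. sqrt (f x)) has_derivative
      (\<lambda>v. (1/2) *\<^sub>R ((\<Sum>j\<in>UNIV. (v $ j) *\<^sub>R partial_deriv j f x) * inverse (sqrt (f x))))) (at x)" for x
    by (rule has_derivative_eq_rhs[OF has_derivative_real_sqrt[OF assms(2) Ck_has_derivative[OF Suc.prems]]])
      (auto simp: fun_eq_iff field_simps)
  show ?case
    by (rule CkI[OF D], unfold axis_sum)
       (rule Ck_linear[OF bounded_linear_scaleR_right] Ck_mult Ck_inverse,
        use Suc Ck_SucD[OF Suc.prems] pos in \<open>auto intro!: Ck_inverse\<close>)+
qed

lemma Ck_nth: "Ck k (\<lambda>x::real^'n::finite. x $ j)"
proof -
  have D: "((\<lambda>x::real^'n. x $ j) has_derivative (\<lambda>h. h $ j)) (at x)" for x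
    by (intro bounded_linear_imp_has_derivative bounded_linear_vec_nth)
  show ?thesis by (rule CkI[OF D]) (auto intro: Ck_const)
qed

lemma smooth_const [intro]: "smooth (\<lambda>x. c)"
  and smooth_add [intro]: "smooth f \<Longrightarrow> smooth g \<Longrightarrow> smooth (\<lambda>x. f x + g x)"
  and smooth_linear: "bounded_linear L \<Longrightarrow> smooth f \<Longrightarrow> smooth (\<lambda>x. L (f x))"
  and smooth_affine: "smooth f \<Longrightarrow> smooth (\<lambda>x. f (r *\<^sub>R x + t))"
  and smooth_nth [intro]: "smooth (\<lambda>x. x $ j)"
  and smooth_sum [intro]: "(\<And>i. i \<in> I \<Longrightarrow> smooth (F i)) \<Longrightarrow> smooth (\<lambda>x. \<Sum>i\<in>I. F i x)"
  by (auto simp: smooth_iff_Ck intro: Ck_const Ck_add Ck_linear Ck_affine Ck_nth Ck_sum)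

lemma smooth_mult [intro]:
  fixes f g :: "real^'n::finite \<Rightarrow> 'b::real_normed_algebra"
  shows "smooth f \<Longrightarrow> smooth g \<Longrightarrow> smooth (\<lambda>x. f x * g x)"
  by (auto simp: smooth_iff_Ck intro: Ck_mult)

lemma smooth_of_real [intro]: "smooth f \<Longrightarrow> smooth (\<lambda>x. complex_of_real (f x))"
  by (rule smooth_linear[OF bounded_linear_of_real])

lemma smooth_uminus [intro]: "smooth f \<Longrightarrow> smooth (\<lambda>x. - f x)"
  by (rule smooth_linear[OF bounded_linear_minus[OF bounded_linear_ident]])

lemma smooth_diff [intro]: "smooth f \<Longrightarrow> smooth g \<Longrightarrow> smooth (\<lambda>x. f x - g x)"
  using smooth_add[OF _ smooth_uminus, of f g] by simp

lemma smooth_inverse [intro]: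
  fixes f :: "real^'n::finite \<Rightarrow> real"
  shows "smooth f \<Longrightarrow> (\<And>x. f x \<noteq> 0) \<Longrightarrow> smooth (\<lambda>x. inverse (f x))"
  by (auto simp: smooth_iff_Ck intro: Ck_inverse)

lemma smooth_sqrt [intro]:
  fixes f :: "real^'n::finite \<Rightarrow> real"
  shows "smooth f \<Longrightarrow> (\<And>x. f x > 0) \<Longrightarrow> smooth (\<lambda>x. sqrt (f x))"
  by (auto simp: smooth_iff_Ck intro: Ck_sqrt)

lemma smooth_compose_family:
  fixes h :: "'p \<Rightarrow> real \<Rightarrow> 'b::real_normed_vector" and f :: "real^'n::finite \<Rightarrow> real"
  assumes "\<And>p t. (h p has_vector_derivative h (d p) t) (at t)" and "smooth f"
  shows "smooth (\<lambda>x. h p (f x))"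
  using assms by (auto simp: smooth_iff_Ck intro: Ck_compose_family)

lemma smooth_cis [intro]: "smooth f \<Longrightarrow> smooth (\<lambda>x. cis (f x))"
proof -
  have "smooth (\<lambda>x. 1 * cis (f x))" if "smooth f"
    by (rule smooth_compose_family[where h="\<lambda>c t. c * cis t" and d="\<lambda>c. c * \<i>" and f=f, OF _ that])
       (unfold cis_conv_exp mult.assoc, intro has_vector_derivative_mult_right has_vector_derivative_iexp)
  then show "smooth f \<Longrightarrow> smooth (\<lambda>x. cis (f x))" by simp
qed

lemma smooth_cos [intro]: "smooth f \<Longrightarrow> smooth (\<lambda>x. cos (f x :: real))"
  using smooth_linear[OF bounded_linear_Re smooth_cis[of f]] by simp

lemma smooth_inner [intro]: "smooth (\<lambda>x. x \<bullet> a)"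
  unfolding inner_vec_def inner_real_def by (intro smooth_sum smooth_mult smooth_nth smooth_const)

lemma smooth_norm_sq [intro]: "smooth (\<lambda>x. (norm x)\<^sup>2)"
  unfolding power2_norm_eq_inner inner_vec_def inner_real_def by (intro smooth_sum smooth_mult smooth_nth)

lemma smooth_partial_deriv [intro]: "smooth f \<Longrightarrow> smooth (partial_deriv j f)"
  unfolding smooth_iff_Ck by (meson Ck.simps(2))

lemma smooth_has_derivative:
  "smooth f \<Longrightarrow> (f has_derivative (\<lambda>h. \<Sum>j\<in>UNIV. (h $ j) *\<^sub>R partial_deriv j f x)) (at x)"
  using Ck_has_derivative[of 0 f] unfolding smooth_iff_Ck by blast

lemma smooth_continuous_on: "smooth f \<Longrightarrow> continuous_on S f"
  by (meson smooth_has_derivative has_derivative_continuous continuous_at_imp_continuous_on)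

lemma smooth_borel_measurable [measurable_dest]: "smooth f \<Longrightarrow> f \<in> borel_measurable borel"
  by (intro borel_measurable_continuous_onI smooth_continuous_on)

section \<open>Flat functions and the cutoffs built from them\<close>

definition flat_exp :: "real poly \<Rightarrow> real \<Rightarrow> real"
  where "flat_exp p t = (if t \<le> 0 then 0 else poly p (inverse t) * exp (- inverse t))"

lemma flat_exp_limit:
  fixes p :: "real poly"
  shows "((\<lambda>t. poly p (inverse t) * exp (- inverse t)) \<longlongrightarrow> 0) (at_right 0)"
proof -
  have "((\<lambda>t. poly p t * exp (- t)) \<longlongrightarrow> (0::real)) at_top"
  proof (induction p)
    case 0
    then show ?case by simp
  next
    case (pCons a p)
    have eq: "(\<lambda>t. poly (pCons a p) t * exp (- t)) = (\<lambda>t. a * exp (- t) + poly (pCons 0 p) t * exp (- t))"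
      by (auto simp: algebra_simps)
    have "((\<lambda>t. poly (pCons 0 p) t * exp (- t)) \<longlongrightarrow> (0::real)) at_top"
    proof -
      have "poly (pCons 0 p) t * exp (- t) = (\<Sum>i\<le>degree (pCons 0 p). coeff (pCons 0 p) i * (t ^ i / exp t))" for t
        by (simp only: poly_altdef sum_distrib_right) (simp add: exp_minus field_simps)
      moreover have "((\<lambda>t. \<Sum>i\<le>degree (pCons 0 p). coeff (pCons 0 p) i * (t ^ i / exp t)) \<longlongrightarrow>
          (\<Sum>i\<le>degree (pCons 0 p). coeff (pCons 0 p) i * 0)) at_top"
        by (intro tendsto_intros tendsto_power_div_exp_0)
      ultimately show ?thesis by simp
    qed
    moreover have "((\<lambda>t::real. a * exp (- t)) \<longlongrightarrow> a * 0) at_top"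
      using tendsto_power_div_exp_0[of 0] by (intro tendsto_intros) (simp add: exp_minus field_simps)
    ultimately show ?case unfolding eq using tendsto_add by fastforce
  qed
  from filterlim_compose[OF this filterlim_inverse_at_top_right] show ?thesis .
qed

text \<open>For \<open>t > 0\<close>, differentiation of \<open>p (1 / t) * exp (- 1 / t)\<close>
  produces the factor \<open>(p - p') (1 / t) / t^2\<close>, which is the polynomial
  \<open>[:0,0,1:] * (p - pderiv p)\<close> in \<open>1 / t\<close>. At \<open>0\<close> the right
  difference quotient is \<open>flat_exp (pCons 0 p)\<close>, which tends to
  \<open>0\<close>.\<close>

lemma flat_exp_has_derivative:
  "(flat_exp p has_real_derivative flat_exp ([:0,0,1:] * (p - pderiv p)) t) (at t)"
proof -
  consider "t < 0" | "t > 0" | "t = 0" by linarith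
  then show ?thesis
  proof cases
    case 1
    have "((\<lambda>_. 0) has_real_derivative 0) (at t)" by simp
    then have "(flat_exp p has_real_derivative 0) (at t)"
      by (rule has_field_derivative_transform_within_open[of _ _ _ "{..<0}"]) (use 1 in \<open>auto simp: flat_exp_def\<close>)
    then show ?thesis using 1 by (simp add: flat_exp_def)
  next
    case 2
    have "((\<lambda>t. poly p (inverse t) * exp (- inverse t)) has_real_derivative
        flat_exp ([:0,0,1:] * (p - pderiv p)) t) (at t)"
      using 2 unfolding flat_exp_def
      by (auto intro!: derivative_eq_intros DERIV_chain'[OF _ poly_DERIV]
         simp: algebra_simps power2_eq_square)
    then show ?thesis
      by (rule has_field_derivative_transform_within_open[of _ _ _ "{0<..}"]) (use 2 in \<open>auto simp: flat_exp_def\<close>)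
  next
    case 3
    have "((\<lambda>h. flat_exp p h / h) \<longlongrightarrow> 0) (at_left 0)"
      by (rule tendsto_eventually) (auto simp: eventually_at_filter flat_exp_def)
    moreover have "((\<lambda>h. flat_exp p h / h) \<longlongrightarrow> 0) (at_right 0)"
    proof (rule Lim_transform_eventually[OF flat_exp_limit[of "pCons 0 p"]])
      show "\<forall>\<^sub>F x in at_right 0. poly (pCons 0 p) (inverse x) * exp (- inverse x) = flat_exp p x / x"
        using eventually_at_right_less[of "0::real"]
        by eventually_elim (auto simp: flat_exp_def field_simps)
    qed
    ultimately have "((\<lambda>h. flat_exp p h / h) \<longlongrightarrow> 0) (at 0)"
      by (simp add: filterlim_split_at)
    then show ?thesis using 3 unfolding DERIV_def by (simp add: flat_exp_def)
  qed
qed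

lemma smooth_flat_exp:
  assumes "smooth f" shows "smooth (\<lambda>x. flat_exp p (f x))"
  by (rule smooth_compose_family[OF _ assms, where d="\<lambda>p. [:0,0,1:] * (p - pderiv p)"])
     (use flat_exp_has_derivative in \<open>simp add: has_real_derivative_iff_has_vector_derivative\<close>)

definition bump :: "real \<Rightarrow> real" where "bump = flat_exp 1"

lemma bump_pos: "t > 0 \<Longrightarrow> bump t > 0"
  and bump_zero: "t \<le> 0 \<Longrightarrow> bump t = 0"
  and bump_nonneg: "0 \<le> bump t"
  and bump_le_1: "bump t \<le> 1"
  by (auto simp: bump_def flat_exp_def)

lemma bump_mono: "s \<le> t \<Longrightarrow> bump s \<le> bump t"
  by (auto simp: bump_def flat_exp_def le_imp_inverse_le)

lemma smooth_bump [intro]: "smooth f \<Longrightarrow> smooth (\<lambda>x. bump (f x))"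
  unfolding bump_def by (rule smooth_flat_exp)

definition plateau :: "real^'n::finite \<Rightarrow> real"
  where "plateau x = bump (2 - (norm x)\<^sup>2) * inverse (bump (2 - (norm x)\<^sup>2) + bump ((norm x)\<^sup>2 - 1))"

lemma plateau_denom: "bump (2 - t) + bump (t - 1) > 0"
  using bump_pos[of "2 - t"] bump_pos[of "t - 1"] bump_nonneg[of "2 - t"] bump_nonneg[of "t - 1"]
  by (cases "t < 2") auto

lemma smooth_plateau: "smooth plateau"
  unfolding plateau_def[abs_def]
  using plateau_denom by (intro smooth_mult smooth_inverse smooth_add smooth_bump smooth_diff smooth_const smooth_norm_sq)
    (auto simp: less_imp_neq[symmetric])

lemma plateau_nonneg: "0 \<le> plateau x"
  and plateau_le_1: "plateau x \<le> 1"
  and plateau_eq_1: "norm x \<le> 1 \<Longrightarrow> plateau x = 1"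
  and plateau_eq_0: "norm x \<ge> 2 \<Longrightarrow> plateau x = 0"
proof -
  note d = plateau_denom[of "(norm x)\<^sup>2"]
  show "0 \<le> plateau x" "plateau x \<le> 1" using d
    by (simp_all add: plateau_def bump_nonneg divide_simps)
  show "plateau x = 1" if "norm x \<le> 1"
  proof -
    have "(norm x)\<^sup>2 \<le> 1" using that by (simp add: power_le_one)
    then show ?thesis using d by (simp add: plateau_def bump_zero)
  qed
  show "plateau x = 0" if "norm x \<ge> 2"
  proof -
    have "(norm x)\<^sup>2 \<ge> 2\<^sup>2" using that by (intro power_mono) auto
    then show ?thesis by (simp add: plateau_def bump_zero)
  qed
qed

text \<open>Radial monotonicity makes \<open>cutoff m\<close> nonnegative and increasing in
  \<open>m\<close>, so that the cutoff can later be removed by monotone convergence. As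
  \<open>a / (a + b)\<close> increases in \<open>a\<close> and decreases in \<open>b\<close>,
  everything reduces to \<open>a * d \<le> c * b\<close>.\<close>

lemma plateau_antimono: assumes "norm x \<le> norm y" shows "plateau y \<le> plateau x"
proof -
  have le: "(norm x)\<^sup>2 \<le> (norm y)\<^sup>2" using assms by (simp add: power_mono)
  define a b c d where "a = bump (2 - (norm y)\<^sup>2)" and "b = bump ((norm y)\<^sup>2 - 1)"
    and "c = bump (2 - (norm x)\<^sup>2)" and "d = bump ((norm x)\<^sup>2 - 1)"
  have "a \<le> c" "d \<le> b" "0 \<le> a" "0 \<le> d" using le by (auto simp: a_def b_def c_def d_def bump_nonneg intro!: bump_mono)
  moreover have "a + b > 0" "c + d > 0" using plateau_denom by (auto simp: a_def b_def c_def d_def)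
  moreover have "a * d \<le> c * b" using calculation by (intro mult_mono) auto
  ultimately have "a * inverse (a + b) \<le> c * inverse (c + d)"
    by (simp add: field_simps)
  then show ?thesis unfolding plateau_def a_def b_def c_def d_def .
qed

subsection \<open>Test functions\<close>

lemma test_functionsI:
  assumes "smooth \<phi>" "compact C" "C \<subseteq> \<Omega>" "\<And>x. x \<notin> C \<Longrightarrow> \<phi> x = 0"
  shows "\<phi> \<in> test_functions \<Omega>"
proof -
  have "closure {x. \<phi> x \<noteq> 0} \<subseteq> C" using assms by (intro closure_minimal) (auto intro: compact_imp_closed)
  moreover have "bounded {x. \<phi> x \<noteq> 0}" using assms(4)
    by (intro bounded_subset[OF compact_imp_bounded[OF assms(2)]]) blast
  ultimately show ?thesis using assms(1,3) by (auto simp: test_functions_def)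
qed

lemma test_functionsE:
  assumes "\<phi> \<in> test_functions \<Omega>"
  obtains C where "smooth \<phi>" "compact C" "C \<subseteq> \<Omega>" "\<And>x. x \<notin> C \<Longrightarrow> \<phi> x = 0"
  using assms closure_subset[of "{x. \<phi> x \<noteq> 0}"] unfolding test_functions_def by blast

lemma test_functions_smooth: "\<phi> \<in> test_functions \<Omega> \<Longrightarrow> smooth \<phi>"
  by (simp add: test_functions_def)

lemma test_functions_mono: "\<phi> \<in> test_functions \<Omega> \<Longrightarrow> \<Omega> \<subseteq> \<Omega>' \<Longrightarrow> \<phi> \<in> test_functions \<Omega>'"
  by (auto simp: test_functions_def)

lemma test_functions_comp:
  assumes "\<phi> \<in> test_functions \<Omega>" "smooth \<psi>" "\<And>x. \<phi> x = 0 \<Longrightarrow> \<psi> x = 0"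
  shows "\<psi> \<in> test_functions \<Omega>"
  using assms by (auto elim!: test_functionsE intro: test_functionsI)

lemma test_functions_partial_deriv:
  assumes "\<phi> \<in> test_functions \<Omega>" shows "partial_deriv j \<phi> \<in> test_functions \<Omega>"
proof -
  from assms obtain C where C: "smooth \<phi>" "compact C" "C \<subseteq> \<Omega>" "\<And>x. x \<notin> C \<Longrightarrow> \<phi> x = 0"
    by (rule test_functionsE) blast
  show ?thesis
  proof (rule test_functionsI[OF _ C(2,3)])
    fix x assume "x \<notin> C"
    have "((\<lambda>_. 0) has_derivative (\<lambda>_. 0)) (at x)" by simp
    then have "(\<phi> has_derivative (\<lambda>_. 0)) (at x)"
      by (rule has_derivative_transform_within_open[of _ _ _ _ "- C"])
         (use C \<open>x \<notin> C\<close> compact_imp_closed in auto)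
    then show "partial_deriv j \<phi> x = 0" by (rule partial_deriv_eqI)
  qed (use C in auto)
qed

lemma test_functions_bounded:
  assumes "\<phi> \<in> test_functions \<Omega>" shows "\<exists>B. \<forall>x. norm (\<phi> x) \<le> B"
proof -
  from assms obtain C where C: "smooth \<phi>" "compact C" "C \<subseteq> \<Omega>" "\<And>x. x \<notin> C \<Longrightarrow> \<phi> x = 0"
    by (rule test_functionsE) blast
  have "bounded (\<phi> ` C)"
    by (intro compact_imp_bounded compact_continuous_image C smooth_continuous_on)
  then obtain B where "\<forall>x\<in>C. norm (\<phi> x) \<le> B" by (auto simp: bounded_iff)
  then have "\<forall>x. norm (\<phi> x) \<le> max B 0" using C(4) by (metis max.coboundedI1 max.cobounded2 norm_zero)
  then show ?thesis by blast
qed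

lemma compact_support_integrable:
  fixes \<phi> :: "'a::euclidean_space \<Rightarrow> 'b::{banach, second_countable_topology}"
  assumes "continuous_on UNIV \<phi>" "compact C" "\<And>x. x \<notin> C \<Longrightarrow> \<phi> x = 0"
  shows "integrable lborel \<phi>"
proof -
  have "set_integrable lborel C \<phi>"
    unfolding set_integrable_def
    using assms by (intro borel_integrable_compact continuous_on_subset[OF assms(1)]) auto
  moreover have "(\<lambda>x. indicator C x *\<^sub>R \<phi> x) = \<phi>" using assms(3) by (auto simp: indicator_def fun_eq_iff)
  ultimately show ?thesis by (simp add: set_integrable_def)
qed

lemma test_functions_integrable:
  fixes \<phi> :: "real^'n::finite \<Rightarrow> 'b::{banach, second_countable_topology}"
  shows "\<phi> \<in> test_functions \<Omega> \<Longrightarrow> integrable lborel \<phi>"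
  by (erule test_functionsE) (auto intro: compact_support_integrable smooth_continuous_on)

lemma test_functions_lipschitz:
  fixes \<phi> :: "real^'n::finite \<Rightarrow> 'b::real_normed_vector"
  assumes "\<phi> \<in> test_functions \<Omega>" shows "\<exists>L\<ge>0. \<forall>x y. norm (\<phi> x - \<phi> y) \<le> L * norm (x - y)"
proof -
  have "\<exists>B. \<forall>x. norm (partial_deriv j \<phi> x) \<le> B" for j
    using test_functions_bounded[OF test_functions_partial_deriv[OF assms]] .
  then obtain B where B: "\<And>j x. norm (partial_deriv j \<phi> x) \<le> B j" by metis
  have B0: "B j \<ge> 0" for j using B norm_ge_zero order_trans by blast
  let ?L = "\<Sum>j\<in>UNIV. B j"
  have "norm (\<phi> x - \<phi> y) \<le> ?L * norm (x - y)" for x y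
  proof (rule differentiable_bound[where S=UNIV])
    show "(\<phi> has_derivative (\<lambda>h. \<Sum>j\<in>UNIV. (h $ j) *\<^sub>R partial_deriv j \<phi> x)) (at x within UNIV)" for x
      using smooth_has_derivative[OF test_functions_smooth[OF assms]] by simp
    show "onorm (\<lambda>h. \<Sum>j\<in>UNIV. (h $ j) *\<^sub>R partial_deriv j \<phi> x) \<le> ?L" for x
    proof (rule onorm_le)
      fix h :: "real^'n"
      have "norm (\<Sum>j\<in>UNIV. (h $ j) *\<^sub>R partial_deriv j \<phi> x) \<le> (\<Sum>j\<in>UNIV. norm h * B j)"
        by (intro sum_norm_le) (auto intro!: mult_mono B component_le_norm_cart B0)
      then show "norm (\<Sum>j\<in>UNIV. (h $ j) *\<^sub>R partial_deriv j \<phi> x) \<le> ?L * norm h"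
        by (simp add: sum_distrib_left mult.commute)
    qed
  qed auto
  then show ?thesis using B0 by (intro exI[of _ ?L]) (auto intro: sum_nonneg)
qed

section \<open>Lebesgue integrals on Euclidean spaces\<close>

lemma nn_integral_lborel_affine:
  fixes f :: "'a::euclidean_space \<Rightarrow> ennreal"
  assumes [measurable]: "f \<in> borel_measurable borel" and c: "c \<noteq> 0"
  shows "(\<integral>\<^sup>+x. f x \<partial>lborel) = \<bar>c\<bar> ^ DIM('a) * (\<integral>\<^sup>+x. f (t + c *\<^sub>R x) \<partial>lborel)"
  by (subst lborel_affine[OF c, of t])
     (simp add: nn_integral_density nn_integral_distr nn_integral_cmult ennreal_power)

lemma lborel_integrable_affine:
  fixes f :: "'a::euclidean_space \<Rightarrow> 'b::{banach, second_countable_topology}"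
  assumes f: "integrable lborel f" and c: "c \<noteq> 0"
  shows "integrable lborel (\<lambda>x. f (t + c *\<^sub>R x))"
  using f f[THEN borel_measurable_integrable] c unfolding integrable_iff_bounded
  by (subst (asm) nn_integral_lborel_affine[where c=c and t=t]) (auto simp: ennreal_mult_less_top)

lemma lborel_integral_affine:
  fixes f :: "'a::euclidean_space \<Rightarrow> 'b::{banach, second_countable_topology}"
  assumes c: "c \<noteq> 0"
  shows "(LINT x|lborel. f x) = \<bar>c\<bar> ^ DIM('a) *\<^sub>R (LINT x|lborel. f (t + c *\<^sub>R x))"
proof cases
  assume f[measurable]: "integrable lborel f"
  then have [measurable]: "f \<in> borel_measurable borel" by auto
  show ?thesis
    by (subst lborel_affine[OF c, of t], subst integral_density)
       (auto simp: f c integral_distr lborel_integrable_affine)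
next
  assume f: "\<not> integrable lborel f"
  have "\<not> integrable lborel (\<lambda>x. f (t + c *\<^sub>R x))"
  proof
    assume "integrable lborel (\<lambda>x. f (t + c *\<^sub>R x))"
    from lborel_integrable_affine[OF this, of "inverse c" "- (inverse c *\<^sub>R t)"] c f show False
      by (simp add: scaleR_diff_right)
  qed
  then show ?thesis using f by (simp add: not_integrable_integral_eq)
qed

lemmas nn_integral_lborel_shift =
  nn_integral_lborel_affine[where c=1, simplified]
lemmas lborel_integrable_shift = lborel_integrable_affine[where c=1, simplified]
lemmas lborel_integral_shift = lborel_integral_affine[where c=1, simplified]
lemmas nn_integral_lborel_reflect =
  nn_integral_lborel_affine[where c="-1", simplified]
lemmas lborel_integrable_reflect = lborel_integrable_affine[where c="-1", simplified]
lemmas lborel_integral_reflect = lborel_integral_affine[where c="-1", simplified]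

lemma integrable_pairI:
  fixes F :: "'a::euclidean_space \<Rightarrow> 'b::euclidean_space \<Rightarrow> 'c::{banach, second_countable_topology}"
  assumes [measurable]: "case_prod F \<in> borel_measurable (borel \<Otimes>\<^sub>M borel)"
    and fin: "(\<integral>\<^sup>+x. \<integral>\<^sup>+y. norm (F x y) \<partial>lborel \<partial>lborel) < \<infinity>"
  shows "integrable (lborel \<Otimes>\<^sub>M lborel) (case_prod F)"
proof (rule integrableI_bounded)
  have "(\<integral>\<^sup>+p. norm (case_prod F p) \<partial>(lborel \<Otimes>\<^sub>M lborel)) = (\<integral>\<^sup>+x. \<integral>\<^sup>+y. norm (F x y) \<partial>lborel \<partial>lborel)"
    by (subst lborel.nn_integral_fst[symmetric]) auto
  then show "(\<integral>\<^sup>+p. norm (case_prod F p) \<partial>(lborel \<Otimes>\<^sub>M lborel)) < \<infinity>" using fin by simp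
qed auto

lemma integrable_pair_boundI:
  fixes F :: "'a::euclidean_space \<Rightarrow> 'b::euclidean_space \<Rightarrow> 'c::{banach, second_countable_topology}"
  assumes "case_prod F \<in> borel_measurable (borel \<Otimes>\<^sub>M borel)"
    and g: "integrable lborel g" and h: "integrable lborel h"
    and le: "\<And>x y. norm (F x y) \<le> g x * (h y :: real)"
  shows "integrable (lborel \<Otimes>\<^sub>M lborel) (case_prod F)"
proof (rule integrable_pairI[OF assms(1)])
  have [measurable]: "g \<in> borel_measurable borel" "h \<in> borel_measurable borel" using g h by auto
  have "(\<integral>\<^sup>+x. \<integral>\<^sup>+y. norm (F x y) \<partial>lborel \<partial>lborel) \<le> (\<integral>\<^sup>+x. \<integral>\<^sup>+y. ennreal (norm (g x)) * ennreal (norm (h y)) \<partial>lborel \<partial>lborel)"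
  proof (intro nn_integral_mono)
    fix x y show "ennreal (norm (F x y)) \<le> ennreal (norm (g x)) * ennreal (norm (h y))"
      using le[of x y] by (subst ennreal_mult[symmetric]) (auto intro!: ennreal_leI simp: abs_mult[symmetric])
  qed
  also have "\<dots> = (\<integral>\<^sup>+x. norm (g x) \<partial>lborel) * (\<integral>\<^sup>+y. norm (h y) \<partial>lborel)"
    by (simp add: nn_integral_cmult nn_integral_multc)
  also have "\<dots> < \<infinity>" using g h by (simp add: integrable_iff_bounded ennreal_mult_less_top)
  finally show "(\<integral>\<^sup>+x. \<integral>\<^sup>+y. norm (F x y) \<partial>lborel \<partial>lborel) < \<infinity>" .
qed

section \<open>Parameter integrals, product integrals and integrability from decay\<close>

lemma dominated_tendsto_at:
  fixes s :: "'c::first_countable_topology \<Rightarrow> 'a \<Rightarrow> 'b::{banach, second_countable_topology}"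
  assumes "f \<in> borel_measurable M" "\<And>t. s t \<in> borel_measurable M" "integrable M w"
    and "\<And>x. ((\<lambda>t. s t x) \<longlongrightarrow> f x) (at t0)" and "\<And>x t. norm (s t x) \<le> w x"
  shows "((\<lambda>t. LINT x|M. s t x) \<longlongrightarrow> (LINT x|M. f x)) (at t0)"
  unfolding tendsto_at_iff_sequentially comp_def
proof (intro allI impI)
  fix X :: "nat \<Rightarrow> 'c" assume X: "\<forall>i. X i \<in> UNIV - {t0}" "X \<longlonglongrightarrow> t0"
  show "(\<lambda>i. LINT x|M. s (X i) x) \<longlonglongrightarrow> (LINT x|M. f x)"
  proof (rule integral_dominated_convergence[where w=w])
    show "AE x in M. (\<lambda>i. s (X i) x) \<longlonglongrightarrow> f x"
      using assms(4) X by (auto simp: tendsto_at_iff_sequentially comp_def)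
  qed (use assms in auto)
qed

lemma dominated_continuous:
  fixes s :: "'c::{first_countable_topology,t2_space} \<Rightarrow> 'a \<Rightarrow> 'b::{banach, second_countable_topology}"
  assumes "\<And>t. s t \<in> borel_measurable M" "integrable M w"
    and "\<And>x. continuous_on UNIV (\<lambda>t. s t x)" and "\<And>x t. norm (s t x) \<le> w x"
  shows "continuous_on UNIV (\<lambda>t. LINT x|M. s t x)"
proof (rule continuous_at_imp_continuous_on, rule ballI)
  fix t0
  have "((\<lambda>t. LINT x|M. s t x) \<longlongrightarrow> (LINT x|M. s t0 x)) (at t0)"
    using assms by (intro dominated_tendsto_at[where w=w]) (auto simp: continuous_on_def)
  then show "isCont (\<lambda>t. LINT x|M. s t x) t0" by (simp add: isCont_def)
qed

lemma
  fixes f :: "'a::euclidean_space \<Rightarrow> real \<Rightarrow> 'b::{real_normed_field, banach, second_countable_topology}"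
  assumes f: "\<And>b. b \<in> Basis \<Longrightarrow> integrable lborel (f b)"
  shows integrable_lborel_prod_Basis: "integrable lborel (\<lambda>x. \<Prod>b\<in>Basis. f b (x \<bullet> b))"
    and integral_lborel_prod_Basis:
      "(LINT x|lborel. (\<Prod>b\<in>Basis. f b (x \<bullet> b))) = (\<Prod>b\<in>Basis. LINT t|lborel. f b t)"
proof -
  interpret product_sigma_finite "\<lambda>_::'a. lborel :: real measure" ..
  have [measurable]: "\<And>b. b \<in> Basis \<Longrightarrow> f b \<in> borel_measurable borel" using f by auto
  have meas: "(\<lambda>x. \<Prod>b\<in>Basis. f b (x \<bullet> b)) \<in> borel_measurable (borel :: 'a measure)" by measurable
  have T: "(\<lambda>g. \<Sum>b\<in>Basis. g b *\<^sub>R b) \<in> measurable (Pi\<^sub>M Basis (\<lambda>_. lborel)) (borel :: 'a measure)" by measurable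
  have eq: "(\<Prod>b\<in>Basis. f b ((\<Sum>b\<in>Basis. g b *\<^sub>R b) \<bullet> b)) = (\<Prod>b\<in>Basis. f b (g b))" for g
    by (intro prod.cong) auto
  show "integrable lborel (\<lambda>x. \<Prod>b\<in>Basis. f b (x \<bullet> b))"
    by (subst lborel_eq, subst integrable_distr_eq[OF T meas], unfold eq)
       (rule product_integrable_prod, auto simp: f)
  show "(LINT x|lborel. (\<Prod>b\<in>Basis. f b (x \<bullet> b))) = (\<Prod>b\<in>Basis. LINT t|lborel. f b t)"
    by (subst lborel_eq, subst integral_distr[OF T meas], unfold eq)
       (rule product_integral_prod, auto simp: f)
qed

text \<open>The comparison function is the product of \<open>1 / (1 + (x \<bullet> b)^2)\<close>
  over the basis, integrable one coordinate at a time. Each factor is at least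
  \<open>1 / (1 + norm x)^2\<close>, so decay of order \<open>2 * DIM('a)\<close> suffices and polar
  coordinates are avoided.\<close>

lemma integrable_decay:
  fixes g :: "'a::euclidean_space \<Rightarrow> 'b::{banach, second_countable_topology}"
  assumes [measurable]: "g \<in> borel_measurable borel"
    and le: "\<And>x. (1 + norm x) ^ (2 * DIM('a)) * norm (g x) \<le> C"
  shows "integrable lborel g"
proof -
  have "integrable lborel (\<lambda>x. inverse (1 + x\<^sup>2) :: real)"
    using integrable_inverse_1_plus_square by (simp add: set_integrable_def)
  from integrable_lborel_prod_Basis[where f="\<lambda>_::'a. \<lambda>x. inverse (1 + x\<^sup>2)", OF this]
  have "integrable lborel (\<lambda>x::'a. C * (\<Prod>b\<in>Basis. inverse (1 + (x \<bullet> b)\<^sup>2)))" by (rule integrable_mult_right)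
  then show ?thesis
  proof (rule Bochner_Integration.integrable_bound)
    show "AE x in lborel. norm (g x) \<le> norm (C * (\<Prod>b\<in>Basis. inverse (1 + (x \<bullet> b)\<^sup>2)))"
    proof (rule AE_I2)
      fix x :: 'a
      have "1 + (x \<bullet> b)\<^sup>2 \<le> (1 + norm x)\<^sup>2" if "b \<in> Basis" for b
      proof -
        have "\<bar>x \<bullet> b\<bar> \<le> norm x" using that by (rule Basis_le_norm)
        then have "(x \<bullet> b)\<^sup>2 \<le> (norm x)\<^sup>2" by (metis abs_le_square_iff abs_norm_cancel)
        then show ?thesis using norm_ge_zero[of x] by (simp only: power2_sum one_power2)
      qed
      then have "(\<Prod>b\<in>Basis. 1 + (x \<bullet> b)\<^sup>2) \<le> (\<Prod>b\<in>(Basis::'a set). (1 + norm x)\<^sup>2)"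
        by (intro prod_mono) (auto simp: add_nonneg_nonneg)
      also have "\<dots> = (1 + norm x) ^ (2 * DIM('a))" by (simp add: power_mult)
      finally have "(\<Prod>b\<in>Basis. 1 + (x \<bullet> b)\<^sup>2) * norm (g x) \<le> (1 + norm x) ^ (2 * DIM('a)) * norm (g x)"
        by (intro mult_right_mono) auto
      also note le[of x]
      finally have "norm (g x) \<le> C / (\<Prod>b\<in>Basis. 1 + (x \<bullet> b)\<^sup>2)"
        by (subst pos_le_divide_eq) (auto intro!: prod_pos add_pos_nonneg simp: mult.commute)
      then show "norm (g x) \<le> norm (C * (\<Prod>b\<in>Basis. inverse (1 + (x \<bullet> b)\<^sup>2)))"
        by (simp add: prod_inversef[symmetric] divide_inverse comp_def) 
    qed
  qed auto
qed

section \<open>The Fourier transform\<close>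

definition wave :: "'a::euclidean_space \<Rightarrow> 'a \<Rightarrow> complex"
  where "wave x \<xi> = cis (- 2 * pi * (x \<bullet> \<xi>))"

lemma norm_wave [simp]: "norm (wave x \<xi>) = 1" by (simp add: wave_def)

lemma wave_commute: "wave x \<xi> = wave \<xi> x" by (simp add: wave_def inner_commute)
lemma wave_add_left: "wave (x + y) \<xi> = wave x \<xi> * wave y \<xi>"
  by (simp add: wave_def cis_mult inner_add_left algebra_simps)
lemma wave_add_right: "wave x (\<xi> + \<eta>) = wave x \<xi> * wave x \<eta>"
  by (simp add: wave_def cis_mult inner_add_right algebra_simps)
lemma wave_minus_left: "wave (- x) \<xi> = cnj (wave x \<xi>)"
  by (simp add: wave_def cis_cnj)
lemma wave_minus_right: "wave x (- \<xi>) = cnj (wave x \<xi>)"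
  by (simp add: wave_def cis_cnj)
lemma wave_scaleR: "wave (c *\<^sub>R x) \<xi> = wave x (c *\<^sub>R \<xi>)"
  by (simp add: wave_def)
lemma wave_zero [simp]: "wave x 0 = 1" "wave 0 x = 1" by (simp_all add: wave_def)
lemma wave_mult_cnj: "wave x \<xi> * cnj (wave x \<xi>) = 1"
  by (simp add: wave_def cis_cnj cis_mult)

lemma continuous_on_wave [continuous_intros]:
  "continuous_on S f \<Longrightarrow> continuous_on S g \<Longrightarrow> continuous_on S (\<lambda>x. wave (f x) (g x))"
  unfolding wave_def by (intro continuous_intros)

lemma measurable_wave [measurable]:
  assumes [measurable]: "f \<in> borel_measurable M" "g \<in> borel_measurable M"
  shows "(\<lambda>x. wave (f x) (g x)) \<in> borel_measurable M"
  unfolding wave_def cis_conv_exp by measurable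

text \<open>The Taylor remainder is uniform in \<open>\<xi>\<close> and quadratic in
  \<open>h\<close>. After integration it gives the derivative of a Fourier transform directly
  through \<open>has_derivative_quadratic\<close>, without a limit under the integral sign.\<close>

lemma wave_quadratic:
  "norm (wave x (\<xi> + h) - wave x \<xi> - of_real (x \<bullet> h) * (- 2 * pi * \<i> * wave x \<xi>)) \<le> 2 * pi\<^sup>2 * (norm x)\<^sup>2 * (norm h)\<^sup>2"
proof -
  define \<theta> where "\<theta> = - 2 * pi * (x \<bullet> h)"
  have "wave x (\<xi> + h) - wave x \<xi> - of_real (x \<bullet> h) * (- 2 * pi * \<i> * wave x \<xi>) =
      wave x \<xi> * (exp (\<i> * \<theta>) - (1 + \<i> * \<theta>))"
    unfolding wave_add_right by (simp add: wave_def[of x h] cis_conv_exp \<theta>_def algebra_simps)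
  also have "norm \<dots> = norm (exp (\<i> * \<theta>) - (1 + \<i> * \<theta>))" by (simp add: norm_mult)
  also have "\<dots> \<le> \<bar>\<theta>\<bar>\<^sup>2 / 2" using iexp_approx1[of \<theta> 1] by (simp add: numeral_2_eq_2)
  also have "\<bar>\<theta>\<bar> \<le> 2 * pi * (norm x * norm h)"
    using Cauchy_Schwarz_ineq2[of x h] by (simp add: \<theta>_def abs_mult)
  then have "\<bar>\<theta>\<bar>\<^sup>2 / 2 \<le> (2 * pi * (norm x * norm h))\<^sup>2 / 2" by (intro divide_right_mono power_mono) auto
  also have "\<dots> = 2 * pi\<^sup>2 * (norm x)\<^sup>2 * (norm h)\<^sup>2" by (simp add: power_mult_distrib)
  finally show ?thesis by simp
qed

lemma wave_linear: "norm (1 - wave x \<xi>) \<le> 2 * pi * norm x * norm \<xi>"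
proof -
  define \<theta> where "\<theta> = - 2 * pi * (x \<bullet> \<xi>)"
  have "norm (1 - wave x \<xi>) = norm (exp (\<i> * \<theta>) - 1)"
    by (simp add: wave_def cis_conv_exp \<theta>_def norm_minus_commute)
  also have "\<dots> \<le> \<bar>\<theta>\<bar>" using iexp_approx1[of \<theta> 0] by simp
  also have "\<bar>\<theta>\<bar> \<le> 2 * pi * (norm x * norm \<xi>)"
    using Cauchy_Schwarz_ineq2[of x \<xi>] by (simp add: \<theta>_def abs_mult)
  finally show ?thesis by (simp add: mult.assoc)
qed

lemma norm_one_minus_wave_le: "norm (1 - wave x \<xi>) \<le> 2"
  using norm_triangle_ineq4[of 1 "wave x \<xi>"] by simp

lemma fourier_eq:
  fixes f :: "real^'n::finite \<Rightarrow> complex"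
  assumes [measurable]: "f \<in> borel_measurable borel"
  shows "fourier f \<xi> = (LINT x|lborel. f x * wave x \<xi>)"
proof -
  have "fourier f \<xi> = (LINT x|lebesgue. f x * wave x \<xi>)"
    unfolding fourier_def wave_def cis_conv_exp
    by (intro Bochner_Integration.integral_cong) (auto simp: algebra_simps)
  also have "\<dots> = (LINT x|lborel. f x * wave x \<xi>)"
    by (rule integral_completion) simp
  finally show ?thesis .
qed

lemma integrable_mult_wave:
  assumes "integrable M f" "g \<in> borel_measurable M"
  shows "integrable M (\<lambda>x. f x * wave (g x) \<xi>)"
  using assms by (intro Bochner_Integration.integrable_bound[OF assms(1)]) (auto simp: norm_mult)

lemma norm_fourier_le:
  assumes "integrable lborel f" shows "norm (fourier f \<xi>) \<le> (LINT x|lborel. norm (f x))"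
proof -
  have [measurable]: "f \<in> borel_measurable borel" using assms by auto
  have "norm (LINT x|lborel. f x * wave x \<xi>) \<le> (LINT x|lborel. norm (f x * wave x \<xi>))"
    by (rule integral_norm_bound)
  then show ?thesis by (simp add: fourier_eq norm_mult)
qed

lemma continuous_on_fourier:
  fixes f :: "real^'n::finite \<Rightarrow> complex"
  assumes "integrable lborel f" shows "continuous_on UNIV (fourier f)"
proof -
  have [measurable]: "f \<in> borel_measurable borel" using assms by auto
  have "continuous_on UNIV (\<lambda>\<xi>. LINT x|lborel. f x * wave x \<xi>)"
    by (rule dominated_continuous[where w="\<lambda>x. norm (f x)"])
       (auto simp: norm_mult assms intro!: continuous_intros)
  moreover have "fourier f = (\<lambda>\<xi>. LINT x|lborel. f x * wave x \<xi>)" by (simp add: fourier_eq fun_eq_iff)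
  ultimately show ?thesis by simp
qed

subsection \<open>Gaussians\<close>

definition gauss :: "'a::euclidean_space \<Rightarrow> real"
  where "gauss x = exp (- pi * (norm x)\<^sup>2)"

lemma gauss_nonneg [simp]: "0 \<le> gauss x" and gauss_le_1: "gauss x \<le> 1"
  by (simp_all add: gauss_def)

lemma gauss_zero [simp]: "gauss 0 = 1" by (simp add: gauss_def)

lemma continuous_on_gauss [continuous_intros]: "continuous_on S f \<Longrightarrow> continuous_on S (\<lambda>x. gauss (f x))"
  unfolding gauss_def by (intro continuous_intros)

lemma measurable_gauss [measurable]: "f \<in> borel_measurable M \<Longrightarrow> (\<lambda>x. gauss (f x)) \<in> borel_measurable M"
  unfolding gauss_def by measurable

lemma gauss_prod: "gauss (x::'a::euclidean_space) = (\<Prod>b\<in>Basis. gauss (x \<bullet> b))"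
  unfolding gauss_def power2_norm_eq_inner euclidean_inner[of x x] sum_distrib_left exp_sum[OF finite_Basis]
  by (simp add: power2_eq_square)

lemma wave_prod: "wave x \<xi> = (\<Prod>b\<in>Basis. wave (x \<bullet> b) (\<xi> \<bullet> b))" for x :: "'a::euclidean_space"
  unfolding wave_def cis_conv_exp
  by (subst euclidean_inner[of x \<xi>]) (simp add: exp_sum[symmetric] sum_distrib_left)

text \<open>Rescaling by \<open>sqrt (2 * pi)\<close> turns the standard normal density into
  \<open>gauss\<close>, so the characteristic function of the normal law yields the self-duality of
  \<open>exp (- pi * t^2)\<close>.\<close>

lemma gauss_real_integral:
  "integrable lborel (gauss :: real \<Rightarrow> real)"
  "(LINT t|lborel. complex_of_real (gauss t) * wave t s) = of_real (gauss (s::real))"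
proof -
  let ?c = "sqrt (2 * pi)"
  have d: "std_normal_density (0 + ?c * t) * ?c = gauss t" for t
    by (simp add: normal_density_def gauss_def power_mult_distrib)
  have i: "integrable lborel (\<lambda>t. std_normal_density (0 + ?c * t) * ?c)"
    using lborel_integrable_real_affine[of std_normal_density ?c 0] by (intro integrable_mult_left) auto
  then show "integrable lborel (gauss :: real \<Rightarrow> real)" unfolding d .
  have "(LINT t|lborel. complex_of_real (gauss t) * wave t s) =
      (LINT t|lborel. ?c *\<^sub>R (of_real (std_normal_density (0 + ?c * t)) * iexp (- ?c * s * (0 + ?c * t))))"
    by (intro Bochner_Integration.integral_cong refl)
       (simp add: d[symmetric] wave_def cis_conv_exp scaleR_conv_of_real algebra_simps flip: of_real_mult)
  also have "\<dots> = \<bar>?c\<bar> *\<^sub>R (LINT t|lborel. (of_real (std_normal_density (0 + ?c * t)) * iexp (- ?c * s * (0 + ?c * t))))"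
    by simp
  also have "\<dots> = (LINT t|lborel. of_real (std_normal_density t) * iexp (- ?c * s * t))"
    by (subst lborel_integral_real_affine[where c="?c" and t=0]) simp_all
  also have "\<dots> = char std_normal_distribution (- ?c * s)"
    unfolding char_def by (subst integral_density) (auto simp: scaleR_conv_of_real)
  also have "\<dots> = of_real (gauss s)"
    by (simp add: char_std_normal_distribution gauss_def power_mult_distrib)
  finally show "(LINT t|lborel. complex_of_real (gauss t) * wave t s) = of_real (gauss s)" .
qed

lemma integrable_gauss: "integrable lborel (gauss :: 'a::euclidean_space \<Rightarrow> real)"
  using integrable_lborel_prod_Basis[where f="\<lambda>_::'a. gauss", OF gauss_real_integral(1)]
  by (simp add: gauss_prod[symmetric])

lemma gauss_fourier:
  "(LINT x|lborel. complex_of_real (gauss x) * wave x \<xi>) = of_real (gauss (\<xi>::'a::euclidean_space))"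
proof -
  have "(LINT x|lborel. complex_of_real (gauss x) * wave x \<xi>) =
      (LINT x|lborel. (\<Prod>b\<in>Basis. of_real (gauss (x \<bullet> b)) * wave (x \<bullet> b) (\<xi> \<bullet> b)))"
    by (subst gauss_prod, subst wave_prod) (simp add: prod.distrib)
  also have "\<dots> = (\<Prod>b\<in>Basis. LINT t|lborel. of_real (gauss t) * wave t (\<xi> \<bullet> b))"
    by (intro integral_lborel_prod_Basis integrable_mult_wave integrable_of_real gauss_real_integral(1)) auto
  finally show ?thesis unfolding gauss_real_integral(2) by (simp add: gauss_prod[of \<xi>])
qed

lemma gauss_integral: "(LINT x|lborel. complex_of_real (gauss (x::'a::euclidean_space))) = 1"
  using gauss_fourier[of "0::'a"] by simp

text \<open>Gaussian summability: by Fubini and the self-duality of the Gaussian, damping the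
  transform at scale \<open>r\<close> amounts to averaging \<open>f (x / r)\<close> against
  \<open>gauss\<close>, which concentrates at \<open>0\<close>. The damping gives a meaning to the
  inversion integral even for transforms not known to be integrable, such as that of the
  autocorrelation in \<open>plancherel\<close>.\<close>

lemma fourier_gauss_limit:
  fixes f :: "real^'n::finite \<Rightarrow> complex"
  assumes f: "integrable lborel f" and B: "\<And>x. norm (f x) \<le> B" and c: "isCont f 0"
  shows "(\<lambda>k. LINT \<xi>|lborel. fourier f \<xi> * of_real (gauss (\<xi> /\<^sub>R real (Suc k)))) \<longlonglongrightarrow> f 0"
proof -
  have [measurable]: "f \<in> borel_measurable borel" using f by auto
  let ?D = "DIM(real^'n)"
  have eq: "(LINT \<xi>|lborel. fourier f \<xi> * of_real (gauss (\<xi> /\<^sub>R r))) =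
      (LINT x|lborel. f (x /\<^sub>R r) * of_real (gauss x))" if r: "r > 0" for r :: real
  proof -
    have ig: "integrable lborel (\<lambda>\<xi>::real^'n. gauss (\<xi> /\<^sub>R r))"
      using lborel_integrable_affine[OF integrable_gauss, of "inverse r" 0] r by simp
    have inner: "(LINT \<xi>|lborel. wave x \<xi> * of_real (gauss (\<xi> /\<^sub>R r))) = r ^ ?D * gauss (r *\<^sub>R x)" for x :: "real^'n"
    proof -
      have "(LINT \<xi>|lborel. wave x \<xi> * of_real (gauss (\<xi> /\<^sub>R r))) =
          \<bar>r\<bar> ^ ?D *\<^sub>R (LINT \<xi>|lborel. wave x (0 + r *\<^sub>R \<xi>) * of_real (gauss ((0 + r *\<^sub>R \<xi>) /\<^sub>R r)))"
        using r by (intro lborel_integral_affine) auto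
      also have "(LINT \<xi>|lborel. wave x (0 + r *\<^sub>R \<xi>) * of_real (gauss ((0 + r *\<^sub>R \<xi>) /\<^sub>R r))) =
          (LINT \<xi>|lborel. of_real (gauss \<xi>) * wave \<xi> (r *\<^sub>R x))"
        using r by (intro Bochner_Integration.integral_cong refl) (simp add: wave_def inner_commute)
      finally show ?thesis unfolding gauss_fourier using r by (simp add: scaleR_conv_of_real)
    qed
    have "(LINT \<xi>|lborel. fourier f \<xi> * of_real (gauss (\<xi> /\<^sub>R r))) =
        (LINT \<xi>|lborel. (LINT x|lborel. f x * (wave x \<xi> * of_real (gauss (\<xi> /\<^sub>R r)))))"
      by (simp add: fourier_eq mult.assoc[symmetric])
    also have "\<dots> = (LINT x|lborel. (LINT \<xi>|lborel. f x * (wave x \<xi> * of_real (gauss (\<xi> /\<^sub>R r)))))"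
      by (rule lborel_pair.Fubini_integral, rule integrable_pair_boundI[where g="\<lambda>x. norm (f x)" and h="\<lambda>\<xi>. gauss (\<xi> /\<^sub>R r)"])
         (auto simp: norm_mult f ig)
    also have "\<dots> = (LINT x|lborel. f x * (r ^ ?D * gauss (r *\<^sub>R x)))" by (simp add: inner)
    also have "\<dots> = \<bar>inverse r\<bar> ^ ?D *\<^sub>R (LINT x|lborel. f (0 + inverse r *\<^sub>R x) * (r ^ ?D * gauss (r *\<^sub>R (0 + inverse r *\<^sub>R x))))"
      using r by (intro lborel_integral_affine) auto
    also have "\<dots> = (LINT x|lborel. f (x /\<^sub>R r) * of_real (gauss x))"
      using r by (subst integral_scaleR_right[symmetric], intro Bochner_Integration.integral_cong)
         (auto simp: scaleR_conv_of_real[where 'a=complex] power_inverse)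
    finally show ?thesis .
  qed
  have "(\<lambda>k. LINT x|lborel. f (x /\<^sub>R real (Suc k)) * of_real (gauss x)) \<longlonglongrightarrow> (LINT x|lborel. f 0 * of_real (gauss (x::real^'n)))"
  proof (rule integral_dominated_convergence[where w="\<lambda>x. B * gauss x"])
    show "AE x in lborel. (\<lambda>k. f (x /\<^sub>R real (Suc k)) * of_real (gauss x)) \<longlonglongrightarrow> f 0 * of_real (gauss x)"
    proof (rule AE_I2)
      fix x :: "real^'n"
      have "(\<lambda>k. inverse (real (Suc k)) *\<^sub>R x) \<longlonglongrightarrow> 0 *\<^sub>R x"
        by (intro tendsto_intros LIMSEQ_inverse_real_of_nat)
      then have "(\<lambda>k. f (x /\<^sub>R real (Suc k))) \<longlonglongrightarrow> f 0"
        using isCont_tendsto_compose[OF c] by simp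
      then show "(\<lambda>k. f (x /\<^sub>R real (Suc k)) * of_real (gauss x)) \<longlonglongrightarrow> f 0 * of_real (gauss x)"
        by (intro tendsto_intros)
    qed
  qed (auto simp: norm_mult integrable_gauss intro!: mult_right_mono B)
  moreover have "(LINT x|lborel. f 0 * of_real (gauss (x::real^'n))) = f 0"
    unfolding integral_mult_right_zero gauss_integral by simp
  ultimately show ?thesis
    unfolding eq[OF of_nat_0_less_iff[THEN iffD2, OF zero_less_Suc]] by (simp only:)
qed

subsection \<open>Inversion and Plancherel for test functions\<close>

lemma has_derivative_quadratic:
  assumes "bounded_linear f'" and le: "\<And>h. norm (f (x + h) - f x - f' h) \<le> C * (norm h)\<^sup>2"
  shows "(f has_derivative f') (at x)"
  unfolding has_derivative_at
proof (intro conjI assms)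
  have "isCont (\<lambda>h. C * norm h) (0::'a)" by (intro continuous_intros)
  then have "((\<lambda>h. C * norm h) \<longlongrightarrow> 0) (at (0::'a))" by (simp add: isCont_def)
  then show "((\<lambda>h. norm (f (x + h) - f x - f' h) / norm h) \<longlongrightarrow> 0) (at 0)"
  proof (rule tendsto_0_le[where K=1])
    show "\<forall>\<^sub>F h in at 0. norm (norm (f (x + h) - f x - f' h) / norm h) \<le> norm (C * norm h) * 1"
    proof (rule always_eventually, rule allI)
      fix h :: 'a
      have "norm (f (x + h) - f x - f' h) / norm h \<le> (C * (norm h)\<^sup>2) / norm h"
        by (intro divide_right_mono le) auto
      also have "\<dots> = C * norm h" by (simp add: power2_eq_square)
      also have "\<dots> \<le> \<bar>C * norm h\<bar>" by simp
      finally show "norm (norm (f (x + h) - f x - f' h) / norm h) \<le> norm (C * norm h) * 1" by simp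
    qed
  qed
qed

text \<open>The sign is the one for which \<open>fourier (fourier_mult j f)\<close> is the
  \<open>j\<close>-th partial derivative of \<open>fourier f\<close>.\<close>

definition fourier_mult :: "'n::finite \<Rightarrow> (real^'n \<Rightarrow> complex) \<Rightarrow> real^'n \<Rightarrow> complex"
  where "fourier_mult j f x = - 2 * pi * \<i> * of_real (x $ j) * f x"

lemma fourier_mult_test:
  assumes "f \<in> test_functions \<Omega>" shows "fourier_mult j f \<in> test_functions \<Omega>"
  unfolding fourier_mult_def[abs_def]
  by (rule test_functions_comp[OF assms])
    (intro smooth_mult smooth_const smooth_of_real smooth_nth test_functions_smooth[OF assms], simp_all)

lemma integrable_test_times:
  fixes f :: "real^'n::finite \<Rightarrow> complex"
  assumes "f \<in> test_functions \<Omega>" "continuous_on UNIV g"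
  shows "integrable lborel (\<lambda>x. (g x :: complex) * f x)"
  using assms(1)
  by (elim test_functionsE) (rule compact_support_integrable,
      intro continuous_on_mult assms(2) smooth_continuous_on, auto)

lemma fourier_has_derivative:
  assumes "f \<in> test_functions UNIV"
  shows "(fourier f has_derivative (\<lambda>h. \<Sum>j\<in>UNIV. (h $ j) *\<^sub>R fourier (fourier_mult j f) \<xi>)) (at \<xi>)"
proof (rule has_derivative_quadratic)
  have [measurable]: "f \<in> borel_measurable borel"
    using smooth_borel_measurable[OF test_functions_smooth[OF assms]] .
  have if0: "integrable lborel f" by (rule test_functions_integrable[OF assms])
  have "fourier_mult j f \<in> test_functions UNIV" for j by (rule fourier_mult_test[OF assms])
  then have ij: "integrable lborel (fourier_mult j f)" for j by (rule test_functions_integrable)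
  have i2: "integrable lborel (\<lambda>x. (norm x)\<^sup>2 * norm (f x))"
    using integrable_norm[OF integrable_test_times[OF assms, of "\<lambda>x. of_real ((norm x)\<^sup>2)"]]
    by (simp add: norm_mult norm_power continuous_intros)
  fix h
  have "(\<Sum>j\<in>UNIV. (h $ j) *\<^sub>R fourier (fourier_mult j f) \<xi>) =
      (LINT x|lborel. (\<Sum>j\<in>UNIV. (h $ j) *\<^sub>R (fourier_mult j f x * wave x \<xi>)))"
    using ij by (subst Bochner_Integration.integral_sum)
      (auto simp: fourier_eq intro!: integrable_mult_wave)
  also have "\<dots> = (LINT x|lborel. f x * (of_real (x \<bullet> h) * (- 2 * pi * \<i> * wave x \<xi>)))"
    by (intro Bochner_Integration.integral_cong refl)
      (simp add: fourier_mult_def scaleR_conv_of_real inner_vec_def sum_distrib_left sum_distrib_right algebra_simps sum_negf)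
  finally have s: "(\<Sum>j\<in>UNIV. (h $ j) *\<^sub>R fourier (fourier_mult j f) \<xi>) =
      (LINT x|lborel. f x * (of_real (x \<bullet> h) * (- 2 * pi * \<i> * wave x \<xi>)))" .
  have i3: "integrable lborel (\<lambda>x. f x * (of_real (x \<bullet> h) * (- 2 * pi * \<i> * wave x \<xi>)))"
    using integrable_test_times[OF assms, of "\<lambda>x. of_real (x \<bullet> h) * (- 2 * pi * \<i> * wave x \<xi>)"]
    by (simp add: continuous_intros mult.commute)
  have iw: "integrable lborel (\<lambda>x. f x * wave x \<eta>)" for \<eta>
    using if0 by (intro integrable_mult_wave) auto
  have "fourier f (\<xi> + h) - fourier f \<xi> - (\<Sum>j\<in>UNIV. (h $ j) *\<^sub>R fourier (fourier_mult j f) \<xi>) =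
     (LINT x|lborel. f x * (wave x (\<xi> + h) - wave x \<xi> - of_real (x \<bullet> h) * (- 2 * pi * \<i> * wave x \<xi>)))"
    unfolding s right_diff_distrib
    by (subst Bochner_Integration.integral_diff[OF Bochner_Integration.integrable_diff[OF iw iw] i3],
        subst Bochner_Integration.integral_diff[OF iw iw]) (simp add: fourier_eq)
  also have "norm \<dots> \<le> (LINT x|lborel. (2 * pi\<^sup>2 * (norm h)\<^sup>2) * ((norm x)\<^sup>2 * norm (f x)))"
  proof (rule Bochner_Integration.integral_norm_bound_integral)
    fix x
    show "norm (f x * (wave x (\<xi> + h) - wave x \<xi> - of_real (x \<bullet> h) * (- 2 * pi * \<i> * wave x \<xi>)))
        \<le> (2 * pi\<^sup>2 * (norm h)\<^sup>2) * ((norm x)\<^sup>2 * norm (f x))"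
      unfolding norm_mult[of "f x"] using mult_left_mono[OF wave_quadratic[of x \<xi> h] norm_ge_zero[of "f x"]]
      by (simp add: mult_ac)
  next
    show "integrable lborel (\<lambda>x. f x * (wave x (\<xi> + h) - wave x \<xi> - of_real (x \<bullet> h) * (- 2 * pi * \<i> * wave x \<xi>)))"
      unfolding right_diff_distrib by (intro Bochner_Integration.integrable_diff iw i3)
  qed (use i2 in auto)
  also have "\<dots> = (2 * pi\<^sup>2 * (LINT x|lborel. (norm x)\<^sup>2 * norm (f x))) * (norm h)\<^sup>2" by simp
  finally show "norm (fourier f (\<xi> + h) - fourier f \<xi> - (\<Sum>j\<in>UNIV. (h $ j) *\<^sub>R fourier (fourier_mult j f) \<xi>))
     \<le> (2 * pi\<^sup>2 * (LINT x|lborel. (norm x)\<^sup>2 * norm (f x))) * (norm h)\<^sup>2" .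
qed (intro bounded_linear_sum bounded_linear_scaleR_const[OF bounded_linear_vec_nth])

lemma partial_deriv_fourier:
  assumes "f \<in> test_functions UNIV"
  shows "partial_deriv j (fourier f) = fourier (fourier_mult j f)"
  using partial_deriv_eqI[OF fourier_has_derivative[OF assms]] by (auto simp: axis_sum)

text \<open>Test functions are stable under \<open>fourier_mult\<close>, so every iterated
  derivative of a transform is the transform of another test function. Smoothness and decay then
  need to be treated only for the transform itself.\<close>

lemma partial_derivs_fourier:
  assumes "f \<in> test_functions UNIV"
  shows "\<exists>g\<in>test_functions UNIV. partial_derivs js (fourier f) = fourier g"
proof (induction js)
  case Nil
  then show ?case using assms by (auto simp: partial_derivs_def)
next
  case (Cons j js)
  then obtain g where g: "g \<in> test_functions UNIV" "partial_derivs js (fourier f) = fourier g" by blast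
  then have "partial_derivs (j # js) (fourier f) = fourier (fourier_mult j g)"
    using partial_deriv_fourier[OF g(1)] by (simp add: partial_derivs_def)
  then show ?case using fourier_mult_test[OF g(1)] by blast
qed

lemma smooth_fourier:
  assumes "f \<in> test_functions UNIV" shows "smooth (fourier f)"
  unfolding smooth_def
proof
  fix js :: "'a list"
  obtain g where g: "g \<in> test_functions UNIV" "partial_derivs js (fourier f) = fourier g"
    using partial_derivs_fourier[OF assms] by blast
  then show "partial_derivs js (fourier f) differentiable_on UNIV"
    using fourier_has_derivative[OF g(1)] by (auto simp: differentiable_on_def differentiable_def)
qed

lemma has_vector_derivative_at_0_iff:
  fixes f :: "real \<Rightarrow> 'b::real_normed_vector"
  shows "(f has_vector_derivative d) (at 0) \<longleftrightarrow> ((\<lambda>t. (f t - f 0) /\<^sub>R t) \<longlongrightarrow> d) (at 0)"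
proof -
  have "norm ((f t - f 0) /\<^sub>R t - d) = norm (f t - f 0 - t *\<^sub>R d) / norm t" if "t \<noteq> 0" for t
  proof -
    have "(f t - f 0) /\<^sub>R t - d = (f t - f 0 - t *\<^sub>R d) /\<^sub>R t"
      using that by (simp add: scaleR_diff_right)
    then show ?thesis by (simp add: divide_inverse mult.commute)
  qed
  then have "(((\<lambda>t. (f t - f 0) /\<^sub>R t) \<longlongrightarrow> d) (at 0)) \<longleftrightarrow>
      ((\<lambda>t. norm (f t - f 0 - t *\<^sub>R d) / norm t) \<longlongrightarrow> 0) (at 0)"
    unfolding Lim_null[of _ d] tendsto_norm_zero_iff[symmetric, of "\<lambda>t. (f t - f 0) /\<^sub>R t - d"]
    by (intro filterlim_cong refl) (auto simp: eventually_at_filter)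
  then show ?thesis
    by (simp add: has_vector_derivative_def has_derivative_at bounded_linear_scaleR_left)
qed

text \<open>By translation invariance every difference quotient has integral \<open>0\<close>. The
  quotients have steps at most \<open>1\<close>, so they are supported in the ball of radius
  \<open>r + 1\<close>, where the Lipschitz constant dominates them.\<close>

lemma integral_partial_deriv_test:
  fixes g :: "real^'n::finite \<Rightarrow> complex"
  assumes g: "g \<in> test_functions UNIV"
  shows "(LINT x|lborel. partial_deriv j g x) = 0"
proof -
  obtain C where C: "smooth g" "compact C" "\<And>x. x \<notin> C \<Longrightarrow> g x = 0" using g by (rule test_functionsE) blast
  obtain L where L: "L \<ge> 0" "\<And>x y. norm (g x - g y) \<le> L * norm (x - y)"
    using test_functions_lipschitz[OF g] by blast
  obtain r where r: "\<And>x. x \<in> C \<Longrightarrow> norm x \<le> r"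
    using compact_imp_bounded[OF C(2)] by (auto simp: bounded_iff)
  have gi: "integrable lborel g" by (rule test_functions_integrable[OF g])
  have [measurable]: "g \<in> borel_measurable borel" "partial_deriv j g \<in> borel_measurable borel"
    using smooth_borel_measurable[OF C(1)] smooth_borel_measurable[OF smooth_partial_deriv[OF C(1)]] by auto
  let ?h = "\<lambda>k. inverse (real (Suc k))"
  let ?q = "\<lambda>k x. (g (?h k *\<^sub>R axis j 1 + x) - g x) /\<^sub>R ?h k"
  have "(\<lambda>k. LINT x|lborel. ?q k x) \<longlonglongrightarrow> (LINT x|lborel. partial_deriv j g x)"
  proof (rule integral_dominated_convergence[where w="\<lambda>x. indicat_real (cball 0 (r + 1)) x *\<^sub>R L"])
    show "integrable lborel (\<lambda>x. indicat_real (cball (0::real^'n) (r + 1)) x *\<^sub>R L)"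
      by (rule borel_integrable_compact) auto
    show "AE x in lborel. (\<lambda>k. ?q k x) \<longlonglongrightarrow> partial_deriv j g x"
    proof (rule AE_I2)
      fix x :: "real^'n"
      have "((\<lambda>t::real. x + t *\<^sub>R axis j 1) has_derivative (\<lambda>t. t *\<^sub>R axis j 1)) (at 0)"
        by (auto intro!: derivative_eq_intros)
      moreover have "(g has_derivative (\<lambda>h. \<Sum>i\<in>UNIV. (h $ i) *\<^sub>R partial_deriv i g x)) (at (x + 0 *\<^sub>R axis j 1))"
        using smooth_has_derivative[OF C(1), of x] by simp
      ultimately have "((\<lambda>t. g (x + t *\<^sub>R axis j 1)) has_derivative
          (\<lambda>t. \<Sum>i\<in>UNIV. ((t *\<^sub>R axis j 1) $ i) *\<^sub>R partial_deriv i g x)) (at 0)"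
        by (rule has_derivative_compose)
      then have "((\<lambda>t. g (x + t *\<^sub>R axis j 1)) has_vector_derivative partial_deriv j g x) (at 0)"
        unfolding has_vector_derivative_def vector_scaleR_component real_scaleR_def
          scaleR_scaleR[symmetric] scaleR_sum_right[symmetric] axis_sum .
      then have "((\<lambda>t. (g (x + t *\<^sub>R axis j 1) - g x) /\<^sub>R t) \<longlongrightarrow> partial_deriv j g x) (at 0)"
        by (simp add: has_vector_derivative_at_0_iff)
      moreover have "filterlim ?h (at 0) sequentially"
        by (rule filterlim_atI[OF LIMSEQ_inverse_real_of_nat]) simp
      ultimately show "(\<lambda>k. ?q k x) \<longlonglongrightarrow> partial_deriv j g x"
        by (auto dest: filterlim_compose simp: add.commute)
    qed
    show "AE x in lborel. norm (?q k x) \<le> indicat_real (cball 0 (r + 1)) x *\<^sub>R L" for k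
    proof (rule AE_I2)
      fix x
      have h: "?h k > 0" "?h k \<le> 1" by (auto simp: divide_simps)
      show "norm (?q k x) \<le> indicat_real (cball 0 (r + 1)) x *\<^sub>R L"
      proof (cases "norm x \<le> r + 1")
        case True
        have "norm (g (?h k *\<^sub>R axis j 1 + x) - g x) \<le> L * ?h k"
          using L(2)[of "?h k *\<^sub>R axis j 1 + x" x] h(1) by (simp add: norm_axis_1)
        then have "norm (?q k x) \<le> L" using h(1) by (simp add: divide_simps mult.commute)
        then show ?thesis using True by simp
      next
        case False
        have "norm x \<le> norm (?h k *\<^sub>R axis j 1 + x) + ?h k"
          using norm_triangle_ineq4[of "?h k *\<^sub>R axis j 1 + x" "?h k *\<^sub>R axis j (1::real)"] h(1) by (simp add: norm_axis_1)
        then have "x \<notin> C" "?h k *\<^sub>R axis j 1 + x \<notin> C" using False r h(2) by force+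
        then show ?thesis using C(3) L(1) by (simp add: indicator_def)
      qed
    qed
  qed auto
  moreover have "(LINT x|lborel. ?q k x) = 0" for k
    unfolding integral_scaleR_right Bochner_Integration.integral_diff[OF lborel_integrable_shift[OF gi] gi]
      lborel_integral_shift[of g "?h k *\<^sub>R axis j 1", symmetric] by simp
  ultimately have "(\<lambda>k::nat. 0) \<longlonglongrightarrow> (LINT x|lborel. partial_deriv j g x)" by (simp only:)
  then show ?thesis by (rule LIMSEQ_unique[OF _ tendsto_const])
qed

lemma smooth_wave [intro]: "smooth (\<lambda>x. wave x \<xi>)"
  unfolding wave_def by (intro smooth_cis smooth_mult smooth_const smooth_inner)

text \<open>Integration by parts, read off from the vanishing integral of the derivative of
  \<open>f x * wave x \<xi>\<close>.\<close>

lemma fourier_partial_deriv: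
  fixes f :: "real^'n::finite \<Rightarrow> complex"
  assumes f: "f \<in> test_functions UNIV"
  shows "fourier (partial_deriv j f) \<xi> = 2 * pi * \<i> * of_real (\<xi> $ j) * fourier f \<xi>"
proof -
  have sm: "smooth f" by (rule test_functions_smooth[OF f])
  have [measurable]: "f \<in> borel_measurable borel" "partial_deriv j f \<in> borel_measurable borel"
    using smooth_borel_measurable[OF sm] smooth_borel_measurable[OF smooth_partial_deriv[OF sm]] by auto
  let ?g = "\<lambda>x. f x * wave x \<xi>"
  have g: "?g \<in> test_functions UNIV" by (rule test_functions_comp[OF f]) (use sm in auto)
  have dw: "((\<lambda>x. wave x \<xi>) has_derivative (\<lambda>h. of_real (\<xi> \<bullet> h) * (- 2 * pi * \<i> * wave x \<xi>))) (at x)" for x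
  proof (rule has_derivative_quadratic)
    show "bounded_linear (\<lambda>h. of_real (\<xi> \<bullet> h) * (- 2 * pi * \<i> * wave x \<xi>))"
      by (intro bounded_linear_mult_const bounded_linear_compose[OF bounded_linear_of_real] bounded_linear_inner_right)
    show "norm (wave (x + h) \<xi> - wave x \<xi> - of_real (\<xi> \<bullet> h) * (- 2 * pi * \<i> * wave x \<xi>))
        \<le> (2 * pi\<^sup>2 * (norm \<xi>)\<^sup>2) * (norm h)\<^sup>2" for h
      using wave_quadratic[of \<xi> x h] by (simp only: wave_commute[of \<xi>])
  qed
  have "partial_deriv j ?g x = f x * (of_real (\<xi> \<bullet> axis j 1) * (- 2 * pi * \<i> * wave x \<xi>)) +
      (\<Sum>i\<in>UNIV. (axis j 1 $ i) *\<^sub>R partial_deriv i f x) * wave x \<xi>" for x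
    by (rule partial_deriv_eqI[OF has_derivative_mult[OF smooth_has_derivative[OF sm] dw]])
  then have "partial_deriv j ?g = (\<lambda>x. partial_deriv j f x * wave x \<xi> - (2 * pi * \<i> * of_real (\<xi> $ j)) * (f x * wave x \<xi>))"
    unfolding axis_sum by (simp add: fun_eq_iff inner_axis algebra_simps)
  then have "0 = (LINT x|lborel. partial_deriv j f x * wave x \<xi> - (2 * pi * \<i> * of_real (\<xi> $ j)) * (f x * wave x \<xi>))"
    using integral_partial_deriv_test[OF g, of j] by simp
  also have "\<dots> = fourier (partial_deriv j f) \<xi> - (2 * pi * \<i> * of_real (\<xi> $ j)) * fourier f \<xi>"
    using test_functions_integrable[OF f] test_functions_integrable[OF test_functions_partial_deriv[OF f]]
    by (subst Bochner_Integration.integral_diff) (auto simp: fourier_eq intro!: integrable_mult_wave)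
  finally show ?thesis by simp
qed

lemma fourier_decay_coordinate:
  fixes f :: "real^'n::finite \<Rightarrow> complex"
  assumes f: "f \<in> test_functions UNIV"
  shows "\<exists>C. \<forall>\<xi>. \<bar>\<xi> $ j\<bar> ^ N * norm (fourier f \<xi>) \<le> C"
  using f
proof (induction N arbitrary: f)
  case 0
  then show ?case using norm_fourier_le[OF test_functions_integrable] by auto
next
  case (Suc N)
  obtain C where C: "\<And>\<xi>. \<bar>\<xi> $ j\<bar> ^ N * norm (fourier (partial_deriv j f) \<xi>) \<le> C"
    using Suc.IH[OF test_functions_partial_deriv[OF Suc.prems]] by blast
  have "\<bar>\<xi> $ j\<bar> ^ Suc N * norm (fourier f \<xi>) \<le> C" for \<xi>
  proof -
    have "\<bar>\<xi> $ j\<bar> ^ Suc N * norm (fourier f \<xi>) \<le> (2 * pi) * (\<bar>\<xi> $ j\<bar> ^ Suc N * norm (fourier f \<xi>))"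
      using mult_right_mono[of 1 "2 * pi" "\<bar>\<xi> $ j\<bar> ^ Suc N * norm (fourier f \<xi>)"] pi_ge_two by auto
    also have "\<dots> = \<bar>\<xi> $ j\<bar> ^ N * norm (fourier (partial_deriv j f) \<xi>)"
      unfolding fourier_partial_deriv[OF Suc.prems] by (simp add: norm_mult mult_ac)
    finally show ?thesis using C[of \<xi>] by simp
  qed
  then show ?case by blast
qed

lemma fourier_decay:
  fixes f :: "real^'n::finite \<Rightarrow> complex"
  assumes f: "f \<in> test_functions UNIV"
  shows "\<exists>C. \<forall>\<xi>. (1 + norm \<xi>) ^ N * norm (fourier f \<xi>) \<le> C"
proof -
  obtain C where C: "\<And>j \<xi>. \<bar>\<xi> $ j\<bar> ^ N * norm (fourier f \<xi>) \<le> C j"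
    using fourier_decay_coordinate[OF f, of _ N] by metis
  obtain C0 where C0: "\<And>\<xi>. norm (fourier f \<xi>) \<le> C0"
    using norm_fourier_le[OF test_functions_integrable[OF f]] by blast
  let ?n = "real CARD('n)"
  have "(1 + norm \<xi>) ^ N * norm (fourier f \<xi>) \<le> (1 + ?n) ^ N * (C0 + (\<Sum>j\<in>UNIV. C j))" for \<xi>
  proof -
    \<comment> \<open>The largest coordinate controls the norm up to the factor
      \<open>CARD('n)\<close>, so decay in that single coordinate is enough.\<close>
    define m where "m = Max (range (\<lambda>j. \<bar>\<xi> $ j\<bar>))"
    have m: "\<bar>\<xi> $ j\<bar> \<le> m" for j unfolding m_def by (rule Max_ge) auto
    have "m \<in> range (\<lambda>j. \<bar>\<xi> $ j\<bar>)" unfolding m_def by (rule Max_in) auto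
    then obtain i where i: "m = \<bar>\<xi> $ i\<bar>" by blast
    have m0: "m \<ge> 0" using i by simp
    have "norm \<xi> \<le> (\<Sum>j\<in>UNIV. \<bar>\<xi> $ j\<bar>)" by (rule norm_le_l1_cart)
    also have "\<dots> \<le> ?n * m" using sum_bounded_above[of UNIV "\<lambda>j. \<bar>\<xi> $ j\<bar>" m] m by simp
    also have "\<dots> \<le> ?n * max 1 m" by (intro mult_left_mono) auto
    finally have "1 + norm \<xi> \<le> (1 + ?n) * max 1 m" by (simp add: distrib_right)
    then have "(1 + norm \<xi>) ^ N \<le> ((1 + ?n) * max 1 m) ^ N" by (intro power_mono) auto
    also have "\<dots> \<le> (1 + ?n) ^ N * (1 + m ^ N)"
      unfolding power_mult_distrib using m0 by (intro mult_left_mono) (auto simp: max_def)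
    finally have "(1 + norm \<xi>) ^ N * norm (fourier f \<xi>) \<le> (1 + ?n) ^ N * ((1 + m ^ N) * norm (fourier f \<xi>))"
      by (subst mult.assoc[symmetric], intro mult_right_mono) auto
    also have "(1 + m ^ N) * norm (fourier f \<xi>) = norm (fourier f \<xi>) + \<bar>\<xi> $ i\<bar> ^ N * norm (fourier f \<xi>)"
      by (simp add: i algebra_simps)
    also have "\<dots> \<le> C0 + C i" by (intro add_mono C C0)
    also have "C i \<le> (\<Sum>j\<in>UNIV. C j)"
      by (rule member_le_sum) (auto intro: order_trans[OF _ C[where \<xi>=0]] zero_le_mult_iff)
    finally show ?thesis by (simp add: mult_left_mono)
  qed
  then show ?thesis by blast
qed

lemma fourier_schwartz:
  assumes f: "f \<in> test_functions UNIV" shows "fourier f \<in> schwartz"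
  unfolding schwartz_def
proof (intro CollectI conjI allI)
  show "smooth (fourier f)" by (rule smooth_fourier[OF f])
  fix js :: "'a list" and N
  obtain g where g: "g \<in> test_functions UNIV" "partial_derivs js (fourier f) = fourier g"
    using partial_derivs_fourier[OF f] by blast
  show "bdd_above (range (\<lambda>x. (1 + norm x) ^ N * norm (partial_derivs js (fourier f) x)))"
    unfolding g(2) using fourier_decay[OF g(1), of N] by (auto simp: bdd_above_def)
qed

lemma measurable_fourier:
  "integrable lborel f \<Longrightarrow> fourier f \<in> borel_measurable borel"
  by (intro borel_measurable_continuous_onI continuous_on_fourier)

lemma integrable_poly_fourier:
  fixes f :: "real^'n::finite \<Rightarrow> complex" and p :: "real^'n \<Rightarrow> real"
  assumes f: "f \<in> test_functions UNIV" and [measurable]: "p \<in> borel_measurable borel"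
    and p: "\<And>\<xi>. \<bar>p \<xi>\<bar> \<le> B * (1 + norm \<xi>) ^ N"
  shows "integrable lborel (\<lambda>\<xi>. p \<xi> *\<^sub>R fourier f \<xi>)"
proof -
  have [measurable]: "fourier f \<in> borel_measurable borel"
    by (rule measurable_fourier[OF test_functions_integrable[OF f]])
  obtain C where C: "\<And>\<xi>. (1 + norm \<xi>) ^ (2 * DIM(real^'n) + N) * norm (fourier f \<xi>) \<le> C"
    using fourier_decay[OF f] by blast
  have "0 \<le> B" using p[of 0] by simp
  show ?thesis
  proof (rule integrable_decay)
    fix \<xi>
    have "(1 + norm \<xi>) ^ (2 * DIM(real^'n)) * norm (p \<xi> *\<^sub>R fourier f \<xi>) \<le>
      (1 + norm \<xi>) ^ (2 * DIM(real^'n)) * ((B * (1 + norm \<xi>) ^ N) * norm (fourier f \<xi>))"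
      by (auto intro!: mult_left_mono mult_right_mono p)
    also have "\<dots> = B * ((1 + norm \<xi>) ^ (2 * DIM(real^'n) + N) * norm (fourier f \<xi>))"
      by (simp only: power_add mult_ac)
    also have "\<dots> \<le> B * C" by (intro mult_left_mono C \<open>0 \<le> B\<close>)
    finally show "(1 + norm \<xi>) ^ (2 * DIM(real^'n)) * norm (p \<xi> *\<^sub>R fourier f \<xi>) \<le> B * C" .
  qed simp
qed

lemma integrable_fourier:
  "f \<in> test_functions UNIV \<Longrightarrow> integrable lborel (fourier f)"
  using integrable_poly_fourier[of f "\<lambda>_. 1" 1 0] by simp

lemma gauss_scaled_mono: "gauss (\<xi> /\<^sub>R real (Suc k)) \<le> gauss (\<xi> /\<^sub>R real (Suc (Suc k)))"
proof -
  have "inverse (real (Suc (Suc k))) \<le> inverse (real (Suc k))" by (intro le_imp_inverse_le) auto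
  then have "norm (\<xi> /\<^sub>R real (Suc (Suc k))) \<le> norm (\<xi> /\<^sub>R real (Suc k))"
    by (simp add: mult_right_mono)
  then show ?thesis by (simp add: gauss_def power_mono del: norm_scaleR)
qed

lemma continuous_at_gauss: "isCont gauss (x :: 'a::euclidean_space)"
  using continuous_on_gauss[OF continuous_on_id[of "UNIV :: 'a set"]] by (simp add: continuous_on_eq_continuous_at)

lemma gauss_scaled_limit: "(\<lambda>k. gauss (\<xi> /\<^sub>R real (Suc k))) \<longlonglongrightarrow> 1"
proof -
  have "(\<lambda>k. inverse (real (Suc k)) *\<^sub>R \<xi>) \<longlonglongrightarrow> 0 *\<^sub>R \<xi>"
    by (intro tendsto_scaleR LIMSEQ_inverse_real_of_nat tendsto_const)
  then have "(\<lambda>k. gauss (\<xi> /\<^sub>R real (Suc k))) \<longlonglongrightarrow> gauss (0 *\<^sub>R \<xi>)"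
    by (rule isCont_tendsto_compose[rotated])
       (simp add: continuous_at_gauss)
  then show ?thesis by simp
qed

text \<open>\<open>fourier_gauss_limit\<close> recovers only the value at \<open>0\<close>.
  Translation moves the point \<open>- x\<close> there, and on the Fourier side it becomes the
  factor \<open>wave \<xi> x\<close>.\<close>

lemma fourier_inversion:
  fixes f :: "real^'n::finite \<Rightarrow> complex"
  assumes f: "f \<in> test_functions UNIV"
  shows "fourier (fourier f) x = f (- x)"
proof -
  define g where "g y = f (- x + y)" for y
  have cf: "continuous_on UNIV f" by (rule smooth_continuous_on[OF test_functions_smooth[OF f]])
  have fi: "integrable lborel f" by (rule test_functions_integrable[OF f])
  have Fi: "integrable lborel (fourier f)" by (rule integrable_fourier[OF f])
  have [measurable]: "f \<in> borel_measurable borel" "fourier f \<in> borel_measurable borel" "g \<in> borel_measurable borel" using fi Fi by (auto simp: g_def[abs_def])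
  obtain B where B: "\<And>x. norm (f x) \<le> B" using test_functions_bounded[OF f] by blast
  have Fg: "fourier g \<xi> = fourier f \<xi> * wave \<xi> x" for \<xi>
  proof -
    have "fourier f \<xi> = (LINT y|lborel. f (- x + y) * wave (- x + y) \<xi>)"
      using lborel_integral_shift[of "\<lambda>y. f y * wave y \<xi>" "- x"] by (simp add: fourier_eq)
    also have "\<dots> = (LINT y|lborel. wave (- x) \<xi> * (g y * wave y \<xi>))"
      by (intro Bochner_Integration.integral_cong refl) (simp only: g_def wave_add_left mult_ac)
    also have "\<dots> = wave (- x) \<xi> * fourier g \<xi>" by (simp add: fourier_eq)
    finally show ?thesis by (simp add: wave_minus_left wave_commute[of \<xi> x] wave_mult_cnj mult_ac
          mult.assoc[symmetric])
  qed
  have "(\<lambda>k. LINT \<xi>|lborel. fourier g \<xi> * of_real (gauss (\<xi> /\<^sub>R real (Suc k)))) \<longlonglongrightarrow> g 0"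
  proof (rule fourier_gauss_limit[where B=B])
    show "integrable lborel g" unfolding g_def by (rule lborel_integrable_shift[OF fi])
    have "continuous_on UNIV g"
      unfolding g_def by (intro continuous_on_compose2[OF cf] continuous_intros) auto
    then show "isCont g 0" by (simp add: continuous_on_eq_continuous_at)
  qed (simp add: g_def B)
  moreover have "(\<lambda>k. LINT \<xi>|lborel. fourier g \<xi> * of_real (gauss (\<xi> /\<^sub>R real (Suc k)))) \<longlonglongrightarrow> (LINT \<xi>|lborel. fourier f \<xi> * wave \<xi> x)"
  proof (rule integral_dominated_convergence[where w="\<lambda>\<xi>. norm (fourier f \<xi>)"])
    show "AE \<xi> in lborel. (\<lambda>k. fourier g \<xi> * of_real (gauss (\<xi> /\<^sub>R real (Suc k)))) \<longlonglongrightarrow> fourier f \<xi> * wave \<xi> x"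
    proof (rule AE_I2)
      fix \<xi> :: "real^'n"
      have "(\<lambda>k. fourier g \<xi> * of_real (gauss (\<xi> /\<^sub>R real (Suc k)))) \<longlonglongrightarrow> fourier g \<xi> * of_real 1"
        by (intro tendsto_intros gauss_scaled_limit)
      then show "(\<lambda>k. fourier g \<xi> * of_real (gauss (\<xi> /\<^sub>R real (Suc k)))) \<longlonglongrightarrow> fourier f \<xi> * wave \<xi> x"
        unfolding Fg of_real_1 mult_1_right .
    qed
  qed (auto simp: Fg norm_mult Fi gauss_le_1 intro!: mult_left_le)
  ultimately have "(LINT \<xi>|lborel. fourier f \<xi> * wave \<xi> x) = g 0" by (rule LIMSEQ_unique[rotated])
  moreover have "fourier (fourier f) x = (LINT \<xi>|lborel. fourier f \<xi> * wave \<xi> x)" by (simp add: fourier_eq)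
  ultimately show ?thesis by (simp add: g_def)
qed

text \<open>The autocorrelation \<open>A\<close> has transform
  \<open>norm (fourier F \<xi>)^2\<close> and its value at \<open>0\<close> is the integral of
  \<open>F^2\<close>. Gaussian summability evaluates the damped integrals, and since the transform
  is nonnegative and the Gaussians increase to \<open>1\<close>, monotone convergence removes the
  damping. In this form it applies to the gradient components of a test function, whose supports may
  be unbounded.\<close>

lemma plancherel:
  fixes F :: "real^'n::finite \<Rightarrow> real"
  assumes Fi: "integrable lborel F" and Fc: "continuous_on UNIV F" and B: "\<And>x. \<bar>F x\<bar> \<le> B"
  shows "(\<integral>\<^sup>+\<xi>. ennreal ((norm (fourier (\<lambda>x. of_real (F x)) \<xi>))\<^sup>2) \<partial>lborel) = (\<integral>\<^sup>+x. ennreal ((F x)\<^sup>2) \<partial>lborel)"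
proof -
  let ?F = "\<lambda>x. complex_of_real (F x)"
  define A where "A z = (LINT x|lborel. F (z + x) * F x)" for z
  have [measurable]: "F \<in> borel_measurable borel" using Fi by auto
  have "0 \<le> B" using B[of 0] by simp
  have cz: "continuous_on UNIV (\<lambda>z. F (z + x))" for x
    by (intro continuous_on_compose2[OF Fc] continuous_intros) auto
  have Ac: "continuous_on UNIV A"
    unfolding A_def
    by (rule dominated_continuous[where w="\<lambda>x. B * \<bar>F x\<bar>"])
       (auto simp: abs_mult Fi intro!: mult_right_mono B continuous_intros cz)
  have FF: "integrable lborel (\<lambda>x. F (z + x) * F x)" for z
    by (rule Bochner_Integration.integrable_bound[of _ "\<lambda>x. B * F x"])
       (auto simp: Fi abs_mult intro!: mult_right_mono order_trans[OF B])
  have AB: "\<bar>A z\<bar> \<le> (LINT x|lborel. B * \<bar>F x\<bar>)" for z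
    unfolding A_def real_norm_def[symmetric]
  proof (rule Bochner_Integration.integral_norm_bound_integral)
    show "integrable lborel (\<lambda>x. F (z + x) * F x)" by (rule FF)
  qed (auto simp: Fi abs_mult intro!: mult_right_mono B)
  have pair: "integrable (lborel \<Otimes>\<^sub>M lborel) (case_prod (\<lambda>z x. ?F (z + x) * ?F x * wave z \<xi>))" for \<xi>
  proof (rule integrable_pairI)
    have "(\<integral>\<^sup>+ z. \<integral>\<^sup>+ x. ennreal (norm (?F (z + x) * ?F x * wave z \<xi>)) \<partial>lborel \<partial>lborel) =
       (\<integral>\<^sup>+ x. \<integral>\<^sup>+ z. ennreal \<bar>F (z + x)\<bar> * ennreal \<bar>F x\<bar> \<partial>lborel \<partial>lborel)"
      by (subst lborel_pair.Fubini') (auto simp: norm_mult abs_mult ennreal_mult)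
    also have "\<dots> = (\<integral>\<^sup>+ x. (\<integral>\<^sup>+ z. ennreal \<bar>F z\<bar> \<partial>lborel) * ennreal \<bar>F x\<bar> \<partial>lborel)"
      using nn_integral_lborel_shift[of "\<lambda>z. ennreal \<bar>F z\<bar>"]
      by (simp add: nn_integral_multc add.commute)
    also have "\<dots> = (\<integral>\<^sup>+ z. ennreal \<bar>F z\<bar> \<partial>lborel) * (\<integral>\<^sup>+ z. ennreal \<bar>F z\<bar> \<partial>lborel)"
      by (simp add: nn_integral_cmult)
    also have "\<dots> < \<infinity>" using Fi by (simp add: integrable_iff_bounded ennreal_mult_less_top)
    finally show "(\<integral>\<^sup>+ z. \<integral>\<^sup>+ x. ennreal (norm (?F (z + x) * ?F x * wave z \<xi>)) \<partial>lborel \<partial>lborel) < \<infinity>" .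
  qed simp
  have Aint: "(LINT x|lborel. ?F (z + x) * ?F x * wave z \<xi>) = of_real (A z) * wave z \<xi>" for z \<xi>
    unfolding A_def by (simp flip: of_real_mult integral_of_real)
  have Ai: "integrable lborel (\<lambda>z. complex_of_real (A z))"
    using lborel_pair.integrable_fst[OF pair[of 0]] unfolding Aint by simp
  have FA: "fourier (\<lambda>z. of_real (A z)) \<xi> = of_real ((norm (fourier ?F \<xi>))\<^sup>2)" for \<xi>
  proof -
    have [measurable]: "A \<in> borel_measurable borel" by (rule borel_measurable_continuous_onI[OF Ac])
    have "fourier (\<lambda>z. of_real (A z)) \<xi> = (LINT z|lborel. LINT x|lborel. ?F (z + x) * ?F x * wave z \<xi>)"
      unfolding Aint by (simp add: fourier_eq)
    also have "\<dots> = (LINT x|lborel. LINT z|lborel. ?F (z + x) * ?F x * wave z \<xi>)"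
      by (rule lborel_pair.Fubini_integral[OF pair, symmetric])
    also have "\<dots> = (LINT x|lborel. fourier ?F \<xi> * cnj (?F x * wave x \<xi>))"
    proof (intro Bochner_Integration.integral_cong refl)
      fix x
      have "(LINT z|lborel. ?F (z + x) * ?F x * wave z \<xi>) = (LINT z|lborel. ?F (x + z) * wave (x + z) \<xi> * (cnj (wave x \<xi>) * ?F x))"
        by (intro Bochner_Integration.integral_cong refl)
           (simp add: wave_add_left add.commute[of _ x] mult_ac wave_mult_cnj)
      also have "\<dots> = (LINT z|lborel. ?F z * wave z \<xi>) * (cnj (wave x \<xi>) * ?F x)"
        by (subst lborel_integral_shift[of _ x]) simp
      finally show "(LINT z|lborel. ?F (z + x) * ?F x * wave z \<xi>) = fourier ?F \<xi> * cnj (?F x * wave x \<xi>)"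
        by (simp add: fourier_eq mult_ac)
    qed
    also have "\<dots> = fourier ?F \<xi> * cnj (fourier ?F \<xi>)"
      using Fi by (simp add: fourier_eq del: complex_cnj_mult flip: Bochner_Integration.integral_cnj)
    finally show ?thesis unfolding complex_norm_square .
  qed
  define G where "G k \<xi> = (norm (fourier ?F \<xi>))\<^sup>2 * gauss (\<xi> /\<^sub>R real (Suc k))" for k \<xi>
  have Fm[measurable]: "fourier ?F \<in> borel_measurable borel" by (rule measurable_fourier) (use Fi in simp)
  have [measurable]: "G k \<in> borel_measurable borel" for k unfolding G_def[abs_def] by measurable
  have Gi: "integrable lborel (G k)" for k
  proof (rule Bochner_Integration.integrable_bound[of _ "\<lambda>\<xi>. (LINT x|lborel. norm (?F x))\<^sup>2 * gauss (\<xi> /\<^sub>R real (Suc k))"])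
    show "integrable lborel (\<lambda>\<xi>::real^'n. (LINT x|lborel. norm (?F x))\<^sup>2 * gauss (\<xi> /\<^sub>R real (Suc k)))"
      using lborel_integrable_affine[OF integrable_gauss[where 'a="real^'n"], of "inverse (real (Suc k))" 0] by simp
    have "norm (fourier ?F \<xi>) \<le> (LINT x|lborel. norm (?F x))" for \<xi>
      by (rule norm_fourier_le) (use Fi in simp)
    then show "AE \<xi> in lborel. norm (G k \<xi>) \<le> norm ((LINT x|lborel. norm (?F x))\<^sup>2 * gauss (\<xi> /\<^sub>R real (Suc k)))"
      by (intro AE_I2) (auto simp: G_def abs_mult intro!: mult_right_mono power_mono)
  qed simp
  have "(\<lambda>k. LINT \<xi>|lborel. fourier (\<lambda>z. of_real (A z)) \<xi> * of_real (gauss (\<xi> /\<^sub>R real (Suc k)))) \<longlonglongrightarrow> of_real (A 0)"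
    by (rule fourier_gauss_limit[OF Ai]) (use AB Ac in \<open>auto simp: continuous_on_eq_continuous_at\<close>)
  then have "(\<lambda>k. complex_of_real (LINT \<xi>|lborel. G k \<xi>)) \<longlonglongrightarrow> of_real (A 0)"
    unfolding FA G_def of_real_mult[symmetric] integral_complex_of_real .
  then have lim1: "(\<lambda>k. ennreal (LINT \<xi>|lborel. G k \<xi>)) \<longlonglongrightarrow> ennreal (A 0)"
    by (intro tendsto_ennrealI) (simp only: tendsto_of_real_iff)
  have "(\<lambda>k. \<integral>\<^sup>+\<xi>. ennreal (G k \<xi>) \<partial>lborel) \<longlonglongrightarrow> (\<integral>\<^sup>+\<xi>. ennreal ((norm (fourier ?F \<xi>))\<^sup>2) \<partial>lborel)"
  proof (rule nn_integral_LIMSEQ)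
    show "incseq (\<lambda>k \<xi>. ennreal (G k \<xi>))"
      by (intro incseq_SucI le_funI ennreal_leI) (auto simp: G_def gauss_scaled_mono intro!: mult_left_mono simp del: of_nat_Suc)
    show "(\<lambda>k. ennreal (G k \<xi>)) \<longlonglongrightarrow> ennreal ((norm (fourier ?F \<xi>))\<^sup>2)" for \<xi>
    proof (rule tendsto_ennrealI)
      have "(\<lambda>k. G k \<xi>) \<longlonglongrightarrow> (norm (fourier ?F \<xi>))\<^sup>2 * 1"
        unfolding G_def by (intro tendsto_intros gauss_scaled_limit)
      then show "(\<lambda>k. G k \<xi>) \<longlonglongrightarrow> (norm (fourier ?F \<xi>))\<^sup>2" by simp
    qed
  qed auto
  moreover have "(\<integral>\<^sup>+\<xi>. ennreal (G k \<xi>) \<partial>lborel) = ennreal (LINT \<xi>|lborel. G k \<xi>)" for k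
    by (rule nn_integral_eq_integral[OF Gi]) (auto simp: G_def)
  ultimately have "(\<integral>\<^sup>+\<xi>. ennreal ((norm (fourier ?F \<xi>))\<^sup>2) \<partial>lborel) = ennreal (A 0)"
    using LIMSEQ_unique[OF _ lim1] by simp
  also have "\<dots> = (\<integral>\<^sup>+x. ennreal ((F x)\<^sup>2) \<partial>lborel)"
  proof -
    have "integrable lborel (\<lambda>x. F x * F x)"
      using FF[of 0] by simp
    then show ?thesis by (simp add: A_def nn_integral_eq_integral power2_eq_square)
  qed
  finally show ?thesis .
qed

section \<open>The nonlocal gradient on test functions\<close>

text \<open>The Borel form of \<open>\<rho>\<close>: a kernel that is everywhere a function of the
  norm, so that Fubini arguments can be carried out on \<open>lborel\<close>.\<close>

locale radial_kernel =
  fixes \<beta> :: "real \<Rightarrow> real" and r :: "real^'n::finite \<Rightarrow> real"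
  assumes measurable_profile [measurable]: "\<beta> \<in> borel_measurable borel"
    and profile_nonneg: "0 \<le> \<beta> t"
    and kernel_eq: "r z = \<beta> (norm z)"
    and kernel_integrable: "integrable lborel (\<lambda>z. min 1 (1 / norm z) * r z)"
begin

lemma measurable_kernel [measurable]: "r \<in> borel_measurable borel"
  unfolding kernel_eq[abs_def] by measurable

lemma kernel_nonneg: "0 \<le> r z" by (simp add: kernel_eq profile_nonneg)

definition weight :: "real^'n \<Rightarrow> real" where "weight z = min 1 (1 / norm z) * r z"

lemma weight_nonneg: "0 \<le> weight z" by (simp add: weight_def kernel_nonneg)

lemma weight_integrable: "integrable lborel weight"
  unfolding weight_def by (rule kernel_integrable)

text \<open>The \<open>j\<close>-th component of the vector kernel in \<open>D_rho\<close>. Formally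
  it is also minus the \<open>j\<close>-th partial derivative of the radial primitive
  \<open>Q\<close>, which is why the gradient and the derivative of \<open>Q\<close> share a
  symbol.\<close>

definition vkernel :: "'n \<Rightarrow> real^'n \<Rightarrow> real" where "vkernel j z = z $ j * r z / (norm z)\<^sup>2"

lemma measurable_vkernel [measurable]: "vkernel j \<in> borel_measurable borel"
  unfolding vkernel_def[abs_def] by measurable

text \<open>The kernel is at most \<open>r z / norm z\<close>. Near the origin the bound
  proportional to \<open>norm z\<close> cancels the singularity, elsewhere the constant bound is
  used, and both match \<open>weight\<close>. Integrability of the gradient, of its symbol and of
  the primitive rests on this estimate.\<close>

lemma vkernel_bound:
  assumes "\<bar>a\<bar> \<le> A" "\<bar>a\<bar> \<le> B * norm z" "0 \<le> B"
  shows "\<bar>a\<bar> * \<bar>vkernel j z\<bar> \<le> max A B * weight z"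
proof (cases "z = 0")
  case True
  then show ?thesis using assms weight_nonneg[of z] by (simp add: vkernel_def)
next
  case False
  then have nz: "norm z > 0" by simp
  have "\<bar>vkernel j z\<bar> \<le> norm z * r z / (norm z)\<^sup>2"
    unfolding vkernel_def abs_mult abs_divide
    by (auto intro!: divide_right_mono mult_mono simp: kernel_nonneg component_le_norm_cart)
  also have "\<dots> = r z / norm z" using nz by (simp add: power2_eq_square)
  finally have v: "\<bar>vkernel j z\<bar> \<le> r z / norm z" .
  show ?thesis
  proof (cases "norm z \<le> 1")
    case True
    have "\<bar>a\<bar> * \<bar>vkernel j z\<bar> \<le> (B * norm z) * (r z / norm z)" using assms v by (intro mult_mono) auto
    also have "\<dots> = B * weight z" using nz True by (simp add: weight_def min_def)
    also have "\<dots> \<le> max A B * weight z" by (intro mult_right_mono weight_nonneg) auto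
    finally show ?thesis .
  next
    case F: False
    have "\<bar>a\<bar> * \<bar>vkernel j z\<bar> \<le> A * (r z / norm z)" using assms v by (intro mult_mono) auto
    also have "\<dots> = A * weight z" using nz F by (simp add: weight_def min_def)
    also have "\<dots> \<le> max A B * weight z" by (intro mult_right_mono weight_nonneg) auto
    finally show ?thesis .
  qed
qed

section \<open>The Fourier symbol of the nonlocal gradient\<close>

definition symbol :: "'n \<Rightarrow> real^'n \<Rightarrow> complex"
  where "symbol j \<xi> = (LINT z|lborel. (1 - wave z \<xi>) * of_real (vkernel j z))"

lemma symbol_integrand_bound:
  "norm ((1 - wave z \<xi>) * of_real (vkernel j z)) \<le> max 2 (2 * pi * norm \<xi>) * weight z"
  using vkernel_bound[of "norm (1 - wave z \<xi>)" 2 "2 * pi * norm \<xi>" z j] wave_linear[of z \<xi>] norm_one_minus_wave_le[of z \<xi>]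
  by (simp add: norm_mult mult_ac)

lemma symbol_integrand_integrable: "integrable lborel (\<lambda>z. (1 - wave z \<xi>) * of_real (vkernel j z))"
  by (rule Bochner_Integration.integrable_bound[of _ "\<lambda>z. max 2 (2 * pi * norm \<xi>) * weight z"])
     (use symbol_integrand_bound[of _ \<xi> j] weight_integrable in \<open>auto intro: order_trans[OF _ abs_ge_self]\<close>)

definition symbol_const :: real where "symbol_const = 2 * pi * (LINT z|lborel. weight z)"

lemma symbol_bound: "norm (symbol j \<xi>) \<le> symbol_const * (1 + norm \<xi>)"
proof -
  have "norm (symbol j \<xi>) \<le> (LINT z|lborel. max 2 (2 * pi * norm \<xi>) * weight z)"
    unfolding symbol_def
    by (rule Bochner_Integration.integral_norm_bound_integral)
       (use symbol_integrand_integrable symbol_integrand_bound weight_integrable in auto)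
  also have "\<dots> = max 2 (2 * pi * norm \<xi>) * (LINT z|lborel. weight z)" by simp
  also have "\<dots> \<le> (2 * pi * (1 + norm \<xi>)) * (LINT z|lborel. weight z)"
  proof (intro mult_right_mono max.boundedI)
    have "2 * 1 \<le> 2 * pi * (1 + norm \<xi>)" using pi_ge_two by (intro mult_mono) auto
    then show "2 \<le> 2 * pi * (1 + norm \<xi>)" by (simp only: mult_1_right)
  qed (auto intro!: integral_nonneg_AE weight_nonneg mult_left_mono)
  finally show ?thesis by (simp only: symbol_const_def mult_ac)
qed

text \<open>The integrands are dominated only locally uniformly in \<open>\<xi>\<close>. Division by
  \<open>1 + norm \<xi>\<close> makes \<open>2 * pi * weight\<close> a dominating function for all
  \<open>\<xi>\<close> at once.\<close>

lemma continuous_symbol: "continuous_on UNIV (symbol j)"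
proof -
  let ?s = "\<lambda>\<xi> z. inverse (1 + norm \<xi>) *\<^sub>R ((1 - wave z \<xi>) * of_real (vkernel j z))"
  have "continuous_on UNIV (\<lambda>\<xi>. LINT z|lborel. ?s \<xi> z)"
  proof (rule dominated_continuous[where w="\<lambda>z. (2 * pi) * weight z"])
    show "continuous_on UNIV (\<lambda>\<xi>. ?s \<xi> z)" for z
      by (intro continuous_intros) (auto simp: add_nonneg_eq_0_iff)
    fix z \<xi> :: "real^'n"
    have m: "max 2 (2 * pi * norm \<xi>) \<le> (1 + norm \<xi>) * (2 * pi)"
    proof (rule max.boundedI)
      have "1 * 2 \<le> (1 + norm \<xi>) * (2 * pi)" using pi_ge_two by (intro mult_mono) auto
      then show "2 \<le> (1 + norm \<xi>) * (2 * pi)" by (simp only: mult_1_left)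
    qed (simp add: algebra_simps)
    have "norm (?s \<xi> z) = inverse (1 + norm \<xi>) * norm ((1 - wave z \<xi>) * of_real (vkernel j z))"
      by (simp only: norm_scaleR) simp
    also have "\<dots> \<le> inverse (1 + norm \<xi>) * (((1 + norm \<xi>) * (2 * pi)) * weight z)"
      by (intro mult_left_mono order_trans[OF symbol_integrand_bound] mult_right_mono m weight_nonneg) simp
    also have "\<dots> = 2 * pi * weight z"
    proof -
      have "1 + norm \<xi> \<noteq> 0" using norm_ge_zero[of \<xi>] by linarith
      then show ?thesis by (simp add: field_simps)
    qed
    finally show "norm (?s \<xi> z) \<le> 2 * pi * weight z" .
  qed (use weight_integrable in auto)
  then have "continuous_on UNIV (\<lambda>\<xi>. (1 + norm \<xi>) *\<^sub>R (LINT z|lborel. ?s \<xi> z))"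
    by (intro continuous_intros)
  moreover have "(1 + norm \<xi>) *\<^sub>R (LINT z|lborel. ?s \<xi> z) = symbol j \<xi>" for \<xi>
  proof -
    have "1 + norm \<xi> \<noteq> 0" using norm_ge_zero[of \<xi>] by linarith
    then show ?thesis unfolding integral_scaleR_right symbol_def by simp
  qed
  ultimately show ?thesis by (simp only:)
qed

lemma measurable_symbol [measurable]: "symbol j \<in> borel_measurable borel"
  by (rule borel_measurable_continuous_onI[OF continuous_symbol])

lemma symbol_zero [simp]: "symbol j 0 = 0" by (simp add: symbol_def)

lemma symbol_uminus: "symbol j (- \<xi>) = cnj (symbol j \<xi>)"
proof -
  have "(1 - wave z (- \<xi>)) * of_real (vkernel j z) = cnj ((1 - wave z \<xi>) * of_real (vkernel j z))" for z
    by (simp add: wave_minus_right)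
  then show ?thesis
    unfolding symbol_def by (simp only: Bochner_Integration.integral_cnj)
qed

text \<open>Along a ray the symbol is \<open>o(norm \<xi>)\<close>, strictly better than
  \<open>symbol_bound\<close>. The scaled factor
  \<open>e k * norm (1 - wave z (\<xi> /\<^sub>R e k))\<close> is at most \<open>2\<close> and at
  most \<open>2 * pi * norm \<xi> * norm z\<close> for every \<open>k\<close>, so
  \<open>weight\<close> dominates, while pointwise the prefactor \<open>e k\<close> sends the
  integrand to \<open>0\<close>.\<close>

lemma symbol_sublinear:
  assumes e: "\<And>k. 0 < e k" "\<And>k. e k \<le> 1" "e \<longlonglongrightarrow> 0"
  shows "(\<lambda>k. e k *\<^sub>R symbol j (\<xi> /\<^sub>R e k)) \<longlonglongrightarrow> 0"
proof -
  have "(\<lambda>k. LINT z|lborel. e k *\<^sub>R ((1 - wave z (\<xi> /\<^sub>R e k)) * of_real (vkernel j z))) \<longlonglongrightarrow> (LINT z|(lborel :: (real^'n) measure). 0)"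
  proof (rule integral_dominated_convergence[where w="\<lambda>z. max 2 (2 * pi * norm \<xi>) * weight z"])
    show "AE z in lborel. (\<lambda>k. e k *\<^sub>R ((1 - wave z (\<xi> /\<^sub>R e k)) * of_real (vkernel j z))) \<longlonglongrightarrow> 0"
    proof (rule AE_I2, rule tendsto_0_le[where K=1])
      fix z :: "real^'n"
      show "(\<lambda>k. e k * (2 * \<bar>vkernel j z\<bar>)) \<longlonglongrightarrow> 0" using tendsto_mult_left_zero[OF e(3)] by simp
      show "\<forall>\<^sub>F k in sequentially. norm (e k *\<^sub>R ((1 - wave z (\<xi> /\<^sub>R e k)) * complex_of_real (vkernel j z)))
          \<le> norm (e k * (2 * \<bar>vkernel j z\<bar>)) * 1"
        using norm_one_minus_wave_le less_imp_le[OF e(1)]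
        by (intro always_eventually allI) (auto simp: norm_mult abs_mult intro!: mult_left_mono mult_right_mono)
    qed
    show "AE z in lborel. norm (e k *\<^sub>R ((1 - wave z (\<xi> /\<^sub>R e k)) * of_real (vkernel j z))) \<le> max 2 (2 * pi * norm \<xi>) * weight z" for k
    proof (rule AE_I2)
      fix z :: "real^'n"
      let ?a = "e k * norm (1 - wave z (\<xi> /\<^sub>R e k))"
      have a0: "?a \<ge> 0" using e(1)[of k] by simp
      have "?a \<le> 1 * 2" using e(1,2)[of k] norm_one_minus_wave_le by (intro mult_mono) auto
      moreover have "?a \<le> e k * (2 * pi * norm z * norm (\<xi> /\<^sub>R e k))"
        using e(1)[of k] by (intro mult_left_mono wave_linear) auto
      moreover have "e k * (2 * pi * norm z * norm (\<xi> /\<^sub>R e k)) = (2 * pi * norm \<xi>) * norm z"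
        using e(1)[of k] by (simp add: field_simps)
      ultimately have "?a \<le> 2" "?a \<le> (2 * pi * norm \<xi>) * norm z" by (simp_all only: mult_1_left)
      then have "\<bar>?a\<bar> * \<bar>vkernel j z\<bar> \<le> max 2 (2 * pi * norm \<xi>) * weight z"
        using a0 by (intro vkernel_bound) auto
      then show "norm (e k *\<^sub>R ((1 - wave z (\<xi> /\<^sub>R e k)) * of_real (vkernel j z))) \<le> max 2 (2 * pi * norm \<xi>) * weight z"
        using a0 e(1)[of k] by (simp add: norm_mult mult_ac)
    qed
  qed (use weight_integrable in auto)
  then show ?thesis unfolding integral_scaleR_right symbol_def by simp
qed

definition symbol_sq :: "real^'n \<Rightarrow> real" where "symbol_sq \<xi> = (\<Sum>j\<in>UNIV. (norm (symbol j \<xi>))\<^sup>2)"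

lemma symbol_sq_nonneg: "0 \<le> symbol_sq \<xi>" by (simp add: symbol_sq_def sum_nonneg)
lemma symbol_sq_zero [simp]: "symbol_sq 0 = 0" by (simp add: symbol_sq_def)
lemma symbol_sq_uminus: "symbol_sq (- \<xi>) = symbol_sq \<xi>" by (simp add: symbol_sq_def symbol_uminus)

lemma continuous_symbol_sq: "continuous_on UNIV symbol_sq"
  unfolding symbol_sq_def by (intro continuous_intros continuous_symbol)

lemma measurable_symbol_sq [measurable]: "symbol_sq \<in> borel_measurable borel"
  by (rule borel_measurable_continuous_onI[OF continuous_symbol_sq])

lemma symbol_sq_bound: "symbol_sq \<xi> \<le> (real CARD('n) * symbol_const\<^sup>2) * (1 + norm \<xi>)\<^sup>2"
proof -
  have "symbol_sq \<xi> \<le> (\<Sum>j\<in>(UNIV::'n set). (symbol_const * (1 + norm \<xi>))\<^sup>2)"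
    unfolding symbol_sq_def by (intro sum_mono power_mono symbol_bound) auto
  then show ?thesis by (simp add: power_mult_distrib mult.assoc)
qed

lemma symbol_sq_sublinear:
  assumes e: "\<And>k. 0 < e k" "\<And>k. e k \<le> 1" "e \<longlonglongrightarrow> 0"
  shows "(\<lambda>k. (e k)\<^sup>2 * symbol_sq (\<xi> /\<^sub>R e k)) \<longlonglongrightarrow> 0"
proof -
  have "(\<lambda>k. \<Sum>j\<in>(UNIV::'n set). (norm (e k *\<^sub>R symbol j (\<xi> /\<^sub>R e k)))\<^sup>2) \<longlonglongrightarrow> (\<Sum>j\<in>(UNIV::'n set). (norm (0::complex))\<^sup>2)"
    by (intro tendsto_sum tendsto_power tendsto_norm symbol_sublinear e)
  moreover have "(\<Sum>j\<in>(UNIV::'n set). (norm (e k *\<^sub>R symbol j (\<xi> /\<^sub>R e k)))\<^sup>2) = (e k)\<^sup>2 * symbol_sq (\<xi> /\<^sub>R e k)" for k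
    by (simp add: symbol_sq_def power_mult_distrib sum_distrib_left)
  ultimately show ?thesis by simp
qed

section \<open>The gradient components of a test function and their energy\<close>

definition dcomp :: "'n \<Rightarrow> (real^'n \<Rightarrow> real) \<Rightarrow> real^'n \<Rightarrow> real"
  where "dcomp j \<phi> x = (LINT z|lborel. (\<phi> x - \<phi> (x - z)) * vkernel j z)"

lemma dcomp_integrand_bound:
  assumes "\<phi> \<in> test_functions UNIV"
  shows "\<exists>C\<ge>0. \<forall>x z. \<forall>j. \<bar>\<phi> x - \<phi> (x - z)\<bar> * \<bar>vkernel j z\<bar> \<le> C * weight z"
proof -
  obtain B where B: "\<And>x. \<bar>\<phi> x\<bar> \<le> B" using test_functions_bounded[OF assms] by auto
  obtain L where L: "L \<ge> 0" "\<And>x y. \<bar>\<phi> x - \<phi> y\<bar> \<le> L * norm (x - y)"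
    using test_functions_lipschitz[OF assms] by auto
  have "\<bar>\<phi> x - \<phi> (x - z)\<bar> * \<bar>vkernel j z\<bar> \<le> max (2 * B) L * weight z" for x z j
  proof (rule vkernel_bound)
    show "\<bar>\<phi> x - \<phi> (x - z)\<bar> \<le> 2 * B" using B[of x] B[of "x - z"] by linarith
    show "\<bar>\<phi> x - \<phi> (x - z)\<bar> \<le> L * norm z" using L(2)[of x "x - z"] by simp
  qed (rule L)
  then show ?thesis using L(1) by (intro exI[of _ "max (2 * B) L"]) auto
qed

lemma dcomp_integrand_integrable:
  assumes "\<phi> \<in> test_functions UNIV"
  shows "integrable lborel (\<lambda>z. (\<phi> x - \<phi> (x - z)) * vkernel j z)"
proof -
  obtain C where C: "C \<ge> 0" "\<And>x z j. \<bar>\<phi> x - \<phi> (x - z)\<bar> * \<bar>vkernel j z\<bar> \<le> C * weight z"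
    using dcomp_integrand_bound[OF assms] by blast
  have [measurable]: "\<phi> \<in> borel_measurable borel"
    by (rule smooth_borel_measurable[OF test_functions_smooth[OF assms]])
  show ?thesis
    by (rule Bochner_Integration.integrable_bound[of _ "\<lambda>z. C * weight z"])
       (use C weight_integrable weight_nonneg in \<open>auto simp: abs_mult\<close>)
qed

lemma dcomp_bounded:
  assumes "\<phi> \<in> test_functions UNIV" shows "\<exists>B. \<forall>x. \<bar>dcomp j \<phi> x\<bar> \<le> B"
proof -
  obtain C where C: "C \<ge> 0" "\<And>x z j. \<bar>\<phi> x - \<phi> (x - z)\<bar> * \<bar>vkernel j z\<bar> \<le> C * weight z"
    using dcomp_integrand_bound[OF assms] by blast
  have "norm (dcomp j \<phi> x) \<le> (LINT z|lborel. C * weight z)" for x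
    unfolding dcomp_def
    by (rule Bochner_Integration.integral_norm_bound_integral)
       (use C dcomp_integrand_integrable[OF assms] weight_integrable in \<open>auto simp: abs_mult\<close>)
  then show ?thesis by auto
qed

lemma continuous_dcomp:
  assumes "\<phi> \<in> test_functions UNIV" shows "continuous_on UNIV (dcomp j \<phi>)"
proof -
  obtain C where C: "C \<ge> 0" "\<And>x z j. \<bar>\<phi> x - \<phi> (x - z)\<bar> * \<bar>vkernel j z\<bar> \<le> C * weight z"
    using dcomp_integrand_bound[OF assms] by blast
  have c: "continuous_on UNIV \<phi>" by (rule smooth_continuous_on[OF test_functions_smooth[OF assms]])
  then have [measurable]: "\<phi> \<in> borel_measurable borel" by (rule borel_measurable_continuous_onI)
  show ?thesis
    unfolding dcomp_def
    by (rule dominated_continuous[where w="\<lambda>z. C * weight z"])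
       (use C weight_integrable in \<open>auto simp: abs_mult intro!: continuous_intros c continuous_on_compose2[OF c]\<close>)
qed

lemma measurable_dcomp: "\<phi> \<in> test_functions UNIV \<Longrightarrow> dcomp j \<phi> \<in> borel_measurable borel"
  by (rule borel_measurable_continuous_onI[OF continuous_dcomp])

text \<open>The L1 modulus of continuity must satisfy both bounds that \<open>vkernel_bound\<close>
  asks for: a constant one from the triangle inequality, and a linear one from the Lipschitz
  constant times the volume of a ball that, for \<open>norm z \<le> 1\<close>, contains the supports
  of \<open>\<phi>\<close> and of its translate.\<close>

lemma integral_shift_difference_le:
  assumes "\<phi> \<in> test_functions UNIV"
  shows "\<exists>A B. 0 \<le> A \<and> 0 \<le> B \<and> (\<forall>z. (LINT x|lborel. \<bar>\<phi> x - \<phi> (x - z)\<bar>) \<le> A \<and> (LINT x|lborel. \<bar>\<phi> x - \<phi> (x - z)\<bar>) \<le> B * norm (z::real^'n))"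
proof -
  obtain S where S: "smooth \<phi>" "compact S" "\<And>x. x \<notin> S \<Longrightarrow> \<phi> x = 0" using assms by (rule test_functionsE) blast
  obtain L where L: "L \<ge> 0" "\<And>x y. \<bar>\<phi> x - \<phi> y\<bar> \<le> L * norm (x - y)"
    using test_functions_lipschitz[OF assms] by auto
  obtain r where r: "\<And>x. x \<in> S \<Longrightarrow> norm x \<le> r"
    using compact_imp_bounded[OF S(2)] by (auto simp: bounded_iff)
  have [measurable]: "\<phi> \<in> borel_measurable borel" by (rule smooth_borel_measurable[OF S(1)])
  have i: "integrable lborel \<phi>" by (rule test_functions_integrable[OF assms])
  have iz: "integrable lborel (\<lambda>x. \<phi> (x - z))" for z
    using lborel_integrable_shift[OF i, of "- z"] by simp
  define A where "A = 2 * (LINT x|lborel. \<bar>\<phi> x\<bar>)"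
  define V where "V = L * measure lborel (cball (0::real^'n) (r + 1))"
  have A0: "A \<ge> 0" "V \<ge> 0" using L by (auto simp: A_def V_def)
  have leA: "(LINT x|lborel. \<bar>\<phi> x - \<phi> (x - z)\<bar>) \<le> A" for z
  proof -
    have "(LINT x|lborel. \<bar>\<phi> x - \<phi> (x - z)\<bar>) \<le> (LINT x|lborel. \<bar>\<phi> x\<bar> + \<bar>\<phi> (x - z)\<bar>)"
      using i iz by (intro Bochner_Integration.integral_mono) auto
    also have "\<dots> = A"
      using i iz lborel_integral_shift[of "\<lambda>x. \<bar>\<phi> x\<bar>" "- z"] by (simp add: A_def)
    finally show ?thesis .
  qed
  have leV: "(LINT x|lborel. \<bar>\<phi> x - \<phi> (x - z)\<bar>) \<le> V * norm z" if "norm z \<le> 1" for z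
  proof -
    have "(LINT x|lborel. \<bar>\<phi> x - \<phi> (x - z)\<bar>) \<le> (LINT x|lborel. indicat_real (cball (0::real^'n) (r + 1)) x *\<^sub>R (L * norm z))"
    proof (rule integral_mono_AE)
      show "integrable lborel (\<lambda>x. indicat_real (cball (0::real^'n) (r + 1)) x *\<^sub>R (L * norm z))"
        by (rule borel_integrable_compact) auto
      show "AE x in lborel. \<bar>\<phi> x - \<phi> (x - z)\<bar> \<le> indicat_real (cball 0 (r + 1)) x *\<^sub>R (L * norm z)"
      proof (rule AE_I2)
      fix x
      show "\<bar>\<phi> x - \<phi> (x - z)\<bar> \<le> indicat_real (cball 0 (r + 1)) x *\<^sub>R (L * norm z)"
      proof (cases "norm x \<le> r + 1")
        case True
        then show ?thesis using L(2)[of x "x - z"] by simp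
      next
        case False
        then have "x \<notin> S" "x - z \<notin> S" using r[of x] r[of "x - z"] that norm_triangle_ineq2[of x z] by auto
        then show ?thesis using S(3) L(1) by simp
      qed
      qed
    qed (use i iz in auto)
    also have "\<dots> = V * norm z" by (simp add: V_def mult_ac)
    finally show ?thesis .
  qed
  have "(LINT x|lborel. \<bar>\<phi> x - \<phi> (x - z)\<bar>) \<le> (max A V) * norm z" for z
  proof (cases "norm z \<le> 1")
    case True
    have "V * norm z \<le> max A V * norm z" by (intro mult_right_mono) auto
    then show ?thesis using leV[OF True] by linarith
  next
    case False
    have "A * 1 \<le> max A V * norm z" using A0 False by (intro mult_mono) auto
    then show ?thesis using leA[of z] by linarith
  qed
  then show ?thesis using leA A0 by (intro exI[of _ A] exI[of _ "max A V"]) auto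
qed

lemma dcomp_pair_integrable:
  assumes "\<phi> \<in> test_functions UNIV"
  shows "integrable (lborel \<Otimes>\<^sub>M lborel) (\<lambda>(x, z). complex_of_real ((\<phi> x - \<phi> (x - z)) * vkernel j z) * wave x \<xi>)"
proof (rule integrable_pairI)
  obtain A B where AB: "0 \<le> A" "0 \<le> B" "\<And>z. (LINT x|lborel. \<bar>\<phi> x - \<phi> (x - z)\<bar>) \<le> A"
      "\<And>z. (LINT x|lborel. \<bar>\<phi> x - \<phi> (x - z)\<bar>) \<le> B * norm (z::real^'n)"
    using integral_shift_difference_le[OF assms] by blast
  have [measurable]: "\<phi> \<in> borel_measurable borel"
    by (rule smooth_borel_measurable[OF test_functions_smooth[OF assms]])
  show "(\<lambda>(x, z). complex_of_real ((\<phi> x - \<phi> (x - z)) * vkernel j z) * wave x \<xi>) \<in> borel_measurable (borel \<Otimes>\<^sub>M borel)"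
    by measurable
  have i: "integrable lborel \<phi>" by (rule test_functions_integrable[OF assms])
  have iz: "integrable lborel (\<lambda>x. \<phi> (x - z))" for z
    using lborel_integrable_shift[OF i, of "- z"] by simp
  have "(\<integral>\<^sup>+ x. \<integral>\<^sup>+ z. ennreal (norm (complex_of_real ((\<phi> x - \<phi> (x - z)) * vkernel j z) * wave x \<xi>)) \<partial>lborel \<partial>lborel) =
     (\<integral>\<^sup>+ z. \<integral>\<^sup>+ x. ennreal \<bar>\<phi> x - \<phi> (x - z)\<bar> * ennreal \<bar>vkernel j z\<bar> \<partial>lborel \<partial>lborel)"
    by (subst lborel_pair.Fubini') (auto simp: norm_mult abs_mult ennreal_mult simp del: of_real_diff)
  also have "\<dots> = (\<integral>\<^sup>+ z. ennreal ((LINT x|lborel. \<bar>\<phi> x - \<phi> (x - z)\<bar>) * \<bar>vkernel j z\<bar>) \<partial>lborel)"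
    by (intro nn_integral_cong, subst nn_integral_multc)
       (auto simp: nn_integral_eq_integral i iz ennreal_mult)
  also have "\<dots> \<le> (\<integral>\<^sup>+ z. ennreal (max A B * weight z) \<partial>lborel)"
  proof (intro nn_integral_mono ennreal_leI)
    fix z
    have "0 \<le> (LINT x|lborel. \<bar>\<phi> x - \<phi> (x - z)\<bar>)" by simp
    then show "(LINT x|lborel. \<bar>\<phi> x - \<phi> (x - z)\<bar>) * \<bar>vkernel j z\<bar> \<le> max A B * weight z"
      using AB vkernel_bound[of "LINT x|lborel. \<bar>\<phi> x - \<phi> (x - z)\<bar>" A B z j] by simp
  qed
  also have "\<dots> < \<infinity>"
    using weight_integrable AB weight_nonneg by (subst nn_integral_eq_integral) auto
  finally show "(\<integral>\<^sup>+ x. \<integral>\<^sup>+ z. ennreal (norm (complex_of_real ((\<phi> x - \<phi> (x - z)) * vkernel j z) * wave x \<xi>)) \<partial>lborel \<partial>lborel) < \<infinity>" .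
qed

text \<open>A translation by \<open>z\<close> multiplies the transform by
  \<open>wave z \<xi>\<close>. Fubini moves the \<open>z\<close>-integral outside, where it leaves
  exactly \<open>symbol\<close>.\<close>

lemma
  assumes "\<phi> \<in> test_functions UNIV"
  shows integrable_dcomp: "integrable lborel (dcomp j \<phi>)"
    and fourier_dcomp: "fourier (\<lambda>x. of_real (dcomp j \<phi> x)) \<xi> = symbol j \<xi> * fourier (\<lambda>x. of_real (\<phi> x)) \<xi>"
proof -
  have [measurable]: "\<phi> \<in> borel_measurable borel"
    by (rule smooth_borel_measurable[OF test_functions_smooth[OF assms]])
  note [measurable] = measurable_dcomp[OF assms]
  have i: "integrable lborel \<phi>" by (rule test_functions_integrable[OF assms])
  have iz: "integrable lborel (\<lambda>x. \<phi> (x - z))" for z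
    using lborel_integrable_shift[OF i, of "- z"] by simp
  have eq: "(LINT z|lborel. complex_of_real ((\<phi> x - \<phi> (x - z)) * vkernel j z) * wave x \<xi>) = of_real (dcomp j \<phi> x) * wave x \<xi>" for x \<xi>
    by (simp only: integral_mult_left_zero integral_complex_of_real dcomp_def)
  have "integrable lborel (\<lambda>x. of_real (dcomp j \<phi> x) * wave x 0)"
    using lborel_pair.integrable_fst[OF dcomp_pair_integrable[OF assms, of j 0]] unfolding eq .
  from integrable_Re[OF this] show "integrable lborel (dcomp j \<phi>)" by simp
  have "fourier (\<lambda>x. of_real (dcomp j \<phi> x)) \<xi> = (LINT x|lborel. LINT z|lborel. complex_of_real ((\<phi> x - \<phi> (x - z)) * vkernel j z) * wave x \<xi>)"
    unfolding eq by (simp add: fourier_eq)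
  also have "\<dots> = (LINT z|lborel. LINT x|lborel. complex_of_real ((\<phi> x - \<phi> (x - z)) * vkernel j z) * wave x \<xi>)"
    by (rule lborel_pair.Fubini_integral[OF dcomp_pair_integrable[OF assms], symmetric])
  also have "\<dots> = (LINT z|lborel. fourier (\<lambda>x. of_real (\<phi> x)) \<xi> * ((1 - wave z \<xi>) * of_real (vkernel j z)))"
  proof (intro Bochner_Integration.integral_cong refl)
    fix z
    have w: "integrable lborel (\<lambda>x. complex_of_real (\<phi> x) * wave x \<xi>)" "integrable lborel (\<lambda>x. complex_of_real (\<phi> (x - z)) * wave x \<xi>)"
      using i iz by (auto intro!: integrable_mult_wave)
    have "(LINT x|lborel. complex_of_real (\<phi> (x - z)) * wave x \<xi>) = (LINT x|lborel. complex_of_real (\<phi> x) * wave (z + x) \<xi>)"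
      by (subst lborel_integral_shift[of _ z]) simp
    also have "\<dots> = wave z \<xi> * fourier (\<lambda>x. of_real (\<phi> x)) \<xi>"
      by (simp add: fourier_eq wave_add_left mult.left_commute[of _ "wave z \<xi>"])
    finally have s: "(LINT x|lborel. complex_of_real (\<phi> (x - z)) * wave x \<xi>) = wave z \<xi> * fourier (\<lambda>x. of_real (\<phi> x)) \<xi>" .
    have "(LINT x|lborel. complex_of_real ((\<phi> x - \<phi> (x - z)) * vkernel j z) * wave x \<xi>) =
      (LINT x|lborel. (complex_of_real (\<phi> x) * wave x \<xi> - complex_of_real (\<phi> (x - z)) * wave x \<xi>) * of_real (vkernel j z))"
      by (intro Bochner_Integration.integral_cong refl) (simp add: algebra_simps)
    also have "\<dots> = (fourier (\<lambda>x. of_real (\<phi> x)) \<xi> - wave z \<xi> * fourier (\<lambda>x. of_real (\<phi> x)) \<xi>) * of_real (vkernel j z)"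
      unfolding integral_mult_left_zero Bochner_Integration.integral_diff[OF w] s by (simp add: fourier_eq)
    finally show "(LINT x|lborel. complex_of_real ((\<phi> x - \<phi> (x - z)) * vkernel j z) * wave x \<xi>) =
      fourier (\<lambda>x. of_real (\<phi> x)) \<xi> * ((1 - wave z \<xi>) * of_real (vkernel j z))" by (simp add: algebra_simps)
  qed
  also have "\<dots> = fourier (\<lambda>x. of_real (\<phi> x)) \<xi> * symbol j \<xi>" by (simp add: symbol_def)
  finally show "fourier (\<lambda>x. of_real (dcomp j \<phi> x)) \<xi> = symbol j \<xi> * fourier (\<lambda>x. of_real (\<phi> x)) \<xi>"
    by (simp add: mult.commute)
qed

lemma dcomp_energy:
  assumes "\<phi> \<in> test_functions UNIV"
  shows "(\<integral>\<^sup>+x. ennreal (\<Sum>j\<in>UNIV. (dcomp j \<phi> x)\<^sup>2) \<partial>lborel) =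
    (\<integral>\<^sup>+\<xi>. ennreal (symbol_sq \<xi> * (norm (fourier (\<lambda>x. of_real (\<phi> x)) \<xi>))\<^sup>2) \<partial>lborel)"
proof -
  note [measurable] = measurable_dcomp[OF assms]
  have "integrable lborel (\<lambda>x. complex_of_real (\<phi> x))" using test_functions_integrable[OF assms] by simp
  then have [measurable]: "fourier (\<lambda>x. complex_of_real (\<phi> x)) \<in> borel_measurable borel" by (rule measurable_fourier)
  have "(\<integral>\<^sup>+x. ennreal (\<Sum>j\<in>UNIV. (dcomp j \<phi> x)\<^sup>2) \<partial>lborel) = (\<Sum>j\<in>UNIV. \<integral>\<^sup>+x. ennreal ((dcomp j \<phi> x)\<^sup>2) \<partial>lborel)"
    by (subst nn_integral_sum[symmetric]) (auto intro!: nn_integral_cong simp: sum_ennreal)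
  also have "\<dots> = (\<Sum>j\<in>UNIV. \<integral>\<^sup>+\<xi>. ennreal ((norm (symbol j \<xi>))\<^sup>2 * (norm (fourier (\<lambda>x. of_real (\<phi> x)) \<xi>))\<^sup>2) \<partial>lborel)"
  proof (intro sum.cong refl)
    fix j
    obtain B where B: "\<And>x. \<bar>dcomp j \<phi> x\<bar> \<le> B" using dcomp_bounded[OF assms] by blast
    show "(\<integral>\<^sup>+x. ennreal ((dcomp j \<phi> x)\<^sup>2) \<partial>lborel) = (\<integral>\<^sup>+\<xi>. ennreal ((norm (symbol j \<xi>))\<^sup>2 * (norm (fourier (\<lambda>x. of_real (\<phi> x)) \<xi>))\<^sup>2) \<partial>lborel)"
      unfolding plancherel[OF integrable_dcomp[OF assms] continuous_dcomp[OF assms] B, symmetric] fourier_dcomp[OF assms]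
      by (simp add: norm_mult power_mult_distrib)
  qed
  also have "\<dots> = (\<integral>\<^sup>+\<xi>. ennreal (symbol_sq \<xi> * (norm (fourier (\<lambda>x. of_real (\<phi> x)) \<xi>))\<^sup>2) \<partial>lborel)"
    by (subst nn_integral_sum[symmetric]) (auto intro!: nn_integral_cong simp: sum_ennreal symbol_sq_def sum_distrib_right)
  finally show ?thesis .
qed

end

section \<open>The Fourier transform of the radial primitive\<close>

lemma measurable_vec_nth_comp [measurable]:
  fixes f :: "'a \<Rightarrow> real^'n::finite"
  assumes "f \<in> borel_measurable M" shows "(\<lambda>x. f x $ j) \<in> borel_measurable M"
  by (rule measurable_compose[OF assms]) (intro borel_measurable_continuous_onI continuous_intros)

lemma axis_shift_nth: "(x + c *\<^sub>R axis j 1) $ j = x $ j + (c::real)" by (simp add: axis_def)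

lemma norm_replace_coordinate:
  "(norm (x + (t - x $ j) *\<^sub>R axis j (1::real)))\<^sup>2 = (norm x)\<^sup>2 - (x $ j)\<^sup>2 + t\<^sup>2"
  for x :: "real^'n::finite"
proof -
  have "(norm (x + (t - x $ j) *\<^sub>R axis j (1::real)))\<^sup>2 = (norm x)\<^sup>2 + 2 * ((t - x $ j) * x $ j) + (t - x $ j)\<^sup>2"
    unfolding power2_norm_eq_inner by (simp add: inner_simps inner_axis inner_axis' inner_axis_axis power2_eq_square algebra_simps)
  then show ?thesis by (simp add: power2_eq_square algebra_simps)
qed

text \<open>Exchanging the \<open>j\<close>-th coordinate with an additional real variable is a composition of shears.\<close>

lemma nn_integral_swap_coordinate:
  fixes H :: "real^'n::finite \<Rightarrow> real \<Rightarrow> ennreal"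
  assumes [measurable]: "case_prod H \<in> borel_measurable (borel \<Otimes>\<^sub>M borel)"
  shows "(\<integral>\<^sup>+x. \<integral>\<^sup>+t. H x t \<partial>lborel \<partial>lborel) =
    (\<integral>\<^sup>+y. \<integral>\<^sup>+s. H (y + (s - y $ j) *\<^sub>R axis j 1) (y $ j) \<partial>lborel \<partial>lborel)"
proof -
  have "(\<integral>\<^sup>+x. \<integral>\<^sup>+t. H x t \<partial>lborel \<partial>lborel) = (\<integral>\<^sup>+x. \<integral>\<^sup>+s. H x (x $ j + s) \<partial>lborel \<partial>lborel)"
    by (intro nn_integral_cong nn_integral_lborel_shift) simp
  also have "\<dots> = (\<integral>\<^sup>+s. \<integral>\<^sup>+x. H x (x $ j + s) \<partial>lborel \<partial>lborel)"
    by (rule lborel_pair.Fubini') simp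
  also have "\<dots> = (\<integral>\<^sup>+s. \<integral>\<^sup>+y. H (- s *\<^sub>R axis j 1 + y) ((- s *\<^sub>R axis j 1 + y) $ j + s) \<partial>lborel \<partial>lborel)"
    by (intro nn_integral_cong nn_integral_lborel_shift) simp
  also have "\<dots> = (\<integral>\<^sup>+s. \<integral>\<^sup>+y. H (- s *\<^sub>R axis j 1 + y) (y $ j) \<partial>lborel \<partial>lborel)"
    by (simp add: axis_def)
  also have "\<dots> = (\<integral>\<^sup>+y. \<integral>\<^sup>+s. H (- s *\<^sub>R axis j 1 + y) (y $ j) \<partial>lborel \<partial>lborel)"
    by (rule lborel_pair.Fubini') simp
  also have "\<dots> = (\<integral>\<^sup>+y. \<integral>\<^sup>+s. H (- (y $ j - s) *\<^sub>R axis j 1 + y) (y $ j) \<partial>lborel \<partial>lborel)"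
  proof (rule nn_integral_cong)
    fix y :: "real^'n"
    show "(\<integral>\<^sup>+s. H (- s *\<^sub>R axis j 1 + y) (y $ j) \<partial>lborel) = (\<integral>\<^sup>+s. H (- (y $ j - s) *\<^sub>R axis j 1 + y) (y $ j) \<partial>lborel)"
      using nn_integral_lborel_reflect[of "\<lambda>s. H (- s *\<^sub>R axis j 1 + y) (y $ j)" "y $ j"] by simp
  qed
  finally show ?thesis by (simp add: add.commute)
qed

lemma lborel_reflect_coordinate:
  "distr lborel borel (\<lambda>x::real^'n::finite. x - (2 * x $ j) *\<^sub>R axis j 1) = lborel"
proof -
  let ?c = "\<lambda>b::real^'n. if b = axis j 1 then -1 else 1 :: real"
  have aB: "axis j 1 \<in> (Basis :: (real^'n) set)" by (simp add: axis_in_Basis_iff)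
  have "(\<Sum>b\<in>Basis. (?c b * (x \<bullet> b)) *\<^sub>R b) = x - (2 * x $ j) *\<^sub>R axis j 1" for x :: "real^'n"
  proof -
    have "(\<Sum>b\<in>Basis. (?c b * (x \<bullet> b)) *\<^sub>R b) = (\<Sum>b\<in>Basis. (x \<bullet> b) *\<^sub>R b - (if b = axis j 1 then (2 * (x \<bullet> b)) *\<^sub>R b else 0))"
      by (intro sum.cong) (auto simp: scaleR_2[symmetric] algebra_simps)
    also have "\<dots> = x - (2 * (x \<bullet> axis j 1)) *\<^sub>R axis j 1"
      using aB by (simp add: sum_subtractf euclidean_representation)
    finally show ?thesis by (simp add: inner_axis)
  qed
  then have "lborel = density (distr lborel borel (\<lambda>x::real^'n. x - (2 * x $ j) *\<^sub>R axis j 1)) (\<lambda>_. (\<Prod>b\<in>(Basis :: (real^'n) set). \<bar>?c b\<bar>))"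
    using lborel_affine_euclidean[of ?c 0] by simp
  also have "(\<Prod>b\<in>(Basis :: (real^'n) set). \<bar>?c b\<bar>) = 1" by (intro prod.neutral) auto
  finally show ?thesis by (simp add: density_1)
qed

section \<open>The radial primitive as a superposition of line segments\<close>

context radial_kernel
begin

text \<open>The extended-valued primitive admits Tonelli arguments before its finiteness is known.
  \<open>Qfun\<close> is its real-valued companion, equal to \<open>0\<close> where the integral
  diverges.\<close>

definition Qnn :: "real^'n \<Rightarrow> ennreal"
  where "Qnn x = (\<integral>\<^sup>+t. (if norm x < t then ennreal (\<beta> t / t) else 0) \<partial>lborel)"

definition Qfun :: "real^'n \<Rightarrow> real"
  where "Qfun x = (LINT t|lborel. (if norm x < t then \<beta> t / t else 0))"

lemma measurable_Qnn [measurable]: "Qnn \<in> borel_measurable borel"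
  unfolding Qnn_def by measurable

lemma Qfun_eq: "Qfun x = enn2real (Qnn x)"
proof -
  have "Qfun x = enn2real (\<integral>\<^sup>+t. ennreal (if norm x < t then \<beta> t / t else 0) \<partial>lborel)"
    unfolding Qfun_def
  proof (rule integral_eq_nn_integral)
    show "AE t in lborel. 0 \<le> (if norm x < t then \<beta> t / t else 0)"
    proof (rule AE_I2)
      fix t show "0 \<le> (if norm x < t then \<beta> t / t else 0)"
        using profile_nonneg[of t] norm_ge_zero[of x] by (cases "norm x < t") (simp_all del: norm_ge_zero)
    qed
  qed measurable
  also have "(\<integral>\<^sup>+t. ennreal (if norm x < t then \<beta> t / t else 0) \<partial>lborel) = Qnn x"
    unfolding Qnn_def by (intro nn_integral_cong) auto
  finally show ?thesis .
qed

lemma measurable_Qfun [measurable]: "Qfun \<in> borel_measurable borel"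
  unfolding Qfun_eq[abs_def] by measurable

lemma Qfun_nonneg: "0 \<le> Qfun x" by (simp add: Qfun_eq)

lemma vkernel_nonneg: "0 \<le> y $ j \<Longrightarrow> 0 \<le> vkernel j y"
  by (simp add: vkernel_def kernel_nonneg)

text \<open>The substitution \<open>t = sqrt (a\<^sup>2 + s\<^sup>2)\<close>, where \<open>a\<close> is the distance of \<open>x\<close> to the \<open>j\<close>-th axis.\<close>

lemma Qnn_eq_line_integral:
  assumes "x \<noteq> 0"
  shows "Qnn x = (\<integral>\<^sup>+s. (if \<bar>x $ j\<bar> < s then ennreal (vkernel j (x + (s - x $ j) *\<^sub>R axis j 1)) else 0) \<partial>lborel)"
proof -
  define a where "a = (norm x)\<^sup>2 - (x $ j)\<^sup>2"
  define b where "b = \<bar>x $ j\<bar>"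
  define g where "g s = sqrt (a + s\<^sup>2)" for s
  define g' where "g' s = s / sqrt (a + s\<^sup>2)" for s
  have a0: "a \<ge> 0" using component_le_norm_cart[of x j] by (simp add: a_def abs_le_square_iff[symmetric])
  have b0: "b \<ge> 0" by (simp add: b_def)
  have gb: "g b = norm x" by (simp add: g_def a_def b_def)
  have pos: "a + s\<^sup>2 > 0" if "s \<ge> b" for s
  proof (cases "a > 0")
    \<comment> \<open>Here \<open>x\<close> lies on the \<open>j\<close>-th axis, and
      \<open>x \<noteq> 0\<close> forces \<open>b > 0\<close>, which keeps the square root away from
      \<open>0\<close>.\<close>
    case False
    then have "a = 0" using a0 by simp
    then have "b > 0" using assms by (auto simp: a_def b_def)
    then show ?thesis using that a0 by (simp add: add_nonneg_pos)
  qed (simp add: add_pos_nonneg)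
  have gpos: "g s > 0" if "s \<ge> b" for s using pos[OF that] by (simp add: g_def)
  have gmono: "g s \<le> g t" if "b \<le> s" "s \<le> t" for s t
    using that b0 by (simp add: g_def power_mono)
  have ny: "norm (x + (s - x $ j) *\<^sub>R axis j 1) = g s" for s
    using norm_replace_coordinate[of x s j] by (simp add: g_def a_def real_sqrt_unique)
  have V: "vkernel j (x + (s - x $ j) *\<^sub>R axis j 1) = \<beta> (g s) / g s * g' s" if "s \<ge> b" for s
    using gpos[OF that] by (simp add: vkernel_def kernel_eq ny axis_shift_nth g_def g'_def power2_eq_square)
  let ?f = "\<lambda>t. \<beta> t / t"
  \<comment> \<open>The substitution rule is applied on compact intervals. Letting \<open>n\<close>
    grow exhausts the half-lines on both sides, because \<open>g (b + real n)\<close> is at least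
    \<open>b + real n\<close>.\<close>
  have sub: "(\<integral>\<^sup>+t. ennreal (?f t * indicator {norm x..g (b + real n)} t) \<partial>lborel) =
      (\<integral>\<^sup>+s. ennreal (?f (g s) * g' s * indicator {b..b + real n} s) \<partial>lborel)" for n
    unfolding gb[symmetric]
  proof (rule nn_integral_substitution)
    show "set_borel_measurable borel {g b..g (b + real n)} ?f"
      unfolding set_borel_measurable_def by measurable
    show "(g has_real_derivative g' s) (at s)" if "s \<in> {b..b + real n}" for s
      unfolding g_def[abs_def] g'_def using pos[of s] that
      by (auto intro!: derivative_eq_intros simp: field_simps)
    show "continuous_on {b..b + real n} g'"
      unfolding g'_def by (intro continuous_intros) (use pos in \<open>auto simp: less_imp_neq[symmetric]\<close>)
    show "0 \<le> g' s" if "s \<in> {b..b + real n}" for s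
      using that b0 a0 by (simp add: g'_def)
  qed simp
  have lim1: "(\<lambda>n. \<integral>\<^sup>+t. ennreal (?f t * indicator {norm x..g (b + real n)} t) \<partial>lborel) \<longlonglongrightarrow>
      (\<integral>\<^sup>+t. ennreal (?f t * indicator {norm x..} t) \<partial>lborel)"
  proof (rule nn_integral_LIMSEQ)
    show "incseq (\<lambda>n t. ennreal (?f t * indicator {norm x..g (b + real n)} t))"
    proof (intro incseq_SucI le_funI ennreal_leI)
      fix n t
      show "?f t * indicator {norm x..g (b + real n)} t \<le> ?f t * indicator {norm x..g (b + real (Suc n))} t"
        using gmono[of "b + real n" "b + real (Suc n)"] profile_nonneg[of t] b0 order_trans[OF norm_ge_zero[of x], of t]
        by (auto simp: indicator_def intro!: divide_nonneg_nonneg)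
    qed
    show "(\<lambda>n. ennreal (?f t * indicator {norm x..g (b + real n)} t)) \<longlonglongrightarrow> ennreal (?f t * indicator {norm x..} t)" for t
    proof (rule tendsto_eventually)
      have "t \<le> g (b + real n)" if "n \<ge> nat \<lceil>\<bar>t\<bar>\<rceil>" for n
      proof -
        have "\<bar>t\<bar> \<le> b + real n" using that b0 by linarith
        then have "\<bar>t\<bar> \<le> sqrt ((b + real n)\<^sup>2)" by simp
        also have "\<dots> \<le> g (b + real n)" unfolding g_def using a0 by (intro real_sqrt_le_mono) simp
        finally show ?thesis by simp
      qed
      then show "\<forall>\<^sub>F n in sequentially. ennreal (?f t * indicator {norm x..g (b + real n)} t) = ennreal (?f t * indicator {norm x..} t)"
        by (intro eventually_sequentiallyI[of "nat \<lceil>\<bar>t\<bar>\<rceil>"]) (auto simp: indicator_def)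
    qed
  qed measurable
  have [measurable]: "g \<in> borel_measurable borel" "g' \<in> borel_measurable borel"
    unfolding g_def[abs_def] g'_def[abs_def] by measurable
  have lim2: "(\<lambda>n. \<integral>\<^sup>+s. ennreal (?f (g s) * g' s * indicator {b..b + real n} s) \<partial>lborel) \<longlonglongrightarrow>
      (\<integral>\<^sup>+s. ennreal (?f (g s) * g' s * indicator {b..} s) \<partial>lborel)"
  proof (rule nn_integral_LIMSEQ)
    show "incseq (\<lambda>n s. ennreal (?f (g s) * g' s * indicator {b..b + real n} s))"
    proof (intro incseq_SucI le_funI ennreal_leI)
      fix n s
      have "0 \<le> ?f (g s) * g' s" if "s \<ge> b"
        using that gpos[OF that] profile_nonneg[of "g s"] b0 a0 by (simp add: g'_def)
      then show "?f (g s) * g' s * indicator {b..b + real n} s \<le> ?f (g s) * g' s * indicator {b..b + real (Suc n)} s"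
        by (auto simp: indicator_def)
    qed
    show "(\<lambda>n. ennreal (?f (g s) * g' s * indicator {b..b + real n} s)) \<longlonglongrightarrow> ennreal (?f (g s) * g' s * indicator {b..} s)" for s
    proof (rule tendsto_eventually)
      have "s \<le> b + real n" if "n \<ge> nat \<lceil>\<bar>s\<bar>\<rceil>" for n using that b0 by linarith
      then show "\<forall>\<^sub>F n in sequentially. ennreal (?f (g s) * g' s * indicator {b..b + real n} s) = ennreal (?f (g s) * g' s * indicator {b..} s)"
        by (intro eventually_sequentiallyI[of "nat \<lceil>\<bar>s\<bar>\<rceil>"]) (auto simp: indicator_def)
    qed
  qed measurable
  have "Qnn x = (\<integral>\<^sup>+t. ennreal (?f t * indicator {norm x..} t) \<partial>lborel)"
    unfolding Qnn_def
    by (rule nn_integral_cong_AE, use AE_lborel_singleton[of "norm x"] in eventually_elim) (auto simp: indicator_def)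
  also have "\<dots> = (\<integral>\<^sup>+s. ennreal (?f (g s) * g' s * indicator {b..} s) \<partial>lborel)"
    using LIMSEQ_unique[OF lim1[unfolded sub] lim2] .
  also have "\<dots> = (\<integral>\<^sup>+s. (if \<bar>x $ j\<bar> < s then ennreal (vkernel j (x + (s - x $ j) *\<^sub>R axis j 1)) else 0) \<partial>lborel)"
    by (rule nn_integral_cong_AE, use AE_lborel_singleton[of b] in eventually_elim) (auto simp: indicator_def V b_def[symmetric])
  finally show ?thesis .
qed

text \<open>After the exchange of coordinates \<open>y $ j\<close> is the former integration
  variable and \<open>s\<close> the former \<open>x $ j\<close>, so
  \<open>\<bar>x $ j\<bar> < t\<close> becomes \<open>\<bar>s\<bar> < y $ j\<close>. Each
  \<open>y\<close> in the half-space thus spreads the density \<open>vkernel j y\<close> along the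
  segment from its mirror image to itself.\<close>

definition Qdens :: "'n \<Rightarrow> (real^'n) \<times> real \<Rightarrow> real"
  where "Qdens j = (\<lambda>(y, s). if \<bar>s\<bar> < y $ j then vkernel j y else 0)"

lemma measurable_Qdens [measurable]: "Qdens j \<in> borel_measurable (borel \<Otimes>\<^sub>M borel)"
  unfolding Qdens_def by measurable

lemma Qdens_nonneg: "0 \<le> Qdens j p"
  by (auto simp: Qdens_def split: prod.split intro!: vkernel_nonneg)

lemma nn_integral_Qnn:
  assumes [measurable]: "g \<in> borel_measurable borel"
  shows "(\<integral>\<^sup>+x. Qnn x * g x \<partial>lborel) =
    (\<integral>\<^sup>+y. \<integral>\<^sup>+s. ennreal (Qdens j (y, s)) * g (y + (s - y $ j) *\<^sub>R axis j 1) \<partial>lborel \<partial>lborel)"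
proof -
  let ?H = "\<lambda>x t. (if \<bar>x $ j\<bar> < t then ennreal (vkernel j (x + (t - x $ j) *\<^sub>R axis j 1)) else 0) * g x"
  have "(\<integral>\<^sup>+x. Qnn x * g x \<partial>lborel) = (\<integral>\<^sup>+x. \<integral>\<^sup>+t. ?H x t \<partial>lborel \<partial>lborel)"
  proof (rule nn_integral_cong_AE, use AE_lborel_singleton[of 0] in eventually_elim)
    fix x :: "real^'n" assume "x \<noteq> 0"
    then show "Qnn x * g x = (\<integral>\<^sup>+t. ?H x t \<partial>lborel)"
      by (subst Qnn_eq_line_integral[of x j], simp, subst nn_integral_multc) simp_all
  qed
  also have "\<dots> = (\<integral>\<^sup>+y. \<integral>\<^sup>+s. ?H (y + (s - y $ j) *\<^sub>R axis j 1) (y $ j) \<partial>lborel \<partial>lborel)"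
    by (rule nn_integral_swap_coordinate) measurable
  also have "\<dots> = (\<integral>\<^sup>+y. \<integral>\<^sup>+s. ennreal (Qdens j (y, s)) * g (y + (s - y $ j) *\<^sub>R axis j 1) \<partial>lborel \<partial>lborel)"
    by (intro nn_integral_cong) (auto simp: Qdens_def axis_shift_nth algebra_simps simp flip: scaleR_add_left)
  finally show ?thesis .
qed

text \<open>\<open>Q\<close> may fail to be integrable at infinity, but decay in one coordinate is
  enough: the weight integrated over \<open>\<bar>s\<bar> < y $ j\<close> is at most
  \<open>c\<close> and at most \<open>2 * y $ j\<close>, the pair of bounds that
  \<open>vkernel_bound\<close> needs. Hence \<open>Q\<close> is finite almost everywhere and can be
  paired with functions of quadratic decay.\<close>

lemma Qnn_weighted_finite: "(\<integral>\<^sup>+x. Qnn x * ennreal (inverse (1 + (x $ j)\<^sup>2)) \<partial>lborel) < \<infinity>"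
proof -
  define c where "c = (LINT s|lborel. inverse (1 + s\<^sup>2 :: real))"
  have ic: "integrable lborel (\<lambda>s::real. inverse (1 + s\<^sup>2))"
    using integrable_inverse_1_plus_square by (simp add: set_integrable_def)
  have ii: "integrable lborel (\<lambda>s. inverse (1 + s\<^sup>2) * indicator {-m<..<m} s)" for m :: real
    using integrable_mult_indicator[OF _ ic, of "{-m<..<m}"] by (simp add: mult.commute)
  define I where "I m = (LINT s|lborel. inverse (1 + s\<^sup>2) * indicator {-m<..<m} s)" for m :: real
  have I0: "0 \<le> I m" for m unfolding I_def by (intro integral_nonneg_AE) auto
  have Ic: "I m \<le> c" for m unfolding I_def c_def
    by (intro integral_mono_AE ii ic) (auto simp: indicator_def)
  have Im: "I m \<le> 2 * m" if "m \<ge> 0" for m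
  proof -
    have "I m \<le> (LINT s|lborel. indicator {-m<..<m} s)"
      unfolding I_def
    proof (intro integral_mono_AE ii AE_I2)
      fix s show "inverse (1 + s\<^sup>2) * indicat_real {- m<..<m} s \<le> indicat_real {- m<..<m} s"
        by (intro mult_left_le_one_le) (auto simp: inverse_le_1_iff)
    qed (use that in \<open>auto intro!: integrable_real_indicator\<close>)
    also have "\<dots> = 2 * m" using that by simp
    finally show ?thesis .
  qed
  have "(\<integral>\<^sup>+x. Qnn x * ennreal (inverse (1 + (x $ j)\<^sup>2)) \<partial>lborel) =
    (\<integral>\<^sup>+y. \<integral>\<^sup>+s. ennreal (Qdens j (y, s)) * ennreal (inverse (1 + s\<^sup>2)) \<partial>lborel \<partial>lborel)"
    by (subst nn_integral_Qnn[of _ j]) (simp_all add: axis_shift_nth)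
  also have "\<dots> \<le> (\<integral>\<^sup>+y. ennreal (max c 2 * weight y) \<partial>lborel)"
  proof (intro nn_integral_mono)
    fix y :: "real^'n"
    show "(\<integral>\<^sup>+s. ennreal (Qdens j (y, s)) * ennreal (inverse (1 + s\<^sup>2)) \<partial>lborel) \<le> ennreal (max c 2 * weight y)"
    proof (cases "y $ j > 0")
      case False
      then have "Qdens j (y, s) = 0" for s by (auto simp: Qdens_def)
      then show ?thesis by simp
    next
      case True
      have v: "0 \<le> vkernel j y" using True by (simp add: vkernel_nonneg)
      have "(\<integral>\<^sup>+s. ennreal (Qdens j (y, s)) * ennreal (inverse (1 + s\<^sup>2)) \<partial>lborel) =
        (\<integral>\<^sup>+s. ennreal (vkernel j y) * ennreal (inverse (1 + s\<^sup>2) * indicator {- (y $ j)<..<y $ j} s) \<partial>lborel)"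
        by (intro nn_integral_cong) (auto simp: Qdens_def indicator_def)
      also have "\<dots> = ennreal (I (y $ j) * vkernel j y)"
        unfolding I_def using v
        by (subst nn_integral_cmult, simp, subst nn_integral_eq_integral[OF ii])
           (auto simp: ennreal_mult'' mult.commute I0[unfolded I_def] ennreal_mult)
      also have "\<dots> \<le> ennreal (max c 2 * weight y)"
      proof (rule ennreal_leI)
        have "I (y $ j) \<le> 2 * norm y"
          using Im[of "y $ j"] True component_le_norm_cart[of y j] by simp
        then show "I (y $ j) * vkernel j y \<le> max c 2 * weight y"
          using vkernel_bound[of "I (y $ j)" c 2 y j] I0 Ic v by simp
      qed
      finally show ?thesis .
    qed
  qed
  also have "\<dots> < \<infinity>"
  proof -
    have "0 \<le> c" unfolding c_def by (intro integral_nonneg_AE) auto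
    then show ?thesis using weight_integrable weight_nonneg by (subst nn_integral_eq_integral) auto
  qed
  finally show ?thesis .
qed

lemma Qnn_finite_AE: "AE x in lborel. Qnn x = ennreal (Qfun x)"
proof -
  have "AE x in lborel. Qnn x * ennreal (inverse (1 + (x $ undefined)\<^sup>2)) \<noteq> \<infinity>"
    using Qnn_weighted_finite[of undefined] by (intro nn_integral_PInf_AE) (auto simp: less_top)
  then show ?thesis
  proof eventually_elim
    case (elim x)
    have "inverse (1 + (x $ undefined)\<^sup>2) > (0::real)" by (simp add: add_pos_nonneg)
    then have "Qnn x \<noteq> \<infinity>" using elim by (auto simp: ennreal_top_mult)
    then show ?case by (simp add: Qfun_eq less_top)
  qed
qed

text \<open>The measure with density \<open>Q\<close> is the image of a measure on the \<open>(y, s)\<close>-space.\<close>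

lemma density_Qfun:
  "density lborel (\<lambda>x. ennreal (Qfun x)) =
    distr (density (lborel \<Otimes>\<^sub>M lborel) (\<lambda>p. ennreal (Qdens j p))) borel (\<lambda>(y, s). y + (s - y $ j) *\<^sub>R axis j 1)"
proof (rule measure_eqI)
  let ?T = "\<lambda>(y, s). y + (s - y $ j) *\<^sub>R axis j (1::real) :: real^'n"
  have T: "?T \<in> borel \<Otimes>\<^sub>M borel \<rightarrow>\<^sub>M borel" by measurable
  fix A assume "A \<in> sets (density lborel (\<lambda>x. ennreal (Qfun x)))"
  then have [measurable]: "A \<in> sets borel" by simp
  have "emeasure (density lborel (\<lambda>x. ennreal (Qfun x))) A = (\<integral>\<^sup>+x. Qnn x * indicator A x \<partial>lborel)"
    by (subst emeasure_density, simp, simp, rule nn_integral_cong_AE, use Qnn_finite_AE in eventually_elim) simp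
  also have "\<dots> = (\<integral>\<^sup>+y. \<integral>\<^sup>+s. ennreal (Qdens j (y, s)) * indicator A (?T (y, s)) \<partial>lborel \<partial>lborel)"
    by (subst nn_integral_Qnn[of _ j]) simp_all
  also have "\<dots> = (\<integral>\<^sup>+p. ennreal (Qdens j p) * indicator A (?T p) \<partial>(lborel \<Otimes>\<^sub>M lborel))"
    by (subst lborel.nn_integral_fst[symmetric]) (auto simp: case_prod_unfold)
  also have "\<dots> = (\<integral>\<^sup>+p. ennreal (Qdens j p) * indicator (?T -` A \<inter> space (lborel \<Otimes>\<^sub>M lborel)) p \<partial>(lborel \<Otimes>\<^sub>M lborel))"
    by (intro nn_integral_cong) (auto simp: indicator_def space_pair_measure)
  also have "\<dots> = emeasure (distr (density (lborel \<Otimes>\<^sub>M lborel) (\<lambda>p. ennreal (Qdens j p))) borel ?T) A"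
    using measurable_sets[OF T, of A]
    by (subst emeasure_distr, simp, simp, subst emeasure_density) (auto simp: space_pair_measure)
  finally show "emeasure (density lborel (\<lambda>x. ennreal (Qfun x))) A =
    emeasure (distr (density (lborel \<Otimes>\<^sub>M lborel) (\<lambda>p. ennreal (Qdens j p))) borel ?T) A" .
qed simp

lemma Qfun_integrable_decay:
  fixes G :: "real^'n \<Rightarrow> complex"
  assumes [measurable]: "G \<in> borel_measurable borel" and G: "\<And>x. (1 + norm x)\<^sup>2 * norm (G x) \<le> C"
  shows "integrable lborel (\<lambda>x. Qfun x *\<^sub>R G x)"
proof (rule integrableI_bounded)
  fix j :: 'n
  have C0: "0 \<le> C" using order_trans[OF _ G[of 0]] by simp
  have le: "norm (G x) \<le> C * inverse (1 + (x $ j)\<^sup>2)" for x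
  proof -
    have "1 + (x $ j)\<^sup>2 \<le> (1 + norm x)\<^sup>2"
      using component_le_norm_cart[of x j] norm_ge_zero[of x] power_mono[of "\<bar>x $ j\<bar>" "norm x" 2]
      by (simp add: power2_sum)
    then have "(1 + (x $ j)\<^sup>2) * norm (G x) \<le> C"
      using order_trans[OF mult_right_mono G] by auto
    then show ?thesis by (subst divide_inverse[symmetric], subst pos_le_divide_eq) (auto simp: add_pos_nonneg mult.commute)
  qed
  have "(\<integral>\<^sup>+x. ennreal (norm (Qfun x *\<^sub>R G x)) \<partial>lborel) \<le> (\<integral>\<^sup>+x. ennreal C * (Qnn x * ennreal (inverse (1 + (x $ j)\<^sup>2))) \<partial>lborel)"
  proof (rule nn_integral_mono_AE, use Qnn_finite_AE in eventually_elim)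
    fix x assume q: "Qnn x = ennreal (Qfun x)"
    have "norm (Qfun x *\<^sub>R G x) \<le> Qfun x * (C * inverse (1 + (x $ j)\<^sup>2))"
      using le[of x] by (auto simp: Qfun_nonneg intro!: mult_left_mono)
    then have "ennreal (norm (Qfun x *\<^sub>R G x)) \<le> ennreal (C * (Qfun x * inverse (1 + (x $ j)\<^sup>2)))"
      by (intro ennreal_leI) (simp only: mult_ac)
    then show "ennreal (norm (Qfun x *\<^sub>R G x)) \<le> ennreal C * (Qnn x * ennreal (inverse (1 + (x $ j)\<^sup>2)))"
      unfolding q using C0 Qfun_nonneg[of x] by (simp add: ennreal_mult)
  qed
  also have "\<dots> < \<infinity>" using Qnn_weighted_finite[of j] by (subst nn_integral_cmult) (auto simp: ennreal_mult_less_top)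
  finally show "(\<integral>\<^sup>+x. ennreal (norm (Qfun x *\<^sub>R G x)) \<partial>lborel) < \<infinity>" .
qed measurable

lemma
  fixes G :: "real^'n \<Rightarrow> complex"
  assumes [measurable]: "G \<in> borel_measurable borel" and i: "integrable lborel (\<lambda>x. Qfun x *\<^sub>R G x)"
  shows Qdens_integrable: "integrable (lborel \<Otimes>\<^sub>M lborel) (\<lambda>(y, s). Qdens j (y, s) *\<^sub>R G (y + (s - y $ j) *\<^sub>R axis j 1))"
    and integral_Qfun: "(LINT x|lborel. Qfun x *\<^sub>R G x) =
      (LINT y|lborel. LINT s|lborel. Qdens j (y, s) *\<^sub>R G (y + (s - y $ j) *\<^sub>R axis j 1))"
proof -
  let ?T = "\<lambda>(y, s). y + (s - y $ j) *\<^sub>R axis j (1::real) :: real^'n"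
  let ?N = "density (lborel \<Otimes>\<^sub>M lborel) (\<lambda>p. ennreal (Qdens j p))"
  have "integrable (density lborel (\<lambda>x. ennreal (Qfun x))) G"
    using i by (subst integrable_density) (auto simp: Qfun_nonneg)
  then have "integrable ?N (\<lambda>p. G (?T p))"
    unfolding density_Qfun[of j] by (subst (asm) integrable_distr_eq) auto
  then have "integrable (lborel \<Otimes>\<^sub>M lborel) (\<lambda>p. Qdens j p *\<^sub>R G (?T p))"
    by (subst (asm) integrable_density) (auto simp: Qdens_nonneg)
  then show I: "integrable (lborel \<Otimes>\<^sub>M lborel) (\<lambda>(y, s). Qdens j (y, s) *\<^sub>R G (y + (s - y $ j) *\<^sub>R axis j 1))"
    by (simp add: case_prod_unfold)
  have "(LINT x|lborel. Qfun x *\<^sub>R G x) = (LINT x|density lborel (\<lambda>x. ennreal (Qfun x)). G x)"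
    by (subst integral_density) (auto simp: Qfun_nonneg)
  also have "\<dots> = (LINT p|?N. G (?T p))"
    unfolding density_Qfun[of j] by (subst integral_distr) auto
  also have "\<dots> = (LINT p|(lborel \<Otimes>\<^sub>M lborel). Qdens j p *\<^sub>R G (?T p))"
    by (subst integral_density) (auto simp: Qdens_nonneg)
  also have "\<dots> = (LINT y|lborel. LINT s|lborel. Qdens j (y, s) *\<^sub>R G (y + (s - y $ j) *\<^sub>R axis j 1))"
    using lborel_pair.integral_fst[OF I] by (simp add: case_prod_unfold)
  finally show "(LINT x|lborel. Qfun x *\<^sub>R G x) =
      (LINT y|lborel. LINT s|lborel. Qdens j (y, s) *\<^sub>R G (y + (s - y $ j) *\<^sub>R axis j 1))" .
qed

end

section \<open>The derivative of the primitive tested against Fourier transforms\<close>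

context radial_kernel
begin

definition flip :: "'n \<Rightarrow> real^'n \<Rightarrow> real^'n" where "flip j x = x - (2 * x $ j) *\<^sub>R axis j 1"

lemma measurable_flip [measurable]: "flip j \<in> borel_measurable borel"
  unfolding flip_def[abs_def] by measurable

lemma flip_nth: "flip j x $ j = - (x $ j)" by (simp add: flip_def axis_def)

lemma norm_flip: "norm (flip j x) = norm x"
proof -
  have "flip j x = x + (- (x $ j) - x $ j) *\<^sub>R axis j 1"
    by (simp add: flip_def algebra_simps flip: scaleR_2)
  then have "(norm (flip j x))\<^sup>2 = (norm x)\<^sup>2" using norm_replace_coordinate[of x "- (x $ j)" j] by simp
  then show ?thesis by simp
qed

lemma flip_flip [simp]: "flip j (flip j x) = x"
  by (simp add: flip_def algebra_simps axis_def)

lemma vkernel_flip: "vkernel j (flip j z) = - vkernel j z"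
  by (simp add: vkernel_def flip_nth norm_flip kernel_eq)

lemma lborel_flip: "distr lborel borel (flip j) = lborel"
  using lborel_reflect_coordinate[of j] by (simp add: flip_def[abs_def])

definition half_kernel :: "'n \<Rightarrow> real^'n \<Rightarrow> real"
  where "half_kernel j y = (if 0 < y $ j then vkernel j y else 0)"

lemma measurable_half_kernel [measurable]: "half_kernel j \<in> borel_measurable borel"
  unfolding half_kernel_def[abs_def] by measurable

lemma vkernel_split: "vkernel j z = half_kernel j z - half_kernel j (flip j z)"
proof -
  consider "z $ j > 0" | "z $ j < 0" | "z $ j = 0" by linarith
  then show ?thesis
    by cases (auto simp: half_kernel_def flip_nth vkernel_flip, simp add: vkernel_def)
qed

text \<open>Since \<open>vkernel j\<close> is odd under \<open>flip j\<close>, the integral folds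
  onto the half-space \<open>0 < y $ j\<close>. The two end points \<open>flip j y\<close> and
  \<open>y\<close> are those of the segments that make up the primitive.\<close>

lemma symbol_eq_half: "symbol j \<xi> = (LINT y|lborel. half_kernel j y *\<^sub>R (wave (flip j y) \<xi> - wave y \<xi>))"
proof -
  have m: "(\<lambda>z. (1 - wave z \<xi>) * of_real (vkernel j z)) \<in> borel_measurable lborel" by measurable
  have i1: "integrable lborel (\<lambda>z. half_kernel j z *\<^sub>R (1 - wave z \<xi>))"
    by (rule Bochner_Integration.integrable_bound[OF symbol_integrand_integrable[of \<xi> j]])
       (auto simp: half_kernel_def norm_mult)
  have i2: "integrable lborel (\<lambda>z. half_kernel j (flip j z) *\<^sub>R (1 - wave z \<xi>))"
    by (rule Bochner_Integration.integrable_bound[OF symbol_integrand_integrable[of \<xi> j]])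
       (auto simp: half_kernel_def norm_mult vkernel_flip)
  have flip: "(LINT z|lborel. g z) = (LINT z|lborel. g (flip j z))" if [measurable]: "g \<in> borel_measurable borel" for g :: "real^'n \<Rightarrow> complex"
    by (subst lborel_flip[of j, symmetric], subst integral_distr) auto
  have i3: "integrable lborel (\<lambda>z. half_kernel j z *\<^sub>R (1 - wave (flip j z) \<xi>))"
    using i2 by (subst (asm) lborel_flip[of j, symmetric], subst (asm) integrable_distr_eq) auto
  have "symbol j \<xi> = (LINT z|lborel. half_kernel j z *\<^sub>R (1 - wave z \<xi>) - half_kernel j (flip j z) *\<^sub>R (1 - wave z \<xi>))"
    unfolding symbol_def
    by (intro Bochner_Integration.integral_cong refl, subst vkernel_split) (simp add: scaleR_conv_of_real algebra_simps)
  also have "\<dots> = (LINT z|lborel. half_kernel j z *\<^sub>R (1 - wave z \<xi>)) - (LINT z|lborel. half_kernel j (flip j z) *\<^sub>R (1 - wave z \<xi>))"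
    by (rule Bochner_Integration.integral_diff[OF i1 i2])
  also have "(LINT z|lborel. half_kernel j (flip j z) *\<^sub>R (1 - wave z \<xi>)) = (LINT z|lborel. half_kernel j z *\<^sub>R (1 - wave (flip j z) \<xi>))"
    by (subst flip) simp_all
  also have "(LINT z|lborel. half_kernel j z *\<^sub>R (1 - wave z \<xi>)) - \<dots> =
      (LINT z|lborel. half_kernel j z *\<^sub>R (1 - wave z \<xi>) - half_kernel j z *\<^sub>R (1 - wave (flip j z) \<xi>))"
    by (rule Bochner_Integration.integral_diff[OF i1 i3, symmetric])
  also have "\<dots> = (LINT y|lborel. half_kernel j y *\<^sub>R (wave (flip j y) \<xi> - wave y \<xi>))"
    by (intro Bochner_Integration.integral_cong refl) (simp add: algebra_simps)
  finally show ?thesis .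
qed

lemma Qfun_fourier_integrable:
  assumes "f \<in> test_functions UNIV"
  shows "integrable lborel (\<lambda>x. Qfun x *\<^sub>R fourier f x)"
proof -
  obtain C where "\<And>x. (1 + norm x)\<^sup>2 * norm (fourier f x) \<le> C"
    using fourier_decay[OF assms] by blast
  then show ?thesis
    by (intro Qfun_integrable_decay measurable_fourier test_functions_integrable[OF assms])
qed

text \<open>On the segment from \<open>flip j y\<close> to \<open>y\<close> the function
  \<open>fourier (fourier_mult j f)\<close> is the derivative of \<open>fourier f\<close> along the
  \<open>j\<close>-th axis, so the fundamental theorem of calculus leaves only the end
  points.\<close>

lemma Qfun_inner_integral:
  assumes "f \<in> test_functions UNIV"
  shows "(LINT s|lborel. Qdens j (y, s) *\<^sub>R fourier (fourier_mult j f) (y + (s - y $ j) *\<^sub>R axis j 1)) =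
    half_kernel j y *\<^sub>R (fourier f y - fourier f (flip j y))"
proof (cases "y $ j > 0")
  case False
  then have "Qdens j (y, s) = 0" for s by (auto simp: Qdens_def)
  then show ?thesis using False by (simp add: half_kernel_def)
next
  case True
  let ?g = "\<lambda>s. y + (s - y $ j) *\<^sub>R axis j (1::real)"
  let ?F = "fourier (fourier_mult j f)"
  have fm: "fourier_mult j f \<in> test_functions UNIV" by (rule fourier_mult_test[OF assms])
  have [measurable]: "?F \<in> borel_measurable borel"
    by (rule measurable_fourier[OF test_functions_integrable[OF fm]])
  have c: "continuous_on UNIV ?F" by (rule continuous_on_fourier[OF test_functions_integrable[OF fm]])
  have d: "((\<lambda>s. fourier f (?g s)) has_vector_derivative ?F (?g s)) (at s within S)" for s S
  proof -
    have "(?g has_derivative (\<lambda>t. t *\<^sub>R axis j 1)) (at s within S)" by (auto intro!: derivative_eq_intros)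
    from has_derivative_compose[OF this fourier_has_derivative[OF assms]]
    show ?thesis
      unfolding has_vector_derivative_def vector_scaleR_component real_scaleR_def
          scaleR_scaleR[symmetric] scaleR_sum_right[symmetric] axis_sum .
  qed
  have "(LINT s|lborel. Qdens j (y, s) *\<^sub>R ?F (?g s)) =
      (LINT s|lborel. vkernel j y *\<^sub>R (indicator {- (y $ j)..y $ j} s *\<^sub>R ?F (?g s)))"
  proof (rule integral_cong_AE)
    show "AE s in lborel. Qdens j (y, s) *\<^sub>R ?F (?g s) = vkernel j y *\<^sub>R (indicator {- (y $ j)..y $ j} s *\<^sub>R ?F (?g s))"
      using AE_lborel_singleton[of "y $ j"] AE_lborel_singleton[of "- (y $ j)"]
      by eventually_elim (auto simp: Qdens_def indicator_def)
    show "(\<lambda>s. Qdens j (y, s) *\<^sub>R ?F (?g s)) \<in> borel_measurable lborel" unfolding Qdens_def by measurable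
  qed measurable
  also have "\<dots> = vkernel j y *\<^sub>R (LINT s|lborel. indicator {- (y $ j)..y $ j} s *\<^sub>R ?F (?g s))"
    by (rule integral_scaleR_right)
  also have "(LINT s|lborel. indicator {- (y $ j)..y $ j} s *\<^sub>R ?F (?g s)) = fourier f (?g (y $ j)) - fourier f (?g (- (y $ j)))"
  proof (rule integral_FTC_atLeastAtMost)
    show "continuous_on {- (y $ j)..y $ j} (\<lambda>s. ?F (?g s))"
      by (rule continuous_on_compose2[OF c]) (auto intro!: continuous_intros)
  qed (use True d in auto)
  also have "?g (- (y $ j)) = flip j y" by (simp add: flip_def algebra_simps flip: scaleR_2)
  finally show ?thesis using True by (simp add: half_kernel_def)
qed

text \<open>In the language of distributions, \<open>2 * pi * \<i> * (\<xi> $ j)\<close> times the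
  transform of \<open>Q\<close> is \<open>symbol j\<close>. It follows by integrating the end point
  differences against \<open>half_kernel j\<close> and comparing with the folded form of the
  symbol.\<close>

theorem integral_Qfun_fourier:
  assumes "f \<in> test_functions UNIV"
  shows "(LINT x|lborel. Qfun x *\<^sub>R fourier (fourier_mult j f) x) = - (LINT \<xi>|lborel. f \<xi> * symbol j \<xi>)"
proof -
  have fm: "fourier_mult j f \<in> test_functions UNIV" by (rule fourier_mult_test[OF assms])
  have fi: "integrable lborel f" by (rule test_functions_integrable[OF assms])
  have [measurable]: "f \<in> borel_measurable borel" using fi by auto
  have "(LINT x|lborel. Qfun x *\<^sub>R fourier (fourier_mult j f) x) = (LINT y|lborel. half_kernel j y *\<^sub>R (fourier f y - fourier f (flip j y)))"
    unfolding Qfun_inner_integral[OF assms, symmetric]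
    by (rule integral_Qfun[OF measurable_fourier[OF test_functions_integrable[OF fm]] Qfun_fourier_integrable[OF fm]])
  also have "\<dots> = (LINT y|lborel. LINT \<xi>|lborel. half_kernel j y *\<^sub>R (f \<xi> * (wave y \<xi> - wave (flip j y) \<xi>)))"
  proof (intro Bochner_Integration.integral_cong refl)
    fix y
    have i: "integrable lborel (\<lambda>\<xi>. f \<xi> * wave z \<xi>)" for z
      using integrable_mult_wave[OF fi, of "\<lambda>x. x" z] by (simp add: wave_commute[of _ z])
    show "half_kernel j y *\<^sub>R (fourier f y - fourier f (flip j y)) = (LINT \<xi>|lborel. half_kernel j y *\<^sub>R (f \<xi> * (wave y \<xi> - wave (flip j y) \<xi>)))"
      unfolding integral_scaleR_right right_diff_distrib Bochner_Integration.integral_diff[OF i i]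
      by (simp add: fourier_eq wave_commute)
  qed
  also have "\<dots> = (LINT \<xi>|lborel. LINT y|lborel. half_kernel j y *\<^sub>R (f \<xi> * (wave y \<xi> - wave (flip j y) \<xi>)))"
  proof (rule lborel_pair.Fubini_integral[symmetric], rule integrable_pair_boundI)
    obtain C where C: "smooth f" "compact C" "\<And>x. x \<notin> C \<Longrightarrow> f x = 0" using assms by (rule test_functionsE) blast
    show "integrable lborel weight" by (rule weight_integrable)
    show "integrable lborel (\<lambda>\<xi>. norm (f \<xi>) * max 2 (4 * pi * norm \<xi>))"
    proof -
      have c: "continuous_on UNIV (\<lambda>\<xi>. complex_of_real (max 2 (4 * pi * norm (\<xi> :: real^'n))))"
        by (intro continuous_intros)
      have "\<bar>max 2 t\<bar> = max 2 t" for t :: real by simp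
      then show ?thesis
        using integrable_norm[OF integrable_test_times[OF assms c]] by (simp only: norm_mult norm_of_real mult.commute)
    qed
    fix y \<xi> :: "real^'n"
    let ?a = "norm (wave y \<xi> - wave (flip j y) \<xi>)"
    have "\<bar>?a\<bar> * \<bar>vkernel j y\<bar> \<le> max 2 (4 * pi * norm \<xi>) * weight y"
    proof (rule vkernel_bound)
      show "\<bar>?a\<bar> \<le> 2" using norm_triangle_ineq4[of "wave y \<xi>" "wave (flip j y) \<xi>"] by simp
      have "?a \<le> norm (1 - wave y \<xi>) + norm (1 - wave (flip j y) \<xi>)"
        using norm_triangle_ineq4[of "1 - wave (flip j y) \<xi>" "1 - wave y \<xi>"] by simp
      then show "\<bar>?a\<bar> \<le> 4 * pi * norm \<xi> * norm y"
        using wave_linear[of y \<xi>] wave_linear[of "flip j y" \<xi>] by (simp add: norm_flip mult_ac)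
    qed simp
    then have "norm (f \<xi>) * (\<bar>?a\<bar> * \<bar>vkernel j y\<bar>) \<le> norm (f \<xi>) * (max 2 (4 * pi * norm \<xi>) * weight y)"
      by (intro mult_left_mono) auto
    moreover have "norm (half_kernel j y *\<^sub>R (f \<xi> * (wave y \<xi> - wave (flip j y) \<xi>))) \<le> norm (f \<xi>) * (\<bar>?a\<bar> * \<bar>vkernel j y\<bar>)"
      by (simp add: half_kernel_def norm_mult)
    ultimately show "norm (half_kernel j y *\<^sub>R (f \<xi> * (wave y \<xi> - wave (flip j y) \<xi>))) \<le> weight y * (norm (f \<xi>) * max 2 (4 * pi * norm \<xi>))"
      by (simp add: mult_ac)
  qed measurable
  also have "\<dots> = (LINT \<xi>|lborel. - (f \<xi> * symbol j \<xi>))"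
  proof (intro Bochner_Integration.integral_cong refl)
    fix \<xi>
    have "(LINT y|lborel. half_kernel j y *\<^sub>R (f \<xi> * (wave y \<xi> - wave (flip j y) \<xi>))) =
        (LINT y|lborel. - f \<xi> * (half_kernel j y *\<^sub>R (wave (flip j y) \<xi> - wave y \<xi>)))"
      by (intro Bochner_Integration.integral_cong refl) (simp add: algebra_simps)
    also have "\<dots> = - f \<xi> * symbol j \<xi>" unfolding integral_mult_right_zero symbol_eq_half ..
    finally show "(LINT y|lborel. half_kernel j y *\<^sub>R (f \<xi> * (wave y \<xi> - wave (flip j y) \<xi>))) = - (f \<xi> * symbol j \<xi>)" by simp
  qed
  finally show ?thesis by simp
qed

end

section \<open>Cutoffs and the fundamental lemma of the calculus of variations\<close>

text \<open>Equal to \<open>0\<close> near the origin and near infinity. As a difference of two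
  dilates of one function it reduces, on the Fourier side, to a single family evaluated at a small
  and at a large scale.\<close>

definition cutoff :: "nat \<Rightarrow> real^'n::finite \<Rightarrow> real"
  where "cutoff m x = plateau (x /\<^sub>R real (Suc m)) - plateau (real (Suc m) *\<^sub>R x)"

lemma plateau_zero [simp]: "plateau 0 = 1" by (simp add: plateau_eq_1)

lemma scaled_norm_le:
  "norm (x /\<^sub>R real (Suc m)) \<le> norm x" "norm x \<le> norm (real (Suc m) *\<^sub>R x)"
proof -
  have "inverse (real (Suc m)) \<le> 1" by (simp add: inverse_le_1_iff)
  then show "norm (x /\<^sub>R real (Suc m)) \<le> norm x" by (simp add: mult_left_le_one_le)
  show "norm x \<le> norm (real (Suc m) *\<^sub>R x)" using mult_right_mono[of 1 "real (Suc m)" "norm x"] by simp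
qed

lemma cutoff_nonneg: "0 \<le> cutoff m x"
  unfolding cutoff_def using order_trans[OF scaled_norm_le[where m=m and x=x]]
  by (simp add: plateau_antimono del: norm_scaleR)

lemma cutoff_mono: "cutoff m x \<le> cutoff (Suc m) x"
proof -
  have i: "inverse (real (Suc (Suc m))) \<le> inverse (real (Suc m))" by (intro le_imp_inverse_le) auto
  have "norm (x /\<^sub>R real (Suc (Suc m))) \<le> norm (x /\<^sub>R real (Suc m))"
    using mult_right_mono[OF i norm_ge_zero[of x]] by simp
  moreover have "norm (real (Suc m) *\<^sub>R x) \<le> norm (real (Suc (Suc m)) *\<^sub>R x)"
    by (simp add: mult_right_mono)
  ultimately show ?thesis unfolding cutoff_def by (intro diff_mono plateau_antimono)
qed

lemma cutoff_eventually_1: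
  assumes "x \<noteq> 0" shows "eventually (\<lambda>m. cutoff m x = 1) sequentially"
proof (rule eventually_sequentiallyI)
  fix m assume m: "nat \<lceil>norm x + 2 / norm x\<rceil> \<le> m"
  have nx: "norm x > 0" using assms by simp
  have k: "norm x + 2 / norm x \<le> real (Suc m)" using m by linarith
  have "norm x \<le> real (Suc m)" using k nx by (smt (verit) divide_pos_pos)
  then have "norm (x /\<^sub>R real (Suc m)) \<le> 1" by (simp add: divide_simps)
  moreover have "2 / norm x \<le> real (Suc m)" using k nx by linarith
  then have "norm (real (Suc m) *\<^sub>R x) \<ge> 2" using nx by (simp add: divide_simps mult.commute)
  ultimately show "cutoff m x = 1" by (simp add: cutoff_def plateau_eq_1 plateau_eq_0 del: norm_scaleR)
qed

lemma smooth_scaled: "smooth f \<Longrightarrow> smooth (\<lambda>x. f (c *\<^sub>R x))"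
  using smooth_affine[of f c 0] by simp

lemma cutoff_test: "cutoff m \<in> test_functions (- {0})"
proof (rule test_functionsI)
  show "smooth (cutoff m)" unfolding cutoff_def[abs_def]
    by (intro smooth_diff smooth_scaled smooth_plateau)
  let ?r = "inverse (real (Suc m))"
  show "compact (cball 0 (2 * real (Suc m)) - ball (0::real^'a) ?r)"
    by (intro compact_diff) auto
  show "cball 0 (2 * real (Suc m)) - ball (0::real^'a) ?r \<subseteq> - {0}" by auto
  fix x :: "real^'a" assume "x \<notin> cball 0 (2 * real (Suc m)) - ball 0 ?r"
  then consider "norm x > 2 * real (Suc m)" | "norm x < ?r" by fastforce
  then show "cutoff m x = 0"
  proof cases
    case 1
    then have "norm (x /\<^sub>R real (Suc m)) \<ge> 2" by (simp add: divide_simps mult.commute)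
    moreover have "norm (x /\<^sub>R real (Suc m)) \<le> norm (real (Suc m) *\<^sub>R x)"
      using scaled_norm_le[where m=m and x=x] by (rule order_trans)
    ultimately show ?thesis by (simp add: cutoff_def plateau_eq_0 del: norm_scaleR)
  next
    case 2
    then have "norm (real (Suc m) *\<^sub>R x) \<le> 1" by (simp add: divide_simps mult.commute)
    moreover have "norm (x /\<^sub>R real (Suc m)) \<le> norm (real (Suc m) *\<^sub>R x)"
      using scaled_norm_le[where m=m and x=x] by (rule order_trans)
    ultimately show ?thesis by (simp add: cutoff_def plateau_eq_1 del: norm_scaleR)
  qed
qed

lemma measurable_cutoff [measurable]: "cutoff m \<in> borel_measurable borel"
  using smooth_borel_measurable[OF test_functions_smooth[OF cutoff_test]] .

section \<open>Smooth approximation of boxes and the uniqueness of densities\<close>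

lemma smooth_prod [intro]:
  fixes f :: "'i \<Rightarrow> real^'n::finite \<Rightarrow> real"
  shows "(\<And>i. i \<in> I \<Longrightarrow> smooth (f i)) \<Longrightarrow> smooth (\<lambda>x. \<Prod>i\<in>I. f i x)"
  by (induction I rule: infinite_finite_induct) (auto intro: smooth_mult)

definition smooth_box :: "real^'n::finite \<Rightarrow> real^'n \<Rightarrow> nat \<Rightarrow> real^'n \<Rightarrow> real"
  where "smooth_box a b k x = (\<Prod>i\<in>UNIV. bump (real (Suc k) * (x $ i - a $ i)) * bump (real (Suc k) * (b $ i - x $ i)))"

lemma smooth_smooth_box: "smooth (smooth_box a b k)"
  unfolding smooth_box_def[abs_def]
  by (intro smooth_prod smooth_mult smooth_bump smooth_const smooth_diff smooth_nth)

lemma smooth_box_bounds: "0 \<le> smooth_box a b k x" "smooth_box a b k x \<le> 1"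
  unfolding smooth_box_def by (auto intro!: prod_nonneg prod_le_1 mult_le_one simp: bump_nonneg bump_le_1)

lemma bump_scaled_limit:
  assumes "t > 0" shows "(\<lambda>k. bump (real (Suc k) * t)) \<longlonglongrightarrow> 1"
proof -
  have "(\<lambda>k. exp (- (inverse (real (Suc k)) * inverse t))) \<longlonglongrightarrow> exp (- (0 * inverse t))"
    by (intro tendsto_exp tendsto_minus tendsto_mult LIMSEQ_inverse_real_of_nat tendsto_const)
  moreover have "\<not> real (Suc k) * t \<le> 0" for k using assms by (simp add: mult_le_0_iff)
  then have "bump (real (Suc k) * t) = exp (- (inverse (real (Suc k)) * inverse t))" for k
    by (simp add: bump_def flat_exp_def)
  ultimately show ?thesis by simp
qed

lemma smooth_box_limit: "(\<lambda>k. smooth_box a b k x) \<longlonglongrightarrow> indicator (box a b) x"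
proof (cases "x \<in> box a b")
  case True
  then have "a $ i < x $ i" "x $ i < b $ i" for i by (auto simp: mem_box_cart)
  then have "(\<lambda>k. smooth_box a b k x) \<longlonglongrightarrow> (\<Prod>i\<in>(UNIV :: 'a set). 1 * 1)"
    unfolding smooth_box_def by (intro tendsto_prod tendsto_mult bump_scaled_limit) auto
  then show ?thesis using True by simp
next
  case False
  then obtain i where i: "x $ i \<le> a $ i \<or> b $ i \<le> x $ i" by (auto simp: mem_box_cart not_less)
  have "bump (real (Suc k) * (x $ i - a $ i)) * bump (real (Suc k) * (b $ i - x $ i)) = 0" for k
    using i by (auto simp: bump_zero mult_nonneg_nonpos)
  then have "smooth_box a b k x = 0" for k unfolding smooth_box_def by (intro prod_zero) auto
  then show ?thesis using False by simp
qed

text \<open>Boxes form an intersection-stable generator of the Borel sets, so vanishing integrals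
  spread to all Borel sets. The complement step needs the integral over the whole space, obtained by
  exhausting it with boxes.\<close>

lemma AE_zero_if_box_integrals_zero:
  fixes F :: "'a::euclidean_space \<Rightarrow> real"
  assumes Fi: "integrable lborel F" and box: "\<And>a b. (LINT x|lborel. indicator (box a b) x * F x) = 0"
  shows "AE x in lborel. F x = 0"
proof (rule sigma_finite_measure.density_zero[OF sigma_finite_lborel Fi])
  have [measurable]: "F \<in> borel_measurable borel" using Fi by auto
  have iA: "integrable lborel (\<lambda>x. indicator A x * F x)" if "A \<in> sets borel" for A
    using integrable_mult_indicator[OF _ Fi, of A] that by simp
  have "(\<lambda>k. LINT x|lborel. indicator (box (- (real k *\<^sub>R One)) (real k *\<^sub>R One)) x * F x) \<longlonglongrightarrow> (LINT x|lborel. F x)"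
  proof (rule integral_dominated_convergence[where w="\<lambda>x. norm (F x)"])
    show "AE x in lborel. (\<lambda>k. indicator (box (- (real k *\<^sub>R One)) (real k *\<^sub>R One)) x * F x) \<longlonglongrightarrow> F x"
    proof (intro AE_I2 tendsto_eventually)
      fix x :: 'a
      have "x \<in> box (- (real k *\<^sub>R One)) (real k *\<^sub>R One)" if "nat \<lceil>norm x\<rceil> + 1 \<le> k" for k
      proof -
        have "norm x < real k" using that by linarith
        then have "\<bar>x \<bullet> b\<bar> < real k" if "b \<in> Basis" for b using Basis_le_norm[OF that, of x] by linarith
        then show ?thesis by (auto simp: mem_box abs_less_iff) (metis minus_less_iff)
      qed
      then show "\<forall>\<^sub>F k in sequentially. indicator (box (- (real k *\<^sub>R One)) (real k *\<^sub>R One)) x * F x = F x"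
        by (intro eventually_sequentiallyI[of "nat \<lceil>norm x\<rceil> + 1"]) auto
    qed
  qed (use Fi in \<open>auto simp: indicator_def\<close>)
  then have U: "(LINT x|lborel. F x) = 0" unfolding box by (rule LIMSEQ_unique[OF _ tendsto_const])
  fix A :: "'a set" assume "A \<in> sets lborel"
  then have A: "A \<in> sigma_sets UNIV (range (\<lambda>(a, b). box a b))" by (simp add: borel_eq_box)
  have "Int_stable (range (\<lambda>(a, b). box a b :: 'a set))"
    by (auto simp: Int_stable_def box_Int_box)
  moreover have "range (\<lambda>(a, b). box a b :: 'a set) \<subseteq> Pow UNIV" by simp
  moreover note A
  ultimately have "(LINT x|lborel. indicator A x * F x) = 0"
  proof (induction rule: sigma_sets_induct_disjoint)
    case (basic A) then show ?case using box by auto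
  next
    case empty show ?case by simp
  next
    case (compl A)
    then have "A \<in> sets borel" by (simp add: borel_eq_box)
    have "(LINT x|lborel. indicator (UNIV - A) x * F x) = (LINT x|lborel. F x - indicator A x * F x)"
      by (intro Bochner_Integration.integral_cong refl) (auto simp: indicator_def)
    then show ?case using iA[OF \<open>A \<in> sets borel\<close>] Fi U compl by simp
  next
    case (union A)
    then have m: "A i \<in> sets borel" for i by (auto simp: borel_eq_box)
    have "(LINT x:(\<Union>i. A i)|lborel. F x) = (\<Sum>i. LINT x:A i|lborel. F x)"
      by (rule lebesgue_integral_countable_add) (use m union iA[of "\<Union>i. A i"] in \<open>auto simp: disjoint_family_on_def set_integrable_def\<close>)
    then show ?case using union by (simp add: set_lebesgue_integral_def)
  qed
  then show "(LINT x:A|lborel. F x) = 0" by (simp add: set_lebesgue_integral_def)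
qed

section \<open>Transfer between Lebesgue measurable functions and Borel representatives\<close>

lemma measurable_lebesgue_AE:
  fixes f g :: "'a::euclidean_space \<Rightarrow> 'b::topological_space"
  assumes "AE x in lborel. f x = g x" and g: "g \<in> borel_measurable borel"
  shows "f \<in> borel_measurable lebesgue"
proof (rule measurableI)
  have g': "g \<in> borel_measurable lebesgue" using g by (intro measurable_completion) simp
  fix S :: "'b set" assume "S \<in> sets borel"
  then have m: "g -` S \<inter> space lebesgue \<in> sets lebesgue" using measurable_sets[OF g'] by simp
  have "AE x in lebesgue. x \<in> g -` S \<inter> space lebesgue \<longleftrightarrow> x \<in> f -` S \<inter> space lebesgue"
    using AE_completion[OF assms(1)] by eventually_elim auto
  then show "f -` S \<inter> space lebesgue \<in> sets lebesgue"
    by (rule completion.in_sets_AE[OF _ m]) auto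
qed auto

lemma
  fixes f g :: "'a::euclidean_space \<Rightarrow> 'b::{banach, second_countable_topology}"
  assumes ae: "AE x in lborel. f x = g x" and g: "g \<in> borel_measurable borel"
  shows integral_lebesgue_AE: "(LINT x|lebesgue. f x) = (LINT x|lborel. g x)"
    and integrable_lebesgue_AE: "integrable lebesgue f \<longleftrightarrow> integrable lborel g"
proof -
  have f: "f \<in> borel_measurable lebesgue" by (rule measurable_lebesgue_AE[OF assms])
  have g': "g \<in> borel_measurable lebesgue" using g by (intro measurable_completion) simp
  have "(LINT x|lebesgue. f x) = (LINT x|lebesgue. g x)"
    by (rule integral_cong_AE[OF f g' AE_completion[OF ae]])
  also have "\<dots> = (LINT x|lborel. g x)" by (rule integral_completion) (use g in simp)
  finally show "(LINT x|lebesgue. f x) = (LINT x|lborel. g x)" .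
  have "integrable lebesgue f \<longleftrightarrow> integrable lebesgue g"
    by (rule integrable_cong_AE[OF f g' AE_completion[OF ae]])
  also have "\<dots> \<longleftrightarrow> integrable lborel g" by (rule integrable_completion) (use g in simp)
  finally show "integrable lebesgue f \<longleftrightarrow> integrable lborel g" .
qed

lemma lebesgue_borel_representative:
  fixes f :: "'a::euclidean_space \<Rightarrow> real"
  assumes "f \<in> borel_measurable lebesgue"
  obtains g where "g \<in> borel_measurable borel" "AE x in lborel. f x = g x"
  using completion_ex_borel_measurable_real[OF assms] by auto

lemma loc_integrable_times_test:
  fixes h \<psi> :: "real^'n::finite \<Rightarrow> 'b::{real_normed_algebra, banach, second_countable_topology}"
  assumes "h loc_integrable_on S" "\<psi> \<in> test_functions S"
  shows "integrable lebesgue (\<lambda>x. h x * \<psi> x)"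
proof -
  obtain C where C: "smooth \<psi>" "compact C" "C \<subseteq> S" "\<And>x. x \<notin> C \<Longrightarrow> \<psi> x = 0"
    using assms(2) by (rule test_functionsE) blast
  obtain B where B: "\<And>x. norm (\<psi> x) \<le> B" using test_functions_bounded[OF assms(2)] by blast
  have i: "integrable lebesgue (\<lambda>x. indicator C x *\<^sub>R h x)"
    using assms(1) C by (auto simp: loc_integrable_on_def set_integrable_def)
  have [measurable]: "\<psi> \<in> borel_measurable lebesgue"
    using smooth_borel_measurable[OF C(1)] by (intro measurable_completion) simp
  have eq: "h x * \<psi> x = (indicator C x *\<^sub>R h x) * \<psi> x" for x using C(4)[of x] by (auto simp: indicator_def)
  have B0: "0 \<le> B" using B[of undefined] norm_ge_zero order_trans by blast
  show ?thesis unfolding eq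
  proof (rule Bochner_Integration.integrable_bound[where f="\<lambda>x. B *\<^sub>R (indicator C x *\<^sub>R h x)"])
    show "integrable lebesgue (\<lambda>x. B *\<^sub>R (indicator C x *\<^sub>R h x))" by (rule integrable_scaleR_right[OF i])
    show "(\<lambda>x. (indicator C x *\<^sub>R h x) * \<psi> x) \<in> borel_measurable lebesgue"
      using borel_measurable_integrable[OF i] by measurable
    show "AE x in lebesgue. norm ((indicator C x *\<^sub>R h x) * \<psi> x) \<le> norm (B *\<^sub>R (indicator C x *\<^sub>R h x))"
    proof (rule AE_I2)
      fix x
      have "norm ((indicator C x *\<^sub>R h x) * \<psi> x) \<le> norm (indicator C x *\<^sub>R h x) * norm (\<psi> x)"
        by (rule norm_mult_ineq)
      also have "\<dots> \<le> norm (indicator C x *\<^sub>R h x) * B" by (intro mult_left_mono B) simp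
      finally show "norm ((indicator C x *\<^sub>R h x) * \<psi> x) \<le> norm (B *\<^sub>R (indicator C x *\<^sub>R h x))"
        using B0 by (simp add: mult_ac)
    qed
  qed
qed

text \<open>Multiplication by \<open>cutoff m\<close> makes \<open>h\<close> globally integrable and
  turns smooth boxes into admissible test functions, whose limits are the box indicators. Every
  point other than the origin is eventually in the region where the cutoff is
  \<open>1\<close>.\<close>

lemma fundamental_lemma_real:
  fixes h :: "real^'n::finite \<Rightarrow> real"
  assumes h: "h loc_integrable_on (- {0})"
    and zero: "\<And>\<psi>. \<psi> \<in> test_functions (- {0}) \<Longrightarrow> (LINT x|lebesgue. h x * \<psi> x) = 0"
  shows "AE x in lborel. h x = 0"
proof -
  have "AE x in lborel. h x * cutoff m x = 0" for m
  proof -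
    have i: "integrable lebesgue (\<lambda>x. h x * cutoff m x)"
      by (rule loc_integrable_times_test[OF h cutoff_test])
    obtain F where F [measurable]: "F \<in> borel_measurable borel" and ae: "AE x in lborel. h x * cutoff m x = F x"
      using lebesgue_borel_representative[OF borel_measurable_integrable[OF i]] by blast
    have Fi: "integrable lborel F" using integrable_lebesgue_AE[OF ae F] i by simp
    have "AE x in lborel. F x = 0"
    proof (rule AE_zero_if_box_integrals_zero[OF Fi])
      fix a b :: "real^'n"
      have [measurable]: "smooth_box a b k \<in> borel_measurable borel" for k
        by (rule smooth_borel_measurable[OF smooth_smooth_box])
      have "(\<lambda>k. LINT x|lborel. smooth_box a b k x * F x) \<longlonglongrightarrow> (LINT x|lborel. indicator (box a b) x * F x)"
      proof (rule integral_dominated_convergence[where w="\<lambda>x. norm (F x)"])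
        show "AE x in lborel. (\<lambda>k. smooth_box a b k x * F x) \<longlonglongrightarrow> indicator (box a b) x * F x"
          by (intro AE_I2 tendsto_mult smooth_box_limit tendsto_const)
        show "AE x in lborel. norm (smooth_box a b k x * F x) \<le> norm (F x)" for k
          using smooth_box_bounds[of a b k] by (intro AE_I2) (auto simp: abs_mult intro!: mult_left_le_one_le)
      qed (use Fi in auto)
      moreover have "(LINT x|lborel. smooth_box a b k x * F x) = 0" for k
      proof -
        have t: "(\<lambda>x. cutoff m x * smooth_box a b k x) \<in> test_functions (- {0})"
          by (rule test_functions_comp[OF cutoff_test])
             (auto intro!: smooth_mult smooth_smooth_box test_functions_smooth[OF cutoff_test])
        have "(LINT x|lborel. smooth_box a b k x * F x) = (LINT x|lebesgue. h x * (cutoff m x * smooth_box a b k x))"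
          by (rule integral_lebesgue_AE[symmetric], use ae in eventually_elim) (auto simp: mult_ac)
        then show ?thesis using zero[OF t] by simp
      qed
      ultimately show "(LINT x|lborel. indicator (box a b) x * F x) = 0"
        by (simp only:) (rule LIMSEQ_unique[OF _ tendsto_const])
    qed
    with ae show ?thesis by eventually_elim simp
  qed
  then have "AE x in lborel. \<forall>m. h x * cutoff m x = 0" unfolding AE_all_countable ..
  with AE_lborel_singleton[of 0] show ?thesis
  proof eventually_elim
    case (elim x)
    then obtain m where "cutoff m x = 1"
      using eventually_happens[OF cutoff_eventually_1[of x]] by auto
    then show "h x = 0" using elim by (metis mult.right_neutral)
  qed
qed

lemma fundamental_lemma:
  fixes h :: "real^'n::finite \<Rightarrow> complex"
  assumes h: "h loc_integrable_on (- {0})"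
    and zero: "\<And>\<psi>. \<psi> \<in> test_functions (- {0}) \<Longrightarrow> (LINT x|lebesgue. h x * \<psi> x) = 0"
  shows "AE x in lborel. h x = 0"
proof -
  have z: "(LINT x|lebesgue. Re (h x) * \<psi> x) = 0 \<and> (LINT x|lebesgue. Im (h x) * \<psi> x) = 0"
    if "\<psi> \<in> test_functions (- {0})" for \<psi>
  proof -
    have t: "(\<lambda>x. complex_of_real (\<psi> x)) \<in> test_functions (- {0})"
      using that by (elim test_functionsE) (auto intro: test_functionsI)
    have i: "integrable lebesgue (\<lambda>x. h x * of_real (\<psi> x))" by (rule loc_integrable_times_test[OF h t])
    show ?thesis
      using integral_Re[OF i] integral_Im[OF i] zero[OF t] by simp
  qed
  have "(\<lambda>x. Re (h x)) loc_integrable_on (- {0})" "(\<lambda>x. Im (h x)) loc_integrable_on (- {0})"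
    unfolding loc_integrable_on_def set_integrable_def
  proof (safe)
    fix C :: "(real^'n) set" assume C: "compact C" "C \<subseteq> - {0}"
    have i: "integrable lebesgue (\<lambda>x. indicator C x *\<^sub>R h x)"
      using h C by (auto simp: loc_integrable_on_def set_integrable_def)
    show "integrable lebesgue (\<lambda>x. indicator C x *\<^sub>R Re (h x))" using integrable_Re[OF i] by simp
    show "integrable lebesgue (\<lambda>x. indicator C x *\<^sub>R Im (h x))" using integrable_Im[OF i] by simp
  qed
  then have "AE x in lborel. Re (h x) = 0" "AE x in lborel. Im (h x) = 0"
    using z by (auto intro!: fundamental_lemma_real)
  then show ?thesis by eventually_elim (simp add: complex_eq_iff)
qed

section \<open>The Fourier transform of the primitive away from the origin\<close>

context radial_kernel
begin

definition Q_distr :: "'n distribution"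
  where "Q_distr = fourier_distr (distr_of_fun (\<lambda>x. complex_of_real (Qfun x)))"

lemma Q_distr_eq:
  assumes "f \<in> test_functions UNIV"
  shows "Q_distr f = (LINT x|lborel. Qfun x *\<^sub>R fourier f x)"
proof -
  have [measurable]: "fourier f \<in> borel_measurable borel"
    by (rule measurable_fourier[OF test_functions_integrable[OF assms]])
  show ?thesis
    unfolding Q_distr_def fourier_distr_def distr_of_fun_def
    by (rule integral_lebesgue_AE) (auto simp: scaleR_conv_of_real)
qed

lemma Q_distr_fourier_mult:
  assumes "f \<in> test_functions UNIV"
  shows "Q_distr (fourier_mult j f) = - (LINT \<xi>|lborel. f \<xi> * symbol j \<xi>)"
  using Q_distr_eq[OF fourier_mult_test[OF assms]] integral_Qfun_fourier[OF assms] by simp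

lemma fourier_sum:
  assumes "\<And>i. i \<in> I \<Longrightarrow> integrable lborel (f i)"
  shows "fourier (\<lambda>x. \<Sum>i\<in>I. f i x) \<xi> = (\<Sum>i\<in>I. fourier (f i) \<xi>)"
proof -
  have [measurable]: "\<And>i. i \<in> I \<Longrightarrow> f i \<in> borel_measurable borel" using assms by auto
  have "fourier (\<lambda>x. \<Sum>i\<in>I. f i x) \<xi> = (LINT x|lborel. (\<Sum>i\<in>I. f i x * wave x \<xi>))"
    by (subst fourier_eq) (auto simp: sum_distrib_right)
  also have "\<dots> = (\<Sum>i\<in>I. fourier (f i) \<xi>)"
    using assms by (subst Bochner_Integration.integral_sum) (auto simp: fourier_eq intro!: integrable_mult_wave)
  finally show ?thesis .
qed

text \<open>The only possible solution, off the origin, of the equations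
  \<open>2 * pi * \<i> * (\<xi> $ j) * q = symbol j \<xi>\<close> for all \<open>j\<close>: contract
  them with \<open>\<xi>\<close> and divide by its squared norm.\<close>

definition Qhat0 :: "real^'n \<Rightarrow> complex"
  where "Qhat0 \<xi> = (\<Sum>j\<in>UNIV. of_real (\<xi> $ j) * symbol j \<xi>) / (2 * pi * \<i> * of_real ((norm \<xi>)\<^sup>2))"

lemma Qhat0_loc_integrable: "Qhat0 loc_integrable_on (- {0})"
  unfolding loc_integrable_on_def
proof (intro allI impI)
  fix C :: "(real^'n) set" assume C: "compact C \<and> C \<subseteq> - {0}"
  have m: "(\<lambda>x. indicator C x *\<^sub>R Qhat0 x) \<in> borel_measurable borel"
  proof -
    have [measurable]: "C \<in> sets borel" using C compact_imp_closed[of C] by simp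
    show ?thesis unfolding Qhat0_def by measurable
  qed
  have "integrable lborel (\<lambda>x. indicator C x *\<^sub>R Qhat0 x)"
  proof (rule borel_integrable_compact)
    show "continuous_on C Qhat0"
      unfolding Qhat0_def using C
      by (intro continuous_intros continuous_on_subset[OF continuous_symbol]) auto
  qed (use C in auto)
  then show "set_integrable lebesgue C Qhat0"
    unfolding set_integrable_def using integrable_completion[of "\<lambda>x. indicator C x *\<^sub>R Qhat0 x" lborel] m by simp
qed

text \<open>The action of \<open>Q_distr\<close> is known on functions
  \<open>fourier_mult j f\<close>. A test function supported off the origin is a sum of such
  functions, because the quotients \<open>(\<xi> $ j)^2 / (norm \<xi>)^2\<close> sum to
  \<open>1\<close> there. A representing function therefore exists, and the choice in
  \<open>Q_hat\<close> is meaningful.\<close>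

lemma Q_distr_represented: "represents_off_origin Q_distr Qhat0"
  unfolding represents_off_origin_def
proof (intro conjI ballI Qhat0_loc_integrable)
  fix \<psi> :: "real^'n \<Rightarrow> complex" assume t: "\<psi> \<in> test_functions (- {0})"
  then obtain C where C: "smooth \<psi>" "compact C" "C \<subseteq> - {0}" "\<And>x. x \<notin> C \<Longrightarrow> \<psi> x = 0"
    by (rule test_functionsE) blast
  have "open (- C)" "0 \<in> - C" using C compact_imp_closed by auto
  then obtain d where d: "d > 0" "ball 0 d \<subseteq> - C" by (meson openE)
  \<comment> \<open>This equals \<open>1 / (norm x)^2\<close> where \<open>norm x \<ge> d\<close>,
    hence on the support of \<open>\<psi>\<close>, while the bump keeps the denominator positive
    near \<open>0\<close>.\<close>
  define \<eta> where "\<eta> x = inverse ((norm x)\<^sup>2 + bump (d\<^sup>2 - (norm x)\<^sup>2))" for x :: "real^'n"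
  have "(norm x)\<^sup>2 + bump (d\<^sup>2 - (norm x)\<^sup>2) \<noteq> 0" for x :: "real^'n"
    using bump_pos[of "d\<^sup>2 - (norm x)\<^sup>2"] bump_nonneg[of "d\<^sup>2 - (norm x)\<^sup>2"] d
    by (cases "x = 0") (auto simp: add_nonneg_eq_0_iff)
  then have s\<eta>: "smooth \<eta>" unfolding \<eta>_def[abs_def]
    by (intro smooth_inverse smooth_add smooth_bump smooth_diff smooth_const smooth_norm_sq) auto
  have \<eta>: "\<psi> x * of_real (\<eta> x) = \<psi> x / of_real ((norm x)\<^sup>2)" for x
  proof (cases "norm x < d")
    case True
    then have "\<psi> x = 0" using d C(4)[of x] by (auto simp: subset_iff)
    then show ?thesis by simp
  next
    case False
    then have "d\<^sup>2 \<le> (norm x)\<^sup>2" using d by (intro power_mono) auto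
    then show ?thesis by (simp add: \<eta>_def bump_zero divide_inverse of_real_inverse)
  qed
  define f where "f j x = - (\<psi> x * (of_real (x $ j * \<eta> x) * (1 / (2 * pi * \<i>))))" for j x
  have ft: "f j \<in> test_functions UNIV" for j
  proof (rule test_functions_mono[OF test_functions_comp[OF t]])
    show "smooth (f j)" unfolding f_def[abs_def]
      by (intro smooth_uminus smooth_mult smooth_const smooth_of_real smooth_nth C s\<eta>)
  qed (auto simp: f_def)
  have dec: "\<psi> x = (\<Sum>j\<in>UNIV. fourier_mult j (f j) x)" for x
  proof (cases "x = 0")
    case True
    then show ?thesis using C(3) C(4)[of 0] by (auto simp: fourier_mult_def f_def)
  next
    case False
    have "fourier_mult j (f j) x = (\<psi> x * of_real (\<eta> x)) * of_real ((x $ j)\<^sup>2)" for j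
      by (simp add: fourier_mult_def f_def power2_eq_square)
    then have "(\<Sum>j\<in>UNIV. fourier_mult j (f j) x) = (\<psi> x / of_real ((norm x)\<^sup>2)) * of_real (\<Sum>j\<in>UNIV. (x $ j)\<^sup>2)"
      unfolding \<eta>[symmetric] of_real_sum sum_distrib_left by simp
    also have "(\<Sum>j\<in>UNIV. (x $ j)\<^sup>2) = (norm x)\<^sup>2"
      unfolding power2_norm_eq_inner inner_vec_def inner_real_def by (simp add: power2_eq_square)
    finally show ?thesis using False by simp
  qed
  have fm: "fourier_mult j (f j) \<in> test_functions UNIV" for j by (rule fourier_mult_test[OF ft])
  have t': "\<psi> \<in> test_functions UNIV" by (rule test_functions_mono[OF t]) simp
  have "fourier \<psi> = (\<lambda>\<xi>. \<Sum>j\<in>UNIV. fourier (fourier_mult j (f j)) \<xi>)"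
  proof
    fix \<xi>
    have "fourier \<psi> \<xi> = fourier (\<lambda>x. \<Sum>j\<in>UNIV. fourier_mult j (f j) x) \<xi>" unfolding dec[symmetric] ..
    then show "fourier \<psi> \<xi> = (\<Sum>j\<in>UNIV. fourier (fourier_mult j (f j)) \<xi>)"
      using test_functions_integrable[OF fm] by (subst (asm) fourier_sum) auto
  qed
  then have "Q_distr \<psi> = (LINT x|lborel. (\<Sum>j\<in>UNIV. Qfun x *\<^sub>R fourier (fourier_mult j (f j)) x))"
    by (simp add: Q_distr_eq[OF t'] scaleR_sum_right)
  also have "\<dots> = (\<Sum>j\<in>UNIV. Q_distr (fourier_mult j (f j)))"
    unfolding Q_distr_eq[OF fm] by (rule Bochner_Integration.integral_sum) (rule Qfun_fourier_integrable[OF fm])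
  also have "\<dots> = (\<Sum>j\<in>UNIV. - (LINT \<xi>|lborel. f j \<xi> * symbol j \<xi>))"
    by (simp add: Q_distr_fourier_mult[OF ft])
  also have "\<dots> = (LINT \<xi>|lborel. (\<Sum>j\<in>UNIV. - (f j \<xi> * symbol j \<xi>)))"
  proof -
    have "integrable lborel (\<lambda>\<xi>. f j \<xi> * symbol j \<xi>)" for j
      using integrable_test_times[OF ft continuous_symbol] by (simp add: mult.commute)
    then show ?thesis by (subst Bochner_Integration.integral_sum) auto
  qed
  also have "\<dots> = (LINT \<xi>|lborel. Qhat0 \<xi> * \<psi> \<xi>)"
  proof (intro Bochner_Integration.integral_cong refl)
    fix \<xi>
    have "(\<Sum>j\<in>UNIV. - (f j \<xi> * symbol j \<xi>)) = (\<Sum>j\<in>UNIV. (\<psi> \<xi> * of_real (\<eta> \<xi>)) * (of_real (\<xi> $ j) * symbol j \<xi> / (2 * pi * \<i>)))"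
      by (intro sum.cong refl) (simp add: f_def)
    also have "\<dots> = Qhat0 \<xi> * \<psi> \<xi>"
      unfolding \<eta> sum_distrib_left[symmetric] sum_divide_distrib[symmetric] Qhat0_def by (simp add: mult_ac)
    finally show "(\<Sum>j\<in>UNIV. - (f j \<xi> * symbol j \<xi>)) = Qhat0 \<xi> * \<psi> \<xi>" .
  qed
  also have "\<dots> = distr_of_fun Qhat0 \<psi>"
    unfolding distr_of_fun_def
  proof (rule integral_lebesgue_AE[symmetric])
    have [measurable]: "\<psi> \<in> borel_measurable borel" by (rule smooth_borel_measurable[OF C(1)])
    show "(\<lambda>\<xi>. Qhat0 \<xi> * \<psi> \<xi>) \<in> borel_measurable borel" unfolding Qhat0_def by measurable
  qed simp
  finally show "Q_distr \<psi> = distr_of_fun Qhat0 \<psi>" .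
qed

text \<open>\<open>Q_hat\<close> is an arbitrary choice, so every representing function has to be
  covered. Testing with \<open>fourier_mult j \<psi>\<close> transfers the factor
  \<open>\<xi> $ j\<close> to \<open>g\<close>, and the fundamental lemma identifies the product
  with the symbol.\<close>

lemma Q_distr_unique:
  assumes g: "represents_off_origin Q_distr g"
  shows "AE \<xi> in lborel. 2 * pi * \<i> * of_real (\<xi> $ j) * g \<xi> = symbol j \<xi>"
proof -
  have gl: "g loc_integrable_on (- {0})" using g by (simp add: represents_off_origin_def)
  let ?p = "\<lambda>\<xi>::real^'n. 2 * pi * \<i> * complex_of_real (\<xi> $ j)"
  define h where "h \<xi> = ?p \<xi> * g \<xi> - symbol j \<xi>" for \<xi>
  have "AE \<xi> in lborel. h \<xi> = 0"
  proof (rule fundamental_lemma)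
    show "h loc_integrable_on (- {0})"
      unfolding loc_integrable_on_def set_integrable_def
    proof (intro allI impI)
      fix C :: "(real^'n) set" assume C: "compact C \<and> C \<subseteq> - {0}"
      obtain r where r: "\<And>x. x \<in> C \<Longrightarrow> norm x \<le> r"
        using compact_imp_bounded[of C] C by (auto simp: bounded_iff)
      have i1: "integrable lebesgue (\<lambda>x. indicator C x *\<^sub>R g x)"
        using gl C by (auto simp: loc_integrable_on_def set_integrable_def)
      have m1: "?p \<in> borel_measurable lebesgue" by (rule measurable_completion) simp
      have "integrable lebesgue (\<lambda>x. ?p x * (indicator C x *\<^sub>R g x))"
      proof (rule Bochner_Integration.integrable_bound[where f="\<lambda>x. (2 * pi * r) *\<^sub>R (indicator C x *\<^sub>R g x)"])
        show "integrable lebesgue (\<lambda>x. (2 * pi * r) *\<^sub>R (indicator C x *\<^sub>R g x))" by (rule integrable_scaleR_right[OF i1])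
        show "(\<lambda>x. ?p x * (indicator C x *\<^sub>R g x)) \<in> borel_measurable lebesgue"
          by (rule borel_measurable_times[OF m1 borel_measurable_integrable[OF i1]])
        show "AE x in lebesgue. norm (?p x * (indicator C x *\<^sub>R g x)) \<le> norm ((2 * pi * r) *\<^sub>R (indicator C x *\<^sub>R g x))"
        proof (rule AE_I2)
          fix x
          show "norm (?p x * (indicator C x *\<^sub>R g x)) \<le> norm ((2 * pi * r) *\<^sub>R (indicator C x *\<^sub>R g x))"
          proof (cases "x \<in> C")
            case True
            have "\<bar>x $ j\<bar> \<le> \<bar>r\<bar>" using r[OF True] component_le_norm_cart[of x j] by linarith
            then show ?thesis using True by (simp add: norm_mult abs_mult mult_right_mono)
          qed simp
        qed
      qed
      moreover have "integrable lebesgue (\<lambda>x. indicator C x *\<^sub>R symbol j x)"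
        using C compact_imp_closed[of C]
        by (subst integrable_completion)
           (auto intro!: borel_integrable_compact continuous_on_subset[OF continuous_symbol])
      ultimately have "integrable lebesgue (\<lambda>x. ?p x * (indicator C x *\<^sub>R g x) - indicator C x *\<^sub>R symbol j x)"
        by (rule Bochner_Integration.integrable_diff)
      then show "integrable lebesgue (\<lambda>x. indicator C x *\<^sub>R h x)"
        by (simp add: h_def scaleR_conv_of_real algebra_simps)
    qed
    fix \<psi> :: "real^'n \<Rightarrow> complex" assume t: "\<psi> \<in> test_functions (- {0})"
    have t': "\<psi> \<in> test_functions UNIV" by (rule test_functions_mono[OF t]) simp
    have tm: "fourier_mult j \<psi> \<in> test_functions (- {0})" by (rule fourier_mult_test[OF t])
    have i1: "integrable lebesgue (\<lambda>\<xi>. g \<xi> * fourier_mult j \<psi> \<xi>)" by (rule loc_integrable_times_test[OF gl tm])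
    have i2': "integrable lborel (\<lambda>\<xi>. \<psi> \<xi> * symbol j \<xi>)"
      using integrable_test_times[OF t' continuous_symbol[of j]] by (simp add: mult.commute)
    then have i2: "integrable lebesgue (\<lambda>\<xi>. \<psi> \<xi> * symbol j \<xi>)"
      by (subst integrable_completion) auto
    have "(LINT \<xi>|lebesgue. g \<xi> * fourier_mult j \<psi> \<xi>) = - (LINT \<xi>|lebesgue. \<psi> \<xi> * symbol j \<xi>)"
      using g tm Q_distr_fourier_mult[OF t', of j] borel_measurable_integrable[OF i2']
      by (subst integral_completion) (auto simp: represents_off_origin_def distr_of_fun_def)
    then have "(LINT \<xi>|lebesgue. - (g \<xi> * fourier_mult j \<psi> \<xi>) - \<psi> \<xi> * symbol j \<xi>) = 0"
      using i1 i2 by (subst Bochner_Integration.integral_diff) auto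
    moreover have "- (g \<xi> * fourier_mult j \<psi> \<xi>) - \<psi> \<xi> * symbol j \<xi> = h \<xi> * \<psi> \<xi>" for \<xi>
      by (simp add: h_def fourier_mult_def algebra_simps)
    ultimately show "(LINT \<xi>|lebesgue. h \<xi> * \<psi> \<xi>) = 0" by simp
  qed
  then show ?thesis by eventually_elim (simp add: h_def)
qed

lemma symbol_sq_eq_AE:
  assumes "represents_off_origin Q_distr g"
  shows "AE \<xi> in lborel. (norm (\<chi> j. 2 * pi * \<i> * complex_of_real (\<xi> $ j) * g \<xi>))\<^sup>2 = symbol_sq \<xi>"
proof -
  have "AE \<xi> in lborel. \<forall>j\<in>(UNIV::'n set). 2 * pi * \<i> * complex_of_real (\<xi> $ j) * g \<xi> = symbol j \<xi>"
    by (rule AE_finite_allI[OF finite]) (rule Q_distr_unique[OF assms])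
  then show ?thesis
  proof eventually_elim
    case (elim \<xi>)
    then have "(\<chi> j. 2 * pi * \<i> * complex_of_real (\<xi> $ j) * g \<xi>) = (\<chi> j. symbol j \<xi>)" by (simp add: vec_eq_iff)
    then show ?case
      unfolding norm_vec_def L2_set_def symbol_sq_def by (simp add: sum_nonneg)
  qed
qed

end

section \<open>Second differences of Fourier transforms\<close>

text \<open>If \<open>norm (v - \<zeta>) \<le> H\<close> then
  \<open>1 + norm \<zeta> \<le> (1 + H) * (1 + norm v)\<close>, so decay at \<open>v\<close> can be
  measured at \<open>\<zeta>\<close>. Mean value estimates along segments starting at
  \<open>\<zeta>\<close> need this uniformity.\<close>

lemma fourier_test_decay_segment:
  fixes f :: "real^'n::finite \<Rightarrow> complex"
  assumes f: "f \<in> test_functions UNIV" and H: "0 \<le> H"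
  shows "\<exists>C\<ge>0. \<forall>\<zeta> v. norm (v - \<zeta>) \<le> H \<longrightarrow> norm (fourier f v) \<le> C / (1 + norm \<zeta>) ^ N"
proof -
  obtain C where C: "\<And>\<xi>. (1 + norm \<xi>) ^ N * norm (fourier f \<xi>) \<le> C" using fourier_decay[OF f] by blast
  have C0: "0 \<le> C" using order_trans[OF _ C[of 0]] by simp
  have "norm (fourier f v) \<le> ((1 + H) ^ N * C) / (1 + norm \<zeta>) ^ N" if "norm (v - \<zeta>) \<le> H" for \<zeta> v
  proof -
    have "norm \<zeta> \<le> norm v + norm (v - \<zeta>)" using norm_triangle_ineq4[of v "v - \<zeta>"] by simp
    moreover have "0 \<le> H * norm v" using H by simp
    moreover have "(1 + H) * (1 + norm v) = 1 + norm v + H + H * norm v" by (simp add: algebra_simps)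
    ultimately have "1 + norm \<zeta> \<le> (1 + H) * (1 + norm v)" using that by linarith
    then have "(1 + norm \<zeta>) ^ N \<le> ((1 + H) * (1 + norm v)) ^ N" by (intro power_mono) auto
    then have "(1 + norm \<zeta>) ^ N * norm (fourier f v) \<le> (1 + H) ^ N * ((1 + norm v) ^ N * norm (fourier f v))"
      by (simp only: power_mult_distrib mult.assoc[symmetric]) (intro mult_right_mono, auto)
    also have "\<dots> \<le> (1 + H) ^ N * C" using H by (intro mult_left_mono C) auto
    finally show ?thesis
      by (subst pos_le_divide_eq) (auto simp: mult.commute intro!: zero_less_power add_pos_nonneg)
  qed
  then show ?thesis using C0 H by (intro exI[of _ "(1 + H) ^ N * C"]) auto
qed

lemma norm_gradient_le:
  "norm (\<Sum>j\<in>UNIV. (h $ j) *\<^sub>R (p j :: complex)) \<le> (\<Sum>j\<in>UNIV. norm (p j)) * norm (h :: real^'n::finite)"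
proof -
  have "norm (\<Sum>j\<in>UNIV. (h $ j) *\<^sub>R p j) \<le> (\<Sum>j\<in>UNIV. norm (p j) * norm h)"
    by (intro sum_norm_le) (simp, subst mult.commute, intro mult_left_mono component_le_norm_cart, simp)
  then show ?thesis by (simp add: sum_distrib_right)
qed

lemma fourier_difference_decay:
  fixes f :: "real^'n::finite \<Rightarrow> complex"
  assumes f: "f \<in> test_functions UNIV" and H: "0 \<le> H"
  shows "\<exists>C\<ge>0. \<forall>\<zeta> v. norm (v - \<zeta>) \<le> H \<longrightarrow> norm (fourier f v - fourier f \<zeta>) \<le> C / (1 + norm \<zeta>) ^ N * norm (v - \<zeta>)"
proof -
  have "\<exists>C\<ge>0. \<forall>\<zeta> v. norm (v - \<zeta>) \<le> H \<longrightarrow> norm (fourier (fourier_mult j f) v) \<le> C / (1 + norm \<zeta>) ^ N" for j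
    by (rule fourier_test_decay_segment[OF fourier_mult_test[OF f] H])
  then obtain C where C: "\<And>j. C j \<ge> 0" "\<And>j \<zeta> v. norm (v - \<zeta>) \<le> H \<Longrightarrow> norm (fourier (fourier_mult j f) v) \<le> C j / (1 + norm \<zeta>) ^ N"
    by metis
  have "norm (fourier f v - fourier f \<zeta>) \<le> (\<Sum>j\<in>UNIV. C j) / (1 + norm \<zeta>) ^ N * norm (v - \<zeta>)"
    if v: "norm (v - \<zeta>) \<le> H" for \<zeta> v
  proof (rule differentiable_bound[where S="closed_segment \<zeta> v"])
    fix w assume w: "w \<in> closed_segment \<zeta> v"
    show "(fourier f has_derivative (\<lambda>h. \<Sum>j\<in>UNIV. (h $ j) *\<^sub>R fourier (fourier_mult j f) w)) (at w within closed_segment \<zeta> v)"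
      by (rule has_derivative_at_withinI[OF fourier_has_derivative[OF f]])
    show "onorm (\<lambda>h. \<Sum>j\<in>UNIV. (h $ j) *\<^sub>R fourier (fourier_mult j f) w) \<le> (\<Sum>j\<in>UNIV. C j) / (1 + norm \<zeta>) ^ N"
    proof (rule onorm_le)
      fix h :: "real^'n"
      have "norm (w - \<zeta>) \<le> H" using segment_bound(1)[OF w] v by simp
      then have "(\<Sum>j\<in>UNIV. norm (fourier (fourier_mult j f) w)) \<le> (\<Sum>j\<in>UNIV. C j / (1 + norm \<zeta>) ^ N)"
        by (intro sum_mono C)
      then show "norm (\<Sum>j\<in>UNIV. (h $ j) *\<^sub>R fourier (fourier_mult j f) w) \<le> (\<Sum>j\<in>UNIV. C j) / (1 + norm \<zeta>) ^ N * norm h"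
        unfolding sum_divide_distrib by (intro order_trans[OF norm_gradient_le] mult_right_mono) auto
    qed
  qed auto
  then show ?thesis using C(1) by (intro exI[of _ "\<Sum>j\<in>UNIV. C j"]) (auto intro: sum_nonneg)
qed

lemma fourier_linearization_decay:
  fixes f :: "real^'n::finite \<Rightarrow> complex"
  assumes f: "f \<in> test_functions UNIV" and H: "0 \<le> H"
  shows "\<exists>C\<ge>0. \<forall>\<zeta> h. norm h \<le> H \<longrightarrow>
    norm (fourier f (\<zeta> + h) - fourier f \<zeta> - (\<Sum>j\<in>UNIV. (h $ j) *\<^sub>R fourier (fourier_mult j f) \<zeta>)) \<le> C / (1 + norm \<zeta>) ^ N * (norm h)\<^sup>2"
proof -
  have "\<exists>C\<ge>0. \<forall>\<zeta> v. norm (v - \<zeta>) \<le> H \<longrightarrow>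
      norm (fourier (fourier_mult j f) v - fourier (fourier_mult j f) \<zeta>) \<le> C / (1 + norm \<zeta>) ^ N * norm (v - \<zeta>)" for j
    by (rule fourier_difference_decay[OF fourier_mult_test[OF f] H])
  then obtain C where C: "\<And>j. C j \<ge> 0" "\<And>j \<zeta> v. norm (v - \<zeta>) \<le> H \<Longrightarrow>
      norm (fourier (fourier_mult j f) v - fourier (fourier_mult j f) \<zeta>) \<le> C j / (1 + norm \<zeta>) ^ N * norm (v - \<zeta>)"
    by metis
  let ?D = "\<lambda>v h. \<Sum>j\<in>UNIV. (h $ j) *\<^sub>R fourier (fourier_mult j f) v"
  have "norm (fourier f (\<zeta> + h) - fourier f \<zeta> - ?D \<zeta> h) \<le> (\<Sum>j\<in>UNIV. C j) / (1 + norm \<zeta>) ^ N * (norm h)\<^sup>2"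
    if h: "norm h \<le> H" for \<zeta> h
  proof -
    have "norm (fourier f (\<zeta> + h) - fourier f \<zeta> - ?D \<zeta> ((\<zeta> + h) - \<zeta>)) \<le> norm ((\<zeta> + h) - \<zeta>) * ((\<Sum>j\<in>UNIV. C j) / (1 + norm \<zeta>) ^ N * norm h)"
    proof (rule differentiable_bound_linearization[where S="closed_segment \<zeta> (\<zeta> + h)" and f'="?D"])
      show "\<zeta> + t *\<^sub>R (\<zeta> + h - \<zeta>) \<in> closed_segment \<zeta> (\<zeta> + h)" if "t \<in> {0..1}" for t
        using that by (auto simp: closed_segment_def algebra_simps intro!: exI[of _ t])
      fix w assume w: "w \<in> closed_segment \<zeta> (\<zeta> + h)"
      show "(fourier f has_derivative ?D w) (at w within closed_segment \<zeta> (\<zeta> + h))"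
        by (rule has_derivative_at_withinI[OF fourier_has_derivative[OF f]])
      have wz: "norm (w - \<zeta>) \<le> norm h" using segment_bound(1)[OF w] by simp
      show "onorm (?D w - ?D \<zeta>) \<le> (\<Sum>j\<in>UNIV. C j) / (1 + norm \<zeta>) ^ N * norm h"
      proof (rule onorm_le)
        fix k :: "real^'n"
        have "(?D w - ?D \<zeta>) k = (\<Sum>j\<in>UNIV. (k $ j) *\<^sub>R (fourier (fourier_mult j f) w - fourier (fourier_mult j f) \<zeta>))"
          by (simp add: sum_subtractf scaleR_diff_right)
        also have "norm \<dots> \<le> (\<Sum>j\<in>UNIV. norm (fourier (fourier_mult j f) w - fourier (fourier_mult j f) \<zeta>)) * norm k"
          by (rule norm_gradient_le)
        also have "\<dots> \<le> (\<Sum>j\<in>UNIV. C j / (1 + norm \<zeta>) ^ N * norm h) * norm k"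
        proof (intro mult_right_mono sum_mono)
          fix j
          have "norm (fourier (fourier_mult j f) w - fourier (fourier_mult j f) \<zeta>) \<le> C j / (1 + norm \<zeta>) ^ N * norm (w - \<zeta>)"
            using wz h by (intro C) simp
          also have "\<dots> \<le> C j / (1 + norm \<zeta>) ^ N * norm h" using wz C(1) by (intro mult_left_mono) auto
          finally show "norm (fourier (fourier_mult j f) w - fourier (fourier_mult j f) \<zeta>) \<le> C j / (1 + norm \<zeta>) ^ N * norm h" .
        qed simp
        finally show "norm ((?D w - ?D \<zeta>) k) \<le> (\<Sum>j\<in>UNIV. C j) / (1 + norm \<zeta>) ^ N * norm h * norm k"
          by (simp add: sum_divide_distrib sum_distrib_right)
      qed
    qed simp
    then show ?thesis by (simp add: power2_eq_square mult_ac)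
  qed
  then show ?thesis using C(1) by (intro exI[of _ "\<Sum>j\<in>UNIV. C j"]) (auto intro: sum_nonneg)
qed

text \<open>Normalized so that it is the counterpart of multiplication by
  \<open>1 - cos (2 * pi * (x \<bullet> h))\<close> under the Fourier transform.\<close>

definition second_diff :: "real^'n::finite \<Rightarrow> (real^'n \<Rightarrow> 'b::real_vector) \<Rightarrow> real^'n \<Rightarrow> 'b"
  where "second_diff h F \<zeta> = F \<zeta> - (1/2) *\<^sub>R F (\<zeta> + h) - (1/2) *\<^sub>R F (\<zeta> - h)"

text \<open>The linear terms at \<open>h\<close> and \<open>- h\<close> cancel, leaving two
  quadratic remainders. The resulting factor \<open>(norm h)^2\<close> is what competes with the
  growth of the squared symbol in \<open>moment_tendsto_0\<close>.\<close>

lemma second_diff_fourier_decay: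
  fixes f :: "real^'n::finite \<Rightarrow> complex"
  assumes f: "f \<in> test_functions UNIV" and H: "0 \<le> H"
  shows "\<exists>C\<ge>0. \<forall>\<zeta> h. norm h \<le> H \<longrightarrow> (1 + norm \<zeta>) ^ N * norm (second_diff h (fourier f) \<zeta>) \<le> C * (norm h)\<^sup>2"
proof -
  obtain C where C: "C \<ge> 0" "\<And>\<zeta> h. norm h \<le> H \<Longrightarrow>
    norm (fourier f (\<zeta> + h) - fourier f \<zeta> - (\<Sum>j\<in>UNIV. (h $ j) *\<^sub>R fourier (fourier_mult j f) \<zeta>)) \<le> C / (1 + norm \<zeta>) ^ N * (norm h)\<^sup>2"
    using fourier_linearization_decay[OF f H, of N] by blast
  have "(1 + norm \<zeta>) ^ N * norm (second_diff h (fourier f) \<zeta>) \<le> C * (norm h)\<^sup>2" if h: "norm h \<le> H" for \<zeta> h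
  proof -
    let ?L = "\<Sum>j\<in>UNIV. (h $ j) *\<^sub>R fourier (fourier_mult j f) \<zeta>"
    let ?a = "fourier f (\<zeta> + h) - fourier f \<zeta> - ?L" and ?b = "fourier f (\<zeta> - h) - fourier f \<zeta> + ?L"
    let ?B = "C / (1 + norm \<zeta>) ^ N * (norm h)\<^sup>2"
    have a: "norm ?a \<le> ?B" by (rule C(2)[OF h])
    have b: "norm ?b \<le> ?B" using C(2)[of "- h" \<zeta>] h by (simp add: sum_negf)
    have "second_diff h (fourier f) \<zeta> = - ((1/2) *\<^sub>R (?a + ?b))"
      by (simp add: second_diff_def scaleR_conv_of_real algebra_simps)
    then have "norm (second_diff h (fourier f) \<zeta>) = norm (?a + ?b) / 2" by simp
    also have "\<dots> \<le> (norm ?a + norm ?b) / 2" by (intro divide_right_mono norm_triangle_ineq) simp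
    also have "\<dots> \<le> (?B + ?B) / 2" by (intro divide_right_mono add_mono a b) simp
    also have "\<dots> = ?B" by simp
    finally have le: "norm (second_diff h (fourier f) \<zeta>) \<le> ?B" .
    have pos: "(1 + norm \<zeta>) ^ N > 0" by (intro zero_less_power add_pos_nonneg) auto
    have "norm (second_diff h (fourier f) \<zeta>) \<le> C * (norm h)\<^sup>2 / (1 + norm \<zeta>) ^ N" using le by simp
    then show ?thesis unfolding pos_le_divide_eq[OF pos] by (simp only: mult.commute)
  qed
  then show ?thesis using C(1) by blast
qed

lemma fourier_modulated:
  fixes f :: "real^'n::finite \<Rightarrow> complex"
  assumes [measurable]: "f \<in> borel_measurable borel"
  shows "fourier (\<lambda>x. f x * wave x \<eta>) \<xi> = fourier f (\<xi> + \<eta>)"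
  by (simp add: fourier_eq wave_add_right mult_ac)

lemma fourier_dilated:
  fixes f :: "real^'n::finite \<Rightarrow> complex"
  assumes [measurable]: "f \<in> borel_measurable borel" and c: "c > 0"
  shows "fourier f (\<xi> /\<^sub>R c) = c ^ DIM(real^'n) *\<^sub>R fourier (\<lambda>x. f (c *\<^sub>R x)) \<xi>"
proof -
  have "fourier f (\<xi> /\<^sub>R c) = (LINT x|lborel. f x * wave x (\<xi> /\<^sub>R c))" by (simp add: fourier_eq)
  also have "\<dots> = \<bar>c\<bar> ^ DIM(real^'n) *\<^sub>R (LINT x|lborel. f (0 + c *\<^sub>R x) * wave (0 + c *\<^sub>R x) (\<xi> /\<^sub>R c))"
    using c by (intro lborel_integral_affine) simp
  also have "(LINT x|lborel. f (0 + c *\<^sub>R x) * wave (0 + c *\<^sub>R x) (\<xi> /\<^sub>R c)) = fourier (\<lambda>x. f (c *\<^sub>R x)) \<xi>"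
    using c by (simp add: fourier_eq wave_scaleR)
  finally show ?thesis using c by simp
qed

lemma wave_plus_wave_minus: "wave z \<eta> + wave z (- \<eta>) = of_real (2 * cos (2 * pi * (z \<bullet> \<eta>)))"
  by (simp add: wave_def complex_eq_iff)

lemma integral_second_diff:
  fixes f g h :: "'a \<Rightarrow> complex"
  assumes "integrable M f" "integrable M g" "integrable M h"
  shows "(LINT x|M. f x - (1/2) *\<^sub>R g x - (1/2) *\<^sub>R h x) = (LINT x|M. f x) - (1/2) *\<^sub>R (LINT x|M. g x) - (1/2) *\<^sub>R (LINT x|M. h x)"
proof -
  have "integrable M (\<lambda>x. (1/2) *\<^sub>R g x)" "integrable M (\<lambda>x. (1/2) *\<^sub>R h x)" using assms by auto
  then show ?thesis using assms(1)
    by (simp only: Bochner_Integration.integral_diff Bochner_Integration.integrable_diff integral_scaleR_right)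
qed

lemma fourier_one_minus_cos:
  fixes f :: "real^'n::finite \<Rightarrow> complex"
  assumes f: "integrable lborel f"
  shows "fourier (\<lambda>x. of_real (1 - cos (2 * pi * (x \<bullet> \<eta>))) * f x) \<xi> = second_diff \<eta> (fourier f) \<xi>"
proof -
  have [measurable]: "f \<in> borel_measurable borel" using f by auto
  have i: "integrable lborel (\<lambda>x. f x * wave x \<zeta>)" for \<zeta> by (intro integrable_mult_wave f) auto
  have eq: "of_real (1 - cos (2 * pi * (x \<bullet> \<eta>))) * f x * wave x \<xi> =
     f x * wave x \<xi> - (1/2) *\<^sub>R (f x * wave x (\<xi> + \<eta>)) - (1/2) *\<^sub>R (f x * wave x (\<xi> + - \<eta>))" for x
  proof -
    have c: "complex_of_real (1 - cos (2 * pi * (x \<bullet> \<eta>))) = 1 - (wave x \<eta> + wave x (- \<eta>)) / 2"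
      unfolding wave_plus_wave_minus by simp
    show ?thesis unfolding c wave_add_right scaleR_conv_of_real by (simp add: field_simps)
  qed
  have "fourier (\<lambda>x. of_real (1 - cos (2 * pi * (x \<bullet> \<eta>))) * f x) \<xi> =
    (LINT x|lborel. f x * wave x \<xi> - (1/2) *\<^sub>R (f x * wave x (\<xi> + \<eta>)) - (1/2) *\<^sub>R (f x * wave x (\<xi> + - \<eta>)))"
    unfolding eq[symmetric] by (rule fourier_eq) measurable
  also have "\<dots> = second_diff \<eta> (fourier f) \<xi>"
    unfolding second_diff_def fourier_eq[OF \<open>f \<in> borel_measurable borel\<close>]
    by (subst integral_second_diff[OF i i i]) simp
  finally show ?thesis .
qed

section \<open>The Levy--Khintchine identity\<close>

definition cplateau :: "real^'n::finite \<Rightarrow> complex" where "cplateau x = of_real (plateau x)"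

lemma cplateau_test: "cplateau \<in> test_functions UNIV"
  unfolding cplateau_def[abs_def]
  by (rule test_functionsI[where C="cball 0 2"]) (auto intro!: smooth_of_real smooth_plateau plateau_eq_0)

lemma cplateau_scaled_test: "c > 0 \<Longrightarrow> (\<lambda>x. cplateau (c *\<^sub>R x)) \<in> test_functions UNIV"
  unfolding cplateau_def
  by (rule test_functionsI[where C="cball 0 (2 / c)"])
     (auto intro!: smooth_of_real smooth_scaled smooth_plateau plateau_eq_0 simp: field_simps)

lemma integral_fourier_cplateau: "(LINT \<xi>|lborel. fourier (cplateau :: real^'n::finite \<Rightarrow> complex) \<xi>) = 1"
proof -
  let ?p = "cplateau :: real^'n \<Rightarrow> complex"
  have "fourier (fourier ?p) 0 = ?p (- 0)" by (rule fourier_inversion[OF cplateau_test])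
  moreover have "fourier (fourier ?p) 0 = (LINT \<xi>|lborel. fourier ?p \<xi>)"
    by (subst fourier_eq) (auto intro: measurable_fourier test_functions_integrable[OF cplateau_test])
  ultimately show ?thesis by (simp add: cplateau_def)
qed

context radial_kernel
begin

definition symbol_sq_const :: real where "symbol_sq_const = real CARD('n) * symbol_const\<^sup>2"

lemma symbol_sq_const_nonneg: "0 \<le> symbol_sq_const" by (simp add: symbol_sq_const_def)

lemma symbol_sq_scaled_bound:
  assumes "0 \<le> c" shows "symbol_sq (c *\<^sub>R \<xi> + a) \<le> symbol_sq_const * (1 + c + norm a)\<^sup>2 * (1 + norm \<xi>)\<^sup>2"
proof -
  have "norm (c *\<^sub>R \<xi> + a) \<le> c * norm \<xi> + norm a" using norm_triangle_ineq[of "c *\<^sub>R \<xi>" a] assms by simp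
  moreover have "0 \<le> norm a * norm \<xi>" "0 \<le> norm \<xi>" by simp_all
  moreover have "(1 + c + norm a) * (1 + norm \<xi>) = 1 + norm \<xi> + c + c * norm \<xi> + norm a + norm a * norm \<xi>"
    by (simp add: algebra_simps)
  ultimately have "1 + norm (c *\<^sub>R \<xi> + a) \<le> (1 + c + norm a) * (1 + norm \<xi>)"
    using assms by linarith
  then have "(1 + norm (c *\<^sub>R \<xi> + a))\<^sup>2 \<le> ((1 + c + norm a) * (1 + norm \<xi>))\<^sup>2" by (intro power_mono) auto
  then have "symbol_sq_const * (1 + norm (c *\<^sub>R \<xi> + a))\<^sup>2 \<le> symbol_sq_const * ((1 + c + norm a) * (1 + norm \<xi>))\<^sup>2"
    by (intro mult_left_mono) (auto simp: symbol_sq_const_def)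
  from order_trans[OF symbol_sq_bound[folded symbol_sq_const_def] this]
  show ?thesis by (simp add: power_mult_distrib mult.assoc)
qed

lemma symbol_sq_times_fourier_integrable:
  assumes f: "f \<in> test_functions UNIV" and "0 \<le> c"
  shows "integrable lborel (\<lambda>\<xi>. symbol_sq (c *\<^sub>R \<xi> + a) *\<^sub>R fourier f (\<xi> + b))"
proof -
  have "(\<lambda>x. f x * wave x b) \<in> test_functions UNIV"
    by (rule test_functions_comp[OF f]) (auto intro!: smooth_mult smooth_wave test_functions_smooth[OF f])
  from integrable_poly_fourier[OF this, of "\<lambda>\<xi>. symbol_sq (c *\<^sub>R \<xi> + a)" "symbol_sq_const * (1 + c + norm a)\<^sup>2" 2]
  show ?thesis using symbol_sq_scaled_bound[OF assms(2), of _ a] symbol_sq_nonneg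
    smooth_borel_measurable[OF test_functions_smooth[OF f]]
    by (simp add: fourier_modulated)
qed

text \<open>The squared symbol paired with \<open>1 - cos\<close> localized at distance about
  \<open>1 / c\<close> from the origin. The wide and the narrow plateau of a cutoff correspond to
  \<open>c\<close> equal to \<open>inverse (real (Suc m))\<close> and to
  \<open>real (Suc m)\<close>.\<close>

definition moment :: "real^'n \<Rightarrow> real \<Rightarrow> complex"
  where "moment \<eta> c = (LINT \<xi>|lborel. symbol_sq \<xi> *\<^sub>R fourier (\<lambda>x. of_real (1 - cos (2 * pi * (x \<bullet> \<eta>))) * cplateau (c *\<^sub>R x)) \<xi>)"

lemma moment_eq:
  assumes c: "c > 0"
  shows "moment \<eta> c = (LINT \<zeta>|lborel. symbol_sq (c *\<^sub>R \<zeta>) *\<^sub>R second_diff (\<eta> /\<^sub>R c) (fourier cplateau) \<zeta>)"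
proof -
  have cm: "cplateau \<in> borel_measurable (borel :: (real^'n) measure)"
    by (rule smooth_borel_measurable[OF test_functions_smooth[OF cplateau_test]])
  have i: "integrable lborel (\<lambda>x::real^'n. cplateau (c *\<^sub>R x))"
    by (rule test_functions_integrable[OF cplateau_scaled_test[OF c]])
  have s: "c ^ DIM(real^'n) *\<^sub>R second_diff \<eta> (fourier (\<lambda>x. cplateau (c *\<^sub>R x))) (c *\<^sub>R \<zeta>) =
     second_diff (\<eta> /\<^sub>R c) (fourier cplateau) \<zeta>" for \<zeta>
  proof -
    have d: "fourier cplateau v = c ^ DIM(real^'n) *\<^sub>R fourier (\<lambda>x. cplateau (c *\<^sub>R x)) (c *\<^sub>R v)" for v :: "real^'n"
      using fourier_dilated[OF cm c, of "c *\<^sub>R v"] c by simp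
    have z: "c *\<^sub>R (\<zeta> + \<eta> /\<^sub>R c) = c *\<^sub>R \<zeta> + \<eta>" "c *\<^sub>R (\<zeta> - \<eta> /\<^sub>R c) = c *\<^sub>R \<zeta> - \<eta>"
      using c by (simp_all add: scaleR_add_right scaleR_diff_right)
    show ?thesis
      unfolding second_diff_def d z by (simp add: scaleR_diff_right mult.commute)
  qed
  have "moment \<eta> c = (LINT \<xi>|lborel. symbol_sq \<xi> *\<^sub>R second_diff \<eta> (fourier (\<lambda>x. cplateau (c *\<^sub>R x))) \<xi>)"
    unfolding moment_def fourier_one_minus_cos[OF i] ..
  also have "\<dots> = \<bar>c\<bar> ^ DIM(real^'n) *\<^sub>R (LINT \<zeta>|lborel. symbol_sq (0 + c *\<^sub>R \<zeta>) *\<^sub>R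
      second_diff \<eta> (fourier (\<lambda>x. cplateau (c *\<^sub>R x))) (0 + c *\<^sub>R \<zeta>))"
    using c by (intro lborel_integral_affine) simp
  also have "\<dots> = (LINT \<zeta>|lborel. symbol_sq (c *\<^sub>R \<zeta>) *\<^sub>R second_diff (\<eta> /\<^sub>R c) (fourier cplateau) \<zeta>)"
    unfolding integral_scaleR_right[symmetric] s[symmetric] using c
    by (intro Bochner_Integration.integral_cong refl) (simp add: mult.commute)
  finally show ?thesis .
qed

text \<open>The narrow plateau. After rescaling, the second difference has step
  \<open>\<eta> / (m + 1)\<close> and gains \<open>1 / (m + 1)^2\<close>, while the squared symbol
  at \<open>(m + 1) * \<zeta>\<close> is \<open>o((m + 1)^2)\<close>. Hence no contribution
  concentrated at the origin, such as the Laplacian of a Dirac mass, enters the formula.\<close>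

lemma moment_tendsto_0: "(\<lambda>m. moment \<eta> (real (Suc m))) \<longlonglongrightarrow> 0"
proof -
  let ?e = "\<lambda>m. inverse (real (Suc m))"
  let ?N = "2 * DIM(real^'n)"
  let ?G = "\<lambda>m \<zeta>. symbol_sq (real (Suc m) *\<^sub>R \<zeta>) *\<^sub>R second_diff (\<eta> /\<^sub>R real (Suc m)) (fourier cplateau) \<zeta>"
  have e: "0 < ?e m" "?e m \<le> 1" "?e \<longlonglongrightarrow> 0" for m
    using LIMSEQ_inverse_real_of_nat by (auto simp: inverse_le_1_iff)
  \<comment> \<open>The power \<open>?N\<close> makes the bound integrable, and the two additional
    powers absorb the quadratic growth of \<open>symbol_sq\<close> in
    \<open>\<zeta>\<close>.\<close>
  obtain C where C: "C \<ge> 0" "\<And>\<zeta> h. norm h \<le> norm \<eta> \<Longrightarrow>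
      (1 + norm \<zeta>) ^ (?N + 2) * norm (second_diff h (fourier cplateau) (\<zeta>::real^'n)) \<le> C * (norm h)\<^sup>2"
    using second_diff_fourier_decay[OF cplateau_test, of "norm \<eta>" "?N + 2"] by auto
  have [measurable]: "fourier cplateau \<in> borel_measurable (borel :: (real^'n) measure)"
    by (rule measurable_fourier[OF test_functions_integrable[OF cplateau_test]])
  have h: "norm (\<eta> /\<^sub>R real (Suc m)) \<le> norm \<eta>" for m
    using mult_right_mono[OF e(2)[of m] norm_ge_zero[of \<eta>]] by simp
  have pos: "1 + norm \<zeta> > 0" for \<zeta> :: "real^'n" by (intro add_pos_nonneg) auto
  have bound: "norm (?G m \<zeta>) \<le> (?e m)\<^sup>2 * symbol_sq (\<zeta> /\<^sub>R ?e m) * (C * (norm \<eta>)\<^sup>2 / (1 + norm \<zeta>) ^ (?N + 2))" for m \<zeta>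
  proof -
    have "(1 + norm \<zeta>) ^ (?N + 2) * norm (second_diff (\<eta> /\<^sub>R real (Suc m)) (fourier cplateau) \<zeta>) \<le> C * (norm (\<eta> /\<^sub>R real (Suc m)))\<^sup>2"
      by (rule C(2)[OF h])
    then have "norm (second_diff (\<eta> /\<^sub>R real (Suc m)) (fourier cplateau) \<zeta>) \<le> C * (norm (\<eta> /\<^sub>R real (Suc m)))\<^sup>2 / (1 + norm \<zeta>) ^ (?N + 2)"
      using pos[of \<zeta>] by (subst pos_le_divide_eq) (auto simp: mult.commute)
    also have "(norm (\<eta> /\<^sub>R real (Suc m)))\<^sup>2 = (?e m)\<^sup>2 * (norm \<eta>)\<^sup>2"
      unfolding norm_scaleR power_mult_distrib by simp
    finally have "symbol_sq (real (Suc m) *\<^sub>R \<zeta>) * norm (second_diff (\<eta> /\<^sub>R real (Suc m)) (fourier cplateau) \<zeta>) \<le>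
       symbol_sq (real (Suc m) *\<^sub>R \<zeta>) * (C * ((?e m)\<^sup>2 * (norm \<eta>)\<^sup>2) / (1 + norm \<zeta>) ^ (?N + 2))"
      by (intro mult_left_mono symbol_sq_nonneg)
    then show ?thesis using symbol_sq_nonneg by (simp add: mult_ac)
  qed
  have "(\<lambda>m. LINT \<zeta>|lborel. ?G m \<zeta>) \<longlonglongrightarrow> (LINT \<zeta>|(lborel :: (real^'n) measure). 0)"
  \<comment> \<open>The factor \<open>4\<close> comes from
    \<open>1 + real (Suc m) \<le> 2 * real (Suc m)\<close>, squared; the remaining powers of
    \<open>m\<close> cancel against \<open>?e m\<close>.\<close>
  proof (rule integral_dominated_convergence[where w="\<lambda>\<zeta>. symbol_sq_const * 4 * C * (norm \<eta>)\<^sup>2 / (1 + norm \<zeta>) ^ ?N"])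
    show "integrable lborel (\<lambda>\<zeta>::real^'n. symbol_sq_const * 4 * C * (norm \<eta>)\<^sup>2 / (1 + norm \<zeta>) ^ ?N)"
      using C(1) pos symbol_sq_const_nonneg by (intro integrable_decay[where C="symbol_sq_const * 4 * C * (norm \<eta>)\<^sup>2"])
        (auto simp: abs_mult less_imp_neq[symmetric])
    show "AE \<zeta> in lborel. (\<lambda>m. ?G m \<zeta>) \<longlonglongrightarrow> 0"
    proof (rule AE_I2, rule tendsto_0_le[where K=1])
      fix \<zeta> :: "real^'n"
      show "(\<lambda>m. (?e m)\<^sup>2 * symbol_sq (\<zeta> /\<^sub>R ?e m) * (C * (norm \<eta>)\<^sup>2 / (1 + norm \<zeta>) ^ (?N + 2))) \<longlonglongrightarrow> 0"
        by (rule tendsto_mult_left_zero[OF symbol_sq_sublinear[OF e]])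
      show "\<forall>\<^sub>F m in sequentially. norm (?G m \<zeta>) \<le> norm ((?e m)\<^sup>2 * symbol_sq (\<zeta> /\<^sub>R ?e m) * (C * (norm \<eta>)\<^sup>2 / (1 + norm \<zeta>) ^ (?N + 2))) * 1"
        by (intro always_eventually allI) (simp only: mult_1_right real_norm_def, intro order_trans[OF bound] abs_ge_self)
    qed
    show "AE \<zeta> in lborel. norm (?G m \<zeta>) \<le> symbol_sq_const * 4 * C * (norm \<eta>)\<^sup>2 / (1 + norm \<zeta>) ^ ?N" for m
    proof (rule AE_I2)
      fix \<zeta> :: "real^'n"
      have "symbol_sq (\<zeta> /\<^sub>R ?e m) \<le> symbol_sq_const * (1 + real (Suc m))\<^sup>2 * (1 + norm \<zeta>)\<^sup>2"
        using symbol_sq_scaled_bound[of "real (Suc m)" \<zeta> 0] by simp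
      also have "\<dots> \<le> symbol_sq_const * (2 * real (Suc m))\<^sup>2 * (1 + norm \<zeta>)\<^sup>2"
        by (intro mult_right_mono mult_left_mono power_mono) (auto simp: symbol_sq_const_def)
      finally have "(?e m)\<^sup>2 * symbol_sq (\<zeta> /\<^sub>R ?e m) \<le> (?e m)\<^sup>2 * (symbol_sq_const * (2 * real (Suc m))\<^sup>2 * (1 + norm \<zeta>)\<^sup>2)"
        by (intro mult_left_mono) auto
      also have "\<dots> = symbol_sq_const * 4 * (1 + norm \<zeta>)\<^sup>2 * (?e m * real (Suc m))\<^sup>2"
        by (simp only: power_mult_distrib mult_ac) simp
      also have "?e m * real (Suc m) = 1" by simp
      finally have "(?e m)\<^sup>2 * symbol_sq (\<zeta> /\<^sub>R ?e m) * (C * (norm \<eta>)\<^sup>2 / (1 + norm \<zeta>) ^ (?N + 2)) \<le>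
          symbol_sq_const * 4 * (1 + norm \<zeta>)\<^sup>2 * 1\<^sup>2 * (C * (norm \<eta>)\<^sup>2 / (1 + norm \<zeta>) ^ (?N + 2))"
        using C(1) pos[of \<zeta>] by (intro mult_right_mono) auto
      also have "\<dots> = symbol_sq_const * 4 * C * (norm \<eta>)\<^sup>2 / (1 + norm \<zeta>) ^ ?N"
      proof -
        have "s * q\<^sup>2 * 1\<^sup>2 * (t / q ^ (N + 2)) = s * t / q ^ N" if "q > 0" for s t q :: real and N
          using that by (simp add: power_add power2_eq_square)
        note gen = this[OF pos[of \<zeta>]]
        show ?thesis unfolding gen by (simp only: mult.assoc)
      qed
      finally show "norm (?G m \<zeta>) \<le> symbol_sq_const * 4 * C * (norm \<eta>)\<^sup>2 / (1 + norm \<zeta>) ^ ?N"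
        using bound[of m \<zeta>] by linarith
    qed
    show "?G m \<in> borel_measurable lborel" for m unfolding second_diff_def by measurable
  qed simp
  then show ?thesis by (simp add: moment_eq del: of_nat_Suc)
qed

text \<open>The wide plateau. Here the step of the second difference grows, so a translation of the
  integration variable moves the difference onto \<open>symbol_sq\<close>, where it has the fixed
  step \<open>\<eta>\<close>. In the limit it equals \<open>symbol_sq 0 - symbol_sq \<eta>\<close>
  by evenness, and the transform of the plateau has integral \<open>cplateau 0 = 1\<close>.\<close>

lemma moment_tendsto_symbol_sq: "(\<lambda>m. moment \<eta> (inverse (real (Suc m)))) \<longlonglongrightarrow> - of_real (symbol_sq \<eta>)"
proof -
  let ?e = "\<lambda>m. inverse (real (Suc m))"
  let ?p = "fourier (cplateau :: real^'n \<Rightarrow> complex)"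
  have e0: "0 \<le> ?e m" "?e m \<le> 1" "?e m > 0" for m by (auto simp: inverse_le_1_iff)
  have pt: "cplateau \<in> test_functions (UNIV :: (real^'n) set)" by (rule cplateau_test)
  have [measurable]: "?p \<in> borel_measurable borel" by (rule measurable_fourier[OF test_functions_integrable[OF pt]])
  have i: "integrable lborel (\<lambda>\<xi>. symbol_sq (?e m *\<^sub>R \<xi> + a) *\<^sub>R ?p (\<xi> + b))" for a b m
    by (rule symbol_sq_times_fourier_integrable[OF pt e0(1)])
  have i0: "integrable lborel (\<lambda>\<xi>. symbol_sq (?e m *\<^sub>R \<xi>) *\<^sub>R ?p \<xi>)" for m using i[of m 0 0] by simp
  let ?D = "\<lambda>m \<zeta>. symbol_sq (?e m *\<^sub>R \<zeta>) - (1/2) * symbol_sq (?e m *\<^sub>R \<zeta> + - \<eta>) - (1/2) * symbol_sq (?e m *\<^sub>R \<zeta> + \<eta>)"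
  have eq: "moment \<eta> (?e m) = (LINT \<zeta>|lborel. ?D m \<zeta> *\<^sub>R ?p \<zeta>)" for m
  proof -
    let ?k = "\<eta> /\<^sub>R ?e m"
    have sh: "(LINT \<zeta>|lborel. symbol_sq (?e m *\<^sub>R \<zeta>) *\<^sub>R ?p (\<zeta> + b)) = (LINT \<zeta>|lborel. symbol_sq (?e m *\<^sub>R \<zeta> + - (?e m *\<^sub>R b)) *\<^sub>R ?p \<zeta>)" for b
      by (subst lborel_integral_shift[of _ "- b"]) (simp add: scaleR_diff_right)
    have ek: "?e m *\<^sub>R ?k = \<eta>" using e0(3)[of m] by simp
    have "moment \<eta> (?e m) = (LINT \<zeta>|lborel. symbol_sq (?e m *\<^sub>R \<zeta>) *\<^sub>R ?p \<zeta> -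
        (1/2) *\<^sub>R (symbol_sq (?e m *\<^sub>R \<zeta>) *\<^sub>R ?p (\<zeta> + ?k)) - (1/2) *\<^sub>R (symbol_sq (?e m *\<^sub>R \<zeta>) *\<^sub>R ?p (\<zeta> + - ?k)))"
      unfolding moment_eq[OF e0(3)] second_diff_def
      by (intro Bochner_Integration.integral_cong refl) (simp add: scaleR_diff_right)
    also have "\<dots> = (LINT \<zeta>|lborel. symbol_sq (?e m *\<^sub>R \<zeta>) *\<^sub>R ?p \<zeta>) -
        (1/2) *\<^sub>R (LINT \<zeta>|lborel. symbol_sq (?e m *\<^sub>R \<zeta>) *\<^sub>R ?p (\<zeta> + ?k)) -
        (1/2) *\<^sub>R (LINT \<zeta>|lborel. symbol_sq (?e m *\<^sub>R \<zeta>) *\<^sub>R ?p (\<zeta> + - ?k))"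
      by (rule integral_second_diff[OF i0 i[of m 0, unfolded add_0_right] i[of m 0, unfolded add_0_right]])
    also have "\<dots> = (LINT \<zeta>|lborel. symbol_sq (?e m *\<^sub>R \<zeta>) *\<^sub>R ?p \<zeta>) -
        (1/2) *\<^sub>R (LINT \<zeta>|lborel. symbol_sq (?e m *\<^sub>R \<zeta> + - \<eta>) *\<^sub>R ?p \<zeta>) -
        (1/2) *\<^sub>R (LINT \<zeta>|lborel. symbol_sq (?e m *\<^sub>R \<zeta> + \<eta>) *\<^sub>R ?p \<zeta>)"
      unfolding sh scaleR_minus_right ek minus_minus ..
    also have "\<dots> = (LINT \<zeta>|lborel. symbol_sq (?e m *\<^sub>R \<zeta>) *\<^sub>R ?p \<zeta> -
        (1/2) *\<^sub>R (symbol_sq (?e m *\<^sub>R \<zeta> + - \<eta>) *\<^sub>R ?p \<zeta>) - (1/2) *\<^sub>R (symbol_sq (?e m *\<^sub>R \<zeta> + \<eta>) *\<^sub>R ?p \<zeta>))"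
      by (rule integral_second_diff[OF i0 i[of m _ 0, unfolded add_0_right] i[of m _ 0, unfolded add_0_right], symmetric])
    also have "\<dots> = (LINT \<zeta>|lborel. ?D m \<zeta> *\<^sub>R ?p \<zeta>)"
      by (simp only: scaleR_scaleR scaleR_diff_left)
    finally show ?thesis .
  qed
  have "(\<lambda>m. LINT \<zeta>|lborel. ?D m \<zeta> *\<^sub>R ?p \<zeta>) \<longlonglongrightarrow> (LINT \<zeta>|lborel. (- symbol_sq \<eta>) *\<^sub>R ?p \<zeta>)"
  proof (rule integral_dominated_convergence[where w="\<lambda>\<zeta>. norm ((2 * (symbol_sq_const * (2 + norm \<eta>)\<^sup>2) * (1 + norm \<zeta>)\<^sup>2) *\<^sub>R ?p \<zeta>)"])
    have c0: "0 \<le> symbol_sq_const" by (simp add: symbol_sq_const_def)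
    show "integrable lborel (\<lambda>\<zeta>. norm ((2 * (symbol_sq_const * (2 + norm \<eta>)\<^sup>2) * (1 + norm \<zeta>)\<^sup>2) *\<^sub>R ?p \<zeta>))"
      using c0 by (intro integrable_norm integrable_poly_fourier[OF pt, where B="2 * (symbol_sq_const * (2 + norm \<eta>)\<^sup>2)" and N=2])
        (auto simp: abs_mult)
    have cont: "isCont symbol_sq x" for x
      using continuous_symbol_sq by (simp add: continuous_on_eq_continuous_at)
    show "AE \<zeta> in lborel. (\<lambda>m. ?D m \<zeta> *\<^sub>R ?p \<zeta>) \<longlonglongrightarrow> (- symbol_sq \<eta>) *\<^sub>R ?p \<zeta>"
    proof (rule AE_I2)
      fix \<zeta> :: "real^'n"
      have t: "(\<lambda>m. ?e m *\<^sub>R \<zeta> + a) \<longlonglongrightarrow> 0 *\<^sub>R \<zeta> + a" for a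
        by (intro tendsto_add tendsto_scaleR LIMSEQ_inverse_real_of_nat tendsto_const)
      have M: "(\<lambda>m. symbol_sq (?e m *\<^sub>R \<zeta> + a)) \<longlonglongrightarrow> symbol_sq a" for a
        using isCont_tendsto_compose[OF cont t] by simp
      have "(\<lambda>m. ?D m \<zeta> *\<^sub>R ?p \<zeta>) \<longlonglongrightarrow> (symbol_sq 0 - (1/2) * symbol_sq (- \<eta>) - (1/2) * symbol_sq \<eta>) *\<^sub>R ?p \<zeta>"
        using M[of 0] by (intro tendsto_scaleR tendsto_diff tendsto_mult M tendsto_const) simp
      then show "(\<lambda>m. ?D m \<zeta> *\<^sub>R ?p \<zeta>) \<longlonglongrightarrow> (- symbol_sq \<eta>) *\<^sub>R ?p \<zeta>"
        by (simp add: symbol_sq_uminus)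
    qed
    show "AE \<zeta> in lborel. norm (?D m \<zeta> *\<^sub>R ?p \<zeta>) \<le> norm ((2 * (symbol_sq_const * (2 + norm \<eta>)\<^sup>2) * (1 + norm \<zeta>)\<^sup>2) *\<^sub>R ?p \<zeta>)" for m
    proof (rule AE_I2)
      fix \<zeta> :: "real^'n"
      let ?B = "symbol_sq_const * (2 + norm \<eta>)\<^sup>2 * (1 + norm \<zeta>)\<^sup>2"
      have le: "symbol_sq (?e m *\<^sub>R \<zeta> + a) \<le> ?B" if "norm a \<le> norm \<eta>" for a
      proof -
        have "symbol_sq_const * (1 + ?e m + norm a)\<^sup>2 * (1 + norm \<zeta>)\<^sup>2 \<le> ?B"
          using that e0[of m] c0 by (intro mult_right_mono mult_left_mono power_mono) auto
        then show ?thesis using symbol_sq_scaled_bound[OF e0(1)[of m], of \<zeta> a] by linarith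
      qed
      have "\<bar>?D m \<zeta>\<bar> \<le> 2 * ?B"
      proof -
        have "symbol_sq (?e m *\<^sub>R \<zeta>) \<le> ?B" using le[of 0] by simp
        moreover have "symbol_sq (?e m *\<^sub>R \<zeta> + - \<eta>) \<le> ?B" "symbol_sq (?e m *\<^sub>R \<zeta> + \<eta>) \<le> ?B"
          by (rule le, simp)+
        moreover have "0 \<le> symbol_sq v" for v by (rule symbol_sq_nonneg)
        moreover have "\<bar>a - (1/2) * b - (1/2) * c\<bar> \<le> 2 * B"
          if "a \<le> B" "b \<le> B" "c \<le> B" "0 \<le> a" "0 \<le> b" "0 \<le> c" for a b c B :: real
          using that by (intro abs_leI) linarith+
        ultimately show ?thesis by blast
      qed
      then show "norm (?D m \<zeta> *\<^sub>R ?p \<zeta>) \<le> norm ((2 * (symbol_sq_const * (2 + norm \<eta>)\<^sup>2) * (1 + norm \<zeta>)\<^sup>2) *\<^sub>R ?p \<zeta>)"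
        unfolding norm_scaleR by (intro mult_right_mono) (simp_all only: real_norm_def mult.assoc, use c0 in auto)
    qed
  qed measurable
  also have "(LINT \<zeta>|lborel. (- symbol_sq \<eta>) *\<^sub>R ?p \<zeta>) = - of_real (symbol_sq \<eta>)"
    unfolding integral_scaleR_right integral_fourier_cplateau by (simp add: scaleR_conv_of_real)
  finally show ?thesis unfolding eq .
qed

end

text \<open>The nonnegative Borel form of \<open>K\<close> off the origin. Evenness appears in
  \<open>levy_fourier\<close> because applying the Fourier transform twice returns the reflected
  function.\<close>

locale levy_kernel = radial_kernel \<beta> r
  for \<beta> :: "real \<Rightarrow> real" and r :: "real^'n::finite \<Rightarrow> real" +
  fixes k :: "real^'n \<Rightarrow> real"
  assumes measurable_levy [measurable]: "k \<in> borel_measurable borel"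
    and levy_nonneg: "0 \<le> k z"
    and levy_integrable: "\<phi> \<in> test_functions (- {0}) \<Longrightarrow> integrable lborel (\<lambda>x. complex_of_real (k x) * \<phi> x)"
    and levy_fourier: "\<phi> \<in> test_functions (- {0}) \<Longrightarrow> (\<And>x. \<phi> (- x) = \<phi> x) \<Longrightarrow>
      (LINT x|lborel. complex_of_real (k x) * \<phi> x) = - (LINT \<xi>|lborel. symbol_sq \<xi> *\<^sub>R fourier \<phi> \<xi>)"
begin

lemma one_minus_cos_times_test:
  fixes f :: "real^'n \<Rightarrow> complex"
  assumes "f \<in> test_functions \<Omega>"
  shows "(\<lambda>x. of_real (1 - cos (2 * pi * (x \<bullet> \<eta>))) * f x) \<in> test_functions \<Omega>"
  by (rule test_functions_comp[OF assms])
     (auto intro!: smooth_mult smooth_of_real smooth_diff smooth_cos smooth_const smooth_inner test_functions_smooth[OF assms])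

theorem levy_khintchine:
  "(\<integral>\<^sup>+z. ennreal ((1 - cos (2 * pi * (z \<bullet> \<eta>))) * k z) \<partial>lborel) = ennreal (symbol_sq \<eta>)"
proof -
  let ?c = "\<lambda>x::real^'n. 1 - cos (2 * pi * (x \<bullet> \<eta>))"
  define f where "f c x = complex_of_real (?c x) * cplateau (c *\<^sub>R x)" for c and x :: "real^'n"
  define \<phi> where "\<phi> m x = complex_of_real (?c x) * of_real (cutoff m x)" for m and x :: "real^'n"
  let ?e = "\<lambda>m. inverse (real (Suc m))"
  have c0: "0 \<le> ?c x" for x by simp
  have ft: "f c \<in> test_functions UNIV" if "c > 0" for c
    unfolding f_def[abs_def] by (rule one_minus_cos_times_test[OF cplateau_scaled_test[OF that]])
  have \<phi>_diff: "\<phi> m x = f (?e m) x - f (real (Suc m)) x" for m x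
    by (simp add: \<phi>_def f_def cutoff_def cplateau_def right_diff_distrib del: of_nat_Suc)
  have cut: "(\<lambda>x::real^'n. complex_of_real (cutoff m x)) \<in> test_functions (- {0})" for m
    by (rule test_functionsE[OF cutoff_test]) (auto intro: test_functionsI)
  have \<phi>t: "\<phi> m \<in> test_functions (- {0})" for m
    unfolding \<phi>_def[abs_def] by (rule one_minus_cos_times_test[OF cut])
  have \<phi>e: "\<phi> m (- x) = \<phi> m x" for m x
    by (simp add: \<phi>_def cutoff_def plateau_def)
  define I where "I m = (LINT x|lborel. ?c x * k x * cutoff m x)" for m
  have eqI: "complex_of_real (k x) * \<phi> m x = of_real (?c x * k x * cutoff m x)" for m x
    by (simp add: \<phi>_def)
  have ii: "integrable lborel (\<lambda>x. ?c x * k x * cutoff m x)" for m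
    using integrable_Re[OF levy_integrable[OF \<phi>t[of m]]] unfolding eqI by (simp del: of_real_mult)
  have int: "complex_of_real (I m) = - (moment \<eta> (?e m) - moment \<eta> (real (Suc m)))" for m
  proof -
    have fe: "f (?e m) \<in> test_functions UNIV" "f (real (Suc m)) \<in> test_functions UNIV" by (auto intro!: ft)
    have s: "integrable lborel (\<lambda>\<xi>. symbol_sq \<xi> *\<^sub>R fourier g \<xi>)" if "g \<in> test_functions UNIV" for g
      using symbol_sq_times_fourier_integrable[OF that, of 1 0 0] by simp
    have "fourier (\<phi> m) \<xi> = fourier (f (?e m)) \<xi> - fourier (f (real (Suc m))) \<xi>" for \<xi>
    proof -
      have i: "integrable lborel (f (?e m))" "integrable lborel (f (real (Suc m)))"
        using fe by (auto intro: test_functions_integrable)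
      have [measurable]: "f (?e m) \<in> borel_measurable borel" "f (real (Suc m)) \<in> borel_measurable borel"
        using i by auto
      have "fourier (\<phi> m) \<xi> = (LINT x|lborel. f (?e m) x * wave x \<xi> - f (real (Suc m)) x * wave x \<xi>)"
        unfolding \<phi>_diff[abs_def] by (subst fourier_eq) (auto simp: left_diff_distrib simp del: of_nat_Suc)
      also have "\<dots> = (LINT x|lborel. f (?e m) x * wave x \<xi>) - (LINT x|lborel. f (real (Suc m)) x * wave x \<xi>)"
        by (rule Bochner_Integration.integral_diff) (intro integrable_mult_wave i, simp)+
      finally show ?thesis by (simp only: fourier_eq[OF \<open>f (?e m) \<in> borel_measurable borel\<close>]
            fourier_eq[OF \<open>f (real (Suc m)) \<in> borel_measurable borel\<close>])
    qed
    then have "complex_of_real (I m) = - (LINT \<xi>|lborel. symbol_sq \<xi> *\<^sub>R fourier (f (?e m)) \<xi> - symbol_sq \<xi> *\<^sub>R fourier (f (real (Suc m))) \<xi>)"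
      using levy_fourier[OF \<phi>t \<phi>e, of m] unfolding eqI I_def integral_complex_of_real by (simp only: scaleR_diff_right)
    also have "\<dots> = - (moment \<eta> (?e m) - moment \<eta> (real (Suc m)))"
      unfolding moment_def f_def[symmetric] by (subst Bochner_Integration.integral_diff[OF s[OF fe(1)] s[OF fe(2)]]) simp
    finally show ?thesis .
  qed
  have "(\<lambda>m. - (moment \<eta> (?e m) - moment \<eta> (real (Suc m)))) \<longlonglongrightarrow> - (- complex_of_real (symbol_sq \<eta>) - 0)"
    by (intro tendsto_minus tendsto_diff moment_tendsto_symbol_sq moment_tendsto_0)
  then have "(\<lambda>m. complex_of_real (I m)) \<longlonglongrightarrow> of_real (symbol_sq \<eta>)" unfolding int by simp
  then have "I \<longlonglongrightarrow> symbol_sq \<eta>" by (simp only: tendsto_of_real_iff)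
  then have l1: "(\<lambda>m. ennreal (I m)) \<longlonglongrightarrow> ennreal (symbol_sq \<eta>)" by (rule tendsto_ennrealI)
  \<comment> \<open>The cutoffs increase to \<open>1\<close> off the origin and
    \<open>1 - cos\<close> vanishes at it, so monotone convergence applies and finiteness of the
    limiting integral is part of the conclusion.\<close>
  have "(\<lambda>m. \<integral>\<^sup>+x. ennreal (?c x * k x * cutoff m x) \<partial>lborel) \<longlonglongrightarrow> (\<integral>\<^sup>+x. ennreal (?c x * k x) \<partial>lborel)"
  proof (rule nn_integral_LIMSEQ)
    show "incseq (\<lambda>m x. ennreal (?c x * k x * cutoff m x))"
      by (intro incseq_SucI le_funI ennreal_leI mult_left_mono cutoff_mono mult_nonneg_nonneg c0 levy_nonneg)
    show "(\<lambda>m. ennreal (?c x * k x * cutoff m x)) \<longlonglongrightarrow> ennreal (?c x * k x)" for x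
    proof (cases "x = 0")
      case False
      then show ?thesis
        by (intro tendsto_eventually eventually_mono[OF cutoff_eventually_1[OF False]]) simp
    qed simp
  qed measurable
  moreover have "(\<integral>\<^sup>+x. ennreal (?c x * k x * cutoff m x) \<partial>lborel) = ennreal (I m)" for m
    unfolding I_def by (rule nn_integral_eq_integral[OF ii]) (auto intro!: mult_nonneg_nonneg levy_nonneg cutoff_nonneg)
  ultimately show ?thesis using LIMSEQ_unique[OF _ l1] by simp
qed

text \<open>The shift \<open>z\<close> is the outer variable because Plancherel and Fatou are
  applied for fixed \<open>z\<close>; \<open>energy_alt\<close> restores the order of
  \<open>bilinear_form\<close>.\<close>

definition energy :: "(real^'n \<Rightarrow> real) \<Rightarrow> ennreal"
  where "energy w = (\<integral>\<^sup>+z. \<integral>\<^sup>+x. ennreal ((w x - w (x - z))\<^sup>2 * k z) \<partial>lborel \<partial>lborel)"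

definition grad_sq :: "(real^'n \<Rightarrow> real) \<Rightarrow> ennreal"
  where "grad_sq \<phi> = (\<integral>\<^sup>+x. ennreal (\<Sum>j\<in>UNIV. (dcomp j \<phi> x)\<^sup>2) \<partial>lborel)"

text \<open>Plancherel for \<open>\<phi> x - \<phi> (x - z)\<close> produces the factor \<open>(norm
  (1 - wave z \<xi>))^2 = 2 * (1 - cos (2 * pi * (z \<bullet> \<xi>)))\<close>, the origin of the
  constant \<open>2\<close>. Integration against \<open>k\<close> in \<open>z\<close>, moved inside
  by Tonelli, is then \<open>levy_khintchine\<close>.\<close>

theorem energy_test_function:
  assumes t: "\<phi> \<in> test_functions UNIV"
  shows "energy \<phi> = 2 * grad_sq \<phi>"
proof -
  let ?F = "fourier (\<lambda>x. complex_of_real (\<phi> x))"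
  have c: "continuous_on UNIV \<phi>" by (rule smooth_continuous_on[OF test_functions_smooth[OF t]])
  then have [measurable]: "\<phi> \<in> borel_measurable borel" by (rule borel_measurable_continuous_onI)
  have i: "integrable lborel \<phi>" by (rule test_functions_integrable[OF t])
  have iz: "integrable lborel (\<lambda>x. \<phi> (x - z))" for z
    using lborel_integrable_shift[OF i, of "- z"] by simp
  have [measurable]: "?F \<in> borel_measurable borel" by (rule measurable_fourier) (use i in simp)
  obtain B where B: "\<And>x. \<bar>\<phi> x\<bar> \<le> B" using test_functions_bounded[OF t] by auto
  have shift: "(\<integral>\<^sup>+x. ennreal ((\<phi> x - \<phi> (x - z))\<^sup>2) \<partial>lborel) =
      (\<integral>\<^sup>+\<xi>. ennreal (2 * (1 - cos (2 * pi * (z \<bullet> \<xi>))) * (norm (?F \<xi>))\<^sup>2) \<partial>lborel)" for z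
  proof -
    have F: "fourier (\<lambda>x. complex_of_real (\<phi> x - \<phi> (x - z))) \<xi> = (1 - wave z \<xi>) * ?F \<xi>" for \<xi>
    proof -
      have w: "integrable lborel (\<lambda>x. complex_of_real (\<phi> x) * wave x \<xi>)" "integrable lborel (\<lambda>x. complex_of_real (\<phi> (x - z)) * wave x \<xi>)"
        using i iz by (auto intro!: integrable_mult_wave)
      have "(LINT x|lborel. complex_of_real (\<phi> (x - z)) * wave x \<xi>) = (LINT x|lborel. complex_of_real (\<phi> x) * wave (z + x) \<xi>)"
        by (subst lborel_integral_shift[of _ z]) simp
      also have "\<dots> = wave z \<xi> * ?F \<xi>"
        by (simp add: fourier_eq wave_add_left mult.left_commute[of _ "wave z \<xi>"])
      finally have s: "(LINT x|lborel. complex_of_real (\<phi> (x - z)) * wave x \<xi>) = wave z \<xi> * ?F \<xi>" .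
      have "fourier (\<lambda>x. complex_of_real (\<phi> x - \<phi> (x - z))) \<xi> = (LINT x|lborel. complex_of_real (\<phi> x) * wave x \<xi> - complex_of_real (\<phi> (x - z)) * wave x \<xi>)"
        by (subst fourier_eq) (auto simp: left_diff_distrib)
      also have "\<dots> = ?F \<xi> - wave z \<xi> * ?F \<xi>"
        unfolding Bochner_Integration.integral_diff[OF w] s by (simp add: fourier_eq)
      finally show ?thesis by (simp add: algebra_simps)
    qed
    have n: "(norm (1 - wave z \<xi>))\<^sup>2 = 2 * (1 - cos (2 * pi * (z \<bullet> \<xi>)))" for \<xi>
    proof -
      have "(norm (1 - wave z \<xi>))\<^sup>2 = (1 - cos (2 * pi * (z \<bullet> \<xi>)))\<^sup>2 + (sin (2 * pi * (z \<bullet> \<xi>)))\<^sup>2"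
        by (simp add: cmod_power2 wave_def)
      then show ?thesis by (simp add: sin_squared_eq power2_eq_square algebra_simps)
    qed
    have "(\<integral>\<^sup>+x. ennreal ((\<phi> x - \<phi> (x - z))\<^sup>2) \<partial>lborel) = (\<integral>\<^sup>+\<xi>. ennreal ((norm (fourier (\<lambda>x. complex_of_real (\<phi> x - \<phi> (x - z))) \<xi>))\<^sup>2) \<partial>lborel)"
    proof (rule plancherel[symmetric, where B="2 * B"])
      show "integrable lborel (\<lambda>x. \<phi> x - \<phi> (x - z))" by (rule Bochner_Integration.integrable_diff[OF i iz])
      show "continuous_on UNIV (\<lambda>x. \<phi> x - \<phi> (x - z))"
        by (intro continuous_intros c continuous_on_compose2[OF c]) auto
      show "\<bar>\<phi> x - \<phi> (x - z)\<bar> \<le> 2 * B" for x using B[of x] B[of "x - z"] by linarith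
    qed
    then show ?thesis unfolding F by (simp only: norm_mult power_mult_distrib n)
  qed
  have "energy \<phi> = (\<integral>\<^sup>+z. (\<integral>\<^sup>+x. ennreal ((\<phi> x - \<phi> (x - z))\<^sup>2) \<partial>lborel) * ennreal (k z) \<partial>lborel)"
    unfolding energy_def by (simp add: ennreal_mult levy_nonneg nn_integral_multc)
  also have "\<dots> = (\<integral>\<^sup>+z. \<integral>\<^sup>+\<xi>. ennreal (2 * (norm (?F \<xi>))\<^sup>2) * ennreal ((1 - cos (2 * pi * (z \<bullet> \<xi>))) * k z) \<partial>lborel \<partial>lborel)"
    unfolding shift
    by (intro nn_integral_cong, subst nn_integral_multc[symmetric], simp, intro nn_integral_cong)
       (simp add: ennreal_mult[symmetric] levy_nonneg mult_ac)
  also have "\<dots> = (\<integral>\<^sup>+\<xi>. \<integral>\<^sup>+z. ennreal (2 * (norm (?F \<xi>))\<^sup>2) * ennreal ((1 - cos (2 * pi * (z \<bullet> \<xi>))) * k z) \<partial>lborel \<partial>lborel)"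
    by (rule lborel_pair.Fubini') measurable
  also have "\<dots> = (\<integral>\<^sup>+\<xi>. ennreal (2 * (norm (?F \<xi>))\<^sup>2) * ennreal (symbol_sq \<xi>) \<partial>lborel)"
    by (intro nn_integral_cong, subst nn_integral_cmult) (simp_all add: levy_khintchine)
  also have "\<dots> = (\<integral>\<^sup>+\<xi>. 2 * ennreal (symbol_sq \<xi> * (norm (?F \<xi>))\<^sup>2) \<partial>lborel)"
    by (intro nn_integral_cong) (simp add: ennreal_mult symbol_sq_nonneg mult_ac)
  also have "\<dots> = 2 * grad_sq \<phi>"
    unfolding grad_sq_def dcomp_energy[OF t] by (rule nn_integral_cmult) measurable
  finally show ?thesis .
qed

lemma energy_contraction:
  assumes "\<And>x y. \<bar>v x - v y\<bar> \<le> \<bar>w x - w y\<bar>"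
  shows "energy v \<le> energy w"
  unfolding energy_def
proof (intro nn_integral_mono ennreal_leI mult_right_mono levy_nonneg)
  fix x z
  show "(v x - v (x - z))\<^sup>2 \<le> (w x - w (x - z))\<^sup>2"
    using assms[of x "x - z"] by (simp add: abs_le_square_iff)
qed

text \<open>Fatou is used twice, in \<open>x\<close> for each shift and then in \<open>z\<close>.
  For a fixed shift the translated sequence converges almost everywhere too.\<close>

lemma energy_lower_semicontinuous:
  assumes [measurable]: "\<And>n. \<phi> n \<in> borel_measurable borel" "w \<in> borel_measurable borel"
    and lim: "AE x in lborel. (\<lambda>n. \<phi> n x) \<longlonglongrightarrow> w x" and le: "\<And>n. energy (\<phi> n) \<le> C"
  shows "energy w \<le> C"
proof -
  have z: "(\<integral>\<^sup>+x. ennreal ((w x - w (x - z))\<^sup>2 * k z) \<partial>lborel) \<le>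
      liminf (\<lambda>n. \<integral>\<^sup>+x. ennreal ((\<phi> n x - \<phi> n (x - z))\<^sup>2 * k z) \<partial>lborel)" for z
  proof -
    have "AE x in distr lborel borel (\<lambda>x. - z + x). (\<lambda>n. \<phi> n x) \<longlonglongrightarrow> w x"
      unfolding lborel_distr_plus by (rule lim)
    then have "AE x in lborel. (\<lambda>n. \<phi> n (- z + x)) \<longlonglongrightarrow> w (- z + x)"
      by (subst (asm) AE_distr_iff) auto
    then have "AE x in lborel. (\<lambda>n. ennreal ((\<phi> n x - \<phi> n (x - z))\<^sup>2 * k z)) \<longlonglongrightarrow> ennreal ((w x - w (x - z))\<^sup>2 * k z)"
      using lim by eventually_elim (auto intro!: tendsto_ennrealI tendsto_intros)
    then have "AE x in lborel. ennreal ((w x - w (x - z))\<^sup>2 * k z) \<le> liminf (\<lambda>n. ennreal ((\<phi> n x - \<phi> n (x - z))\<^sup>2 * k z))"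
    proof eventually_elim
      case (elim x)
      then show ?case using lim_imp_Liminf[OF _ elim] by simp
    qed
    then have "(\<integral>\<^sup>+x. ennreal ((w x - w (x - z))\<^sup>2 * k z) \<partial>lborel) \<le> (\<integral>\<^sup>+x. liminf (\<lambda>n. ennreal ((\<phi> n x - \<phi> n (x - z))\<^sup>2 * k z)) \<partial>lborel)"
      by (rule nn_integral_mono_AE)
    also have "\<dots> \<le> liminf (\<lambda>n. \<integral>\<^sup>+x. ennreal ((\<phi> n x - \<phi> n (x - z))\<^sup>2 * k z) \<partial>lborel)"
      by (rule nn_integral_liminf) measurable
    finally show ?thesis .
  qed
  have "energy w \<le> (\<integral>\<^sup>+z. liminf (\<lambda>n. \<integral>\<^sup>+x. ennreal ((\<phi> n x - \<phi> n (x - z))\<^sup>2 * k z) \<partial>lborel) \<partial>lborel)"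
    unfolding energy_def by (intro nn_integral_mono z)
  also have "\<dots> \<le> liminf (\<lambda>n. energy (\<phi> n))"
    unfolding energy_def by (rule nn_integral_liminf) measurable
  also have "\<dots> \<le> limsup (\<lambda>n. energy (\<phi> n))" by (rule Liminf_le_Limsup) simp
  also have "\<dots> \<le> C" by (rule Limsup_bounded) (auto simp: le)
  finally show ?thesis .
qed

end

section \<open>Borel representatives of radial kernels\<close>

lemma AE_lborel_exists:
  assumes "AE x in (lborel :: 'a::euclidean_space measure). P x" shows "\<exists>x. P x"
proof (rule ccontr)
  assume "\<not> (\<exists>x. P x)"
  then have "AE x in (lborel :: 'a measure). False" using assms by simp
  then have "ae_filter (lborel :: 'a measure) = bot" by (simp add: trivial_limit_def)
  then show False by (simp add: ae_filter_eq_bot_iff)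
qed

text \<open>Intended for the set where \<open>\<rho>\<close> differs from a Borel representative: by
  Tonelli in \<open>(x, s)\<close> almost every line through the origin meets it in a null set of
  parameters, so a radial profile can be read off along one such line.\<close>

lemma AE_lborel_dilations_avoid_null_set:
  fixes N :: "'a::euclidean_space set"
  assumes N: "N \<in> null_sets lborel"
  shows "AE x in lborel. AE s in lborel. s \<noteq> 0 \<longrightarrow> s *\<^sub>R x \<notin> N"
proof -
  have [measurable]: "N \<in> sets borel" using N by auto
  let ?f = "\<lambda>x s. if s \<noteq> 0 then indicator N (s *\<^sub>R x) else (0::ennreal)"
  have Z: "(\<integral>\<^sup>+x. ?f x s \<partial>lborel) = 0" for s :: real
  proof (cases "s = 0")
    case False
    have "(\<integral>\<^sup>+x. indicator N x \<partial>(lborel :: 'a measure)) = 0" using N by (simp add: null_sets_def)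
    then show ?thesis using nn_integral_lborel_affine[of "indicator N" s 0] False by simp
  qed simp
  have "(\<integral>\<^sup>+x. \<integral>\<^sup>+s. ?f x s \<partial>lborel \<partial>lborel) = (\<integral>\<^sup>+s. \<integral>\<^sup>+x. ?f x s \<partial>lborel \<partial>lborel)"
    by (rule lborel_pair.Fubini') measurable
  then have "(\<integral>\<^sup>+x. \<integral>\<^sup>+s. ?f x s \<partial>lborel \<partial>lborel) = 0" unfolding Z by simp
  then have "AE x in lborel. (\<integral>\<^sup>+s. ?f x s \<partial>lborel) = 0"
    by (subst (asm) nn_integral_0_iff_AE) measurable
  then show ?thesis
  proof eventually_elim
    case (elim x)
    then have "AE s in lborel. ?f x s = 0" by (subst (asm) nn_integral_0_iff_AE) auto
    then show ?case by eventually_elim (auto simp: indicator_def split: if_splits)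
  qed
qed

text \<open>Tonelli for the condition \<open>s * norm x \<in> N\<close> shows that its solutions
  \<open>x\<close> form a null set for almost every \<open>s > 0\<close>. One such \<open>s\<close>
  is then undone by a dilation, which replaces polar coordinates.\<close>

lemma AE_norm_avoids_null_set:
  fixes N :: "real set"
  assumes N: "N \<in> null_sets lborel"
  shows "AE x in (lborel :: 'a::euclidean_space measure). norm x \<notin> N"
proof -
  have [measurable]: "N \<in> sets borel" using N by auto
  let ?f = "\<lambda>(x::'a) s. if 0 < s then indicator N (s * norm x) else (0::ennreal)"
  have "(\<integral>\<^sup>+x. \<integral>\<^sup>+s. ?f x s \<partial>lborel \<partial>lborel) = (\<integral>\<^sup>+(x::'a). 0 \<partial>lborel)"
  proof (rule nn_integral_cong_AE, use AE_lborel_singleton[of "0::'a"] in eventually_elim)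
    fix x :: 'a assume "x \<noteq> 0"
    then have nx: "norm x \<noteq> 0" by simp
    have "(\<integral>\<^sup>+s. ?f x s \<partial>lborel) \<le> (\<integral>\<^sup>+s. indicator N (0 + norm x * s) \<partial>lborel)"
      by (intro nn_integral_mono) (auto simp: mult.commute)
    also have "\<dots> = 0"
      using nn_integral_real_affine[of "indicator N" "norm x" 0] nx N by (simp add: null_sets_def ennreal_eq_0_iff)
    finally show "(\<integral>\<^sup>+s. ?f x s \<partial>lborel) = 0" by simp
  qed
  then have "(\<integral>\<^sup>+s. \<integral>\<^sup>+x. ?f x s \<partial>lborel \<partial>lborel) = 0"
    by (subst lborel_pair.Fubini') auto
  then have S: "AE s in lborel. (\<integral>\<^sup>+x. ?f x s \<partial>lborel) = 0"
    by (subst (asm) nn_integral_0_iff_AE) measurable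
  have pos: "\<not> (AE s in lborel. \<not> (0 < (s::real)))"
  proof
    assume "AE s in lborel. \<not> (0 < (s::real))"
    then have "emeasure lborel {0<..<1::real} = 0"
      by (subst AE_iff_measurable[symmetric, where P="\<lambda>s. \<not> (0 < s \<and> s < 1)"]) (auto elim: eventually_mono)
    then show False by simp
  qed
  have "\<exists>s>0. (\<integral>\<^sup>+x. ?f x s \<partial>lborel) = 0"
  proof (rule ccontr)
    assume n: "\<not> (\<exists>s>0. (\<integral>\<^sup>+x. ?f x s \<partial>lborel) = 0)"
    have "AE s in lborel. \<not> (0 < (s::real))" by (rule eventually_mono[OF S]) (use n in blast)
    then show False using pos by blast
  qed
  then obtain s :: real where s: "s > 0" "(\<integral>\<^sup>+x. ?f x s \<partial>lborel) = 0" by blast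
  have "(\<integral>\<^sup>+x. indicator N (norm x) \<partial>(lborel :: 'a measure)) = 0"
    using nn_integral_lborel_affine[of "\<lambda>x::'a. indicator N (norm x)" s 0] s by simp
  then have "AE x in (lborel :: 'a measure). indicator N (norm x) = (0::ennreal)"
    by (subst (asm) nn_integral_0_iff_AE) auto
  then show ?thesis by eventually_elim (simp add: indicator_eq_0_iff)
qed

text \<open>A Borel representative of a radial function need not be radial. Its restriction to a
  well chosen ray is a Borel profile, and the radial function with this profile agrees with
  \<open>\<rho>\<close> almost everywhere because null sets of radii have null preimages.\<close>

lemma radial_kernel_representative:
  fixes \<rho> :: "real^'n::finite \<Rightarrow> real"
  assumes nonneg: "\<And>x. x \<noteq> 0 \<Longrightarrow> 0 \<le> \<rho> x" and rad: "radial \<rho>"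
    and int: "integrable lebesgue (\<lambda>x. min 1 (1 / norm x) * \<rho> x)"
  obtains \<beta> and r :: "real^'n \<Rightarrow> real" where "radial_kernel \<beta> r" "AE x in lborel. \<rho> x = r x"
    "\<And>x::real^'n. Q_rho \<rho> x = radial_kernel.Qfun \<beta> x"
proof -
  let ?m = "\<lambda>x::real^'n. min 1 (1 / norm x)"
  have mm: "?m \<in> borel_measurable lebesgue" by (rule measurable_completion) simp
  have "(\<lambda>x. (?m x * \<rho> x) / ?m x) \<in> borel_measurable lebesgue"
    by (rule borel_measurable_divide[OF borel_measurable_integrable[OF int] mm])
  then obtain g where g [measurable]: "g \<in> borel_measurable borel" and ag: "AE x in lborel. (?m x * \<rho> x) / ?m x = g x"
    by (rule lebesgue_borel_representative)
  have "AE x in lborel. \<rho> x = g x"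
    using ag AE_lborel_singleton[of "0::real^'n"] by eventually_elim (auto simp: min_def split: if_splits)
  then obtain N where N: "\<And>x. x \<notin> N \<Longrightarrow> \<rho> x = g x" "N \<in> null_sets lborel" by (rule AE_E3) auto
  have Nm [measurable]: "N \<in> sets borel" using N(2) by auto
  obtain e where e: "e \<noteq> 0" "AE s in lborel. s \<noteq> 0 \<longrightarrow> s *\<^sub>R e \<notin> N"
    using AE_lborel_exists[OF AE_conjI[OF AE_lborel_singleton[of 0] AE_lborel_dilations_avoid_null_set[OF N(2)]]] by blast
  have ne: "norm e > 0" using e by simp
  \<comment> \<open>Truncation at \<open>0\<close> gives a nonnegative profile at every argument,
    including those where the representative differs from \<open>\<rho>\<close>.\<close>
  define \<beta> where "\<beta> t = max 0 (g ((t / norm e) *\<^sub>R e))" for t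
  have \<beta>m [measurable]: "\<beta> \<in> borel_measurable borel" unfolding \<beta>_def[abs_def] by measurable
  have rr: "radial_rep \<rho> (norm x) = \<rho> x" if "x \<noteq> 0" for x
  proof -
    have "norm (SOME y::real^'n. norm y = norm x) = norm x" by (rule someI[of _ x]) simp
    then show ?thesis using rad that unfolding radial_rep_def radial_def by (metis norm_eq_zero)
  qed
  have "AE t in lborel. t / norm e \<noteq> 0 \<longrightarrow> (t / norm e) *\<^sub>R e \<notin> N"
    using AE_borel_affine[of "inverse (norm e)" "\<lambda>s. s \<noteq> 0 \<longrightarrow> s *\<^sub>R e \<notin> N" 0] e ne
    by (simp add: divide_inverse mult.commute)
  then have "AE t in lborel. 0 < t \<longrightarrow> \<beta> t = radial_rep \<rho> t"
  proof eventually_elim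
    case (elim t)
    show ?case
    proof
      assume t: "0 < t"
      let ?x = "(t / norm e) *\<^sub>R e"
      have "?x \<notin> N" "?x \<noteq> 0" "norm ?x = t" using elim t e ne by auto
      then show "\<beta> t = radial_rep \<rho> t" using N(1)[of ?x] rr[of ?x] nonneg[of ?x] by (simp add: \<beta>_def)
    qed
  qed
  then obtain N1 where N1: "\<And>t. t \<notin> N1 \<Longrightarrow> 0 < t \<longrightarrow> \<beta> t = radial_rep \<rho> t" "N1 \<in> null_sets lborel"
    by (rule AE_E3) auto
  define r where "r x = \<beta> (norm x)" for x :: "real^'n"
  have ae: "AE x in lborel. \<rho> x = r x"
    using AE_norm_avoids_null_set[OF N1(2)] AE_lborel_singleton[of "0::real^'n"]
    by eventually_elim (use N1(1) rr in \<open>auto simp: r_def\<close>)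
  have rm [measurable]: "r \<in> borel_measurable borel" unfolding r_def[abs_def] by measurable
  have "integrable lborel (\<lambda>x. ?m x * r x)"
  proof -
    have "AE x in lborel. ?m x * \<rho> x = ?m x * r x" using ae by eventually_elim simp
    from integrable_lebesgue_AE[OF this] int show ?thesis by simp
  qed
  then have rk: "radial_kernel \<beta> r"
    by unfold_locales (auto simp: r_def \<beta>_def[abs_def])
  interpret radial_kernel \<beta> r by (rule rk)
  have Q: "Q_rho \<rho> x = Qfun x" for x :: "real^'n"
    unfolding Q_rho_def Qfun_def set_lebesgue_integral_def
  proof (rule integral_lebesgue_AE)
    show "AE t in lborel. indicat_real {norm x<..} t *\<^sub>R (radial_rep \<rho> t / t) = (if norm x < t then \<beta> t / t else 0)"
      by (rule eventually_mono[OF AE_not_in[OF N1(2)]])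
         (use N1(1) le_less_trans[OF norm_ge_zero[of x]] in \<open>auto simp: indicator_def\<close>)
  qed measurable
  show ?thesis by (rule that[OF rk ae Q])
qed

context radial_kernel
begin

text \<open>The equality holds at every \<open>x\<close>: for each fixed \<open>x\<close>, the
  points \<open>y\<close> with \<open>x - y\<close> in the exceptional set form a null set.\<close>

lemma D_rho_eq_dcomp:
  assumes ae: "AE x in lborel. \<rho> x = r x" and t: "\<phi> \<in> test_functions UNIV"
  shows "D_rho \<rho> \<phi> x = (\<chi> j. dcomp j \<phi> x)"
proof -
  have [measurable]: "\<phi> \<in> borel_measurable borel"
    by (rule smooth_borel_measurable[OF test_functions_smooth[OF t]])
  let ?G = "\<lambda>y. \<Sum>j\<in>UNIV. ((\<phi> x - \<phi> y) * vkernel j (x - y)) *\<^sub>R axis j (1::real)"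
  obtain N where N: "\<And>z. z \<notin> N \<Longrightarrow> \<rho> z = r z" "N \<in> null_sets lborel" using ae by (rule AE_E3) auto
  have "AE y in lborel. x - y \<notin> N"
  proof -
    have [measurable]: "N \<in> sets borel" using N(2) by auto
    have d: "distr lborel borel (\<lambda>y. x - y) = (lborel :: (real^'n) measure)"
      using lborel_affine[of "-1" x] by (simp add: density_1)
    have "AE z in distr lborel borel (\<lambda>y. x - y). z \<notin> N" unfolding d by (rule AE_not_in[OF N(2)])
    then show ?thesis by (subst (asm) AE_distr_iff) auto
  qed
  then have ae': "AE y in lborel. ((\<phi> x - \<phi> y) / norm (x - y) * \<rho> (x - y)) *\<^sub>R ((x - y) /\<^sub>R norm (x - y)) = ?G y"
  proof eventually_elim
    case (elim y)
    have G: "?G y = (\<chi> j. (\<phi> x - \<phi> y) * vkernel j (x - y))"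
      by (simp add: vec_eq_iff axis_def if_distrib[of "\<lambda>c. _ * c"] cong: if_cong)
    show ?case unfolding G N(1)[OF elim] by (simp add: vec_eq_iff vkernel_def power2_eq_square divide_inverse mult_ac)
  qed
  have refl: "(LINT y|lborel. (\<phi> x - \<phi> y) * vkernel j (x - y)) = dcomp j \<phi> x" for j
    unfolding dcomp_def by (subst lborel_integral_reflect[of _ x]) simp
  have int: "integrable lborel (\<lambda>y. (\<phi> x - \<phi> y) * vkernel j (x - y))" for j
    using lborel_integrable_reflect[OF dcomp_integrand_integrable[OF t, of x j], of x] by simp
  have "D_rho \<rho> \<phi> x = (LINT y|lborel. ?G y)"
    unfolding D_rho_def by (rule integral_lebesgue_AE[OF ae']) measurable
  also have "\<dots> = (\<Sum>j\<in>UNIV. dcomp j \<phi> x *\<^sub>R axis j 1)"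
    using int by (subst Bochner_Integration.integral_sum) (auto simp: refl)
  also have "\<dots> = (\<chi> j. dcomp j \<phi> x)"
    by (simp add: vec_eq_iff axis_def if_distrib[of "\<lambda>c. _ * c"] cong: if_cong)
  finally show ?thesis .
qed

end

section \<open>Completeness of the space of square integrable functions\<close>

lemma sq_norm_add_le: "(norm (a + b))\<^sup>2 \<le> 2 * (norm a)\<^sup>2 + 2 * (norm b)\<^sup>2" for a b :: "'a::real_normed_vector"
proof -
  have "(norm (a + b))\<^sup>2 \<le> (norm a + norm b)\<^sup>2" by (intro power_mono norm_triangle_ineq) simp
  also have "\<dots> \<le> 2 * (norm a)\<^sup>2 + 2 * (norm b)\<^sup>2"
    using zero_le_power2[of "norm a - norm b"] by (simp add: power2_sum power2_diff)
  finally show ?thesis .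
qed

text \<open>Boundedness of the weighted terms already gives increments of size
  \<open>(1/2) ^ m\<close> up to a constant, hence an absolutely convergent telescoping
  series.\<close>

lemma fast_Cauchy_convergent:
  fixes f :: "nat \<Rightarrow> 'b::banach"
  assumes "(\<Sum>m. ennreal (4 ^ m * (norm (f (Suc m) - f m))\<^sup>2)) < \<infinity>"
  shows "convergent f"
proof -
  have s: "summable (\<lambda>m. 4 ^ m * (norm (f (Suc m) - f m))\<^sup>2)"
    by (rule summable_suminf_not_top) (use assms in auto)
  have "Bseq (\<lambda>m. 4 ^ m * (norm (f (Suc m) - f m))\<^sup>2)"
    by (rule convergent_imp_Bseq[OF convergentI[OF summable_LIMSEQ_zero[OF s]]])
  then obtain K where K: "K > 0" "\<And>m. norm (4 ^ m * (norm (f (Suc m) - f m))\<^sup>2) \<le> K" by (auto elim: BseqE)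
  have b: "norm (f (Suc m) - f m) \<le> sqrt K * (1/2) ^ m" for m
  proof (rule power2_le_imp_le)
    have "4 ^ m * (norm (f (Suc m) - f m))\<^sup>2 \<le> K" using K(2)[of m] by simp
    then have "(norm (f (Suc m) - f m))\<^sup>2 \<le> K * (1/4) ^ m" by (simp add: field_simps)
    also have "\<dots> = (sqrt K * (1/2) ^ m)\<^sup>2"
    proof -
      have "((1/2) ^ m)\<^sup>2 = (((1/2)\<^sup>2) ^ m :: real)" by (simp only: power_mult[symmetric] mult.commute)
      then show ?thesis using K(1) by (simp add: power_mult_distrib power2_eq_square[of "1/2"])
    qed
    finally show "(norm (f (Suc m) - f m))\<^sup>2 \<le> (sqrt K * (1/2) ^ m)\<^sup>2" .
  qed (use K(1) in simp)
  have "summable (\<lambda>m. sqrt K * (1/2) ^ m)" by (intro summable_mult summable_geometric) simp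
  then have "summable (\<lambda>m. f (Suc m) - f m)"
    by (rule summable_comparison_test'[where N=0]) (rule b)
  then have "convergent (\<lambda>n. \<Sum>m<n. f (Suc m) - f m)" by (simp add: summable_iff_convergent)
  then have "convergent (\<lambda>n. (f n - f 0) + f 0)" unfolding sum_lessThan_telescope
    by (intro convergent_add convergent_const)
  then show ?thesis by simp
qed

text \<open>The limit is built along a fast subsequence, but Fatou applied to the distance from each
  fixed \<open>F n\<close> transfers the Cauchy rate \<open>\<epsilon> n\<close> to the whole
  sequence.\<close>

lemma L2_complete:
  fixes F :: "nat \<Rightarrow> 'a::euclidean_space \<Rightarrow> 'b::euclidean_space"
  assumes [measurable]: "\<And>n. F n \<in> borel_measurable borel"
    and cauchy: "\<And>n l. n \<le> l \<Longrightarrow> (\<integral>\<^sup>+x. ennreal ((norm (F n x - F l x))\<^sup>2) \<partial>lborel) \<le> ennreal (\<epsilon> n)"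
    and \<epsilon>: "\<epsilon> \<longlonglongrightarrow> 0"
  obtains V where "V \<in> borel_measurable borel"
    "\<And>n. (\<integral>\<^sup>+x. ennreal ((norm (F n x - V x))\<^sup>2) \<partial>lborel) \<le> ennreal (\<epsilon> n)"
proof -
  \<comment> \<open>The rate \<open>(1/8) ^ i\<close> leaves a summable \<open>(1/2) ^ i\<close>
    after multiplication by the weight \<open>4 ^ i\<close> of
    \<open>fast_Cauchy_convergent\<close>.\<close>
  have "\<exists>n. \<forall>m\<ge>n. \<epsilon> m < (1/8) ^ i" for i :: nat
    using order_tendstoD(2)[OF \<epsilon>, of "(1/8) ^ i"] by (simp add: eventually_sequentially)
  then obtain N where N: "\<And>i m. N i \<le> m \<Longrightarrow> \<epsilon> m < (1/8) ^ i" by metis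
  define s where "s i = (\<Sum>j\<le>i. N j) + i" for i
  have sN: "N i \<le> s i" for i using member_le_sum[of i "{..i}" N] by (simp add: s_def)
  have sS: "s i \<le> s (Suc i)" for i by (simp add: s_def)
  have si: "i \<le> s i" for i by (simp add: s_def)
  have d: "(\<integral>\<^sup>+x. ennreal ((norm (F (s (Suc m)) x - F (s m) x))\<^sup>2) \<partial>lborel) \<le> ennreal ((1/8) ^ m)" for m
  proof -
    have "(\<integral>\<^sup>+x. ennreal ((norm (F (s m) x - F (s (Suc m)) x))\<^sup>2) \<partial>lborel) \<le> ennreal (\<epsilon> (s m))" by (rule cauchy[OF sS])
    also have "\<dots> \<le> ennreal ((1/8) ^ m)" using N[OF sN[of m]] by (intro ennreal_leI) simp
    finally show ?thesis by (simp add: norm_minus_commute)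
  qed
  have "(\<integral>\<^sup>+x. (\<Sum>m. ennreal (4 ^ m * (norm (F (s (Suc m)) x - F (s m) x))\<^sup>2)) \<partial>lborel) =
      (\<Sum>m. \<integral>\<^sup>+x. ennreal (4 ^ m * (norm (F (s (Suc m)) x - F (s m) x))\<^sup>2) \<partial>lborel)"
    by (rule nn_integral_suminf) measurable
  also have "\<dots> \<le> (\<Sum>m. ennreal ((1/2) ^ m))"
  proof (intro suminf_le summableI)
    fix m :: nat
    have "(\<integral>\<^sup>+x. ennreal (4 ^ m * (norm (F (s (Suc m)) x - F (s m) x))\<^sup>2) \<partial>lborel) =
      ennreal (4 ^ m) * (\<integral>\<^sup>+x. ennreal ((norm (F (s (Suc m)) x - F (s m) x))\<^sup>2) \<partial>lborel)"
      by (subst nn_integral_cmult[symmetric]) (auto simp: ennreal_mult)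
    also have "\<dots> \<le> ennreal (4 ^ m) * ennreal ((1/8) ^ m)" by (intro mult_left_mono d) simp
    also have "\<dots> = ennreal ((1/2) ^ m)" by (simp add: ennreal_mult[symmetric] power_mult_distrib[symmetric])
    finally show "(\<integral>\<^sup>+x. ennreal (4 ^ m * (norm (F (s (Suc m)) x - F (s m) x))\<^sup>2) \<partial>lborel) \<le> ennreal ((1/2) ^ m)" .
  qed
  also have "\<dots> < \<infinity>"
    using summable_geometric[of "1/2::real"] by (subst suminf_ennreal2) (auto simp: less_top)
  finally have "AE x in lborel. (\<Sum>m. ennreal (4 ^ m * (norm (F (s (Suc m)) x - F (s m) x))\<^sup>2)) \<noteq> \<infinity>"
    by (intro nn_integral_PInf_AE) (auto simp: less_top)
  then have conv: "AE x in lborel. convergent (\<lambda>m. F (s m) x)"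
    by eventually_elim (intro fast_Cauchy_convergent, simp add: less_top)
  define V where "V x = lim (\<lambda>m. F (s m) x)" for x
  have Vm [measurable]: "V \<in> borel_measurable borel" unfolding V_def[abs_def] by measurable
  have "(\<integral>\<^sup>+x. ennreal ((norm (F n x - V x))\<^sup>2) \<partial>lborel) \<le> ennreal (\<epsilon> n)" for n
  proof -
    have "AE x in lborel. ennreal ((norm (F n x - V x))\<^sup>2) \<le> liminf (\<lambda>m. ennreal ((norm (F n x - F (s m) x))\<^sup>2))"
      using conv
    proof eventually_elim
      case (elim x)
      then have "(\<lambda>m. F (s m) x) \<longlonglongrightarrow> V x" unfolding V_def by (simp add: convergent_LIMSEQ_iff)
      then have "(\<lambda>m. ennreal ((norm (F n x - F (s m) x))\<^sup>2)) \<longlonglongrightarrow> ennreal ((norm (F n x - V x))\<^sup>2)"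
        by (intro tendsto_ennrealI tendsto_intros)
      then show ?case using lim_imp_Liminf by (metis order_refl trivial_limit_sequentially)
    qed
    then have "(\<integral>\<^sup>+x. ennreal ((norm (F n x - V x))\<^sup>2) \<partial>lborel) \<le> (\<integral>\<^sup>+x. liminf (\<lambda>m. ennreal ((norm (F n x - F (s m) x))\<^sup>2)) \<partial>lborel)"
      by (rule nn_integral_mono_AE)
    also have "\<dots> \<le> liminf (\<lambda>m. \<integral>\<^sup>+x. ennreal ((norm (F n x - F (s m) x))\<^sup>2) \<partial>lborel)"
      by (rule nn_integral_liminf) measurable
    also have "\<dots> \<le> ennreal (\<epsilon> n)"
    proof -
      have "eventually (\<lambda>m. (\<integral>\<^sup>+x. ennreal ((norm (F n x - F (s m) x))\<^sup>2) \<partial>lborel) \<le> ennreal (\<epsilon> n)) sequentially"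
        by (rule eventually_sequentiallyI[of n]) (intro cauchy order_trans[OF _ si])
      then have "limsup (\<lambda>m. \<integral>\<^sup>+x. ennreal ((norm (F n x - F (s m) x))\<^sup>2) \<partial>lborel) \<le> ennreal (\<epsilon> n)"
        by (rule Limsup_bounded)
      then show ?thesis using Liminf_le_Limsup order_trans trivial_limit_sequentially by blast
    qed
    finally show ?thesis .
  qed
  then show ?thesis using that Vm by blast
qed

section \<open>The space of weakly differentiable functions\<close>

lemma AE_lborel_affine:
  fixes P :: "'a::euclidean_space \<Rightarrow> bool"
  assumes P: "AE x in lborel. P x" and c: "c \<noteq> 0"
  shows "AE x in lborel. P (t + c *\<^sub>R x)"
proof -
  obtain N where N: "\<And>x. x \<notin> N \<Longrightarrow> P x" "N \<in> null_sets lborel" using P by (rule AE_E3) auto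
  have [measurable]: "N \<in> sets borel" using N(2) by auto
  have "(\<integral>\<^sup>+x. indicator N x \<partial>lborel) = 0" using N(2) by (simp add: null_sets_def)
  then have "(\<integral>\<^sup>+x. indicator N (t + c *\<^sub>R x) \<partial>lborel) = 0"
    using nn_integral_lborel_affine[of "indicator N" c t] c by simp
  then have "AE x in lborel. indicator N (t + c *\<^sub>R x) = (0::ennreal)"
    by (subst (asm) nn_integral_0_iff_AE) auto
  then show ?thesis by eventually_elim (use N(1) in \<open>auto simp: indicator_eq_0_iff\<close>)
qed

lemma AE_lborel_reflect:
  "AE x in (lborel :: 'a::euclidean_space measure). P x \<Longrightarrow> AE y in lborel. P (x - y)"
  using AE_lborel_affine[of P "-1" x] by simp

lemma AE_lborel_translate:
  "AE x in (lborel :: 'a::euclidean_space measure). P x \<Longrightarrow> AE x in lborel. P (x - z)"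
  using AE_lborel_affine[of P 1 "- z"] by simp

lemma AE_not_in_open:
  fixes S :: "'a::euclidean_space set"
  assumes "open S" "AE x in lborel. x \<notin> S" shows "S = {}"
proof -
  have "S \<in> null_sets lborel" using assms by (subst AE_iff_null_sets) auto
  then have "negligible S" by (simp add: negligible_iff_null_sets null_sets_completionI)
  then show ?thesis using open_not_negligible[OF assms(1)] by blast
qed

lemma L2_on_UNIV_iff:
  fixes f g :: "real^'n::finite \<Rightarrow> 'b::euclidean_space"
  assumes ae: "AE x in lborel. f x = g x" and g [measurable]: "g \<in> borel_measurable borel"
  shows "L2_on UNIV f \<longleftrightarrow> (\<integral>\<^sup>+x. ennreal ((norm (g x))\<^sup>2) \<partial>lborel) < \<infinity>"
proof -
  have "AE x in lborel. (norm (f x))\<^sup>2 = (norm (g x))\<^sup>2" using ae by eventually_elim simp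
  from integrable_lebesgue_AE[OF this] show ?thesis
    unfolding L2_on_def set_borel_measurable_def set_integrable_def
    using measurable_lebesgue_AE[OF ae g] by (simp add: integrable_iff_bounded)
qed

lemma L2_tendstoI:
  fixes F :: "nat \<Rightarrow> real^'n::finite \<Rightarrow> 'b::euclidean_space"
  assumes [measurable]: "\<And>k. F k \<in> borel_measurable borel" and g [measurable]: "g \<in> borel_measurable borel"
    and ae: "AE x in lborel. f x = g x"
    and le: "\<And>k. (\<integral>\<^sup>+x. ennreal ((norm (F k x - g x))\<^sup>2) \<partial>lborel) \<le> ennreal (\<epsilon> k)" and \<epsilon>: "\<epsilon> \<longlonglongrightarrow> 0"
  shows "L2_tendsto F f"
  unfolding L2_tendsto_def
proof (intro conjI allI)
  have ae': "AE x in lborel. F k x - f x = F k x - g x" for k using ae by eventually_elim simp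
  have ae2: "AE x in lborel. (norm (F k x - f x))\<^sup>2 = (norm (F k x - g x))\<^sup>2" for k using ae by eventually_elim simp
  show "L2_on UNIV (\<lambda>x. F k x - f x)" for k
    by (subst L2_on_UNIV_iff[OF ae']) (auto intro: le_less_trans[OF le])
  have "(LINT x|lebesgue. (norm (F k x - f x))\<^sup>2) = enn2real (\<integral>\<^sup>+x. ennreal ((norm (F k x - g x))\<^sup>2) \<partial>lborel)" for k
    by (subst integral_lebesgue_AE[OF ae2], simp, subst integral_eq_nn_integral) auto
  moreover have "enn2real (\<integral>\<^sup>+x. ennreal ((norm (F k x - g x))\<^sup>2) \<partial>lborel) \<le> max 0 (\<epsilon> k)" for k
    using enn2real_mono[OF le[of k]] by (cases "0 \<le> \<epsilon> k") (auto simp: enn2real_ennreal ennreal_neg)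
  moreover have "(\<lambda>k. max 0 (\<epsilon> k)) \<longlonglongrightarrow> max 0 0" by (intro tendsto_max tendsto_const \<epsilon>)
  ultimately have "eventually (\<lambda>k. (LINT x|lebesgue. (norm (F k x - f x))\<^sup>2) \<le> max 0 (\<epsilon> k)) sequentially"
    "(\<lambda>k. max 0 (\<epsilon> k)) \<longlonglongrightarrow> 0" by auto
  then show "(\<lambda>k. LINT x|lebesgue. (norm (F k x - f x))\<^sup>2) \<longlonglongrightarrow> 0"
    by (rule tendsto_sandwich[where f="\<lambda>_. 0", rotated 1, OF _ tendsto_const]) auto
qed

lemma L2_tendstoD:
  fixes F :: "nat \<Rightarrow> real^'n::finite \<Rightarrow> 'b::euclidean_space"
  assumes L: "L2_tendsto F f" and [measurable]: "\<And>k. F k \<in> borel_measurable borel" and g [measurable]: "g \<in> borel_measurable borel"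
    and ae: "AE x in lborel. f x = g x"
  obtains a where "a \<longlonglongrightarrow> (0::real)" "\<And>k. 0 \<le> a k"
    "\<And>k. (\<integral>\<^sup>+x. ennreal ((norm (F k x - g x))\<^sup>2) \<partial>lborel) = ennreal (a k)"
proof (rule that)
  have ae2: "AE x in lborel. (norm (F k x - f x))\<^sup>2 = (norm (F k x - g x))\<^sup>2" for k using ae by eventually_elim simp
  let ?a = "\<lambda>k. LINT x|lebesgue. (norm (F k x - f x))\<^sup>2"
  show "?a \<longlonglongrightarrow> 0" using L by (simp add: L2_tendsto_def)
  show "0 \<le> ?a k" for k by simp
  have i: "integrable lebesgue (\<lambda>x. (norm (F k x - f x))\<^sup>2)" for k
    using L by (simp add: L2_tendsto_def L2_on_def set_integrable_def)
  have "integrable lborel (\<lambda>x. (norm (F k x - g x))\<^sup>2)" for k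
    using i[of k] integrable_lebesgue_AE[OF ae2[of k]] by simp
  then show "(\<integral>\<^sup>+x. ennreal ((norm (F k x - g x))\<^sup>2) \<partial>lborel) = ennreal (?a k)" for k
    by (subst integral_lebesgue_AE[OF ae2]) (auto intro!: nn_integral_eq_integral)
qed

lemma test_functions_lincomb:
  fixes \<phi> \<psi> :: "real^'n::finite \<Rightarrow> real"
  assumes "\<phi> \<in> test_functions \<Omega>" "\<psi> \<in> test_functions \<Omega>"
  shows "(\<lambda>x. a * \<phi> x + b * \<psi> x) \<in> test_functions \<Omega>"
proof -
  obtain C where C: "smooth \<phi>" "compact C" "C \<subseteq> \<Omega>" "\<And>x. x \<notin> C \<Longrightarrow> \<phi> x = 0" using assms(1) by (rule test_functionsE) blast
  obtain D where D: "smooth \<psi>" "compact D" "D \<subseteq> \<Omega>" "\<And>x. x \<notin> D \<Longrightarrow> \<psi> x = 0" using assms(2) by (rule test_functionsE) blast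
  show ?thesis
    by (rule test_functionsI[where C="C \<union> D"]) (use C D in \<open>auto intro!: smooth_add smooth_mult\<close>)
qed

context radial_kernel
begin

lemma dcomp_lincomb:
  assumes "\<phi> \<in> test_functions UNIV" "\<psi> \<in> test_functions UNIV"
  shows "dcomp j (\<lambda>x. a * \<phi> x + b * \<psi> x) x = a * dcomp j \<phi> x + b * dcomp j \<psi> x"
proof -
  have "dcomp j (\<lambda>x. a * \<phi> x + b * \<psi> x) x =
      (LINT z|lborel. a * ((\<phi> x - \<phi> (x - z)) * vkernel j z) + b * ((\<psi> x - \<psi> (x - z)) * vkernel j z))"
    unfolding dcomp_def by (intro Bochner_Integration.integral_cong refl) (simp add: algebra_simps)
  then show ?thesis
    using dcomp_integrand_integrable[OF assms(1)] dcomp_integrand_integrable[OF assms(2)] by (simp add: dcomp_def)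
qed

section \<open>Gradient energy and membership in the closure\<close>

definition grad_energy :: "(real^'n \<Rightarrow> real) \<Rightarrow> real"
  where "grad_energy \<phi> = (LINT x|lborel. (\<Sum>j\<in>UNIV. (dcomp j \<phi> x)\<^sup>2))"

lemma grad_integrable:
  assumes "\<phi> \<in> test_functions UNIV" shows "integrable lborel (\<lambda>x. \<Sum>j\<in>UNIV. (dcomp j \<phi> x)\<^sup>2)"
proof (rule Bochner_Integration.integrable_sum)
  fix j
  obtain B where B: "\<And>x. \<bar>dcomp j \<phi> x\<bar> \<le> B" using dcomp_bounded[OF assms] by blast
  note [measurable] = measurable_dcomp[OF assms]
  show "integrable lborel (\<lambda>x. (dcomp j \<phi> x)\<^sup>2)"
  proof (rule Bochner_Integration.integrable_bound[where f="\<lambda>x. B * \<bar>dcomp j \<phi> x\<bar>"])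
    show "integrable lborel (\<lambda>x. B * \<bar>dcomp j \<phi> x\<bar>)" using integrable_dcomp[OF assms] by simp
    show "AE x in lborel. norm ((dcomp j \<phi> x)\<^sup>2) \<le> norm (B * \<bar>dcomp j \<phi> x\<bar>)"
    proof (rule AE_I2)
      fix x
      have "\<bar>dcomp j \<phi> x\<bar> * \<bar>dcomp j \<phi> x\<bar> \<le> \<bar>B\<bar> * \<bar>dcomp j \<phi> x\<bar>"
        using B[of x] by (intro mult_right_mono) auto
      then show "norm ((dcomp j \<phi> x)\<^sup>2) \<le> norm (B * \<bar>dcomp j \<phi> x\<bar>)"
        by (simp add: power2_eq_square abs_mult)
    qed
  qed measurable
qed

lemma nn_integral_grad:
  assumes "\<phi> \<in> test_functions UNIV"
  shows "(\<integral>\<^sup>+x. ennreal (\<Sum>j\<in>UNIV. (dcomp j \<phi> x)\<^sup>2) \<partial>lborel) = ennreal (grad_energy \<phi>)"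
  unfolding grad_energy_def by (rule nn_integral_eq_integral[OF grad_integrable[OF assms]]) (intro AE_I2 sum_nonneg zero_le_power2)

lemma grad_energy_nonneg: "0 \<le> grad_energy \<phi>"
  unfolding grad_energy_def by (intro integral_nonneg_AE AE_I2 sum_nonneg zero_le_power2)

lemma grad_energy_parallelogram:
  assumes t: "\<phi> \<in> test_functions UNIV" "\<psi> \<in> test_functions UNIV"
  shows "grad_energy (\<lambda>x. 1 * \<phi> x + (-1) * \<psi> x) =
    2 * grad_energy \<phi> + 2 * grad_energy \<psi> - 4 * grad_energy (\<lambda>x. (1/2) * \<phi> x + (1/2) * \<psi> x)"
proof -
  have "(\<Sum>j\<in>UNIV. (dcomp j (\<lambda>x. 1 * \<phi> x + (-1) * \<psi> x) x)\<^sup>2) =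
     2 * (\<Sum>j\<in>UNIV. (dcomp j \<phi> x)\<^sup>2) + 2 * (\<Sum>j\<in>UNIV. (dcomp j \<psi> x)\<^sup>2) -
     4 * (\<Sum>j\<in>UNIV. (dcomp j (\<lambda>x. (1/2) * \<phi> x + (1/2) * \<psi> x) x)\<^sup>2)" for x
    unfolding dcomp_lincomb[OF t] sum_distrib_left sum.distrib[symmetric] sum_subtractf[symmetric]
    by (intro sum.cong refl) (simp add: power2_eq_square field_simps)
  then show ?thesis
    unfolding grad_energy_def
    using grad_integrable[OF t(1)] grad_integrable[OF t(2)] grad_integrable[OF test_functions_lincomb[OF t, of "1/2" "1/2"]]
    by simp
qed

text \<open>Functions of nearly minimal gradient energy in small \<open>L\<^sup>2\<close>-balls around \<open>w\<close>
  have gradients that form a Cauchy sequence, by the parallelogram law.\<close>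

lemma gradient_closure:
  assumes [measurable]: "w \<in> borel_measurable borel"
    and approx: "\<And>n::nat. \<exists>\<phi>\<in>test_functions UNIV.
      (\<integral>\<^sup>+x. ennreal ((\<phi> x - w x)\<^sup>2) \<partial>lborel) \<le> ennreal (inverse (real (Suc n))) \<and> grad_energy \<phi> \<le> C"
  obtains \<omega> V \<epsilon> where "\<And>n. \<omega> n \<in> test_functions UNIV"
    "\<And>n::nat. (\<integral>\<^sup>+x. ennreal ((\<omega> n x - w x)\<^sup>2) \<partial>lborel) \<le> ennreal (inverse (real (Suc n)))"
    "V \<in> borel_measurable borel" "\<epsilon> \<longlonglongrightarrow> 0"
    "\<And>n. (\<integral>\<^sup>+x. ennreal ((norm ((\<chi> j. dcomp j (\<omega> n) x) - V x))\<^sup>2) \<partial>lborel) \<le> ennreal (\<epsilon> n)"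
proof -
  let ?i = "\<lambda>n. inverse (real (Suc n))"
  define S where "S n = {\<phi> \<in> test_functions UNIV. (\<integral>\<^sup>+x. ennreal ((\<phi> x - w x)\<^sup>2) \<partial>lborel) \<le> ennreal (?i n)}" for n :: nat
  have i_mono: "?i l \<le> ?i n" if "n \<le> l" for n l using that by (intro le_imp_inverse_le) auto
  have S_mono: "S l \<subseteq> S n" if "n \<le> l" for n l
    using order_trans[OF _ ennreal_leI[OF i_mono[OF that]]] by (auto simp: S_def)
  define d where "d n = Inf (grad_energy ` S n)" for n
  have ne: "grad_energy ` S n \<noteq> {}" for n using approx[of n] by (auto simp: S_def)
  have bdd: "bdd_below (grad_energy ` S n)" for n using grad_energy_nonneg by (auto simp: bdd_below_def)
  have dC: "d n \<le> C" for n
  proof -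
    obtain \<phi> where "\<phi> \<in> S n" "grad_energy \<phi> \<le> C" using approx[of n] by (auto simp: S_def)
    then show ?thesis using cInf_lower[OF imageI bdd, of \<phi> n] by (simp add: d_def)
  qed
  \<comment> \<open>The balls shrink, so their infima increase. The common bound \<open>C\<close>
    makes these converge.\<close>
  have dm: "incseq d" unfolding incseq_def d_def by (intro allI impI cInf_superset_mono[OF ne bdd image_mono[OF S_mono]])
  obtain D where D: "d \<longlonglongrightarrow> D" "\<And>n. d n \<le> D" using incseq_convergent[OF dm, of C] dC by auto
  have "\<exists>\<phi>\<in>S n. grad_energy \<phi> < d n + ?i n" for n
    using cInf_lessD[OF ne, of n "d n + ?i n"] by (simp add: d_def[symmetric] del: of_nat_Suc)
  then obtain \<omega> where \<omega>: "\<And>n. \<omega> n \<in> S n" "\<And>n. grad_energy (\<omega> n) < d n + ?i n" by metis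
  have t: "\<omega> n \<in> test_functions UNIV" for n using \<omega>(1)[of n] by (simp add: S_def)
  have [measurable]: "\<omega> n \<in> borel_measurable borel" for n by (rule smooth_borel_measurable[OF test_functions_smooth[OF t]])
  note [measurable] = measurable_dcomp[OF t]
  \<comment> \<open>The parallelogram law gives \<open>2 * E n + 2 * E l - 4 * E mid\<close> for the
    energy of the difference; insert \<open>E n < d n + ?i n\<close>, \<open>E l < D + ?i n\<close>
    and \<open>E mid \<ge> d n\<close>.\<close>
  define \<epsilon> where "\<epsilon> n = 2 * (D - d n) + 4 * ?i n" for n
  have "(\<lambda>n. 2 * (D - d n) + 4 * ?i n) \<longlonglongrightarrow> 2 * (D - D) + 4 * 0"
    by (intro tendsto_add tendsto_mult tendsto_diff tendsto_const D(1) LIMSEQ_inverse_real_of_nat)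
  then have \<epsilon>0: "\<epsilon> \<longlonglongrightarrow> 0" by (simp add: \<epsilon>_def[abs_def])
  define F where "F n x = (\<chi> j. dcomp j (\<omega> n) x)" for n x
  have Fm [measurable]: "F n \<in> borel_measurable borel" for n
    unfolding F_def[abs_def]
    by (intro borel_measurable_continuous_onI continuous_on_vec_lambda continuous_dcomp t)
  have half: "ennreal (1/2) * ennreal a + ennreal (1/2) * ennreal a = ennreal a" if a: "0 \<le> a" for a
  proof -
    have h: "ennreal (1/2) * ennreal a = ennreal (a/2)" using ennreal_mult[of "1/2" a] a by simp
    show ?thesis unfolding h using ennreal_plus[of "a/2" "a/2", symmetric] a by (simp del: ennreal_plus)
  qed
  have cauchy: "(\<integral>\<^sup>+x. ennreal ((norm (F n x - F l x))\<^sup>2) \<partial>lborel) \<le> ennreal (\<epsilon> n)" if nl: "n \<le> l" for n l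
  proof -
    let ?diff = "\<lambda>x. 1 * \<omega> n x + (-1) * \<omega> l x" and ?mid = "\<lambda>x. (1/2) * \<omega> n x + (1/2) * \<omega> l x"
    have td: "?diff \<in> test_functions UNIV" by (rule test_functions_lincomb[OF t t])
    have tm: "?mid \<in> test_functions UNIV" by (rule test_functions_lincomb[OF t t])
    \<comment> \<open>Convexity of the square keeps the midpoint in the ball of index
      \<open>n\<close>, so \<open>d n\<close> bounds its energy from below.\<close>
    have "(\<integral>\<^sup>+x. ennreal ((?mid x - w x)\<^sup>2) \<partial>lborel) \<le>
        (\<integral>\<^sup>+x. ennreal (1/2) * ennreal ((\<omega> n x - w x)\<^sup>2) + ennreal (1/2) * ennreal ((\<omega> l x - w x)\<^sup>2) \<partial>lborel)"
    proof (intro nn_integral_mono)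
      fix x
      have "(?mid x - w x)\<^sup>2 \<le> (1/2) * (\<omega> n x - w x)\<^sup>2 + (1/2) * (\<omega> l x - w x)\<^sup>2"
        using zero_le_power2[of "\<omega> n x - \<omega> l x"] by (simp add: power2_eq_square field_simps)
      then show "ennreal ((?mid x - w x)\<^sup>2) \<le> ennreal (1/2) * ennreal ((\<omega> n x - w x)\<^sup>2) + ennreal (1/2) * ennreal ((\<omega> l x - w x)\<^sup>2)"
        by (subst (1 2) ennreal_mult[symmetric], simp_all del: ennreal_plus add: ennreal_plus[symmetric] ennreal_leI)
    qed
    also have "\<dots> = ennreal (1/2) * (\<integral>\<^sup>+x. ennreal ((\<omega> n x - w x)\<^sup>2) \<partial>lborel) + ennreal (1/2) * (\<integral>\<^sup>+x. ennreal ((\<omega> l x - w x)\<^sup>2) \<partial>lborel)"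
      by (subst nn_integral_add) (auto simp: nn_integral_cmult)
    also have "\<dots> \<le> ennreal (1/2) * ennreal (?i n) + ennreal (1/2) * ennreal (?i n)"
      using \<omega>(1)[of n] S_mono[OF nl] \<omega>(1)[of l] by (intro add_mono mult_left_mono) (auto simp: S_def)
    also have "\<dots> = ennreal (?i n)" by (rule half) simp
    finally have "?mid \<in> S n" using tm by (simp add: S_def)
    then have dmid: "d n \<le> grad_energy ?mid" unfolding d_def by (intro cInf_lower bdd) auto
    have "grad_energy ?diff \<le> \<epsilon> n"
      using grad_energy_parallelogram[OF t t, of n l] dmid \<omega>(2)[of n] \<omega>(2)[of l] D(2)[of l] i_mono[OF nl]
      unfolding \<epsilon>_def by argo
    moreover have "(norm (F n x - F l x))\<^sup>2 = (\<Sum>j\<in>UNIV. (dcomp j ?diff x)\<^sup>2)" for x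
      unfolding dcomp_lincomb[OF t t] norm_vec_def L2_set_def F_def by (simp add: sum_nonneg)
    ultimately show ?thesis by (simp only: nn_integral_grad[OF td]) (intro ennreal_leI)
  qed
  obtain V where "V \<in> borel_measurable borel" "\<And>n. (\<integral>\<^sup>+x. ennreal ((norm (F n x - V x))\<^sup>2) \<partial>lborel) \<le> ennreal (\<epsilon> n)"
    by (rule L2_complete[OF Fm cauchy \<epsilon>0]) auto
  then show ?thesis using t \<omega>(1) \<epsilon>0 by (intro that[of \<omega> V \<epsilon>]) (auto simp: S_def F_def)
qed

text \<open>This takes the place of a weak compactness argument: a uniform bound on the gradient
  energies of L2 approximants is enough, since \<open>gradient_closure\<close> supplies another
  sequence whose gradients converge strongly.\<close>

lemma H_rho_memI:
  assumes ae_\<rho>: "AE x in lborel. \<rho> x = r x" and ae: "AE x in lborel. w' x = w x" and w [measurable]: "w \<in> borel_measurable borel"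
    and L2: "(\<integral>\<^sup>+x. ennreal ((w x)\<^sup>2) \<partial>lborel) < \<infinity>"
    and approx: "\<And>n::nat. \<exists>\<phi>\<in>test_functions UNIV.
      (\<integral>\<^sup>+x. ennreal ((\<phi> x - w x)\<^sup>2) \<partial>lborel) \<le> ennreal (inverse (real (Suc n))) \<and> grad_energy \<phi> \<le> C"
  shows "w' \<in> H_rho \<rho>"
proof -
  obtain \<omega> V \<epsilon> where \<omega>: "\<And>n. \<omega> n \<in> test_functions UNIV"
    "\<And>n::nat. (\<integral>\<^sup>+x. ennreal ((\<omega> n x - w x)\<^sup>2) \<partial>lborel) \<le> ennreal (inverse (real (Suc n)))"
    and V [measurable]: "V \<in> borel_measurable borel" and \<epsilon>: "\<epsilon> \<longlonglongrightarrow> 0"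
    and conv: "\<And>n. (\<integral>\<^sup>+x. ennreal ((norm ((\<chi> j. dcomp j (\<omega> n) x) - V x))\<^sup>2) \<partial>lborel) \<le> ennreal (\<epsilon> n)"
    by (rule gradient_closure[OF w approx]) blast
  have [measurable]: "\<omega> n \<in> borel_measurable borel" for n by (rule smooth_borel_measurable[OF test_functions_smooth[OF \<omega>(1)]])
  have D: "D_rho \<rho> (\<omega> n) = (\<lambda>x. \<chi> j. dcomp j (\<omega> n) x)" for n
    using D_rho_eq_dcomp[OF ae_\<rho> \<omega>(1)] by blast
  have Dm [measurable]: "(\<lambda>x. \<chi> j. dcomp j (\<omega> n) x) \<in> borel_measurable borel" for n
    by (intro borel_measurable_continuous_onI continuous_on_vec_lambda continuous_dcomp \<omega>)
  have "has_D_rho \<rho> w' V"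
    unfolding has_D_rho_def
  proof (intro conjI exI allI)
    show "L2_on UNIV w'" using L2 by (subst L2_on_UNIV_iff[OF ae w]) simp
    show "L2_on UNIV V"
    proof (subst L2_on_UNIV_iff[where g=V])
      let ?D = "\<lambda>x. \<chi> j. dcomp j (\<omega> 0) x"
      have "(\<integral>\<^sup>+x. ennreal ((norm (V x))\<^sup>2) \<partial>lborel) \<le> (\<integral>\<^sup>+x. 2 * ennreal ((norm (?D x))\<^sup>2) + 2 * ennreal ((norm (?D x - V x))\<^sup>2) \<partial>lborel)"
      proof (intro nn_integral_mono)
        fix x
        have "(norm (V x))\<^sup>2 \<le> 2 * (norm (?D x))\<^sup>2 + 2 * (norm (?D x - V x))\<^sup>2"
          using sq_norm_add_le[of "?D x" "V x - ?D x"] by (simp add: norm_minus_commute)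
        then have "ennreal ((norm (V x))\<^sup>2) \<le> ennreal (2 * (norm (?D x))\<^sup>2 + 2 * (norm (?D x - V x))\<^sup>2)" by (rule ennreal_leI)
        then show "ennreal ((norm (V x))\<^sup>2) \<le> 2 * ennreal ((norm (?D x))\<^sup>2) + 2 * ennreal ((norm (?D x - V x))\<^sup>2)"
          by (simp add: ennreal_plus ennreal_mult)
      qed
      also have "\<dots> = 2 * (\<integral>\<^sup>+x. ennreal ((norm (?D x))\<^sup>2) \<partial>lborel) + 2 * (\<integral>\<^sup>+x. ennreal ((norm (?D x - V x))\<^sup>2) \<partial>lborel)"
        by (subst nn_integral_add) (auto simp: nn_integral_cmult)
      also have "(\<integral>\<^sup>+x. ennreal ((norm (?D x))\<^sup>2) \<partial>lborel) = ennreal (grad_energy (\<omega> 0))"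
        unfolding nn_integral_grad[OF \<omega>(1), symmetric] norm_vec_def L2_set_def by (simp add: sum_nonneg)
      also have "2 * ennreal (grad_energy (\<omega> 0)) + 2 * (\<integral>\<^sup>+x. ennreal ((norm (?D x - V x))\<^sup>2) \<partial>lborel) < \<infinity>"
        using le_less_trans[OF conv[of 0], of top] by (simp add: ennreal_mult_less_top)
      finally show "(\<integral>\<^sup>+x. ennreal ((norm (V x))\<^sup>2) \<partial>lborel) < \<infinity>" .
    qed auto
    show "\<omega> n \<in> test_functions UNIV" for n by (rule \<omega>)
    show "L2_tendsto \<omega> w'"
      by (rule L2_tendstoI[OF _ w ae _ LIMSEQ_inverse_real_of_nat]) (use \<omega>(2) in auto)
    show "L2_tendsto (\<lambda>k. D_rho \<rho> (\<omega> k)) V"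
      unfolding D by (rule L2_tendstoI[OF Dm V _ conv \<epsilon>]) simp
  qed
  then show ?thesis by (auto simp: H_rho_def)
qed

text \<open>Convergence of the gradients in L2 bounds their energies, with \<open>2 * B\<close> plus
  twice the squared norm of the limit \<open>V\<close> as a common bound.\<close>

lemma H_rho_approx:
  assumes ae_\<rho>: "AE x in lborel. \<rho> x = r x" and u: "u \<in> H_rho \<rho>"
    and ae: "AE x in lborel. u x = ub x" and ub [measurable]: "ub \<in> borel_measurable borel"
  obtains \<phi> C a where "\<And>n. \<phi> n \<in> test_functions UNIV" "\<And>n. grad_energy (\<phi> n) \<le> C" "a \<longlonglongrightarrow> (0::real)" "\<And>n. 0 \<le> a n"
    "\<And>n::nat. (\<integral>\<^sup>+x. ennreal ((\<phi> n x - ub x)\<^sup>2) \<partial>lborel) = ennreal (a n)"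
proof -
  obtain V \<phi> where V: "L2_on UNIV V" and t: "\<And>n. \<phi> n \<in> test_functions UNIV" and L: "L2_tendsto \<phi> u" "L2_tendsto (\<lambda>k. D_rho \<rho> (\<phi> k)) V"
    using u by (auto simp: H_rho_def has_D_rho_def)
  have [measurable]: "\<phi> n \<in> borel_measurable borel" for n by (rule smooth_borel_measurable[OF test_functions_smooth[OF t]])
  obtain a where a: "a \<longlonglongrightarrow> (0::real)" "\<And>n. 0 \<le> a n" "\<And>n::nat. (\<integral>\<^sup>+x. ennreal ((norm (\<phi> n x - ub x))\<^sup>2) \<partial>lborel) = ennreal (a n)"
    by (rule L2_tendstoD[OF L(1) _ ub ae]) auto
  have D: "D_rho \<rho> (\<phi> n) = (\<lambda>x. \<chi> j. dcomp j (\<phi> n) x)" for n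
    using D_rho_eq_dcomp[OF ae_\<rho> t] by blast
  let ?b = "\<lambda>n. LINT x|lebesgue. (norm (D_rho \<rho> (\<phi> n) x - V x))\<^sup>2"
  have "?b \<longlonglongrightarrow> 0" using L(2) by (simp add: L2_tendsto_def)
  then have "Bseq ?b" by (rule convergent_imp_Bseq[OF convergentI])
  then obtain B where "\<forall>n. norm (?b n) \<le> B" by (rule BseqE) blast
  then have B: "?b n \<le> B" for n using order_trans[OF abs_ge_self, of "?b n"] by simp
  have iV: "integrable lebesgue (\<lambda>x. (norm (V x))\<^sup>2)" using V by (simp add: L2_on_def set_integrable_def)
  have iD: "integrable lebesgue (\<lambda>x. (norm (D_rho \<rho> (\<phi> n) x - V x))\<^sup>2)" for n
    using L(2) by (simp add: L2_tendsto_def L2_on_def set_integrable_def)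
  have g: "grad_energy (\<phi> n) \<le> 2 * B + 2 * (LINT x|lebesgue. (norm (V x))\<^sup>2)" for n
  proof -
    note [measurable] = measurable_dcomp[OF t]
    have sq: "(norm (D_rho \<rho> (\<phi> n) x))\<^sup>2 = (\<Sum>j\<in>UNIV. (dcomp j (\<phi> n) x)\<^sup>2)" for x
      unfolding D norm_vec_def L2_set_def by (simp add: sum_nonneg)
    have "integrable lebesgue (\<lambda>x. \<Sum>j\<in>UNIV. (dcomp j (\<phi> n) x)\<^sup>2)"
      using grad_integrable[OF t] by (subst integrable_completion) auto
    moreover have "grad_energy (\<phi> n) = (LINT x|lebesgue. (norm (D_rho \<rho> (\<phi> n) x))\<^sup>2)"
      unfolding sq grad_energy_def by (rule integral_completion[symmetric]) measurable
    moreover have "(LINT x|lebesgue. (norm (D_rho \<rho> (\<phi> n) x))\<^sup>2) \<le> (LINT x|lebesgue. 2 * (norm (D_rho \<rho> (\<phi> n) x - V x))\<^sup>2 + 2 * (norm (V x))\<^sup>2)"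
    proof (rule integral_mono_AE)
      show "AE x in lebesgue. (norm (D_rho \<rho> (\<phi> n) x))\<^sup>2 \<le> 2 * (norm (D_rho \<rho> (\<phi> n) x - V x))\<^sup>2 + 2 * (norm (V x))\<^sup>2"
        using sq_norm_add_le[of "D_rho \<rho> (\<phi> n) x - V x" "V x" for x] by (intro AE_I2) simp
    qed (use iV iD calculation(1) in \<open>auto simp: sq\<close>)
    moreover have "\<dots> = 2 * ?b n + 2 * (LINT x|lebesgue. (norm (V x))\<^sup>2)" using iV iD by simp
    ultimately show ?thesis using B[of n] by linarith
  qed
  show ?thesis by (rule that[OF t g a(1,2)]) (use a(3) in simp)
qed

end

text \<open>Half of a smoothed \<open>\<bar>t\<bar> - t\<close>, that is, of twice the negative
  part. Subtracting \<open>\<delta>\<close> gives the value \<open>0\<close> at \<open>0\<close>, so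
  that composition preserves compact supports.\<close>

definition smooth_neg :: "real \<Rightarrow> real \<Rightarrow> real" where "smooth_neg \<delta> t = (1/2) * (sqrt (t * t + \<delta>\<^sup>2) - \<delta> - t)"

lemma smooth_neg_zero: "\<delta> > 0 \<Longrightarrow> smooth_neg \<delta> 0 = 0" by (simp add: smooth_neg_def)

lemma smooth_neg_lipschitz: "\<bar>smooth_neg \<delta> s - smooth_neg \<delta> t\<bar> \<le> \<bar>s - t\<bar>"
proof -
  \<comment> \<open>Reverse triangle inequality for the complex numbers with real parts
    \<open>s\<close> and \<open>t\<close> and common imaginary part \<open>\<delta>\<close>.\<close>
  have "\<bar>sqrt (s * s + \<delta>\<^sup>2) - sqrt (t * t + \<delta>\<^sup>2)\<bar> \<le> \<bar>s - t\<bar>"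
    using norm_triangle_ineq3[of "Complex s \<delta>" "Complex t \<delta>"] by (simp add: cmod_def power2_eq_square)
  moreover have "\<bar>(1/2) * (p - \<delta> - s) - (1/2) * (q - \<delta> - t)\<bar> \<le> \<bar>s - t\<bar>" if "\<bar>p - q\<bar> \<le> \<bar>s - t\<bar>" for p q :: real
    using that unfolding abs_if by (auto split: if_splits simp: field_simps)
  ultimately show ?thesis unfolding smooth_neg_def by blast
qed

lemma smooth_neg_approx: "\<delta> > 0 \<Longrightarrow> \<bar>smooth_neg \<delta> t - max 0 (- t)\<bar> \<le> \<delta>"
proof -
  assume \<delta>: "\<delta> > 0"
  have "\<bar>t\<bar> \<le> sqrt (t * t + \<delta>\<^sup>2)" by (intro real_le_rsqrt) (simp add: power2_eq_square)
  moreover have "sqrt (t * t + \<delta>\<^sup>2) \<le> \<bar>t\<bar> + \<delta>"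
    using \<delta> by (intro real_le_lsqrt) (auto simp: power2_eq_square algebra_simps)
  moreover have eq: "max 0 (- t) = (\<bar>t\<bar> - t) / 2" by (simp add: max_def)
  ultimately show ?thesis using \<delta> unfolding smooth_neg_def eq by (intro abs_leI) (simp_all add: field_simps)
qed

lemma smooth_neg_test:
  assumes "\<phi> \<in> test_functions \<Omega>" "\<delta> > 0"
  shows "(\<lambda>x. smooth_neg \<delta> (\<phi> x)) \<in> test_functions \<Omega>"
proof (rule test_functions_comp[OF assms(1)])
  have "\<phi> x * \<phi> x + \<delta>\<^sup>2 > 0" for x using assms(2) by (simp add: add_nonneg_pos)
  then show "smooth (\<lambda>x. smooth_neg \<delta> (\<phi> x))"
    unfolding smooth_neg_def
    by (intro smooth_mult smooth_const smooth_diff smooth_sqrt smooth_add test_functions_smooth[OF assms(1)]) auto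
qed (simp add: smooth_neg_zero assms)

section \<open>The negative part and functions of vanishing energy\<close>

context levy_kernel
begin

lemma energy_grad_energy:
  assumes "\<phi> \<in> test_functions UNIV" shows "energy \<phi> = ennreal (2 * grad_energy \<phi>)"
  using energy_test_function[OF assms] grad_energy_nonneg[of \<phi>]
  by (simp add: grad_sq_def nn_integral_grad[OF assms] ennreal_mult)

text \<open>The gradient involves signed cancellations, so its energy shows no direct monotonicity
  under truncation. The detour through \<open>energy\<close>, whose density is nonnegative, bounds
  the gradient energy of \<open>smooth_neg \<delta> (\<phi> m)\<close> by that of
  \<open>\<phi> m\<close>.\<close>

lemma neg_part_H_rho:
  assumes ae_\<rho>: "AE x in lborel. \<rho> x = r x" and u: "u \<in> H_rho \<rho>"
    and ae: "AE x in lborel. u x = ub x" and ub [measurable]: "ub \<in> borel_measurable borel"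
  shows "(\<lambda>x. max 0 (- u x)) \<in> H_rho \<rho>"
proof -
  obtain \<phi> C a where t: "\<And>n. \<phi> n \<in> test_functions UNIV" and C: "\<And>n. grad_energy (\<phi> n) \<le> C"
    and a: "a \<longlonglongrightarrow> (0::real)" "\<And>n. 0 \<le> a n"
    and conv: "\<And>n::nat. (\<integral>\<^sup>+x. ennreal ((\<phi> n x - ub x)\<^sup>2) \<partial>lborel) = ennreal (a n)"
    by (rule H_rho_approx[OF ae_\<rho> u ae ub]) blast
  have [measurable]: "\<phi> n \<in> borel_measurable borel" for n by (rule smooth_borel_measurable[OF test_functions_smooth[OF t]])
  let ?w = "\<lambda>x. max 0 (- ub x)"
  show ?thesis
  proof (rule H_rho_memI[OF ae_\<rho>, where w="?w" and C=C])
    show "AE x in lborel. max 0 (- u x) = ?w x" using ae by eventually_elim simp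
    show "?w \<in> borel_measurable borel" by measurable
    have "(\<integral>\<^sup>+x. ennreal ((?w x)\<^sup>2) \<partial>lborel) \<le> (\<integral>\<^sup>+x. ennreal ((norm (ub x))\<^sup>2) \<partial>lborel)"
      by (intro nn_integral_mono ennreal_leI) (simp add: max_def)
    also have "\<dots> < \<infinity>" using u L2_on_UNIV_iff[OF ae ub] by (auto simp: H_rho_def has_D_rho_def)
    finally show "(\<integral>\<^sup>+x. ennreal ((?w x)\<^sup>2) \<partial>lborel) < \<infinity>" .
    fix n :: nat
    define i where "i = inverse (real (Suc n))"
    have i: "i > 0" by (simp add: i_def)
    have "eventually (\<lambda>m. a m < i / 4) sequentially" using order_tendstoD(2)[OF a(1), of "i / 4"] i by simp
    then obtain m where m: "a m < i / 4" by (auto simp: eventually_sequentially)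
    obtain S where S: "compact S" "\<And>x. x \<notin> S \<Longrightarrow> \<phi> m x = 0" using t[of m] by (rule test_functionsE) blast
    have [measurable]: "S \<in> sets borel" using S(1) by (simp add: borel_compact)
    define M where "M = measure lborel S"
    have M: "emeasure lborel S = ennreal M" "0 \<le> M"
      using emeasure_compact_finite[OF S(1)] by (auto simp: M_def emeasure_eq_ennreal_measure)
    \<comment> \<open>The smoothing error lives on \<open>S\<close>, so its square integrates to at
      most \<open>\<delta>^2 * M\<close>, here at most \<open>i / 4\<close>. Together with
      \<open>a m < i / 4\<close> and the two factors \<open>2\<close> the total is at most
      \<open>i\<close>. The \<open>+ 1\<close> avoids division by zero when
      \<open>M = 0\<close>.\<close>
    define \<delta> where "\<delta> = sqrt (i / (4 * (M + 1)))"
    have \<delta>: "\<delta> > 0" "\<delta>\<^sup>2 * M \<le> i / 4" using i M(2) by (auto simp: \<delta>_def field_simps)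
    define \<psi> where "\<psi> x = smooth_neg \<delta> (\<phi> m x)" for x
    have \<psi>: "\<psi> \<in> test_functions UNIV" unfolding \<psi>_def[abs_def] by (rule smooth_neg_test[OF t \<delta>(1)])
    have [measurable]: "\<psi> \<in> borel_measurable borel" by (rule smooth_borel_measurable[OF test_functions_smooth[OF \<psi>]])
    have "energy \<psi> \<le> energy (\<phi> m)" by (rule energy_contraction) (simp add: \<psi>_def smooth_neg_lipschitz)
    then have "grad_energy \<psi> \<le> grad_energy (\<phi> m)"
      using grad_energy_nonneg[of "\<phi> m"] by (simp add: energy_grad_energy[OF \<psi>] energy_grad_energy[OF t] ennreal_le_iff)
    then have g: "grad_energy \<psi> \<le> C" using C[of m] by simp
    have sum_sq: "(p + q)\<^sup>2 \<le> 2 * p\<^sup>2 + 2 * q\<^sup>2" for p q :: real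
      using zero_le_power2[of "p - q"] by (simp add: power2_sum power2_diff)
    have sq: "(\<psi> x - ?w x)\<^sup>2 \<le> 2 * (\<phi> m x - ub x)\<^sup>2 + 2 * (\<delta>\<^sup>2 * indicator S x)" for x
    proof -
      have "\<bar>\<psi> x - max 0 (- \<phi> m x)\<bar> \<le> \<delta> * indicator S x"
        using smooth_neg_approx[OF \<delta>(1), of "\<phi> m x"] S(2)[of x] smooth_neg_zero[OF \<delta>(1)] by (cases "x \<in> S") (auto simp: \<psi>_def)
      moreover have "\<bar>max 0 (- \<phi> m x) - ?w x\<bar> \<le> \<bar>\<phi> m x - ub x\<bar>" by (auto simp: max_def)
      ultimately have "\<bar>\<psi> x - ?w x\<bar> \<le> \<bar>\<phi> m x - ub x\<bar> + \<delta> * indicator S x" by linarith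
      then have "(\<psi> x - ?w x)\<^sup>2 \<le> (\<bar>\<phi> m x - ub x\<bar> + \<delta> * indicator S x)\<^sup>2" using abs_le_square_iff \<delta>(1) by fastforce
      also have "\<dots> \<le> 2 * \<bar>\<phi> m x - ub x\<bar>\<^sup>2 + 2 * (\<delta> * indicator S x)\<^sup>2"
        by (rule sum_sq)
      finally show ?thesis by (cases "x \<in> S") simp_all
    qed
    have "(\<integral>\<^sup>+x. ennreal ((\<psi> x - ?w x)\<^sup>2) \<partial>lborel) \<le>
        (\<integral>\<^sup>+x. 2 * ennreal ((\<phi> m x - ub x)\<^sup>2) + 2 * (ennreal (\<delta>\<^sup>2) * indicator S x) \<partial>lborel)"
    proof (intro nn_integral_mono)
      fix x
      show "ennreal ((\<psi> x - ?w x)\<^sup>2) \<le> 2 * ennreal ((\<phi> m x - ub x)\<^sup>2) + 2 * (ennreal (\<delta>\<^sup>2) * indicator S x)"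
        using ennreal_leI[OF sq[of x]] by (simp add: ennreal_plus ennreal_mult ennreal_indicator)
    qed
    also have "\<dots> = 2 * ennreal (a m) + 2 * (ennreal (\<delta>\<^sup>2) * ennreal M)"
      by (subst nn_integral_add) (auto simp: nn_integral_cmult nn_integral_cmult_indicator conv M(1))
    also have "\<dots> = ennreal (2 * a m + 2 * (\<delta>\<^sup>2 * M))"
      using a(2)[of m] M(2) by (simp add: ennreal_plus ennreal_mult)
    also have "\<dots> \<le> ennreal i" using m \<delta>(2) by (intro ennreal_leI) linarith
    finally show "\<exists>\<psi>\<in>test_functions UNIV. (\<integral>\<^sup>+x. ennreal ((\<psi> x - ?w x)\<^sup>2) \<partial>lborel) \<le> ennreal (inverse (real (Suc n))) \<and> grad_energy \<psi> \<le> C"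
      using \<psi> g by (auto simp: i_def)
  qed
qed

text \<open>A subsequence of the approximants converges almost everywhere, and lower semicontinuity
  carries their common energy bound over. Finiteness is what makes the bilinear form of
  \<open>u\<close> with its negative part an absolutely convergent integral.\<close>

lemma H_rho_energy_finite:
  assumes ae_\<rho>: "AE x in lborel. \<rho> x = r x" and u: "u \<in> H_rho \<rho>"
    and ae: "AE x in lborel. u x = ub x" and ub [measurable]: "ub \<in> borel_measurable borel"
  shows "energy ub < \<infinity>"
proof -
  obtain \<phi> C a where t: "\<And>n. \<phi> n \<in> test_functions UNIV" and C: "\<And>n. grad_energy (\<phi> n) \<le> C"
    and a: "a \<longlonglongrightarrow> (0::real)" "\<And>n. 0 \<le> a n"
    and conv: "\<And>n::nat. (\<integral>\<^sup>+x. ennreal ((\<phi> n x - ub x)\<^sup>2) \<partial>lborel) = ennreal (a n)"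
    by (rule H_rho_approx[OF ae_\<rho> u ae ub]) blast
  have [measurable]: "\<phi> n \<in> borel_measurable borel" for n by (rule smooth_borel_measurable[OF test_functions_smooth[OF t]])
  have i: "integrable lborel (\<lambda>x. (\<phi> n x - ub x)\<^sup>2)" for n
    by (rule integrableI_bounded) (simp_all add: conv)
  have "(LINT x|lborel. norm ((\<phi> n x - ub x)\<^sup>2)) = a n" for n
    using a(2)[of n] by (subst integral_eq_nn_integral) (simp_all add: conv)
  then have "(\<lambda>n. LINT x|lborel. norm ((\<phi> n x - ub x)\<^sup>2)) \<longlonglongrightarrow> 0" using a(1) by simp
  from tendsto_L1_AE_subseq[OF i this] obtain s :: "nat \<Rightarrow> nat"
    where s: "AE x in lborel. (\<lambda>n. (\<phi> (s n) x - ub x)\<^sup>2) \<longlonglongrightarrow> 0" by blast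
  have "AE x in lborel. (\<lambda>n. \<phi> (s n) x) \<longlonglongrightarrow> ub x"
    using s
  proof eventually_elim
    case (elim x)
    from tendsto_real_sqrt[OF elim] have "(\<lambda>n. \<bar>\<phi> (s n) x - ub x\<bar>) \<longlonglongrightarrow> 0" by simp
    then show ?case by (simp add: tendsto_rabs_zero_iff LIM_zero_iff)
  qed
  moreover have "energy (\<phi> (s n)) \<le> ennreal (2 * C)" for n
    unfolding energy_grad_energy[OF t] using C[of "s n"] by (intro ennreal_leI) simp
  ultimately have "energy ub \<le> ennreal (2 * C)"
    by (intro energy_lower_semicontinuous[OF _ ub, of "\<lambda>n. \<phi> (s n)"]) measurable
  then show ?thesis by (rule le_less_trans) simp
qed

lemma energy_alt:
  assumes [measurable]: "w \<in> borel_measurable borel"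
  shows "energy w = (\<integral>\<^sup>+x. \<integral>\<^sup>+y. ennreal ((w x - w y)\<^sup>2 * k (x - y)) \<partial>lborel \<partial>lborel)"
proof -
  have m: "(\<lambda>(x, z). ennreal ((w x - w (x - z))\<^sup>2 * k z)) \<in> borel_measurable (lborel \<Otimes>\<^sub>M lborel)"
    by measurable
  have inner: "(\<integral>\<^sup>+z. ennreal ((w x - w (x - z))\<^sup>2 * k z) \<partial>lborel) = (\<integral>\<^sup>+y. ennreal ((w x - w y)\<^sup>2 * k (x - y)) \<partial>lborel)" for x
    using nn_integral_lborel_reflect[of "\<lambda>z. ennreal ((w x - w (x - z))\<^sup>2 * k z)" x] by simp
  have "energy w = (\<integral>\<^sup>+x. \<integral>\<^sup>+z. ennreal ((w x - w (x - z))\<^sup>2 * k z) \<partial>lborel \<partial>lborel)"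
    unfolding energy_def by (rule lborel_pair.Fubini'[OF m])
  also have "\<dots> = (\<integral>\<^sup>+x. \<integral>\<^sup>+y. ennreal ((w x - w y)\<^sup>2 * k (x - y)) \<partial>lborel \<partial>lborel)"
    by (simp only: inner)
  finally show ?thesis .
qed

lemma bilinear_form_eq:
  assumes aeK: "AE x in lborel. K x = k x" and u: "AE x in lborel. u x = ub x" and v: "AE x in lborel. v x = vb x"
    and [measurable]: "ub \<in> borel_measurable borel" "vb \<in> borel_measurable borel"
  shows "bilinear_form K u v = (LINT x|lborel. LINT y|lborel. (ub x - ub y) * (vb x - vb y) * k (x - y))"
  unfolding bilinear_form_def
proof (rule integral_lebesgue_AE)
  show "AE x in lborel. (LINT y|lebesgue. (u x - u y) * (v x - v y) * K (x - y)) =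
      (LINT y|lborel. (ub x - ub y) * (vb x - vb y) * k (x - y))"
    using u v
  proof eventually_elim
    case (elim x)
    have "AE y in lborel. (u x - u y) * (v x - v y) * K (x - y) = (ub x - ub y) * (vb x - vb y) * k (x - y)"
      using u v AE_lborel_reflect[OF aeK, of x] by eventually_elim (use elim in simp)
    then show ?case by (rule integral_lebesgue_AE) measurable
  qed
qed measurable

text \<open>Finite energy makes \<open>g\<close> integrable on the product space, so the iterated
  integral in \<open>pos\<close> is genuine and not a default value. Since \<open>g\<close> is
  nowhere positive, its integral must vanish, and \<open>- g\<close> dominates the energy density of
  the negative part.\<close>

lemma energy_neg_part_zero:
  assumes ub [measurable]: "ub \<in> borel_measurable borel" and fin: "energy ub < \<infinity>"
    and pos: "0 \<le> (LINT x|lborel. LINT y|lborel. (ub x - ub y) * (max 0 (- ub x) - max 0 (- ub y)) * k (x - y))"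
  shows "energy (\<lambda>x. max 0 (- ub x)) = 0"
proof -
  let ?n = "\<lambda>x. max 0 (- ub x)"
  define g where "g x y = (ub x - ub y) * (?n x - ?n y) * k (x - y)" for x y
  have [measurable]: "case_prod g \<in> borel_measurable (borel \<Otimes>\<^sub>M borel)" unfolding g_def[abs_def] by measurable
  have neg: "(?n x - ?n y)\<^sup>2 \<le> - ((ub x - ub y) * (?n x - ?n y))" for x y
  proof -
    \<comment> \<open>Split \<open>ub\<close> into positive and negative parts. Their product
      vanishes at each single point, so only the mixed terms survive, and these are
      nonnegative.\<close>
    have "- ((ub x - ub y) * (?n x - ?n y)) - (?n x - ?n y)\<^sup>2 = max 0 (ub x) * ?n y + max 0 (ub y) * ?n x"
      by (auto simp: max_def power2_eq_square algebra_simps)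
    moreover have "0 \<le> max 0 (ub x) * ?n y + max 0 (ub y) * ?n x" by simp
    ultimately show ?thesis by linarith
  qed
  have lower: "(?n x - ?n y)\<^sup>2 * k (x - y) \<le> - g x y" for x y
    using mult_right_mono[OF neg[of x y] levy_nonneg[of "x - y"]] by (simp add: g_def)
  have g0: "0 \<le> - g x y" for x y
    by (rule order_trans[OF _ lower]) (simp add: levy_nonneg)
  have "\<bar>?n x - ?n y\<bar> \<le> \<bar>ub x - ub y\<bar>" for x y by (auto simp: max_def)
  then have "\<bar>ub x - ub y\<bar> * \<bar>?n x - ?n y\<bar> \<le> \<bar>ub x - ub y\<bar> * \<bar>ub x - ub y\<bar>" for x y by (intro mult_left_mono) auto
  then have upper: "norm (g x y) \<le> (ub x - ub y)\<^sup>2 * k (x - y)" for x y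
    using mult_right_mono[of "\<bar>ub x - ub y\<bar> * \<bar>?n x - ?n y\<bar>" "\<bar>ub x - ub y\<bar> * \<bar>ub x - ub y\<bar>" "k (x - y)"] levy_nonneg[of "x - y"]
    by (simp add: g_def abs_mult power2_eq_square)
  have "(\<integral>\<^sup>+x. \<integral>\<^sup>+y. ennreal (norm (g x y)) \<partial>lborel \<partial>lborel) \<le> energy ub"
    unfolding energy_alt[OF ub] by (intro nn_integral_mono ennreal_leI upper)
  then have ig: "integrable (lborel \<Otimes>\<^sub>M lborel) (case_prod g)"
    using fin by (intro integrable_pairI) auto
  have "(LINT x|lborel. LINT y|lborel. g x y) = integral\<^sup>L (lborel \<Otimes>\<^sub>M lborel) (case_prod g)"
    by (rule lborel_pair.integral_fst'[OF ig, simplified])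
  then have "integral\<^sup>L (lborel \<Otimes>\<^sub>M lborel) (\<lambda>p. - case_prod g p) \<le> 0" using pos by (simp add: g_def)
  moreover have "(\<integral>\<^sup>+p. ennreal (- case_prod g p) \<partial>(lborel \<Otimes>\<^sub>M lborel)) = ennreal (integral\<^sup>L (lborel \<Otimes>\<^sub>M lborel) (\<lambda>p. - case_prod g p))"
    using g0 by (intro nn_integral_eq_integral Bochner_Integration.integrable_minus ig AE_I2) (auto simp: split_beta)
  ultimately have z: "(\<integral>\<^sup>+p. ennreal (- case_prod g p) \<partial>(lborel \<Otimes>\<^sub>M lborel)) = 0" by (simp add: ennreal_neg)
  have "energy ?n \<le> (\<integral>\<^sup>+x. \<integral>\<^sup>+y. ennreal (- g x y) \<partial>lborel \<partial>lborel)"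
    by (subst energy_alt) (auto intro!: nn_integral_mono ennreal_leI lower)
  also have "\<dots> = (\<integral>\<^sup>+p. ennreal (- case_prod g p) \<partial>(lborel \<Otimes>\<^sub>M lborel))"
    by (subst lborel.nn_integral_fst[symmetric]) auto
  finally show ?thesis using z by simp
qed

text \<open>Zero energy makes \<open>w\<close> invariant under some translation, hence under arbitrarily large ones,
  which is incompatible with a bounded support.\<close>

lemma energy_zero_imp_AE_zero:
  assumes w [measurable]: "w \<in> borel_measurable borel" and e: "energy w = 0"
    and \<Omega>: "bounded \<Omega>" "AE x in lborel. x \<notin> \<Omega> \<longrightarrow> w x = 0" and k: "\<not> (AE z in lborel. k z = 0)"
  shows "AE x in lborel. w x = 0"
proof -
  have 1: "AE z in lborel. (\<integral>\<^sup>+x. ennreal ((w x - w (x - z))\<^sup>2 * k z) \<partial>lborel) = 0"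
    using e unfolding energy_def by (subst (asm) nn_integral_0_iff_AE) auto
  have "\<exists>z. z \<noteq> 0 \<and> k z \<noteq> 0 \<and> (\<integral>\<^sup>+x. ennreal ((w x - w (x - z))\<^sup>2 * k z) \<partial>lborel) = 0"
  proof (rule ccontr)
    assume *: "\<not> ?thesis"
    have "AE z in lborel. k z = 0"
      using 1 AE_lborel_singleton[of 0] by eventually_elim (use * in blast)
    then show False using k by blast
  qed
  then obtain z where z: "z \<noteq> 0" "k z \<noteq> 0" "(\<integral>\<^sup>+x. ennreal ((w x - w (x - z))\<^sup>2 * k z) \<partial>lborel) = 0" by blast
  have "AE x in lborel. ennreal ((w x - w (x - z))\<^sup>2 * k z) = 0"
    using z(3) by (subst (asm) nn_integral_0_iff_AE) auto
  then have inv: "AE x in lborel. w x = w (x - z)"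
    by eventually_elim (use z(2) levy_nonneg[of z] in \<open>auto simp: ennreal_eq_0_iff mult_le_0_iff\<close>)
  have "AE x in lborel. w x = w (x - real m *\<^sub>R z)" for m
  proof (induction m)
    case (Suc m)
    show ?case using Suc AE_lborel_translate[OF inv, of "real m *\<^sub>R z"]
      by eventually_elim (simp add: algebra_simps)
  qed simp
  moreover obtain R where R: "\<And>x. x \<in> \<Omega> \<Longrightarrow> norm x \<le> R" using \<Omega>(1) by (auto simp: bounded_iff)
  \<comment> \<open>A translation longer than \<open>2 * R\<close> moves every point of
    \<open>\<Omega>\<close> out of \<open>\<Omega>\<close>.\<close>
  moreover obtain m :: nat where m: "2 * R < real m * norm z"
    using reals_Archimedean3[of "norm z"] z(1) by auto
  ultimately have "AE x in lborel. w x = w (x - real m *\<^sub>R z)" by blast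
  then show ?thesis
    using \<Omega>(2) AE_lborel_translate[OF \<Omega>(2), of "real m *\<^sub>R z"]
  proof eventually_elim
    case (elim x)
    show ?case
    proof (cases "x \<in> \<Omega>")
      case True
      have "real m * norm z - norm x \<le> norm (x - real m *\<^sub>R z)"
        using norm_triangle_ineq2[of "real m *\<^sub>R z" x] by (simp add: norm_minus_commute)
      then have "x - real m *\<^sub>R z \<notin> \<Omega>" using R[OF True] R[of "x - real m *\<^sub>R z"] m by force
      then show ?thesis using elim by simp
    qed (use elim in simp)
  qed
qed

text \<open>A bump function centred at the origin has a nonzero gradient at a point just outside its support.\<close>

lemma levy_not_AE_zero:
  assumes \<epsilon>: "\<epsilon> > 0" and pos: "AE x in lborel. norm x \<le> \<epsilon> \<longrightarrow> 0 < r x"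
  shows "\<not> (AE z in lborel. k z = 0)"
proof
  assume k0: "AE z in lborel. k z = 0"
  \<comment> \<open>With this radius the ball around the point at distance
    \<open>\<epsilon> / 2\<close> on the \<open>j\<close>-th axis stays inside the half-space
    \<open>0 < z $ j\<close> and inside the ball of radius \<open>\<epsilon>\<close>, so
    \<open>vkernel j\<close> is positive almost everywhere on it.\<close>
  define \<delta> where "\<delta> = \<epsilon> / 8"
  have \<delta>: "\<delta> > 0" using \<epsilon> by (simp add: \<delta>_def)
  define \<phi> where "\<phi> x = bump (\<delta>\<^sup>2 - (norm x)\<^sup>2)" for x :: "real^'n"
  have out: "\<phi> x = 0" if "norm x \<ge> \<delta>" for x
    using power_mono[OF that, of 2] \<delta> by (auto simp: \<phi>_def intro!: bump_zero)
  have inn: "\<phi> x > 0" if "norm x < \<delta>" for x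
    using power_strict_mono[OF that, of 2] by (auto simp: \<phi>_def intro!: bump_pos)
  have \<phi>0: "0 \<le> \<phi> x" for x by (simp add: \<phi>_def bump_nonneg)
  have t: "\<phi> \<in> test_functions UNIV"
  proof (rule test_functionsI[where C="cball 0 \<delta>"])
    show "smooth \<phi>" unfolding \<phi>_def[abs_def] by (intro smooth_bump smooth_diff smooth_const smooth_norm_sq)
  qed (auto intro: out)
  have [measurable]: "\<phi> \<in> borel_measurable borel" by (rule smooth_borel_measurable[OF test_functions_smooth[OF t]])
  have "energy \<phi> = (\<integral>\<^sup>+z. 0 \<partial>(lborel :: (real^'n) measure))"
    unfolding energy_def by (rule nn_integral_cong_AE) (use k0 in eventually_elim, simp)
  then have "ennreal (grad_energy \<phi>) = 0" by (simp add: energy_grad_energy[OF t] ennreal_eq_0_iff)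
  then have "AE x in lborel. ennreal (\<Sum>j\<in>UNIV. (dcomp j \<phi> x)\<^sup>2) = 0"
    unfolding nn_integral_grad[OF t, symmetric] using measurable_dcomp[OF t]
    by (subst (asm) nn_integral_0_iff_AE) auto
  then have ae: "AE x in lborel. dcomp j \<phi> x = 0" for j
  proof eventually_elim
    case (elim x)
    then have "(\<Sum>j\<in>UNIV. (dcomp j \<phi> x)\<^sup>2) = 0" by (intro antisym) (auto simp: ennreal_eq_0_iff sum_nonneg)
    then show ?case by (subst (asm) sum_nonneg_eq_0_iff) auto
  qed
  \<comment> \<open>Continuity turns vanishing almost everywhere into vanishing everywhere, since
    the contradiction is found at one particular point.\<close>
  have dz: "dcomp j \<phi> x = 0" for j x
  proof -
    have "open {x. dcomp j \<phi> x \<noteq> 0}"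
      by (intro open_Collect_neq continuous_dcomp t continuous_on_const)
    from AE_not_in_open[OF this] have "{x. dcomp j \<phi> x \<noteq> 0} = {}" using ae[of j] by simp
    then show ?thesis by blast
  qed
  fix j :: 'n
  define x where "x = (\<epsilon> / 2) *\<^sub>R axis j (1::real)"
  have nx: "norm x = \<epsilon> / 2" using \<epsilon> by (simp add: x_def)
  have near: "0 < z $ j \<and> norm z \<le> \<epsilon> \<and> z \<noteq> 0" if "norm (x - z) < \<delta>" for z
  proof -
    have "\<bar>\<epsilon> / 2 - z $ j\<bar> < \<delta>" using component_le_norm_cart[of "x - z" j] that by (simp add: x_def)
    then have "0 < z $ j" using \<epsilon> unfolding \<delta>_def by linarith
    moreover have "norm z \<le> norm x + norm (x - z)" by (metis norm_triangle_sub norm_minus_commute)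
    then have "norm z \<le> \<epsilon>" using nx that \<epsilon> by (simp add: \<delta>_def)
    ultimately show ?thesis by auto
  qed
  \<comment> \<open>The bump vanishes at \<open>x\<close> itself, so the gradient component there is
    minus the integral of a nonnegative function.\<close>
  have "\<phi> x = 0" using nx \<epsilon> by (intro out) (simp add: \<delta>_def)
  then have int: "integrable lborel (\<lambda>z. \<phi> (x - z) * vkernel j z)" "(LINT z|lborel. \<phi> (x - z) * vkernel j z) = 0"
    using dcomp_integrand_integrable[OF t, of x j] dz[of j x] by (simp_all add: dcomp_def)
  have nonneg: "0 \<le> \<phi> (x - z) * vkernel j z" for z
  proof (cases "norm (x - z) < \<delta>")
    case True
    then show ?thesis using near[OF True] \<phi>0[of "x - z"] by (simp add: vkernel_def kernel_nonneg)
  qed (simp add: out)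
  have "AE z in lborel. \<phi> (x - z) * vkernel j z = 0"
    using integral_nonneg_eq_0_iff_AE[OF int(1)] int(2) nonneg by simp
  then have "AE z in lborel. z \<notin> ball x \<delta>"
    using pos
  proof eventually_elim
    case (elim z)
    show ?case
    proof
      assume "z \<in> ball x \<delta>"
      then have d: "norm (x - z) < \<delta>" by (simp add: dist_norm)
      show False using elim inn[OF d] near[OF d] by (auto simp: vkernel_def)
    qed
  qed
  from AE_not_in_open[OF _ this] show False using \<delta> by simp
qed

end

text \<open>Local integrability off the origin makes each \<open>K x * cutoff m x\<close>
  measurable, and \<open>K\<close> is recovered as their limit off the origin. Truncating a Borel
  version at \<open>0\<close> preserves the agreement almost everywhere, because \<open>K\<close> is
  nonnegative off the origin.\<close>

lemma (in radial_kernel) levy_kernel_representative: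
  assumes Q: "\<And>x::real^'n. Q_rho \<rho> x = Qfun x" and T: "is_K_rho \<rho> T"
    and rep: "represents_off_origin T (\<lambda>x. complex_of_real (K x))" and K: "\<And>x. x \<noteq> 0 \<Longrightarrow> 0 \<le> K x"
  obtains k where "levy_kernel \<beta> r k" "AE x in lborel. K x = k x"
proof -
  let ?K = "\<lambda>x. complex_of_real (K x)"
  have loc: "?K loc_integrable_on (- {0})" using rep by (simp add: represents_off_origin_def)
  have cut: "(\<lambda>x::real^'n. complex_of_real (cutoff m x)) \<in> test_functions (- {0})" for m
    by (rule test_functions_comp[OF cutoff_test[of m]]) (auto intro: smooth_of_real test_functions_smooth[OF cutoff_test])
  have "(\<lambda>x. Re (?K x * complex_of_real (cutoff m x))) \<in> borel_measurable lebesgue" for m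
    by (rule borel_measurable_integrable[OF integrable_Re[OF loc_integrable_times_test[OF loc cut]]])
  then have "(\<lambda>x. lim (\<lambda>m. K x * cutoff m x)) \<in> borel_measurable lebesgue"
    by (intro borel_measurable_lim_metric) simp
  then obtain g where [measurable]: "g \<in> borel_measurable borel"
    and g: "AE x in lborel. lim (\<lambda>m. K x * cutoff m x) = g x" by (rule lebesgue_borel_representative)
  define k where "k x = max 0 (g x)" for x
  have km [measurable]: "k \<in> borel_measurable borel" unfolding k_def by measurable
  have aeK: "AE x in lborel. K x = k x"
    using g AE_lborel_singleton[of 0]
  proof eventually_elim
    case (elim x)
    have "(\<lambda>m. K x * cutoff m x) \<longlonglongrightarrow> K x"
      by (rule tendsto_eventually) (use cutoff_eventually_1[OF elim(2)] in eventually_elim, simp)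
    then show ?case using elim K[OF elim(2)] by (simp add: limI k_def)
  qed
  have times: "AE x in lborel. ?K x * f x = complex_of_real (k x) * f x" for f :: "real^'n \<Rightarrow> complex"
    using aeK by eventually_elim simp
  \<comment> \<open>\<open>Qhat0\<close> witnesses existence, so the chosen \<open>Q_hat\<close>
    does represent the distribution; uniqueness then determines the norm of
    \<open>lambda_rho\<close> almost everywhere.\<close>
  have "represents_off_origin Q_distr (Q_hat \<rho>)"
    using someI[of "represents_off_origin Q_distr", OF Q_distr_represented] by (simp add: Q_hat_def Q_distr_def Q)
  from symbol_sq_eq_AE[OF this] have sym: "AE \<xi> in lborel. (norm (lambda_rho \<rho> \<xi>))\<^sup>2 = symbol_sq \<xi>"
    by (simp add: lambda_rho_def)
  have "levy_kernel \<beta> r k"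
  proof (unfold_locales)
    show "0 \<le> k z" for z by (simp add: k_def)
    fix f :: "real^'n \<Rightarrow> complex" assume f: "f \<in> test_functions (- {0})"
    have f': "f \<in> test_functions UNIV" by (rule test_functions_mono[OF f]) simp
    have [measurable]: "f \<in> borel_measurable borel" by (rule smooth_borel_measurable[OF test_functions_smooth[OF f]])
    show "integrable lborel (\<lambda>x. complex_of_real (k x) * f x)"
      using loc_integrable_times_test[OF loc f] by (subst (asm) integrable_lebesgue_AE[OF times]) auto
    assume even: "\<And>x. f (- x) = f x"
    have [measurable]: "fourier f \<in> borel_measurable borel" by (rule measurable_fourier[OF test_functions_integrable[OF f']])
    have "(LINT x|lborel. complex_of_real (k x) * f x) = T f"
      using rep f by (simp add: represents_off_origin_def distr_of_fun_def integral_lebesgue_AE[OF times])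
    \<comment> \<open>Double transformation returns the reflection of \<open>f\<close>, which is
      \<open>f\<close> by evenness. This writes \<open>f\<close> as the transform of a Schwartz
      function, as the definition of \<open>K\<close> requires.\<close>
    also have "f = fourier (fourier f)" using fourier_inversion[OF f'] even by auto
    then have "T f = fourier_distr T (fourier f)" by (simp add: fourier_distr_def)
    also have "\<dots> = (LINT \<xi>|lebesgue. - complex_of_real ((norm (lambda_rho \<rho> \<xi>))\<^sup>2) * fourier f \<xi>)"
      using T fourier_schwartz[OF f'] by (simp add: is_K_rho_def distr_of_fun_def)
    also have "\<dots> = (LINT \<xi>|lborel. - (symbol_sq \<xi> *\<^sub>R fourier f \<xi>))"
    proof (rule integral_lebesgue_AE)
      show "AE \<xi> in lborel. - complex_of_real ((norm (lambda_rho \<rho> \<xi>))\<^sup>2) * fourier f \<xi> = - (symbol_sq \<xi> *\<^sub>R fourier f \<xi>)"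
        using sym by eventually_elim (simp add: scaleR_conv_of_real)
    qed measurable
    finally show "(LINT x|lborel. complex_of_real (k x) * f x) = - (LINT \<xi>|lborel. symbol_sq \<xi> *\<^sub>R fourier f \<xi>)" by simp
  qed (rule km)
  then show ?thesis using aeK by (rule that)
qed

theorem proposition5p4:
  fixes \<rho> :: "real^'n::finite \<Rightarrow> real"
    and T :: "'n distribution"
    and K :: "real^'n \<Rightarrow> real"
    and \<Omega> :: "(real^'n) set"
    and f u :: "real^'n \<Rightarrow> real"
  assumes "\<forall>x. x \<noteq> 0 \<longrightarrow> 0 \<le> \<rho> x"
    and "radial \<rho>"
    and "\<rho> loc_integrable_on UNIV"
    and "integrable lebesgue (\<lambda>x. min 1 (1 / norm x) * \<rho> x)"
    and "\<exists>\<epsilon>>0. (INF x \<in> cball 0 \<epsilon> - {0}. \<rho> x) > 0"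
    and "is_K_rho \<rho> T"
    and "represents_off_origin T (\<lambda>x. complex_of_real (K x))"
    and "\<forall>x. x \<noteq> 0 \<longrightarrow> 0 \<le> K x"
    and "open \<Omega>" and "bounded \<Omega>"
    and "L2_on \<Omega> f"
    and "weak_solution \<rho> \<Omega> f u"
    and "\<forall>\<phi> \<in> H_rho_0 \<rho> \<Omega>. (AE x in lebesgue. 0 \<le> \<phi> x) \<longrightarrow> 0 \<le> bilinear_form K u \<phi>"
    and "AE x in lebesgue. x \<in> - \<Omega> \<longrightarrow> 0 \<le> u x"
  shows "AE x in lebesgue. 0 \<le> u x"
proof -
  obtain \<beta> and r :: "real^'n \<Rightarrow> real" where r: "radial_kernel \<beta> r" and ae_\<rho>: "AE x in lborel. \<rho> x = r x"
    and Q: "\<And>x::real^'n. Q_rho \<rho> x = radial_kernel.Qfun \<beta> x"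
    using radial_kernel_representative[of \<rho>] assms(1,2,4) by blast
  obtain k where "levy_kernel \<beta> r k" and aeK: "AE x in lborel. K x = k x"
    using radial_kernel.levy_kernel_representative[OF r Q assms(6,7)] assms(8) by blast
  then interpret levy_kernel \<beta> r k by simp
  let ?n = "\<lambda>x. max 0 (- u x)"
  have u: "u \<in> H_rho \<rho>" using assms(12) by (simp add: weak_solution_def H_rho_0_def)
  then have "u \<in> borel_measurable lebesgue"
    by (auto simp: H_rho_def has_D_rho_def L2_on_def set_borel_measurable_def)
  then obtain ub where ub [measurable]: "ub \<in> borel_measurable borel" and ae: "AE x in lborel. u x = ub x"
    by (rule lebesgue_borel_representative)
  have ae_n: "AE x in lborel. ?n x = max 0 (- ub x)" using ae by eventually_elim simp
  have out: "AE x in lebesgue. x \<in> - \<Omega> \<longrightarrow> ?n x = 0" using assms(14) by eventually_elim simp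
  \<comment> \<open>Nonnegativity of \<open>u\<close> outside \<open>\<Omega>\<close> provides the
    vanishing exterior values of the negative part.\<close>
  have "?n \<in> H_rho_0 \<rho> \<Omega>" using neg_part_H_rho[OF ae_\<rho> u ae ub] out by (simp add: H_rho_0_def)
  from bspec[OF assms(13) this] have "0 \<le> bilinear_form K u ?n" by simp
  also have "\<dots> = (LINT x|lborel. LINT y|lborel. (ub x - ub y) * (max 0 (- ub x) - max 0 (- ub y)) * k (x - y))"
    by (rule bilinear_form_eq[OF aeK ae ae_n ub]) measurable
  finally have e: "energy (\<lambda>x. max 0 (- ub x)) = 0"
    by (rule energy_neg_part_zero[OF ub H_rho_energy_finite[OF ae_\<rho> u ae ub]])
  obtain \<epsilon> where \<epsilon>: "\<epsilon> > 0" "(INF x \<in> cball 0 \<epsilon> - {0}. \<rho> x) > 0" using assms(5) by blast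
  \<comment> \<open>Nonnegativity of \<open>\<rho>\<close> bounds the values from below, so the real
    infimum is a true lower bound.\<close>
  have lower: "(INF x \<in> cball 0 \<epsilon> - {0}. \<rho> x) \<le> \<rho> x" if "x \<noteq> 0" "norm x \<le> \<epsilon>" for x
    using assms(1) that by (intro cINF_lower) (auto simp: bdd_below_def)
  have "AE x in lborel. norm x \<le> \<epsilon> \<longrightarrow> 0 < r x"
    using ae_\<rho> AE_lborel_singleton[of 0] by eventually_elim (use lower \<epsilon>(2) in force)
  from levy_not_AE_zero[OF \<epsilon>(1) this] have "\<not> (AE z in lborel. k z = 0)" .
  moreover have "AE x in lborel. x \<notin> \<Omega> \<longrightarrow> max 0 (- ub x) = 0"
    using out ae unfolding AE_completion_iff by eventually_elim simp
  ultimately have "AE x in lborel. max 0 (- ub x) = 0"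
    using e assms(10) by (intro energy_zero_imp_AE_zero[where \<Omega>=\<Omega>]) auto
  then show ?thesis
    using ae unfolding AE_completion_iff by eventually_elim (simp add: max_def split: if_splits)
qed

end
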